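(* Let $p$ be a prime and $k$ a perfect field of characteristic $p$. Then the functors $W_n$ ($p$-typical Witt vectors of length $n$), $CW$ (co-Witt vectors), and $CW^u$ (unipotent co-Witt vectors) from $\mathrm{Alg}_k$ to $\mathrm{Dmod}_k^p$ factor naturally through $\mathrm{Pol}_p(k)$, via the polarization functor $\mathrm{pol}\colon\mathrm{Alg}_k\to\mathrm{Pol}_p(k)$. That is, for each such functor $T$ there is a functor $\tilde T\colon\mathrm{Pol}_p(k)\to\mathrm{Dmod}_k^p$ and a natural isomorphism $T\cong\tilde T\circ\mathrm{pol}$.
   Context: $\mathrm{Alg}_k$ is the category of commutative unital $k$-algebras. A $p$-polar $k$-algebra is a $k$-module $A$ with a symmetric $k$-multilinear map $\mu\colon A^{\otimes_k p}\to A$ such that $\mu(\mu(x_1,\dots,x_p),x_{p+1},\dots,x_{2p-1})$ is invariant under all permutations in $\Sigma_{2p-1}$ of $x_1,\dots,x_{2p-1}\in A$. Morphisms are $k$-linear maps compatible with $\mu$; the resulting category is $\mathrm{Pol}_p(k)$. The functor $\mathrm{pol}$ sends a $k$-algebra $R$ to its underlying module with $\mu(x_1,\dots,x_p)=x_1\cdots x_p$. Let $W(k)$ be the ring of $p$-typical Witt vectors of $k$ with Frobenius automorphism $\mathrm{frob}$. A Dieudonné module over $k$ is a $W(k)$-module $M$ with additive maps $F,V\colon M\to M$ such that $FV=VF=p$, $Fa=\mathrm{frob}(a)F$ and $aV=V\,\mathrm{frob}(a)$ for $a\in W(k)$. $\mathrm{Dmod}_k^p$ is the full subcategory of the category of Dieudonné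 modules consisting of the $p$-adic ones, i.e. those $M$ such that for every $x\in M$ the $W(k)$-submodule spanned by all $V^i(x)$ has finite length. For $R\in\mathrm{Alg}_k$, $W_n(R)$ ($n\ge 1$ an integer) is the additive group of $p$-typical Witt vectors $(a_0,\dots,a_{n-1})$ of length $n$, a $W(k)$-module with $F(a_0,\dots,a_{n-1})=(a_0^p,\dots,a_{n-1}^p)$ and $V(a_0,\dots,a_{n-1})=(0,a_0,\dots,a_{n-2})$. $CW^u(R)=\operatorname{colim}(W_1(R)\xrightarrow{V}W_2(R)\xrightarrow{V}\cdots)$ along $V(a_0,\dots,a_{n-1})=(0,a_0,\dots,a_{n-1})$, where $a\in W(k)$ acts on the $n$th term $W_n(R)$ through multiplication by $\mathrm{frob}^{1-n}(a)$ (so that the transition maps are linear), with the induced $F$ and $V$. $CW(R)$ is the set of sequences $(\dots,a_{-1},a_0)$ in $R$ such that for some $r,s\ge 0$ the ideal $I$ generated by $a_{-r},a_{-r-1},\dots$ satisfies $I^{p^s}=0$. Addition is given by $(a+b)_{-n}=\lim_{m\to\infty}S_m(a_{-n-m},\dots,a_{-n},b_{-n-m},\dots,b_{-n})$ (these sequences are eventually constant), where $S_m$ is the polynomial giving the $m$th component of Witt vector addition; $F(\dots,a_{-1},a_0)=(\dots,a_{-1}^p,a_0^p)$ and $V(\dots,a_{-1},a_0)=(\dots,a_{-2},a_{-1})$; the $W(k)$-module structure is the one (due to Fontaine) extending that of the submodule $CW^u(R)\subseteq CW(R)$ of sequences with finitely many nonzero entries, for which the Teichmüller representative of $c\in k$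 acts by $(\dots,a_{-1},a_0)\mapsto(\dots,c^{p^{-1}}a_{-1},c\,a_0)$.
   Formalization: For CW the target is the category of all Dieudonné modules instead of the p-adic ones, since CW(R) need not be p-adic: for R = k[t]/(t^2) and x with x_{-n} = t if n is a power of 2, else 0, the V^i(x) span a module of infinite length. *)

theory Defs
  imports
    "HOL-Library.Poly_Mapping"
    "HOL-Library.FuncSet"
    "HOL-Computational_Algebra.Primes"
    "HOL-Algebra.Module"
    "HOL-Algebra.Ideal_Product"
begin

section \<open>Categories, functors, natural isomorphisms\<close>

text \<open>Hom-sets of different pairs of objects may overlap. Therefore composition carries the source
  object of the composite (\<open>Comp C A g f\<close> is \<open>g \<circ> f\<close> for \<open>f\<close> with source \<open>A\<close>), and the action of
  a functor on morphisms carries source and target.\<close>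

record ('o, 'm) category =
  Ob :: "'o set"
  Hom :: "'o \<Rightarrow> 'o \<Rightarrow> 'm set"
  Id :: "'o \<Rightarrow> 'm"
  Comp :: "'o \<Rightarrow> 'm \<Rightarrow> 'm \<Rightarrow> 'm"

record ('o, 'm, 'o2, 'm2) cat_functor =
  on_ob :: "'o \<Rightarrow> 'o2"
  on_arr :: "'o \<Rightarrow> 'o \<Rightarrow> 'm \<Rightarrow> 'm2"

definition is_functor ::
  "('o, 'm) category \<Rightarrow> ('o2, 'm2) category \<Rightarrow> ('o, 'm, 'o2, 'm2) cat_functor \<Rightarrow> bool" where
  "is_functor C D T \<longleftrightarrow>
     (\<forall>A \<in> Ob C. on_ob T A \<in> Ob D) \<and>
     (\<forall>A \<in> Ob C. \<forall>B \<in> Ob C. \<forall>f \<in> Hom C A B. on_arr T A B f \<in> Hom D (on_ob T A) (on_ob T B)) \<and>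
     (\<forall>A \<in> Ob C. on_arr T A A (Id C A) = Id D (on_ob T A)) \<and>
     (\<forall>A \<in> Ob C. \<forall>B \<in> Ob C. \<forall>E \<in> Ob C. \<forall>f \<in> Hom C A B. \<forall>g \<in> Hom C B E.
        on_arr T A E (Comp C A g f) = Comp D (on_ob T A) (on_arr T B E g) (on_arr T A B f))"

definition functor_comp ::
  "('o2, 'm2, 'o3, 'm3) cat_functor \<Rightarrow> ('o, 'm, 'o2, 'm2) cat_functor \<Rightarrow> ('o, 'm, 'o3, 'm3) cat_functor"
  (infixl "\<circ>\<^sub>F" 55) where
  "S \<circ>\<^sub>F T = \<lparr> on_ob = (\<lambda>A. on_ob S (on_ob T A)),
              on_arr = (\<lambda>A B f. on_arr S (on_ob T A) (on_ob T B) (on_arr T A B f)) \<rparr>"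

definition is_iso :: "('o, 'm) category \<Rightarrow> 'o \<Rightarrow> 'o \<Rightarrow> 'm \<Rightarrow> bool" where
  "is_iso C A B f \<longleftrightarrow>
     f \<in> Hom C A B \<and> (\<exists>g \<in> Hom C B A. Comp C A g f = Id C A \<and> Comp C B f g = Id C B)"

definition naturally_isomorphic ::
  "('o, 'm) category \<Rightarrow> ('o2, 'm2) category \<Rightarrow>
   ('o, 'm, 'o2, 'm2) cat_functor \<Rightarrow> ('o, 'm, 'o2, 'm2) cat_functor \<Rightarrow> bool" where
  "naturally_isomorphic C D S T \<longleftrightarrow>
     is_functor C D S \<and> is_functor C D T \<and>
     (\<exists>\<eta>. (\<forall>A \<in> Ob C. is_iso D (on_ob S A) (on_ob T A) (\<eta> A)) \<and>
          (\<forall>A \<in> Ob C. \<forall>B \<in> Ob C. \<forall>f \<in> Hom C A B.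
             Comp D (on_ob S A) (\<eta> B) (on_arr S A B f) = Comp D (on_ob S A) (on_arr T A B f) (\<eta> A)))"

text \<open>Categories of sets with structure: morphisms are the structure preserving maps between the
  carriers \<open>U A\<close>, represented by functions that are \<open>undefined\<close> outside the carrier of the source.\<close>

definition concrete_category ::
  "'o set \<Rightarrow> ('o \<Rightarrow> 'a set) \<Rightarrow> ('o \<Rightarrow> 'o \<Rightarrow> ('a \<Rightarrow> 'a) \<Rightarrow> bool) \<Rightarrow> ('o, 'a \<Rightarrow> 'a) category" where
  "concrete_category obs U P =
     \<lparr> Ob = obs,
       Hom = (\<lambda>A B. {f \<in> U A \<rightarrow>\<^sub>E U B. P A B f}),
       Id = (\<lambda>A. restrict (\<lambda>x. x) (U A)),
       Comp = (\<lambda>A g f. compose (U A) g f) \<rparr>"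


section \<open>Perfect fields, algebras and $p$-polar algebras\<close>

definition perfect_field :: "nat \<Rightarrow> 'k ring \<Rightarrow> bool" where
  "perfect_field p K \<longleftrightarrow>
     field K \<and> [p] \<cdot>\<^bsub>K\<^esub> \<one>\<^bsub>K\<^esub> = \<zero>\<^bsub>K\<^esub> \<and> (\<lambda>x. x [^]\<^bsub>K\<^esub> p) ` carrier K = carrier K"

definition linear_map ::
  "('k, 'r) ring_scheme \<Rightarrow> ('k, 'a, 'c) module_scheme \<Rightarrow> ('k, 'b, 'd) module_scheme \<Rightarrow> ('a \<Rightarrow> 'b) \<Rightarrow> bool"
  where
  "linear_map S M N f \<longleftrightarrow>
     (\<forall>x \<in> carrier M. f x \<in> carrier N) \<and>
     (\<forall>x \<in> carrier M. \<forall>y \<in> carrier M. f (x \<oplus>\<^bsub>M\<^esub> y) = f x \<oplus>\<^bsub>N\<^esub> f y) \<and>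
     (\<forall>c \<in> carrier S. \<forall>x \<in> carrier M. f (c \<odot>\<^bsub>M\<^esub> x) = c \<odot>\<^bsub>N\<^esub> f x)"

definition Alg :: "'k ring \<Rightarrow> (('k, 'a) module, 'a \<Rightarrow> 'a) category" where
  "Alg K = concrete_category {R. algebra K R} carrier
     (\<lambda>R S f. f \<in> ring_hom R S \<and> linear_map K R S f)"

text \<open>Records for modules extend those for rings; the fields \<open>mult\<close> and \<open>one\<close> of a polar algebra (and
  below of a Dieudonne module) carry no meaning. The map \<open>mu\<close> matters on lists of length \<open>p\<close> only.\<close>

record ('k, 'a) polar = "('k, 'a) module" +
  mu :: "'a list \<Rightarrow> 'a"

definition polar_algebra :: "nat \<Rightarrow> 'k ring \<Rightarrow> ('k, 'a) polar \<Rightarrow> bool" where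
  "polar_algebra p K A \<longleftrightarrow>
     module K A \<and>
     (\<forall>xs. set xs \<subseteq> carrier A \<and> length xs = p \<longrightarrow>
        mu A xs \<in> carrier A \<and>
        (\<forall>ys. mset ys = mset xs \<longrightarrow> mu A ys = mu A xs) \<and>
        (\<forall>i<p. \<forall>y \<in> carrier A.
           mu A (xs[i := xs ! i \<oplus>\<^bsub>A\<^esub> y]) = mu A xs \<oplus>\<^bsub>A\<^esub> mu A (xs[i := y])) \<and>
        (\<forall>i<p. \<forall>c \<in> carrier K. mu A (xs[i := c \<odot>\<^bsub>A\<^esub> xs ! i]) = c \<odot>\<^bsub>A\<^esub> mu A xs)) \<and>
     (\<forall>xs ys. set xs \<subseteq> carrier A \<and> length xs = 2 * p - 1 \<and> mset ys = mset xs \<longrightarrow>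
        mu A (mu A (take p ys) # drop p ys) = mu A (mu A (take p xs) # drop p xs))"

definition Pol :: "nat \<Rightarrow> 'k ring \<Rightarrow> (('k, 'a) polar, 'a \<Rightarrow> 'a) category" where
  "Pol p K = concrete_category {A. polar_algebra p K A} carrier
     (\<lambda>A B f. linear_map K A B f \<and>
        (\<forall>xs. set xs \<subseteq> carrier A \<and> length xs = p \<longrightarrow> f (mu A xs) = mu B (map f xs)))"

definition pol :: "(('k, 'a) module, 'a \<Rightarrow> 'a, ('k, 'a) polar, 'a \<Rightarrow> 'a) cat_functor" where
  "pol = \<lparr> on_ob = (\<lambda>R. \<lparr> carrier = carrier R, mult = undefined, one = undefined, zero = \<zero>\<^bsub>R\<^esub>,
                          add = add R, smult = smult R,
                          mu = (\<lambda>xs. foldr (mult R) xs \<one>\<^bsub>R\<^esub>) \<rparr>),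
           on_arr = (\<lambda>R S f. f) \<rparr>"


section \<open>Witt vectors\<close>

type_synonym 'v int_mpoly = "('v \<Rightarrow>\<^sub>0 nat) \<Rightarrow>\<^sub>0 int"

definition mvar :: "'v \<Rightarrow> 'v int_mpoly" where
  "mvar v = Poly_Mapping.single (Poly_Mapping.single v 1) 1"

definition mpoly_eval :: "('a, 'r) ring_scheme \<Rightarrow> ('v \<Rightarrow> 'a) \<Rightarrow> 'v int_mpoly \<Rightarrow> 'a" where
  "mpoly_eval R \<nu> P =
     (\<Oplus>\<^bsub>R\<^esub>m \<in> Poly_Mapping.keys P.
        [Poly_Mapping.lookup P m] \<cdot>\<^bsub>R\<^esub> (\<Otimes>\<^bsub>R\<^esub>v \<in> Poly_Mapping.keys m. \<nu> v [^]\<^bsub>R\<^esub> Poly_Mapping.lookup m v))"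

definition ghost :: "nat \<Rightarrow> nat \<Rightarrow> (nat \<Rightarrow> 'a) \<Rightarrow> 'a::comm_ring_1" where
  "ghost p n x = (\<Sum>i\<le>n. of_nat (p ^ i) * x i ^ (p ^ (n - i)))"

text \<open>The polynomials giving Witt vector addition and multiplication. The variables \<open>Inl i\<close> and
  \<open>Inr i\<close> are the components with index \<open>i\<close> of the two arguments. By Witt's theorem integral
  polynomials with these ghost components exist (and only variables with index at most \<open>n\<close> occur
  in the \<open>n\<close>-th one); they are unique since the polynomial ring is torsion free.\<close>

definition witt_sum :: "nat \<Rightarrow> nat \<Rightarrow> (nat + nat) int_mpoly" where
  "witt_sum p = (THE S. \<forall>n. ghost p n S =
     ghost p n (\<lambda>i. mvar (Inl i)) + ghost p n (\<lambda>i. mvar (Inr i)))"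

definition witt_prod :: "nat \<Rightarrow> nat \<Rightarrow> (nat + nat) int_mpoly" where
  "witt_prod p = (THE P. \<forall>n. ghost p n P =
     ghost p n (\<lambda>i. mvar (Inl i)) * ghost p n (\<lambda>i. mvar (Inr i)))"

text \<open>The ring of Witt vectors with components indexed by \<open>I\<close>, which is \<open>UNIV\<close> for $W(R)$ and
  \<open>{..<n}\<close> for $W_n(R)$.\<close>

definition witt_ring :: "nat \<Rightarrow> nat set \<Rightarrow> ('a, 'r) ring_scheme \<Rightarrow> (nat \<Rightarrow> 'a) ring" where
  "witt_ring p I R =
     \<lparr> carrier = I \<rightarrow>\<^sub>E carrier R,
       mult = (\<lambda>a b. \<lambda>i\<in>I. mpoly_eval R (case_sum a b) (witt_prod p i)),
       one = (\<lambda>i\<in>I. if i = 0 then \<one>\<^bsub>R\<^esub> else \<zero>\<^bsub>R\<^esub>),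
       zero = (\<lambda>i\<in>I. \<zero>\<^bsub>R\<^esub>),
       add = (\<lambda>a b. \<lambda>i\<in>I. mpoly_eval R (case_sum a b) (witt_sum p i)) \<rparr>"

abbreviation Witt :: "nat \<Rightarrow> 'k ring \<Rightarrow> (nat \<Rightarrow> 'k) ring" where
  "Witt p K \<equiv> witt_ring p UNIV K"

text \<open>The componentwise formula for the Frobenius is valid in characteristic $p$.\<close>

definition frob :: "nat \<Rightarrow> 'k ring \<Rightarrow> (nat \<Rightarrow> 'k) \<Rightarrow> (nat \<Rightarrow> 'k)" where
  "frob p K a = (\<lambda>i. a i [^]\<^bsub>K\<^esub> p)"

definition frob_inv :: "nat \<Rightarrow> 'k ring \<Rightarrow> (nat \<Rightarrow> 'k) \<Rightarrow> (nat \<Rightarrow> 'k)" where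
  "frob_inv p K = inv_into (carrier (Witt p K)) (frob p K)"


section \<open>Dieudonne modules\<close>

record ('w, 'm) dieudonne = "('w, 'm) module" +
  dF :: "'m \<Rightarrow> 'm"
  dV :: "'m \<Rightarrow> 'm"

definition dieudonne_module :: "nat \<Rightarrow> 'k ring \<Rightarrow> (nat \<Rightarrow> 'k, 'm) dieudonne \<Rightarrow> bool" where
  "dieudonne_module p K M \<longleftrightarrow>
     module (Witt p K) M \<and>
     (\<forall>x \<in> carrier M. dF M x \<in> carrier M \<and> dV M x \<in> carrier M) \<and>
     (\<forall>x \<in> carrier M. \<forall>y \<in> carrier M.
        dF M (x \<oplus>\<^bsub>M\<^esub> y) = dF M x \<oplus>\<^bsub>M\<^esub> dF M y \<and> dV M (x \<oplus>\<^bsub>M\<^esub> y) = dV M x \<oplus>\<^bsub>M\<^esub> dV M y) \<and>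
     (\<forall>x \<in> carrier M. dF M (dV M x) = [p] \<cdot>\<^bsub>M\<^esub> x \<and> dV M (dF M x) = [p] \<cdot>\<^bsub>M\<^esub> x) \<and>
     (\<forall>a \<in> carrier (Witt p K). \<forall>x \<in> carrier M.
        dF M (a \<odot>\<^bsub>M\<^esub> x) = frob p K a \<odot>\<^bsub>M\<^esub> dF M x \<and>
        a \<odot>\<^bsub>M\<^esub> dV M x = dV M (frob p K a \<odot>\<^bsub>M\<^esub> x))"

definition submodule_span ::
  "('w, 'r) ring_scheme \<Rightarrow> ('w, 'm, 'c) module_scheme \<Rightarrow> 'm set \<Rightarrow> 'm set" where
  "submodule_span S M X = \<Inter>{N. submodule N S M \<and> X \<subseteq> N}"

text \<open>A submodule \<open>N\<close> of \<open>M\<close> has finite length if it has a finite composition series.\<close>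

definition finite_length ::
  "('w, 'r) ring_scheme \<Rightarrow> ('w, 'm, 'c) module_scheme \<Rightarrow> 'm set \<Rightarrow> bool" where
  "finite_length S M N \<longleftrightarrow>
     (\<exists>(l::nat) c. c 0 = {\<zero>\<^bsub>M\<^esub>} \<and> c l = N \<and>
        (\<forall>i\<le>l. submodule (c i) S M) \<and>
        (\<forall>i<l. c i \<subset> c (Suc i) \<and> \<not> (\<exists>L. submodule L S M \<and> c i \<subset> L \<and> L \<subset> c (Suc i))))"

definition p_adic :: "nat \<Rightarrow> 'k ring \<Rightarrow> (nat \<Rightarrow> 'k, 'm) dieudonne \<Rightarrow> bool" where
  "p_adic p K M \<longleftrightarrow>
     (\<forall>x \<in> carrier M.
        finite_length (Witt p K) M (submodule_span (Witt p K) M (range (\<lambda>i::nat. (dV M ^^ i) x))))"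

definition dieudonne_hom ::
  "nat \<Rightarrow> 'k ring \<Rightarrow> (nat \<Rightarrow> 'k, 'm) dieudonne \<Rightarrow> (nat \<Rightarrow> 'k, 'm) dieudonne \<Rightarrow> ('m \<Rightarrow> 'm) \<Rightarrow> bool" where
  "dieudonne_hom p K M N f \<longleftrightarrow>
     linear_map (Witt p K) M N f \<and>
     (\<forall>x \<in> carrier M. f (dF M x) = dF N (f x) \<and> f (dV M x) = dV N (f x))"

text \<open>\<open>Dmod\<close> consists of all Dieudonne modules, \<open>Dmod_p\<close> is the full subcategory of the $p$-adic
  ones. The functors $W_n$ and $CW^u$ take values in \<open>Dmod_p\<close>, but $CW$ does not: for
  $R = k[t]/(t^2)$ and $x_{-n} = t$ if $n$ is a power of $2$, $x_{-n} = 0$ otherwise, the element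
  $x \in CW(R)$ is killed by $p$ and all $V^i(x)$ are linearly independent.\<close>

definition Dmod :: "nat \<Rightarrow> 'k ring \<Rightarrow> ((nat \<Rightarrow> 'k, 'm) dieudonne, 'm \<Rightarrow> 'm) category" where
  "Dmod p K = concrete_category {M. dieudonne_module p K M} carrier (dieudonne_hom p K)"

definition Dmod_p :: "nat \<Rightarrow> 'k ring \<Rightarrow> ((nat \<Rightarrow> 'k, 'm) dieudonne, 'm \<Rightarrow> 'm) category" where
  "Dmod_p p K =
     concrete_category {M. dieudonne_module p K M \<and> p_adic p K M} carrier (dieudonne_hom p K)"


section \<open>The functors $W_n$\<close>

definition W_ob :: "nat \<Rightarrow> nat \<Rightarrow> ('k, 'a) module \<Rightarrow> (nat \<Rightarrow> 'k, nat \<Rightarrow> 'a) dieudonne" where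
  "W_ob p n R = (let W = witt_ring p {..<n} R in
     \<lparr> carrier = carrier W, mult = mult W, one = \<one>\<^bsub>W\<^esub>, zero = \<zero>\<^bsub>W\<^esub>, add = add W,
       smult = (\<lambda>a x. (\<lambda>i\<in>{..<n}. a i \<odot>\<^bsub>R\<^esub> \<one>\<^bsub>R\<^esub>) \<otimes>\<^bsub>W\<^esub> x),
       dF = (\<lambda>x. \<lambda>i\<in>{..<n}. x i [^]\<^bsub>R\<^esub> p),
       dV = (\<lambda>x. \<lambda>i\<in>{..<n}. if i = 0 then \<zero>\<^bsub>R\<^esub> else x (i - 1)) \<rparr>)"

definition W_arr ::
  "nat \<Rightarrow> nat \<Rightarrow> ('k, 'a) module \<Rightarrow> ('a \<Rightarrow> 'a) \<Rightarrow> (nat \<Rightarrow> 'a) \<Rightarrow> (nat \<Rightarrow> 'a)" where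
  "W_arr p n R f = (\<lambda>x \<in> carrier (W_ob p n R). \<lambda>i\<in>{..<n}. f (x i))"

definition W_functor ::
  "nat \<Rightarrow> 'k ring \<Rightarrow> nat \<Rightarrow>
   (('k, 'a) module, 'a \<Rightarrow> 'a, (nat \<Rightarrow> 'k, nat \<Rightarrow> 'a) dieudonne, (nat \<Rightarrow> 'a) \<Rightarrow> (nat \<Rightarrow> 'a)) cat_functor"
  where
  "W_functor p K n = \<lparr> on_ob = W_ob p n, on_arr = (\<lambda>R S f. W_arr p n R f) \<rparr>"


section \<open>Sequential colimits of Dieudonne modules\<close>

primrec transition :: "(nat \<Rightarrow> 'm \<Rightarrow> 'm) \<Rightarrow> nat \<Rightarrow> nat \<Rightarrow> 'm \<Rightarrow> 'm" where
  "transition t i 0 x = x"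
| "transition t i (Suc d) x = t (i + d) (transition t i d x)"

definition colim_rel ::
  "(nat \<Rightarrow> ('w, 'm) dieudonne) \<Rightarrow> (nat \<Rightarrow> 'm \<Rightarrow> 'm) \<Rightarrow> ((nat \<times> 'm) \<times> (nat \<times> 'm)) set" where
  "colim_rel M t = {((i, x), (j, y)) | i x j y.
     x \<in> carrier (M i) \<and> y \<in> carrier (M j) \<and>
     (\<exists>l \<ge> max i j. transition t i (l - i) x = transition t j (l - j) y)}"

text \<open>The colimit of \<open>M 0 \<rightarrow> M 1 \<rightarrow> \<dots>\<close> along \<open>t i : M i \<rightarrow> M (i + 1)\<close>, as a quotient of the
  disjoint union. Each union below is a union of copies of one equivalence class.\<close>

definition dieudonne_colim ::
  "(nat \<Rightarrow> ('w, 'm) dieudonne) \<Rightarrow> (nat \<Rightarrow> 'm \<Rightarrow> 'm) \<Rightarrow> ('w, (nat \<times> 'm) set) dieudonne" where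
  "dieudonne_colim M t = (let cl = (\<lambda>u. colim_rel M t `` {u}) in
     \<lparr> carrier = (SIGMA i : UNIV. carrier (M i)) // colim_rel M t,
       mult = undefined, one = undefined,
       zero = cl (0, \<zero>\<^bsub>M 0\<^esub>),
       add = (\<lambda>X Y. \<Union>{cl (i, x \<oplus>\<^bsub>M i\<^esub> y) | i x y. (i, x) \<in> X \<and> (i, y) \<in> Y}),
       smult = (\<lambda>a X. \<Union>{cl (i, a \<odot>\<^bsub>M i\<^esub> x) | i x. (i, x) \<in> X}),
       dF = (\<lambda>X. \<Union>{cl (i, dF (M i) x) | i x. (i, x) \<in> X}),
       dV = (\<lambda>X. \<Union>{cl (i, dV (M i) x) | i x. (i, x) \<in> X}) \<rparr>)"


section \<open>Unipotent co-Witt vectors\<close>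

text \<open>The term with index \<open>j\<close> of the diagram is $W_{j+1}(R)$, with \<open>a\<close> acting through
  $\mathrm{frob}^{-j}(a)$.\<close>

definition CWu_term ::
  "nat \<Rightarrow> 'k ring \<Rightarrow> ('k, 'a) module \<Rightarrow> nat \<Rightarrow> (nat \<Rightarrow> 'k, nat \<Rightarrow> 'a) dieudonne" where
  "CWu_term p K R j = (W_ob p (Suc j) R)
     \<lparr> smult := (\<lambda>a x. (frob_inv p K ^^ j) a \<odot>\<^bsub>W_ob p (Suc j) R\<^esub> x) \<rparr>"

definition CWu_trans :: "('k, 'a) module \<Rightarrow> nat \<Rightarrow> (nat \<Rightarrow> 'a) \<Rightarrow> (nat \<Rightarrow> 'a)" where
  "CWu_trans R j x = (\<lambda>i\<in>{..<Suc (Suc j)}. if i = 0 then \<zero>\<^bsub>R\<^esub> else x (i - 1))"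

definition CWu_ob ::
  "nat \<Rightarrow> 'k ring \<Rightarrow> ('k, 'a) module \<Rightarrow> (nat \<Rightarrow> 'k, (nat \<times> (nat \<Rightarrow> 'a)) set) dieudonne" where
  "CWu_ob p K R = dieudonne_colim (CWu_term p K R) (CWu_trans R)"

definition CWu_functor ::
  "nat \<Rightarrow> 'k ring \<Rightarrow>
   (('k, 'a) module, 'a \<Rightarrow> 'a, (nat \<Rightarrow> 'k, (nat \<times> (nat \<Rightarrow> 'a)) set) dieudonne,
    (nat \<times> (nat \<Rightarrow> 'a)) set \<Rightarrow> (nat \<times> (nat \<Rightarrow> 'a)) set) cat_functor"
  where
  "CWu_functor p K = \<lparr> on_ob = CWu_ob p K,
     on_arr = (\<lambda>R S f. \<lambda>X \<in> carrier (CWu_ob p K R).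
       \<Union>{colim_rel (CWu_term p K S) (CWu_trans S) `` {(j, W_arr p (Suc j) R f x)} | j x. (j, x) \<in> X}) \<rparr>"


section \<open>Co-Witt vectors\<close>

definition eventual_value :: "(nat \<Rightarrow> 'a) \<Rightarrow> 'a" where
  "eventual_value s = (THE c. \<forall>\<^sub>F m in sequentially. s m = c)"

text \<open>A co-Witt vector $(\dots, a_{-1}, a_0)$ is represented by \<open>a :: nat \<Rightarrow> 'a\<close> with
  \<open>a n\<close> $= a_{-n}$.

  The scalar multiplication is the continuous extension of the one on $CW^u(R)$: the truncation
  $(a_{-n-m}, \dots, a_0)$ lies in $W_{n+m+1}(R)$, on which \<open>c\<close> acts as multiplication by
  $\mathrm{frob}^{-(n+m)}(c)$, and $a_{-n}$ has index $m$ there. On sequences with finitely many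
  nonzero entries the limit is attained by the action on $CW^u(R)$, and for \<open>c\<close> the Teichmueller
  representative of an element of \<open>K\<close> also called \<open>c\<close>, the entry with index $-n$ of the product is
  $c^{p^{-n}} a_{-n}$.\<close>

definition CW_ob :: "nat \<Rightarrow> 'k ring \<Rightarrow> ('k, 'a) module \<Rightarrow> (nat \<Rightarrow> 'k, nat \<Rightarrow> 'a) dieudonne" where
  "CW_ob p K R =
     \<lparr> carrier = {a. (\<forall>n. a n \<in> carrier R) \<and>
         (\<exists>r s :: nat. (Idl\<^bsub>R\<^esub> (a ` {r..})) [^]\<^bsub>ideals_set R\<^esub> (p ^ s) = {\<zero>\<^bsub>R\<^esub>})},
       mult = undefined, one = undefined,
       zero = (\<lambda>n. \<zero>\<^bsub>R\<^esub>),
       add = (\<lambda>a b n. eventual_value (\<lambda>m.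
         mpoly_eval R (case_sum (\<lambda>i. a (n + m - i)) (\<lambda>i. b (n + m - i))) (witt_sum p m))),
       smult = (\<lambda>c a n. eventual_value (\<lambda>m.
         mpoly_eval R (case_sum (\<lambda>i. (frob_inv p K ^^ (n + m)) c i \<odot>\<^bsub>R\<^esub> \<one>\<^bsub>R\<^esub>) (\<lambda>i. a (n + m - i)))
           (witt_prod p m))),
       dF = (\<lambda>a n. a n [^]\<^bsub>R\<^esub> p),
       dV = (\<lambda>a n. a (Suc n)) \<rparr>"

definition CW_functor ::
  "nat \<Rightarrow> 'k ring \<Rightarrow>
   (('k, 'a) module, 'a \<Rightarrow> 'a, (nat \<Rightarrow> 'k, nat \<Rightarrow> 'a) dieudonne, (nat \<Rightarrow> 'a) \<Rightarrow> (nat \<Rightarrow> 'a)) cat_functor"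
  where
  "CW_functor p K = \<lparr> on_ob = CW_ob p K,
     on_arr = (\<lambda>R S f. \<lambda>a \<in> carrier (CW_ob p K R). \<lambda>n. f (a n)) \<rparr>"

end

theory Submission
  imports Defs
begin

text \<open>The iterates of $\mu$ evaluate on a polar algebra exactly the monomials of degree
  $1 + k(p - 1)$. The polynomials for Witt vector addition are isobaric of weight $p^n$ if the
  components with index $i$ have weight $p^i$, those for multiplication are so in each argument. Since
  $p^i \equiv 1$ modulo $p - 1$, the sum of two Witt vectors over a polar algebra $A$ makes sense, and
  so does the product of a Witt vector over $k$ and one over $A$. Identities between these operations
  are proved for integral polynomials in the elements of $k$ and $A$, where the ghost map is
  injective, and are then evaluated in $A$.

  An isobaric monomial of weight $p^M$ that contains a variable with an index much smaller than $t$
  contains many variables with an index below $t$, so it vanishes if these take values in a nilpotent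
  set. Hence the limits that define the operations on co-Witt vectors exist over $A$, are additive,
  and inherit all identities from Witt vectors. Read backwards, $W_n$ and $CW^u$ consist of the
  co-Witt vectors with finitely many nonzero entries (of index at most $n - 1$ for $W_n$).\<close>

section \<open>Integer polynomials\<close>

text \<open>A polar algebra has no unit and no binary product, so there is no ring in which the Witt
  polynomials could be evaluated directly. This is why the universal case uses an honest polynomial
  ring: evaluation back into \<open>A\<close> respects products only where the number of factors
  from \<open>A\<close> is admissible, and the weights of the Witt polynomials guarantee this for
  every substitution that occurs.

  The relations that involve Frobenius, such as V F = p, hold for componentwise p-th powers only
  modulo p. They come from congruences modulo p^(n+1) between n-th ghost components and become
  equations because p annihilates \<open>K\<close> and \<open>A\<close>.

  The module axioms are checked once, for the co-Witt vectors of a polar algebra. Every other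
  Dieudonne structure, including those on W_n(R), CW(R) and CW^u(R) for an algebra R, is pulled back
  from there, directly or in two steps, along an injective map that respects all operations.\<close>

abbreviation "kys \<equiv> Poly_Mapping.keys"

text \<open>Multisets mediate between exponent vectors and lists: a monomial has to be read as a
  list of variables before a p-ary product can be iterated over it.\<close>

definition mon :: "('v \<Rightarrow>\<^sub>0 nat) \<Rightarrow> 'v multiset" where
  "mon m = Abs_multiset (Poly_Mapping.lookup m)"

lemma count_mon [simp]: "count (mon m) v = Poly_Mapping.lookup m v"
  unfolding mon_def by (rule fun_cong[OF count_Abs_multiset]) (use finite_lookup[of m] in auto)

lemma mon_0 [simp]: "mon 0 = {#}"
  by (rule multiset_eqI) simp

lemma mon_add [simp]: "mon (m + m') = mon m + mon m'"
  by (rule multiset_eqI) (simp add: lookup_add)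

lemma mon_single [simp]: "mon (Poly_Mapping.single v 1) = {#v#}"
  by (rule multiset_eqI) (simp add: lookup_single)

lemma mon_inj: "mon m = mon m' \<longleftrightarrow> m = m'"
  by (metis count_mon poly_mapping_eqI)

lemma set_mset_mon: "set_mset (mon m) = kys m"
  by (simp add: set_eq_iff in_keys_iff flip: count_greater_zero_iff)

text \<open>Integer polynomials are elements of the free abelian group on the monomials,
  \<open>frag_of m\<close> being the monomial \<open>m\<close>. Extension by linearity and induction
  over differences of monomials come from there.\<close>

lemma one_eq_frag_of: "(1 :: 'v int_mpoly) = frag_of 0"
  by (simp add: single_one)

lemma mult_frag_of: "frag_of (m::'v \<Rightarrow>\<^sub>0 nat) * frag_of m' = frag_of (m + m')"
  by (simp add: mult_single)

lemma lookup_of_int_times: "Poly_Mapping.lookup (of_int k * (f :: 'v int_mpoly)) m = k * Poly_Mapping.lookup f m"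
proof -
  have "of_int k * f = Poly_Mapping.map ((*) k) f"
    using single_of_int[where ?'b = int and ?'a = "'v \<Rightarrow>\<^sub>0 nat", of k] by (simp add: mult_map_scale_conv_mult)
  then show ?thesis by (simp add: Poly_Mapping.map.rep_eq when_def)
qed

lemma of_nat_times_cancel: "of_nat n * (f :: 'v int_mpoly) = of_nat n * g \<longleftrightarrow> n = 0 \<or> f = g"
proof -
  have "f = g" if "of_nat n * f = of_nat n * g" "n \<noteq> 0"
  proof (rule poly_mapping_eqI)
    fix m show "Poly_Mapping.lookup f m = Poly_Mapping.lookup g m"
      using arg_cong[OF that(1), of "\<lambda>h. Poly_Mapping.lookup h m"] that(2)
      lookup_of_int_times[of "int n" f m] lookup_of_int_times[of "int n" g m] by simp
  qed
  then show ?thesis by auto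
qed

lemma keys_of_nat_times:
  assumes "n \<noteq> 0" shows "kys (of_nat n * (f :: 'v int_mpoly)) = kys f"
  using lookup_of_int_times[of "int n" f] assms by (auto simp: in_keys_iff)

text \<open>All gradings below are expressed as conditions on supports: the weights of the Witt
  polynomials, degree zero in the variables from \<open>A\<close>, and admissible degree in these
  variables.\<close>

definition polys_in :: "('v \<Rightarrow>\<^sub>0 nat) set \<Rightarrow> 'v int_mpoly set" where
  "polys_in S = {f. kys f \<subseteq> S}"

lemma polys_in_0 [simp]: "0 \<in> polys_in S" by (simp add: polys_in_def)
lemma polys_in_diff: "f \<in> polys_in S \<Longrightarrow> g \<in> polys_in S \<Longrightarrow> f - g \<in> polys_in S"
  using keys_diff[of f g] by (auto simp: polys_in_def)
lemma polys_in_add: "f \<in> polys_in S \<Longrightarrow> g \<in> polys_in S \<Longrightarrow> f + g \<in> polys_in S"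
  using keys_add[of f g] by (auto simp: polys_in_def)
lemma polys_in_uminus: "f \<in> polys_in S \<Longrightarrow> - f \<in> polys_in S"
  by (auto simp: polys_in_def)
lemma polys_in_sum: "(\<And>i. i \<in> I \<Longrightarrow> f i \<in> polys_in S) \<Longrightarrow> sum f I \<in> polys_in S"
  by (induction I rule: infinite_finite_induct) (auto simp: polys_in_add)
lemma polys_in_of_nat: "f \<in> polys_in S \<Longrightarrow> of_nat n * f \<in> polys_in S"
  by (cases "n = 0") (auto simp: polys_in_def keys_of_nat_times)
lemma polys_in_of_nat_iff: "n \<noteq> 0 \<Longrightarrow> of_nat n * f \<in> polys_in S \<longleftrightarrow> f \<in> polys_in S"
  by (auto simp: polys_in_def keys_of_nat_times)
lemma polys_in_frag_of [simp]: "frag_of m \<in> polys_in S \<longleftrightarrow> m \<in> S"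
  by (auto simp: polys_in_def)

lemma polys_in_induct [consumes 1, case_names zero one diff]:
  assumes "f \<in> polys_in S" "P 0" "\<And>m. m \<in> S \<Longrightarrow> P (frag_of m)"
    "\<And>a b. a \<in> polys_in S \<Longrightarrow> b \<in> polys_in S \<Longrightarrow> P a \<Longrightarrow> P b \<Longrightarrow> P (a - b)"
  shows "P f"
proof -
  have "kys f \<subseteq> S" using assms by (simp add: polys_in_def)
  then have "f \<in> polys_in S \<and> P f"
    by (induction f rule: frag_induction) (use assms in \<open>auto simp: polys_in_diff\<close>)
  then show ?thesis by simp
qed

lemma polys_in_mult:
  assumes "f \<in> polys_in S" "g \<in> polys_in T" "\<And>m n. m \<in> S \<Longrightarrow> n \<in> T \<Longrightarrow> m + n \<in> U"
  shows "f * g \<in> polys_in U"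
  using assms(1)
proof (induction f rule: polys_in_induct)
  case (one m)
  show ?case using assms(2)
    by (induction g rule: polys_in_induct) (use one assms(3) in \<open>auto simp: right_diff_distrib polys_in_diff mult_frag_of\<close>)
qed (auto simp: left_diff_distrib polys_in_diff)

lemma int_mpoly_induct [case_names zero one diff]:
  assumes "P 0" "\<And>m. P (frag_of m)" "\<And>a b. P a \<Longrightarrow> P b \<Longrightarrow> P (a - b)"
  shows "P (f :: 'v int_mpoly)"
  using subset_UNIV[of "kys f"] by (induction f rule: frag_induction) (use assms in auto)

definition psubst :: "('v \<Rightarrow> 'w int_mpoly) \<Rightarrow> 'v int_mpoly \<Rightarrow> 'w int_mpoly" where
  "psubst \<tau> = frag_extend (\<lambda>m. \<Prod>v\<in>#mon m. \<tau> v)"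

lemma psubst_add: "psubst \<tau> (f + g) = psubst \<tau> f + psubst \<tau> g"
  by (simp add: psubst_def frag_extend_add)
lemma psubst_diff: "psubst \<tau> (f - g) = psubst \<tau> f - psubst \<tau> g"
  by (simp add: psubst_def frag_extend_diff)
lemma psubst_0 [simp]: "psubst \<tau> 0 = 0"
  by (simp add: psubst_def)
lemma psubst_frag_of: "psubst \<tau> (frag_of m) = (\<Prod>v\<in>#mon m. \<tau> v)"
  by (simp add: psubst_def)
lemma psubst_1 [simp]: "psubst \<tau> 1 = 1"
  by (simp add: one_eq_frag_of psubst_frag_of del: single_one)
lemma psubst_mvar [simp]: "psubst \<tau> (mvar v) = \<tau> v"
  unfolding mvar_def by (simp only: psubst_frag_of mon_single) simp
lemma psubst_mult: "psubst \<tau> (f * g) = psubst \<tau> f * psubst \<tau> g"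
proof (induction f rule: int_mpoly_induct)
  case (one m)
  show ?case by (induction g rule: int_mpoly_induct)
    (simp_all add: psubst_frag_of mult_frag_of psubst_diff algebra_simps)
qed (simp_all add: psubst_diff algebra_simps)
lemma psubst_power: "psubst \<tau> (f ^ n) = psubst \<tau> f ^ n"
  by (induction n) (simp_all add: psubst_mult)
lemma psubst_of_nat [simp]: "psubst \<tau> (of_nat n) = of_nat n"
  by (induction n) (simp_all add: psubst_add)
lemma psubst_sum: "psubst \<tau> (sum f I) = (\<Sum>i\<in>I. psubst \<tau> (f i))"
  by (induction I rule: infinite_finite_induct) (simp_all add: psubst_add)
lemma frag_of_conv_mvar: "frag_of m = (\<Prod>v\<in>#mon m. mvar v)"
proof -
  have *: "\<exists>m. mon m = M \<and> frag_of m = (\<Prod>v\<in>#M. mvar v)" for M :: "'v multiset"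
  proof (induction M)
    case empty
    show ?case by (rule exI[of _ 0]) simp
  next
    case (add x M)
    then obtain m where m: "mon m = M" "frag_of m = (\<Prod>v\<in>#M. mvar v)" by blast
    then show ?case
      by (intro exI[of _ "Poly_Mapping.single x 1 + m"])
        (simp add: mult_frag_of[symmetric] mvar_def del: One_nat_def)
  qed
  from *[of "mon m"] show ?thesis by (auto simp: mon_inj)
qed

text \<open>The variables generate the polynomial ring, so a congruence that is stable under
  differences and products need only be tested on them.\<close>

lemma mpoly_subring_induct [case_names one var diff mult]:
  assumes "P 1" "\<And>v. P (mvar v)" "\<And>a b. P a \<Longrightarrow> P b \<Longrightarrow> P (a - b)" "\<And>a b. P a \<Longrightarrow> P b \<Longrightarrow> P (a * b)"
  shows "P (f :: 'v int_mpoly)"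
proof -
  have "P 0" using assms(3)[OF assms(1,1)] by simp
  moreover have "P (frag_of m)" for m :: "'v \<Rightarrow>\<^sub>0 nat"
  proof -
    have "P (\<Prod>v\<in>#M. mvar v)" for M :: "'v multiset"
      by (induction M) (use assms in auto)
    then show ?thesis by (simp add: frag_of_conv_mvar)
  qed
  ultimately show ?thesis
    by (induction f rule: int_mpoly_induct) (use assms in auto)
qed

section \<open>Congruences and Dwork's lemma\<close>

text \<open>x^p - y^p is x - y times a sum of p products, each congruent to y^(p-1) modulo p. The
  second factor therefore contributes one more p.\<close>

lemma dvd_power_diff:
  fixes x y :: "'b::comm_ring_1"
  assumes "of_nat p dvd d" "d dvd x - y"
  shows "of_nat p * d dvd x ^ p - y ^ p"
proof -
  have pow: "x - y dvd x ^ i - y ^ i" for i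
    by (simp add: power_diff_sumr2)
  have "of_nat p dvd (\<Sum>i<p. y ^ (p - Suc i) * x ^ i)"
  proof -
    have "(\<Sum>i<p. y ^ (p - Suc i) * x ^ i) = (\<Sum>i<p. y ^ (p - Suc i) * (x ^ i - y ^ i)) + of_nat p * y ^ (p - 1)"
    proof -
      have "(\<Sum>i<p. y ^ (p - Suc i) * y ^ i) = (\<Sum>i<p. y ^ (p - 1))"
        by (intro sum.cong refl) (simp flip: power_add)
      then show ?thesis by (simp add: right_diff_distrib sum_subtractf)
    qed
    moreover have "of_nat p dvd (\<Sum>i<p. y ^ (p - Suc i) * (x ^ i - y ^ i))"
      by (intro dvd_sum dvd_mult) (meson assms dvd_trans pow)
    ultimately show ?thesis by simp
  qed
  with assms(2) have "d * of_nat p dvd (x - y) * (\<Sum>i<p. y ^ (p - Suc i) * x ^ i)"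
    by (rule mult_dvd_mono)
  then show ?thesis by (simp add: power_diff_sumr2 mult.commute)
qed

lemma dvd_prime_power_diff:
  fixes x y :: "'b::comm_ring_1"
  assumes "of_nat p dvd x - y"
  shows "of_nat (p ^ Suc n) dvd x ^ (p ^ n) - y ^ (p ^ n)"
proof (induction n)
  case (Suc n)
  have "of_nat p * of_nat (p ^ Suc n) dvd (x ^ p ^ n) ^ p - (y ^ p ^ n) ^ p"
    by (rule dvd_power_diff[OF _ Suc]) simp
  then show ?case by (simp add: mult.commute flip: power_mult)
qed (use assms in simp)

lemma frobenius_add_dvd:
  fixes x y :: "'b::comm_ring_1"
  assumes "prime p"
  shows "of_nat p dvd (x + y) ^ p - (x ^ p + y ^ p)"
proof -
  have p: "p > 1" "0 < p" using prime_gt_1_nat[OF assms] by auto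
  have "(x + y) ^ p = (\<Sum>k\<le>p. of_nat (p choose k) * x ^ k * y ^ (p - k))"
    by (rule binomial_ring)
  also have "{..p} = insert 0 (insert p {0<..<p})" using p by auto
  also have "(\<Sum>k\<in>\<dots>. of_nat (p choose k) * x ^ k * y ^ (p - k)) =
      y ^ p + x ^ p + (\<Sum>k\<in>{0<..<p}. of_nat (p choose k) * x ^ k * y ^ (p - k))"
    using p by simp
  finally have "(x + y) ^ p - (x ^ p + y ^ p) = (\<Sum>k\<in>{0<..<p}. of_nat (p choose k) * x ^ k * y ^ (p - k))"
    by simp
  also have "of_nat p dvd \<dots>"
  proof (intro dvd_sum)
    fix k assume "k \<in> {0<..<p}"
    then have "p dvd (p choose k)" using assms p by (intro dvd_choose_prime) auto
    then have "of_nat p dvd (of_nat (p choose k) :: 'b)" by (metis dvd_def of_nat_mult)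
    then show "of_nat p dvd of_nat (p choose k) * x ^ k * y ^ (p - k)"
      by (simp add: mult.assoc)
  qed
  finally show ?thesis .
qed

section \<open>The lift of Frobenius to integer polynomials, and ghost components\<close>

definition frobl :: "nat \<Rightarrow> 'v int_mpoly \<Rightarrow> 'v int_mpoly" where
  "frobl p = psubst (\<lambda>v. mvar v ^ p)"

text \<open>Both the p-th power and the endomorphism \<open>frobl p\<close> are multiplicative and,
  modulo p, additive; on variables they agree.\<close>

lemma frobl_dvd:
  assumes "prime p"
  shows "of_nat p dvd f ^ p - frobl p f"
proof (induction f rule: mpoly_subring_induct)
  case one
  show ?case by (simp add: frobl_def)
next
  case (var v)
  show ?case by (simp add: frobl_def)
next
  case (diff a b)
  \<comment> \<open>Additivity modulo p is applied to \<open>(a - b) + b\<close>, which avoids the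
    sign of (-b)^p when p = 2.\<close>
  have "(a - b) ^ p - frobl p (a - b) =
    (a ^ p - frobl p a) - (b ^ p - frobl p b) - (((a - b) + b) ^ p - ((a - b) ^ p + b ^ p))"
    by (simp add: frobl_def psubst_diff)
  then show ?case using diff frobenius_add_dvd[OF assms, of "a - b" b]
    by (metis dvd_diff)
next
  case (mult a b)
  have "(a * b) ^ p - frobl p (a * b) = (a ^ p - frobl p a) * b ^ p + frobl p a * (b ^ p - frobl p b)"
    by (simp add: frobl_def psubst_mult algebra_simps power_mult_distrib)
  then show ?case using mult by (metis dvd_add dvd_mult dvd_mult2)
qed

lemma psubst_ghost: "psubst \<tau> (ghost p n x) = ghost p n (\<lambda>i. psubst \<tau> (x i))"
  by (simp add: ghost_def psubst_sum psubst_mult psubst_power flip: of_nat_power)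

text \<open>This recursion links ghost components with Frobenius: modulo p^(n+1), the component with
  index n + 1 depends only on the p-th powers of the entries.\<close>

lemma ghost_Suc: "ghost p (Suc n) x = ghost p n (\<lambda>i. x i ^ p) + of_nat (p ^ Suc n) * x (Suc n)"
proof -
  have "(\<Sum>i\<le>n. of_nat (p ^ i) * x i ^ p ^ (Suc n - i)) = (\<Sum>i\<le>n. of_nat (p ^ i) * (x i ^ p) ^ p ^ (n - i))"
    by (intro sum.cong) (auto simp: Suc_diff_le power_mult[symmetric])
  then show ?thesis by (simp add: ghost_def)
qed

lemma ghost_0 [simp]: "ghost p 0 x = x 0"
  by (simp add: ghost_def)

lemma ghost_split: "ghost p n x = (\<Sum>i<n. of_nat (p ^ i) * x i ^ (p ^ (n - i))) + of_nat (p ^ n) * x n"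
proof -
  have "{..n} = insert n {..<n}" by auto
  then show ?thesis by (simp add: ghost_def add.commute)
qed

text \<open>Raising to the power p^(n-i) improves a congruence modulo p to one modulo p^(n-i+1), and
  the coefficient p^i supplies the remaining factors.\<close>

lemma ghost_cong_dvd:
  fixes x y :: "nat \<Rightarrow> 'b::comm_ring_1"
  assumes "\<And>i. i < n \<Longrightarrow> of_nat p dvd x i - y i"
  shows "of_nat (p ^ Suc n) dvd (\<Sum>i<n. of_nat (p ^ i) * x i ^ (p ^ (n - i))) - (\<Sum>i<n. of_nat (p ^ i) * y i ^ (p ^ (n - i)))"
  unfolding sum_subtractf[symmetric]
proof (intro dvd_sum)
  fix i assume i: "i \<in> {..<n}"
  have "(of_nat (p ^ i) :: 'b) * of_nat (p ^ Suc (n - i)) dvd of_nat (p ^ i) * (x i ^ p ^ (n - i) - y i ^ p ^ (n - i))"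
    using i assms by (intro mult_dvd_mono dvd_prime_power_diff) auto
  moreover have "(of_nat (p ^ i) :: 'b) * of_nat (p ^ Suc (n - i)) = of_nat (p ^ Suc n)"
  proof -
    have "p ^ i * p ^ Suc (n - i) = p ^ Suc n" using i by (simp flip: power_add)
    then show ?thesis by (metis of_nat_mult)
  qed
  ultimately show "(of_nat (p ^ Suc n) :: 'b) dvd of_nat (p ^ i) * x i ^ p ^ (n - i) - of_nat (p ^ i) * y i ^ p ^ (n - i)"
    by (simp add: right_diff_distrib)
qed

lemma of_nat_dvd_cancel:
  assumes "n \<noteq> 0" "of_nat n * of_nat k dvd of_nat n * (f :: 'v int_mpoly)"
  shows "of_nat k dvd f"
proof -
  from assms obtain g where "of_nat n * f = of_nat n * (of_nat k * g)" by (auto simp: dvd_def mult.assoc)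
  then have "f = of_nat k * g" using assms(1) of_nat_times_cancel[of n f "of_nat k * g"] by blast
  then show ?thesis by simp
qed

text \<open>The system is triangular: the n-th ghost component and the earlier entries determine
  \<open>p ^ n * x n\<close>, and the polynomial ring is torsion free.\<close>

lemma ghost_inj:
  fixes x y :: "nat \<Rightarrow> 'v int_mpoly"
  assumes "p \<noteq> 0" "\<And>n. ghost p n x = ghost p n y"
  shows "x = y"
proof
  fix n show "x n = y n"
  proof (induction n rule: less_induct)
    case (less n)
    then have s: "(\<Sum>i<n. of_nat (p ^ i) * x i ^ (p ^ (n - i))) = (\<Sum>i<n. of_nat (p ^ i) * y i ^ (p ^ (n - i)))"
      by (intro sum.cong) auto
    have "of_nat (p ^ n) * x n = of_nat (p ^ n) * y n"
      using assms(2)[of n] unfolding ghost_split s by (rule add_left_imp_eq)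
    then show ?case using assms(1) of_nat_times_cancel[of "p ^ n" "x n" "y n"] by simp
  qed
qed

text \<open>The counterpart of \<open>ghost_inj\<close> for relations that hold only modulo p. The
  assumption has one factor p more than the coefficient p^n of the last entry, and this factor
  survives the cancellation.\<close>

lemma ghost_dvd_imp:
  fixes x y :: "nat \<Rightarrow> 'v int_mpoly"
  assumes "p \<noteq> 0" "\<And>n. of_nat (p ^ Suc n) dvd ghost p n x - ghost p n y"
  shows "of_nat p dvd x n - y n"
proof (induction n rule: less_induct)
  case (less n)
  let ?s = "\<lambda>x. \<Sum>i<n. of_nat (p ^ i) * x i ^ (p ^ (n - i))"
  have s: "of_nat (p ^ Suc n) dvd ?s x - ?s y" by (rule ghost_cong_dvd) (use less in auto)
  have "of_nat (p ^ n) * (x n - y n) = (ghost p n x - ghost p n y) - (?s x - ?s y)"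
    by (simp add: ghost_split algebra_simps)
  then have "of_nat (p ^ Suc n) dvd of_nat (p ^ n) * (x n - y n)"
    by (simp only: dvd_diff[OF assms(2) s])
  then have "of_nat (p ^ n) * of_nat p dvd of_nat (p ^ n) * (x n - y n)"
    by (simp add: mult.commute)
  then show ?case by (rule of_nat_dvd_cancel[rotated]) (use assms(1) in simp)
qed

text \<open>The entries are found one at a time. For n = k + 1 the part of the ghost component made
  of earlier entries is the component k of their p-th powers. Modulo p^n it is congruent to
  \<open>frobl p (w k)\<close>, hence to \<open>w n\<close>, so the remainder is divisible by
  p^n.\<close>

lemma dwork:
  fixes w :: "nat \<Rightarrow> 'v int_mpoly"
  assumes p: "prime p" and w: "\<And>n. of_nat (p ^ Suc n) dvd w (Suc n) - frobl p (w n)"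
  shows "\<exists>x. \<forall>n. ghost p n x = w n"
proof -
  have step: "\<exists>z. (\<Sum>i<n. of_nat (p ^ i) * x i ^ (p ^ (n - i))) + of_nat (p ^ n) * z = w n"
    if x: "\<And>k. k < n \<Longrightarrow> ghost p k x = w k" for x n
  proof -
    have "of_nat (p ^ n) dvd w n - (\<Sum>i<n. of_nat (p ^ i) * x i ^ (p ^ (n - i)))"
    proof (cases n)
      case (Suc k)
      have "(\<Sum>i<n. of_nat (p ^ i) * x i ^ (p ^ (n - i))) = ghost p k (\<lambda>i. x i ^ p)"
        unfolding ghost_def Suc lessThan_Suc_atMost
        by (intro sum.cong) (auto simp: Suc_diff_le power_mult[symmetric])
      moreover have "of_nat (p ^ Suc k) dvd ghost p k (\<lambda>i. x i ^ p) - ghost p k (\<lambda>i. frobl p (x i))"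
        (is "?d dvd ?a - ?b")
      proof -
        let ?s = "\<lambda>x. \<Sum>i<k. of_nat (p ^ i) * x i ^ (p ^ (k - i))"
        have "?a - ?b = (?s (\<lambda>i. x i ^ p) - ?s (\<lambda>i. frobl p (x i))) + of_nat (p ^ k) * (x k ^ p - frobl p (x k))"
          by (simp add: ghost_split algebra_simps)
        moreover have "?d dvd ?s (\<lambda>i. x i ^ p) - ?s (\<lambda>i. frobl p (x i))"
          by (rule ghost_cong_dvd) (simp add: frobl_dvd p)
        moreover have "?d dvd of_nat (p ^ k) * (x k ^ p - frobl p (x k))"
        proof -
          have "of_nat (p ^ k) * of_nat p dvd of_nat (p ^ k) * (x k ^ p - frobl p (x k))"
            by (intro mult_dvd_mono frobl_dvd p) auto
          then show ?thesis by (simp add: mult.commute)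
        qed
        ultimately show ?thesis by (simp only: dvd_add)
      qed
      moreover have "ghost p k (\<lambda>i. frobl p (x i)) = frobl p (w k)"
        using x[of k] Suc by (simp add: frobl_def psubst_ghost[symmetric])
      moreover have "w n - ?a = (w (Suc k) - frobl p (w k)) - (?a - frobl p (w k))" for a
        using Suc by simp
      ultimately show ?thesis using w[of k] Suc by (simp only: dvd_diff)
    qed simp
    then obtain z where "w n - (\<Sum>i<n. of_nat (p ^ i) * x i ^ (p ^ (n - i))) = of_nat (p ^ n) * z"
      by (rule dvdE)
    then show ?thesis by (intro exI[of _ z]) (simp add: algebra_simps)
  qed
  \<comment> \<open>The next entry is chosen as a function of the earlier ones, and the sequence
    arises by well-founded recursion; \<open>gc\<close> states that only smaller indices
    enter.\<close>
  define g where "g n x = (SOME z. (\<Sum>i<n. of_nat (p ^ i) * x i ^ (p ^ (n - i))) + of_nat (p ^ n) * z = w n)" for n x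
  define x where "x = wfrec less_than (\<lambda>x n. g n x)"
  have gc: "g n u = g n v" if "\<And>i. i < n \<Longrightarrow> u i = v i" for n u v
  proof -
    have "(\<Sum>i<n. of_nat (p ^ i) * u i ^ (p ^ (n - i))) = (\<Sum>i<n. of_nat (p ^ i) * v i ^ (p ^ (n - i)))"
      using that by auto
    then show ?thesis by (simp add: g_def)
  qed
  have xn: "x n = g n x" for n
    unfolding x_def by (subst wfrec[OF wf_less_than]) (rule gc, simp add: cut_def)
  have "ghost p n x = w n" for n
  proof (induction n rule: less_induct)
    case (less n)
    have "(\<Sum>i<n. of_nat (p ^ i) * x i ^ (p ^ (n - i))) + of_nat (p ^ n) * g n x = w n"
      unfolding g_def by (rule someI_ex[OF step[OF less]])
    then show ?case
      unfolding ghost_split xn[symmetric] .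
  qed
  then show ?thesis by blast
qed

text \<open>Vectors of variables satisfy the condition of \<open>dwork\<close>. Since
  \<open>frobl p\<close> is a ring homomorphism, sums, products and negatives of such ghost
  components satisfy it too, which yields the Witt polynomials.\<close>

lemma ghost_mvar_dvd: "of_nat (p ^ Suc n) dvd ghost p (Suc n) (\<lambda>i. mvar (h i)) - frobl p (ghost p n (\<lambda>i. mvar (h i)))"
  by (simp add: ghost_Suc frobl_def psubst_ghost)

lemma frobl_simps: "frobl p (f + g) = frobl p f + frobl p g" "frobl p (f * g) = frobl p f * frobl p g"
  "frobl p (f - g) = frobl p f - frobl p g"
  by (simp_all add: frobl_def psubst_add psubst_mult psubst_diff)

lemma dvd_mult_diff:
  fixes a b :: "'b::comm_ring_1"
  assumes "d dvd a - a'" "d dvd b - b'"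
  shows "d dvd a * b - a' * b'"
proof -
  have "a * b - a' * b' = (a - a') * b + a' * (b - b')" by (simp add: algebra_simps)
  then show ?thesis using assms by (metis dvd_add dvd_mult dvd_mult2)
qed

lemma dvd_add_diff:
  fixes a b :: "'b::comm_ring_1"
  assumes "d dvd a - a'" "d dvd b - b'"
  shows "d dvd (a + b) - (a' + b')"
  using dvd_add[OF assms] by (simp add: algebra_simps)

lemma dwork_unique:
  fixes w :: "nat \<Rightarrow> 'v int_mpoly"
  assumes p: "prime p" and w: "\<And>n. of_nat (p ^ Suc n) dvd w (Suc n) - frobl p (w n)"
  shows "\<exists>!x. \<forall>n. ghost p n x = w n"
proof (rule ex_ex1I)
  show "\<exists>x. \<forall>n. ghost p n x = w n" using p w by (rule dwork)
  show "x = y" if "\<forall>n. ghost p n x = w n" "\<forall>n. ghost p n y = w n" for x y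
    by (rule ghost_inj[of p]) (use that p in auto)
qed

lemma witt_sum_ghost:
  assumes "prime p"
  shows "ghost p n (witt_sum p) = ghost p n (\<lambda>i. mvar (Inl i)) + ghost p n (\<lambda>i. mvar (Inr i))"
proof -
  have "\<exists>!x. \<forall>n. ghost p n x = ghost p n (\<lambda>i. mvar (Inl i)) + ghost p n (\<lambda>i. mvar (Inr i) :: (nat + nat) int_mpoly)"
    by (rule dwork_unique[OF assms]) (unfold frobl_simps, intro dvd_add_diff ghost_mvar_dvd)
  from theI'[OF this] show ?thesis unfolding witt_sum_def by (rule spec)
qed

lemma witt_prod_ghost:
  assumes "prime p"
  shows "ghost p n (witt_prod p) = ghost p n (\<lambda>i. mvar (Inl i)) * ghost p n (\<lambda>i. mvar (Inr i))"
proof -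
  have "\<exists>!x. \<forall>n. ghost p n x = ghost p n (\<lambda>i. mvar (Inl i)) * ghost p n (\<lambda>i. mvar (Inr i) :: (nat + nat) int_mpoly)"
    by (rule dwork_unique[OF assms]) (unfold frobl_simps, intro dvd_mult_diff ghost_mvar_dvd)
  from theI'[OF this] show ?thesis unfolding witt_prod_def by (rule spec)
qed

section \<open>Weights\<close>

definition wt :: "('v \<Rightarrow> nat) \<Rightarrow> ('v \<Rightarrow>\<^sub>0 nat) \<Rightarrow> nat" where
  "wt \<omega> m = (\<Sum>v\<in>#mon m. \<omega> v)"

lemma wt_add [simp]: "wt \<omega> (m + m') = wt \<omega> m + wt \<omega> m'"
  by (simp add: wt_def)
lemma wt_0 [simp]: "wt \<omega> 0 = 0"
  by (simp add: wt_def)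

definition homog :: "('v \<Rightarrow> nat) \<Rightarrow> nat \<Rightarrow> 'v int_mpoly set" where
  "homog \<omega> d = polys_in {m. wt \<omega> m = d}"

lemma homog_mvar: "mvar v \<in> homog \<omega> (\<omega> v)"
  unfolding homog_def mvar_def by (simp add: wt_def del: One_nat_def)

lemma homog_mult: "f \<in> homog \<omega> d \<Longrightarrow> g \<in> homog \<omega> e \<Longrightarrow> f * g \<in> homog \<omega> (d + e)"
  unfolding homog_def by (rule polys_in_mult) auto

lemma homog_add: "f \<in> homog \<omega> d \<Longrightarrow> g \<in> homog \<omega> d \<Longrightarrow> f + g \<in> homog \<omega> d"
  unfolding homog_def by (rule polys_in_add)

lemma homog_power: "f \<in> homog \<omega> d \<Longrightarrow> f ^ n \<in> homog \<omega> (n * d)"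
proof (induction n)
  case 0
  show ?case by (simp add: homog_def one_eq_frag_of del: single_one)
qed (auto intro: homog_mult)

lemma homog_ghost_mvar:
  assumes "\<And>i. \<omega> (h i) = p ^ i"
  shows "ghost p n (\<lambda>i. mvar (h i)) \<in> homog \<omega> (p ^ n)"
  unfolding ghost_def homog_def
proof (intro polys_in_sum polys_in_of_nat)
  fix i assume "i \<in> {..n}"
  then have "p ^ (n - i) * \<omega> (h i) = p ^ n" by (simp add: assms flip: power_add)
  then show "mvar (h i) ^ p ^ (n - i) \<in> polys_in {m. wt \<omega> m = p ^ n}"
    using homog_power[OF homog_mvar[of "h i" \<omega>], of "p ^ (n - i)"] by (simp add: homog_def)
qed

lemma homog_0_ghost_mvar:
  assumes "\<And>i. \<omega> (h i) = 0"
  shows "ghost p n (\<lambda>i. mvar (h i)) \<in> homog \<omega> 0"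
  unfolding ghost_def homog_def
proof (intro polys_in_sum polys_in_of_nat)
  fix i
  show "mvar (h i) ^ p ^ (n - i) \<in> polys_in {m. wt \<omega> m = 0}"
    using homog_power[OF homog_mvar[of "h i" \<omega>], of "p ^ (n - i)"] assms by (simp add: homog_def)
qed

text \<open>In the n-th ghost component the power of an earlier entry x_i has weight p^(n-i) * p^i =
  p^n, and cancelling the coefficient p^n of the last entry does not change its support.\<close>

lemma homog_of_ghost:
  assumes "p \<noteq> 0" "\<And>n. ghost p n x \<in> homog \<omega> (p ^ n)"
  shows "x n \<in> homog \<omega> (p ^ n)"
proof (induction n rule: less_induct)
  case (less n)
  have "(\<Sum>i<n. of_nat (p ^ i) * x i ^ (p ^ (n - i))) \<in> polys_in {m. wt \<omega> m = p ^ n}"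
  proof (intro polys_in_sum polys_in_of_nat)
    fix i assume "i \<in> {..<n}"
    then have "p ^ (n - i) * p ^ i = p ^ n" "x i \<in> homog \<omega> (p ^ i)"
      using less by (auto simp flip: power_add)
    then show "x i ^ p ^ (n - i) \<in> polys_in {m. wt \<omega> m = p ^ n}"
      using homog_power[of "x i" \<omega> "p ^ i" "p ^ (n - i)"] by (simp add: homog_def)
  qed
  moreover have "of_nat (p ^ n) * x n = ghost p n x - (\<Sum>i<n. of_nat (p ^ i) * x i ^ (p ^ (n - i)))"
    by (simp add: ghost_split)
  ultimately have "of_nat (p ^ n) * x n \<in> polys_in {m. wt \<omega> m = p ^ n}"
    using assms(2)[of n] unfolding homog_def by (simp only: polys_in_diff)
  then show ?case using assms(1) unfolding homog_def by (subst (asm) polys_in_of_nat_iff) auto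
qed

text \<open>In a sum both arguments consist of entries of \<open>A\<close> and are weighted
  together. In a product the first argument consists of scalars, so each argument needs a grading of
  its own; \<open>wr\<close> is the one that controls the number of factors from
  \<open>A\<close>.\<close>

definition wlr :: "nat \<Rightarrow> nat + nat \<Rightarrow> nat" where "wlr p = case_sum (\<lambda>i. p ^ i) (\<lambda>i. p ^ i)"
definition wl :: "nat \<Rightarrow> nat + nat \<Rightarrow> nat" where "wl p = case_sum (\<lambda>i. p ^ i) (\<lambda>i. 0)"
definition wr :: "nat \<Rightarrow> nat + nat \<Rightarrow> nat" where "wr p = case_sum (\<lambda>i. 0) (\<lambda>i. p ^ i)"

lemma homogD: "f \<in> homog \<omega> d \<Longrightarrow> m \<in> kys f \<Longrightarrow> wt \<omega> m = d"
  by (auto simp: homog_def polys_in_def)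

lemma wt_witt_sum:
  assumes "prime p" "m \<in> kys (witt_sum p n)" shows "wt (wlr p) m = p ^ n"
proof -
  have "ghost p n (witt_sum p) \<in> homog (wlr p) (p ^ n)" for n
    unfolding witt_sum_ghost[OF assms(1)]
    by (intro homog_add homog_ghost_mvar) (simp_all add: wlr_def)
  then have "witt_sum p n \<in> homog (wlr p) (p ^ n)"
    using assms(1) by (intro homog_of_ghost[where x = "witt_sum p" and n = n and p = p]) auto
  then show ?thesis using assms(2) by (rule homogD)
qed

lemma wt_witt_prod:
  assumes "prime p" "m \<in> kys (witt_prod p n)" shows "wt (wl p) m = p ^ n" "wt (wr p) m = p ^ n"
proof -
  have gl: "ghost p n (witt_prod p) \<in> homog (wl p) (p ^ n)" for n
    unfolding witt_prod_ghost[OF assms(1)]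
    using homog_mult[OF homog_ghost_mvar[of "wl p" Inl p n] homog_0_ghost_mvar[of "wl p" Inr p n]]
    by (simp add: wl_def)
  have gr: "ghost p n (witt_prod p) \<in> homog (wr p) (p ^ n)" for n
    unfolding witt_prod_ghost[OF assms(1)]
    using homog_mult[OF homog_0_ghost_mvar[of "wr p" Inl p n] homog_ghost_mvar[of "wr p" Inr p n]]
    by (simp add: wr_def)
  have "witt_prod p n \<in> homog (wl p) (p ^ n)"
    using assms(1) by (intro homog_of_ghost[where x = "witt_prod p" and n = n and p = p] gl) auto
  then show "wt (wl p) m = p ^ n" using assms(2) by (rule homogD)
  have "witt_prod p n \<in> homog (wr p) (p ^ n)"
    using assms(1) by (intro homog_of_ghost[where x = "witt_prod p" and n = n and p = p] gr) auto
  then show "wt (wr p) m = p ^ n" using assms(2) by (rule homogD)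
qed

section \<open>Evaluation of integer polynomials in modules and rings\<close>

text \<open>Adjacent transpositions suffice: the head of \<open>xs\<close> is moved to the front of
  \<open>ys\<close> and then joins the common prefix \<open>pre\<close>. Fixing the multiset
  \<open>M\<close> restricts the swap hypothesis to lists of the right length with the right
  entries. The lemma serves products in rings as well as iterated polar products.\<close>

lemma swap_invariant_imp_perm_invariant:
  assumes swap: "\<And>us x y vs. mset (us @ x # y # vs) = M \<Longrightarrow> g (us @ x # y # vs) = g (us @ y # x # vs)"
    and "mset xs = M" "mset ys = M"
  shows "g xs = g ys"
proof -
  have front: "g (pre @ us @ x # vs) = g (pre @ x # us @ vs)" if "mset (pre @ us @ x # vs) = M" for pre us x vs
    using that
  proof (induction us arbitrary: vs rule: rev_induct)
    case (snoc u us)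
    have "g ((pre @ us) @ u # x # vs) = g ((pre @ us) @ x # u # vs)"
      by (rule swap) (use snoc.prems in simp)
    moreover have "g (pre @ us @ x # u # vs) = g (pre @ x # us @ u # vs)"
      using snoc.prems by (intro snoc.IH) (simp add: add_mset_commute)
    ultimately show ?case by simp
  qed simp
  have "g (pre @ xs) = g (pre @ ys)" if "mset xs = mset ys" "mset (pre @ xs) = M" for pre xs ys
    using that
  proof (induction xs arbitrary: pre ys)
    case (Cons x xs)
    then have "x \<in> set ys" by (metis list.set_intros(1) mset_eq_setD)
    then obtain us vs where ys: "ys = us @ x # vs" by (meson split_list)
    have m: "mset xs = mset (us @ vs)" using Cons.prems(1) ys by simp
    have "g ((pre @ [x]) @ xs) = g ((pre @ [x]) @ us @ vs)"
      by (rule Cons.IH[OF m]) (use Cons.prems in simp)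
    moreover have "g (pre @ ys) = g (pre @ x # us @ vs)"
      unfolding ys by (rule front) (use Cons.prems ys in simp)
    ultimately show ?case by simp
  qed simp
  from this[of xs ys "[]"] assms show ?thesis by simp
qed

text \<open>An arbitrary enumeration of the variables; the evaluations applied to it are invariant
  under permutations.\<close>

definition mlist :: "('v \<Rightarrow>\<^sub>0 nat) \<Rightarrow> 'v list" where
  "mlist m = (SOME xs. mset xs = mon m)"

lemma mset_mlist [simp]: "mset (mlist m) = mon m"
  unfolding mlist_def by (rule someI_ex) (rule ex_mset)

lemma set_mlist: "set (mlist m) = kys m"
  by (metis mset_mlist set_mset_mset set_mset_mon)

subsection \<open>Linear extension\<close>

text \<open>Evaluation in a ring and evaluation in a polar algebra both have this form. The lemmas
  below ask for values in the carrier only on supports, because in a polar algebra a monomial of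
  inadmissible degree has no meaningful value.\<close>

definition lin :: "('a, 'r) ring_scheme \<Rightarrow> ('m \<Rightarrow> 'a) \<Rightarrow> ('m \<Rightarrow>\<^sub>0 int) \<Rightarrow> 'a" where
  "lin G h f = (\<Oplus>\<^bsub>G\<^esub>m \<in> kys f. [Poly_Mapping.lookup f m] \<cdot>\<^bsub>G\<^esub> h m)"

context abelian_group
begin

lemma add_pow_int_add: "x \<in> carrier G \<Longrightarrow> [(i + j :: int)] \<cdot> x = [i] \<cdot> x \<oplus> [j] \<cdot> x"
  using group.int_pow_mult[OF a_group, of x i j] by (simp add: add_pow_def)

lemma add_pow_int_0 [simp]: "[(0::int)] \<cdot> x = \<zero>"
  by (simp add: add_pow_def)

lemma lin_closed [simp]: "(\<And>m. m \<in> kys f \<Longrightarrow> h m \<in> carrier G) \<Longrightarrow> lin G h f \<in> carrier G"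
  unfolding lin_def by (intro finsum_closed) auto

lemma lin_0 [simp]: "lin G h 0 = \<zero>"
  by (simp add: lin_def)

lemma lin_frag_of [simp]: "h m \<in> carrier G \<Longrightarrow> lin G h (frag_of m) = h m"
  by (simp add: lin_def)

lemma lin_superset:
  assumes "finite S" "kys f \<subseteq> S" "\<And>m. m \<in> S \<Longrightarrow> h m \<in> carrier G"
  shows "lin G h f = (\<Oplus>m \<in> S. [Poly_Mapping.lookup f m] \<cdot> h m)"
  unfolding lin_def
  by (rule add.finprod_mono_neutral_cong_left) (use assms in \<open>auto simp: in_keys_iff\<close>)

lemma lin_add:
  assumes "\<And>m. m \<in> kys f \<union> kys g \<Longrightarrow> h m \<in> carrier G"
  shows "lin G h (f + g) = lin G h f \<oplus> lin G h g"
proof -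
  have *: "lin G h e = (\<Oplus>m \<in> kys f \<union> kys g. [Poly_Mapping.lookup e m] \<cdot> h m)"
    if "kys e \<subseteq> kys f \<union> kys g" for e
    using that assms by (intro lin_superset) auto
  show ?thesis
    using assms keys_add[of f g]
    by (simp add: * lookup_add add_pow_int_add flip: add.finprod_multf cong: finsum_cong)
qed

lemma lin_uminus:
  assumes "\<And>m. m \<in> kys f \<Longrightarrow> h m \<in> carrier G"
  shows "lin G h (- f) = \<ominus> lin G h f"
proof -
  have "lin G h f \<oplus> lin G h (- f) = lin G h (f + - f)"
    by (rule lin_add[symmetric]) (use assms in auto)
  moreover have "lin G h f \<in> carrier G" using assms by (rule lin_closed)
  moreover have "lin G h (- f) \<in> carrier G" by (rule lin_closed) (use assms in simp)
  ultimately show ?thesis by (metis minus_equality a_comm lin_0 right_minus)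
qed

lemma lin_diff:
  assumes "\<And>m. m \<in> kys f \<union> kys g \<Longrightarrow> h m \<in> carrier G"
  shows "lin G h (f - g) = lin G h f \<ominus> lin G h g"
  using lin_add[of f "- g" h] lin_uminus[of g h] assms by (simp add: a_minus_def)

lemma lin_of_nat_times:
  fixes h :: "('v \<Rightarrow>\<^sub>0 nat) \<Rightarrow> 'a"
  assumes "\<And>m. m \<in> kys f \<Longrightarrow> h m \<in> carrier G"
  shows "lin G h (of_nat n * f) = [n] \<cdot> lin G h f"
proof (induction n)
  case (Suc n)
  have "kys (of_nat n * f) \<subseteq> kys f" by (cases "n = 0") (auto simp: keys_of_nat_times)
  then have "lin G h (of_nat n * f + f) = lin G h (of_nat n * f) \<oplus> lin G h f"
    using assms by (intro lin_add) auto
  with Suc show ?case by (simp add: algebra_simps)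
qed simp

lemma lin_cong:
  assumes "\<And>m. m \<in> kys f \<Longrightarrow> h m = h' m" "\<And>m. m \<in> kys f \<Longrightarrow> h' m \<in> carrier G"
  shows "lin G h f = lin G h' f"
  unfolding lin_def using assms by (intro finsum_cong') auto

lemma lin_induct_closed:
  assumes "\<zero> \<in> H" "\<And>x y. x \<in> H \<Longrightarrow> y \<in> H \<Longrightarrow> x \<ominus> y \<in> H" "\<And>m. m \<in> kys f \<Longrightarrow> h m \<in> H" "H \<subseteq> carrier G"
  shows "lin G h f \<in> H"
proof -
  \<comment> \<open>Extension by zero outside the support, so that the induction can run over all
    elements \<open>e\<close> of the free abelian group.\<close>
  define h' where "h' m = (if m \<in> kys f then h m else \<zero>)" for m
  have h': "h' m \<in> H" "h' m \<in> carrier G" for m using assms by (auto simp: h'_def)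
  have "lin G h' e \<in> H" for e
    using subset_UNIV by (induction e rule: frag_induction) (use assms h' in \<open>auto simp: lin_diff\<close>)
  moreover have "lin G h f = lin G h' f"
    by (rule lin_cong) (use assms in \<open>auto simp: h'_def\<close>)
  ultimately show ?thesis by simp
qed

lemma lin_hom:
  assumes "abelian_group N" "\<And>x. x \<in> carrier G \<Longrightarrow> \<phi> x \<in> carrier N"
    "\<And>x y. x \<in> carrier G \<Longrightarrow> y \<in> carrier G \<Longrightarrow> \<phi> (x \<oplus> y) = \<phi> x \<oplus>\<^bsub>N\<^esub> \<phi> y"
    "\<And>m. m \<in> kys f \<Longrightarrow> h m \<in> carrier G"
  shows "\<phi> (lin G h f) = lin N (\<lambda>m. \<phi> (h m)) f"
proof -
  interpret N: abelian_group N by fact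
  have z: "\<phi> \<zero> = \<zero>\<^bsub>N\<^esub>"
    using assms(3)[of \<zero> \<zero>] assms(2)[of \<zero>] by (metis N.add.r_cancel_one' l_zero zero_closed)
  have d: "\<phi> (x \<ominus> y) = \<phi> x \<ominus>\<^bsub>N\<^esub> \<phi> y" if "x \<in> carrier G" "y \<in> carrier G" for x y
  proof -
    have "\<phi> (\<ominus> y) \<oplus>\<^bsub>N\<^esub> \<phi> y = \<zero>\<^bsub>N\<^esub>"
      using assms(3)[of "\<ominus> y" y] that z by (simp add: l_neg)
    then have "\<phi> (\<ominus> y) = \<ominus>\<^bsub>N\<^esub> \<phi> y" using that assms(2) by (intro N.minus_equality[symmetric]) auto
    then show ?thesis using that assms(3) by (simp add: a_minus_def)
  qed
  define h' where "h' m = (if m \<in> kys f then h m else \<zero>)" for m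
  have h': "h' m \<in> carrier G" for m using assms by (auto simp: h'_def)
  have "\<phi> (lin G h' e) = lin N (\<lambda>m. \<phi> (h' m)) e" for e
    using subset_UNIV by (induction e rule: frag_induction)
      (use assms(2) h' in \<open>auto simp: lin_diff N.lin_diff z d\<close>)
  moreover have "lin G h f = lin G h' f" "lin N (\<lambda>m. \<phi> (h m)) f = lin N (\<lambda>m. \<phi> (h' m)) f"
    using assms by (auto intro!: lin_cong N.lin_cong simp: h'_def)
  ultimately show ?thesis by simp
qed

end

subsection \<open>Rings\<close>

definition mprod :: "('a, 'r) monoid_scheme \<Rightarrow> 'a list \<Rightarrow> 'a" where
  "mprod R xs = foldr (mult R) xs \<one>\<^bsub>R\<^esub>"

lemma mprod_simps [simp]: "mprod R [] = \<one>\<^bsub>R\<^esub>" "mprod R (x # xs) = x \<otimes>\<^bsub>R\<^esub> mprod R xs"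
  by (simp_all add: mprod_def)

context comm_monoid
begin

lemma mprod_closed [simp]: "set xs \<subseteq> carrier G \<Longrightarrow> mprod G xs \<in> carrier G"
  by (induction xs) auto

lemma mprod_append: "set xs \<subseteq> carrier G \<Longrightarrow> set ys \<subseteq> carrier G \<Longrightarrow> mprod G (xs @ ys) = mprod G xs \<otimes> mprod G ys"
  by (induction xs) (auto simp: m_assoc)

lemma mprod_perm:
  assumes "mset xs = mset ys" "set xs \<subseteq> carrier G"
  shows "mprod G xs = mprod G ys"
proof (rule swap_invariant_imp_perm_invariant[OF _ assms(1) refl])
  fix us x y vs assume "mset (us @ x # y # vs) = mset ys"
  then have "set (us @ x # y # vs) \<subseteq> carrier G" using assms by (metis mset_eq_setD)
  then show "mprod G (us @ x # y # vs) = mprod G (us @ y # x # vs)"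
    by (simp add: mprod_append m_lcomm)
qed

end

abbreviation (input) mono_prod :: "('a, 'r) monoid_scheme \<Rightarrow> ('v \<Rightarrow> 'a) \<Rightarrow> ('v \<Rightarrow>\<^sub>0 nat) \<Rightarrow> 'a" where
  "mono_prod R \<nu> m \<equiv> mprod R (map \<nu> (mlist m))"

context cring
begin

lemma finprod_monomial:
  assumes "\<And>v. v \<in> kys m \<Longrightarrow> \<nu> v \<in> carrier R"
  shows "(\<Otimes>v\<in>kys m. \<nu> v [^] Poly_Mapping.lookup m v) = mono_prod R \<nu> m"
proof -
  have "(\<Otimes>v\<in>set_mset M. \<nu> v [^] count M v) = mprod R (map \<nu> xs)"
    if "mset xs = M" "\<nu> ` set_mset M \<subseteq> carrier R" for xs M using that
  proof (induction xs arbitrary: M)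
    case (Cons x xs)
    have M: "M = add_mset x (mset xs)" using Cons.prems by simp
    have c: "\<nu> x \<in> carrier R" "\<nu> ` set xs \<subseteq> carrier R" using Cons.prems M by auto
    have IH: "(\<Otimes>v\<in>set xs. \<nu> v [^] count (mset xs) v) = mprod R (map \<nu> xs)"
      using Cons.IH[OF refl] c by simp
    \<comment> \<open>The new factor is spread over all variables as an indicator, which treats the
      cases \<open>x\<close> in \<open>xs\<close> and \<open>x\<close> not in \<open>xs\<close> at
      once.\<close>
    have "(\<Otimes>v\<in>set_mset M. \<nu> v [^] count M v) =
      (\<Otimes>v\<in>insert x (set xs). (if x = v then \<nu> v else \<one>) \<otimes> \<nu> v [^] count (mset xs) v)"
      unfolding M by (rule finprod_cong') (use c in \<open>auto simp: m_comm\<close>)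
    also have "\<dots> = (\<Otimes>v\<in>insert x (set xs). (if x = v then \<nu> v else \<one>)) \<otimes>
        (\<Otimes>v\<in>insert x (set xs). \<nu> v [^] count (mset xs) v)"
      by (rule finprod_multf) (use c in auto)
    also have "(\<Otimes>v\<in>insert x (set xs). (if x = v then \<nu> v else \<one>)) = \<nu> x"
      by (rule finprod_singleton) (use c in auto)
    also have "(\<Otimes>v\<in>insert x (set xs). \<nu> v [^] count (mset xs) v) = (\<Otimes>v\<in>set xs. \<nu> v [^] count (mset xs) v)"
      by (rule finprod_mono_neutral_cong_right) (use c in \<open>auto simp: not_in_iff[THEN iffD1]\<close>)
    finally show ?case using IH by simp
  qed simp
  from this[of "mlist m" "mon m"] show ?thesis using assms by (auto simp: set_mset_mon)
qed

lemma mpoly_eval_eq_lin: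
  assumes "\<And>m v. m \<in> kys f \<Longrightarrow> v \<in> kys m \<Longrightarrow> \<nu> v \<in> carrier R"
  shows "mpoly_eval R \<nu> f = lin R (mono_prod R \<nu>) f"
  unfolding mpoly_eval_def lin_def using assms
  by (intro finsum_cong') (auto simp: finprod_monomial set_mlist intro!: add.int_pow_closed mprod_closed)

lemma mono_prod_add:
  assumes "\<And>v. v \<in> kys m \<union> kys m' \<Longrightarrow> \<nu> v \<in> carrier R"
  shows "mono_prod R \<nu> (m + m') = mono_prod R \<nu> m \<otimes> mono_prod R \<nu> m'"
proof -
  have "mprod R (map \<nu> (mlist m @ mlist m')) = mono_prod R \<nu> (m + m')"
    by (rule mprod_perm) (use assms in \<open>auto simp: set_mlist\<close>)
  then show ?thesis using assms by (subst (asm) map_append, subst (asm) mprod_append) (auto simp: set_mlist)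
qed

context
  fixes \<nu> :: "'v \<Rightarrow> 'a"
  assumes \<nu>: "\<And>v. \<nu> v \<in> carrier R"
begin

lemma mono_prod_closed: "mono_prod R \<nu> m \<in> carrier R"
  using \<nu> by (intro mprod_closed) auto

lemma mpoly_eval_closed: "mpoly_eval R \<nu> f \<in> carrier R"
  using \<nu> by (auto simp: mpoly_eval_eq_lin mono_prod_closed intro!: lin_closed)

lemma mpoly_eval_diff: "mpoly_eval R \<nu> (f - g) = mpoly_eval R \<nu> f \<ominus> mpoly_eval R \<nu> g"
  using \<nu> by (simp add: mpoly_eval_eq_lin mono_prod_closed lin_diff)

lemma mpoly_eval_frag_of: "mpoly_eval R \<nu> (frag_of m) = mono_prod R \<nu> m"
  using \<nu> by (simp add: mpoly_eval_eq_lin mono_prod_closed)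

lemma mpoly_eval_0: "mpoly_eval R \<nu> 0 = \<zero>"
  using \<nu> by (simp add: mpoly_eval_eq_lin)

lemma mpoly_eval_1: "mpoly_eval R \<nu> 1 = \<one>"
proof -
  have "mlist (0 :: 'v \<Rightarrow>\<^sub>0 nat) = []"
    by (metis mset_mlist mon_0 mset_zero_iff)
  then show ?thesis by (simp add: one_eq_frag_of mpoly_eval_frag_of del: single_one)
qed

lemma mpoly_eval_mvar: "mpoly_eval R \<nu> (mvar v) = \<nu> v"
proof -
  have "mlist (Poly_Mapping.single v 1 :: 'v \<Rightarrow>\<^sub>0 nat) = [v]"
    by (metis mset_mlist mon_single mset_single_iff)
  then show ?thesis using \<nu> by (simp add: mvar_def mpoly_eval_frag_of del: One_nat_def)
qed

lemma mpoly_eval_mult: "mpoly_eval R \<nu> (f * g) = mpoly_eval R \<nu> f \<otimes> mpoly_eval R \<nu> g"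
proof (induction f rule: int_mpoly_induct)
  case (one m)
  show ?case by (induction g rule: int_mpoly_induct)
    (simp_all add: mpoly_eval_frag_of mult_frag_of mpoly_eval_diff mpoly_eval_0 right_diff_distrib
      mono_prod_add \<nu> mono_prod_closed mpoly_eval_closed minus_eq r_distr r_minus)
qed (simp_all add: mpoly_eval_diff mpoly_eval_0 mpoly_eval_closed left_diff_distrib minus_eq l_distr l_minus)

lemma mpoly_eval_prod_mset:
  "mpoly_eval R \<nu> (\<Prod>v\<in>#mset xs. \<tau> v) = mprod R (map (\<lambda>v. mpoly_eval R \<nu> (\<tau> v)) xs)"
  by (induction xs) (simp_all add: mpoly_eval_1 mpoly_eval_mult)

lemma mpoly_eval_psubst:
  "mpoly_eval R \<nu> (psubst \<tau> f) = mpoly_eval R (\<lambda>v. mpoly_eval R \<nu> (\<tau> v)) f"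
proof -
  have c: "mono_prod R (\<lambda>v. mpoly_eval R \<nu> (\<tau> v)) m \<in> carrier R" for m
    by (intro mprod_closed) (auto simp: mpoly_eval_closed)
  have "mpoly_eval R \<nu> (psubst \<tau> f) = lin R (mono_prod R (\<lambda>v. mpoly_eval R \<nu> (\<tau> v))) f"
  proof (induction f rule: int_mpoly_induct)
    case (one m)
    show ?case using mpoly_eval_prod_mset[of \<tau> "mlist m"] c by (simp add: psubst_frag_of)
  qed (simp_all add: mpoly_eval_0 psubst_diff mpoly_eval_diff lin_diff c)
  then show ?thesis by (simp add: mpoly_eval_eq_lin mpoly_eval_closed)
qed

end

end

section \<open>Iterated products in polar algebras\<close>

definition polar_degree :: "nat \<Rightarrow> nat \<Rightarrow> bool" where
  "polar_degree p n \<longleftrightarrow> (\<exists>k. n = Suc (k * (p - 1)))"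

lemma polar_degree_Suc_0 [simp]: "polar_degree p (Suc 0)" by (simp add: polar_degree_def)

lemma polar_degree_pos: "polar_degree p n \<Longrightarrow> 0 < n" by (auto simp: polar_degree_def)

lemma polar_degree_comp: "polar_degree p (Suc a) \<Longrightarrow> polar_degree p (Suc b) \<Longrightarrow> polar_degree p (Suc (a + b))"
  unfolding polar_degree_def by (metis add_Suc add_Suc_right add_mult_distrib nat.inject)

lemma polar_degree_sum_list:
  assumes "\<And>n. n \<in> set ns \<Longrightarrow> polar_degree p n" shows "\<exists>k. sum_list ns = length ns + k * (p - 1)"
  using assms
proof (induction ns)
  case (Cons n ns)
  then obtain k where k: "sum_list ns = length ns + k * (p - 1)" by auto
  from Cons.prems have "polar_degree p n" by simp
  then obtain k' where "n = Suc (k' * (p - 1))" unfolding polar_degree_def by blast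
  with k
  show ?case by (intro exI[of _ "k + k'"]) (simp add: add_mult_distrib)
qed simp

text \<open>The degree count for substitution: some entries of a list of admissible length are
  replaced by blocks of admissible length, while \<open>m\<close> entries are left alone.\<close>

lemma polar_degree_sum_list':
  assumes "\<And>n. n \<in> set ns \<Longrightarrow> polar_degree p n" "polar_degree p (length ns + m)" shows "polar_degree p (sum_list ns + m)"
proof -
  obtain k where k: "sum_list ns = length ns + k * (p - 1)" using polar_degree_sum_list assms(1) by blast
  obtain j where "length ns + m = Suc (j * (p - 1))" using assms(2) by (auto simp: polar_degree_def)
  with k show ?thesis unfolding polar_degree_def by (intro exI[of _ "j + k"]) (simp add: add_mult_distrib)
qed

lemma polar_degree_power: assumes "2 \<le> p" shows "polar_degree p (p ^ s)"
proof (induction s)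
  case (Suc s)
  then obtain k where k: "p ^ s = Suc (k * (p - 1))" by (auto simp: polar_degree_def)
  obtain q where "p = Suc q" using assms by (cases p) auto
  then have "p * Suc (k * (p - 1)) = Suc ((p * k + 1) * (p - 1))"
    by (simp add: algebra_simps)
  then have "p ^ Suc s = Suc ((p * k + 1) * (p - 1))" by (simp only: k power_Suc)
  then show ?case unfolding polar_degree_def by blast
qed simp

text \<open>An admissible length other than 1 is at least p, so \<open>piter\<close> never stops at
  an admissible list that still has several entries.\<close>

lemma polar_degree_step:
  assumes "2 \<le> p" "polar_degree p (Suc n)" "n \<noteq> 0" shows "p - 1 \<le> n" "polar_degree p (Suc (n - (p - 1)))"
proof -
  obtain k where k: "n = k * (p - 1)" using assms(2) by (auto simp: polar_degree_def)
  with assms(3) obtain j where "k = Suc j" by (cases k) auto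
  with k show "p - 1 \<le> n" "polar_degree p (Suc (n - (p - 1)))" by (auto simp: polar_degree_def)
qed

text \<open>One particular bracketing, nested to the left; that it can be regrouped and permuted
  freely is proved below. The guard on p makes every step shorten the list.\<close>

function piter :: "nat \<Rightarrow> ('a list \<Rightarrow> 'a) \<Rightarrow> 'a list \<Rightarrow> 'a" where
  "piter p \<mu> xs = (if 2 \<le> p \<and> p \<le> length xs then piter p \<mu> (\<mu> (take p xs) # drop p xs) else hd xs)"
  by pat_completeness auto
termination by (relation "measure (\<lambda>(p, \<mu>, xs). length xs)") auto

declare piter.simps [simp del]

text \<open>In the mixed words below \<open>Inl\<close> marks scalars and \<open>Inr\<close> marks
  elements of the polar algebra.\<close>

definition lefts :: "('a + 'b) list \<Rightarrow> 'a list" where "lefts xs = map projl (filter isl xs)"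
definition rights :: "('a + 'b) list \<Rightarrow> 'b list" where "rights xs = map projr (filter (\<lambda>x. \<not> isl x) xs)"

lemma lefts_simps [simp]: "lefts [] = []" "lefts (Inl a # xs) = a # lefts xs" "lefts (Inr b # xs) = lefts xs"
  "lefts (xs @ ys) = lefts xs @ lefts ys"
  by (simp_all add: lefts_def)
lemma rights_simps [simp]: "rights [] = []" "rights (Inl a # xs) = rights xs" "rights (Inr b # xs) = b # rights xs"
  "rights (xs @ ys) = rights xs @ rights ys"
  by (simp_all add: rights_def)
lemma set_lefts: "set (lefts xs) = {a. Inl a \<in> set xs}"
  by (force simp: lefts_def image_iff)
lemma set_rights: "set (rights xs) = {a. Inr a \<in> set xs}"
  by (force simp: rights_def image_iff)
lemma lefts_map: "lefts (map (map_sum f g) xs) = map f (lefts xs)"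
  by (induction xs) (auto simp: map_sum_def split: sum.splits)
lemma rights_map: "rights (map (map_sum f g) xs) = map g (rights xs)"
  by (induction xs) (auto simp: map_sum_def split: sum.splits)
lemma mset_lefts: "mset xs = mset ys \<Longrightarrow> mset (lefts xs) = mset (lefts ys)"
  by (simp add: lefts_def)
lemma mset_rights: "mset xs = mset ys \<Longrightarrow> mset (rights xs) = mset (rights ys)"
  by (simp add: rights_def)

locale polar_alg =
  fixes p :: nat and K :: "'k ring" and A :: "('k, 'a) polar"
  assumes prime_p: "prime p" and polar: "polar_algebra p K A"
begin

lemma p2: "2 \<le> p" using prime_p by (rule prime_ge_2_nat)

sublocale module K A using polar by (simp add: polar_algebra_def)

abbreviation "it \<equiv> piter p (mu A)"

lemmas mu_axioms = polar[unfolded polar_algebra_def, THEN conjunct2, THEN conjunct1, THEN spec, THEN mp, OF conjI]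

lemma mu_closed: "set xs \<subseteq> carrier A \<Longrightarrow> length xs = p \<Longrightarrow> mu A xs \<in> carrier A"
  by (rule mu_axioms[THEN conjunct1])

lemma mu_perm: "set xs \<subseteq> carrier A \<Longrightarrow> length xs = p \<Longrightarrow> mset ys = mset xs \<Longrightarrow> mu A ys = mu A xs"
  by (rule mu_axioms[THEN conjunct2, THEN conjunct1, rule_format])

lemma mu_add:
  assumes "x \<in> carrier A" "y \<in> carrier A" "set xs \<subseteq> carrier A" "length xs = p - 1"
  shows "mu A ((x \<oplus>\<^bsub>A\<^esub> y) # xs) = mu A (x # xs) \<oplus>\<^bsub>A\<^esub> mu A (y # xs)"
proof -
  have "set (x # xs) \<subseteq> carrier A" "length (x # xs) = p" "0 < p" using assms p2 by auto
  from mu_axioms[OF this(1,2), THEN conjunct2, THEN conjunct2, THEN conjunct1, rule_format, OF this(3) assms(2)]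
  have "mu A ((x # xs)[0 := (x # xs) ! 0 \<oplus>\<^bsub>A\<^esub> y]) = mu A (x # xs) \<oplus>\<^bsub>A\<^esub> mu A ((x # xs)[0 := y])"
    .
  then show ?thesis by simp
qed

lemma mu_smult:
  assumes "x \<in> carrier A" "c \<in> carrier K" "set xs \<subseteq> carrier A" "length xs = p - 1"
  shows "mu A ((c \<odot>\<^bsub>A\<^esub> x) # xs) = c \<odot>\<^bsub>A\<^esub> mu A (x # xs)"
proof -
  have "set (x # xs) \<subseteq> carrier A" "length (x # xs) = p" "0 < p" using assms p2 by auto
  from mu_axioms[OF this(1,2), THEN conjunct2, THEN conjunct2, THEN conjunct2, rule_format, OF this(3) assms(2)]
  have "mu A ((x # xs)[0 := c \<odot>\<^bsub>A\<^esub> (x # xs) ! 0]) = c \<odot>\<^bsub>A\<^esub> mu A (x # xs)"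
    .
  then show ?thesis by simp
qed

lemma mu_assoc:
  "set xs \<subseteq> carrier A \<Longrightarrow> length xs = 2 * p - 1 \<Longrightarrow> mset ys = mset xs \<Longrightarrow>
    mu A (mu A (take p ys) # drop p ys) = mu A (mu A (take p xs) # drop p xs)"
  by (rule polar[unfolded polar_algebra_def, THEN conjunct2, THEN conjunct2, rule_format]) simp

lemma it_single [simp]: "it [x] = x"
  using p2 by (subst piter.simps) simp

lemma it_step: "p \<le> length xs \<Longrightarrow> it xs = it (mu A (take p xs) # drop p xs)"
  using p2 by (subst piter.simps) simp

lemma step_closed: "p \<le> length xs \<Longrightarrow> set xs \<subseteq> carrier A \<Longrightarrow> set (mu A (take p xs) # drop p xs) \<subseteq> carrier A"
  using mu_closed[of "take p xs"] set_take_subset[of p xs] set_drop_subset[of p xs] by auto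

lemma it_closed:
  "polar_degree p (length xs) \<Longrightarrow> set xs \<subseteq> carrier A \<Longrightarrow> it xs \<in> carrier A"
proof (induction xs rule: length_induct)
  case (1 xs)
  obtain x ys where xs: "xs = x # ys" using 1(2) polar_degree_pos by (cases xs) auto
  show ?case
  proof (cases "ys = []")
    case False
    then have g: "p - 1 \<le> length ys" "polar_degree p (Suc (length ys - (p - 1)))"
      using polar_degree_step[OF p2, of "length ys"] 1(2) xs by auto
    have "set (mu A (take p xs) # drop p xs) \<subseteq> carrier A"
      using 1(3) g p2 xs by (intro step_closed) auto
    moreover have "Suc (length xs - p) = Suc (length ys - (p - 1))" using xs g p2 by simp
    ultimately have "it (mu A (take p xs) # drop p xs) \<in> carrier A"
      using g p2 xs by (intro 1(1)[rule_format]) (auto simp del: diff_Suc_1)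
    then show ?thesis using g p2 xs by (subst it_step) auto
  qed (use xs 1 in simp)
qed

text \<open>Evaluation proceeds from the left, so it computes the value of the initial block
  \<open>xs\<close> before it touches \<open>ys\<close>.\<close>

lemma it_Cons_append:
  assumes "polar_degree p (length xs)" "set xs \<subseteq> carrier A"
  shows "it (it xs # ys) = it (xs @ ys)"
  using assms
proof (induction xs rule: length_induct)
  case (1 xs)
  obtain x zs where xs: "xs = x # zs" using 1(2) polar_degree_pos by (cases xs) auto
  show ?case
  proof (cases "zs = []")
    case False
    then have g: "p - 1 \<le> length zs" "polar_degree p (Suc (length zs - (p - 1)))"
      using polar_degree_step[OF p2, of "length zs"] 1(2) xs by auto
    have l: "p \<le> length xs" using g p2 xs by simp
    have "set (mu A (take p xs) # drop p xs) \<subseteq> carrier A"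
      using 1(3) g p2 xs by (intro step_closed) auto
    moreover have "Suc (length xs - p) = Suc (length zs - (p - 1))" using xs g p2 by simp
    ultimately have "it (it (mu A (take p xs) # drop p xs) # ys) = it ((mu A (take p xs) # drop p xs) @ ys)"
      using g p2 xs by (intro 1(1)[rule_format]) (auto simp del: diff_Suc_1)
    moreover have "it (xs @ ys) = it ((mu A (take p xs) # drop p xs) @ ys)"
      using l by (subst it_step) auto
    ultimately show ?thesis using l it_step[of xs] by simp
  qed (use xs in simp)
qed

lemma it_p: "length xs = p \<Longrightarrow> it xs = mu A xs"
  using it_step[of xs] by simp

text \<open>The position of the two entries relative to the first multiplication decides. If it
  takes in both, \<open>mu\<close> is symmetric. If it takes in neither, the multiplication is
  carried out and induction applies. If it separates them, the first two multiplications together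
  form the expression in 2p - 1 entries whose symmetry is an axiom.\<close>

lemma it_swap:
  assumes "polar_degree p (length (us @ x # y # vs))" "set (us @ x # y # vs) \<subseteq> carrier A"
  shows "it (us @ x # y # vs) = it (us @ y # x # vs)"
  using assms
proof (induction "length us" arbitrary: us rule: less_induct)
  case less
  let ?xs = "us @ x # y # vs" and ?ys = "us @ y # x # vs"
  have g: "p - 1 \<le> length us + 1 + length vs" "polar_degree p (Suc (length us + 1 + length vs - (p - 1)))"
    using polar_degree_step[OF p2, of "length us + 1 + length vs"] less.prems(1) by auto
  have l: "p \<le> length ?xs" "p \<le> length ?ys" using g by auto
  consider "length us + 2 \<le> p" | "length us + 1 = p" | "p \<le> length us" by linarith
  then show ?case
  proof cases
    case 1
    then obtain ws where ws: "take p ?xs = us @ x # y # ws" "take p ?ys = us @ y # x # ws" "drop p ?xs = drop p ?ys"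
    proof -
      have "p - length us = Suc (Suc (p - length us - 2))" using 1 by simp
      then show ?thesis by (intro that[of "take (p - length us - 2) vs"]) (auto simp: take_Cons' drop_Cons')
    qed
    have "mu A (us @ y # x # ws) = mu A (us @ x # y # ws)"
      using mu_perm[of "take p ?xs" "take p ?ys"] less.prems(2) l ws(1,2)
      by (metis (no_types, lifting) add_mset_commute length_take min.absorb2 mset.simps(2) mset_append order_trans set_take_subset)
    then show ?thesis using l ws by (simp add: it_step)
  next
    case 2
    \<comment> \<open>The entry \<open>y\<close> comes after the first p entries, and an admissible
      length greater than p is at least 2p - 1.\<close>
    have l2: "2 * p - 1 \<le> length ?xs"
    proof -
      have "length us + 1 + length vs - (p - 1) \<noteq> 0" using 2 by simp
      then have "p - 1 \<le> length us + 1 + length vs - (p - 1)" using polar_degree_step(1)[OF p2] g(2) by blast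
      then show ?thesis using p2 2 by simp
    qed
    let ?x1 = "take (2 * p - 1) ?xs" and ?y1 = "take (2 * p - 1) ?ys" and ?r = "drop (2 * p - 1) ?xs"
    define ws where "ws = take (2 * p - 1 - length us - 2) vs"
    have "2 * p - 1 - length us = Suc (Suc (2 * p - 1 - length us - 2))" using 2 p2 by simp
    then have ws: "?x1 = us @ x # y # ws" "?y1 = us @ y # x # ws" "drop (2 * p - 1) ?ys = ?r"
      using 2 p2 by (auto simp: take_Cons' drop_Cons' ws_def)
    have step2: "it zs = it (mu A (mu A (take p z1) # drop p z1) # drop (2 * p - 1) zs)"
      if "length zs = length ?xs" "z1 = take (2 * p - 1) zs" for zs z1
    proof -
      have "min p (2 * p - 1) = p" using p2 by linarith
      then have a: "take p z1 = take p zs" using that by (simp only: take_take)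
      have b: "take p (mu A (take p zs) # drop p zs) = mu A (take p zs) # drop p z1"
        using that p2 l2 by (cases p) (auto simp: drop_take)
      have c: "drop p (mu A (take p zs) # drop p zs) = drop (2 * p - 1) zs"
        using p2 by (cases p) (auto simp: mult_2)
      have "it zs = it (mu A (take p zs) # drop p zs)" using l that by (intro it_step) simp
      also have "\<dots> = it (mu A (mu A (take p zs) # drop p z1) # drop (2 * p - 1) zs)"
        using that l2 p2 by (subst it_step) (auto simp: b[simplified] c[simplified])
      finally show ?thesis using a by simp
    qed
    have "mu A (mu A (take p ?y1) # drop p ?y1) = mu A (mu A (take p ?x1) # drop p ?x1)"
    proof (rule mu_assoc)
      show "set ?x1 \<subseteq> carrier A" using less.prems(2) by (meson order_trans set_take_subset)
      show "length ?x1 = 2 * p - 1" using l2 by simp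
      show "mset ?y1 = mset ?x1" unfolding ws by simp
    qed
    then show ?thesis using step2[of ?xs ?x1] step2[of ?ys ?y1] ws(3) by simp
  next
    case 3
    let ?us = "mu A (take p us) # drop p us"
    have e: "it (us @ zs) = it (?us @ zs)" for zs
      using 3 by (subst it_step) auto
    have "it (?us @ x # y # vs) = it (?us @ y # x # vs)"
    proof (rule less.hyps)
      show "length ?us < length us" using 3 p2 by simp
      show "polar_degree p (length (?us @ x # y # vs))"
      proof -
        have "length (?us @ x # y # vs) = Suc (length us + 1 + length vs - (p - 1))" using 3 p2 by simp
        then show ?thesis using g(2) by (simp only:)
      qed
      show "set (?us @ x # y # vs) \<subseteq> carrier A"
        using less.prems(2) 3 mu_closed[of "take p us"] by (auto dest: in_set_takeD in_set_dropD)
    qed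
    then show ?thesis using e by simp
  qed
qed

lemma it_perm:
  assumes "mset xs = mset ys" "polar_degree p (length xs)" "set xs \<subseteq> carrier A"
  shows "it xs = it ys"
proof (rule swap_invariant_imp_perm_invariant[OF _ assms(1) refl])
  fix us x y vs assume m: "mset (us @ x # y # vs) = mset ys"
  show "it (us @ x # y # vs) = it (us @ y # x # vs)"
    by (rule it_swap) (use m assms in \<open>metis mset_eq_length mset_eq_setD\<close>)+
qed

text \<open>The first entry is enough, since \<open>it_perm\<close> moves any other entry to the
  front. A multiplication leaves the first entry of the new list linear in the old one.\<close>

lemma it_head_linear:
  assumes "polar_degree p (Suc (length xs))" "set xs \<subseteq> carrier A" "x \<in> carrier A"
  shows "y \<in> carrier A \<Longrightarrow> it ((x \<oplus>\<^bsub>A\<^esub> y) # xs) = it (x # xs) \<oplus>\<^bsub>A\<^esub> it (y # xs)"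
    and "c \<in> carrier K \<Longrightarrow> it ((c \<odot>\<^bsub>A\<^esub> x) # xs) = c \<odot>\<^bsub>A\<^esub> it (x # xs)"
proof -
  have "(y \<in> carrier A \<longrightarrow> it ((x \<oplus>\<^bsub>A\<^esub> y) # xs) = it (x # xs) \<oplus>\<^bsub>A\<^esub> it (y # xs)) \<and>
    (c \<in> carrier K \<longrightarrow> it ((c \<odot>\<^bsub>A\<^esub> x) # xs) = c \<odot>\<^bsub>A\<^esub> it (x # xs))"
    using assms
  proof (induction xs arbitrary: x y rule: length_induct)
    case (1 xs)
    show ?case
    proof (cases "xs = []")
      case False
      then have g: "p - 1 \<le> length xs" "polar_degree p (Suc (length xs - (p - 1)))"
        using polar_degree_step[OF p2, of "length xs"] 1(2) by auto
      let ?h = "take (p - 1) xs" and ?t = "drop (p - 1) xs"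
      have st: "it (z # xs) = it (mu A (z # ?h) # ?t)" for z
        using g p2 by (subst it_step) (auto simp: take_Cons' drop_Cons')
      have h: "set ?h \<subseteq> carrier A" "set ?t \<subseteq> carrier A" "length ?h = p - 1"
        using 1(3) g by (auto dest: in_set_takeD in_set_dropD)
      have c: "mu A (z # ?h) \<in> carrier A" if "z \<in> carrier A" for z
        using that h p2 by (intro mu_closed) auto
      have IH: "u \<in> carrier A \<Longrightarrow> v \<in> carrier A \<Longrightarrow> it ((u \<oplus>\<^bsub>A\<^esub> v) # ?t) = it (u # ?t) \<oplus>\<^bsub>A\<^esub> it (v # ?t)"
        "u \<in> carrier A \<Longrightarrow> c \<in> carrier K \<Longrightarrow> it ((c \<odot>\<^bsub>A\<^esub> u) # ?t) = c \<odot>\<^bsub>A\<^esub> it (u # ?t)" for u v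
        using 1(1)[rule_format, of ?t] g h p2 False by (auto simp: Suc_diff_le)
      have "\<And>y. y \<in> carrier A \<Longrightarrow> mu A ((x \<oplus>\<^bsub>A\<^esub> y) # ?h) = mu A (x # ?h) \<oplus>\<^bsub>A\<^esub> mu A (y # ?h)"
        "\<And>c. c \<in> carrier K \<Longrightarrow> mu A ((c \<odot>\<^bsub>A\<^esub> x) # ?h) = c \<odot>\<^bsub>A\<^esub> mu A (x # ?h)"
        using 1(4) h by (blast intro: mu_add mu_smult)+
      then show ?thesis using 1(4) c[of x] c[of y] by (simp add: st IH del: One_nat_def)
    qed (use 1 in auto)
  qed
  then show "y \<in> carrier A \<Longrightarrow> it ((x \<oplus>\<^bsub>A\<^esub> y) # xs) = it (x # xs) \<oplus>\<^bsub>A\<^esub> it (y # xs)"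
    and "c \<in> carrier K \<Longrightarrow> it ((c \<odot>\<^bsub>A\<^esub> x) # xs) = c \<odot>\<^bsub>A\<^esub> it (x # xs)" by auto
qed

lemma it_zero:
  assumes "polar_degree p (Suc (length xs))" "set xs \<subseteq> carrier A"
  shows "it (\<zero>\<^bsub>A\<^esub> # xs) = \<zero>\<^bsub>A\<^esub>"
proof -
  have "it (\<zero>\<^bsub>K\<^esub> \<odot>\<^bsub>A\<^esub> \<zero>\<^bsub>A\<^esub> # xs) = \<zero>\<^bsub>K\<^esub> \<odot>\<^bsub>A\<^esub> it (\<zero>\<^bsub>A\<^esub> # xs)"
    using assms by (intro it_head_linear) auto
  then show ?thesis using assms it_closed[of "\<zero>\<^bsub>A\<^esub> # xs"] by simp
qed

subsection \<open>Evaluation of monomials with scalar and vector entries\<close>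

definition letters :: "('k + 'a) set" where
  "letters = Inl ` carrier K \<union> Inr ` carrier A"

lemma letters_simps [simp]: "Inl c \<in> letters \<longleftrightarrow> c \<in> carrier K" "Inr x \<in> letters \<longleftrightarrow> x \<in> carrier A"
  by (auto simp: letters_def)

definition evl :: "('k + 'a) list \<Rightarrow> 'a" where
  "evl xs = mprod K (lefts xs) \<odot>\<^bsub>A\<^esub> it (rights xs)"

lemma letters_lefts: "set xs \<subseteq> letters \<Longrightarrow> set (lefts xs) \<subseteq> carrier K"
  by (auto simp: set_lefts letters_def)
lemma letters_rights: "set xs \<subseteq> letters \<Longrightarrow> set (rights xs) \<subseteq> carrier A"
  by (auto simp: set_rights letters_def)

lemma evl_closed: "set xs \<subseteq> letters \<Longrightarrow> polar_degree p (length (rights xs)) \<Longrightarrow> evl xs \<in> carrier A"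
  unfolding evl_def by (intro smult_closed R.mprod_closed it_closed letters_lefts letters_rights)

lemma evl_perm:
  assumes "mset xs = mset ys" "set xs \<subseteq> letters" "polar_degree p (length (rights xs))"
  shows "evl xs = evl ys"
  unfolding evl_def using assms
  by (metis R.mprod_perm it_perm mset_lefts mset_rights letters_lefts letters_rights)

text \<open>The composition law for mixed words: multiplying their values amounts to concatenating
  them. Scalars are pulled out by linearity in the first entry, and \<open>ys\<close> collects the
  vector entries of the words that have already been dissolved.\<close>

lemma it_map_evl:
  assumes "\<And>xs. xs \<in> set xss \<Longrightarrow> set xs \<subseteq> letters \<and> polar_degree p (length (rights xs))"
    and "set ys \<subseteq> carrier A" "polar_degree p (length xss + length ys)"
  shows "it (map evl xss @ ys) = mprod K (lefts (concat xss)) \<odot>\<^bsub>A\<^esub> it (rights (concat xss) @ ys)"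
  using assms
proof (induction xss arbitrary: ys)
  case Nil
  then show ?case using it_closed[of ys] by simp
next
  case (Cons xs xss)
  have t: "set xs \<subseteq> letters" "polar_degree p (length (rights xs))" using Cons.prems by auto
  have cl: "set (lefts xs) \<subseteq> carrier K" "set (rights xs) \<subseteq> carrier A"
    using t letters_lefts letters_rights by auto
  have tt: "set (concat xss) \<subseteq> letters" using Cons.prems by auto
  have cm: "set (map evl xss @ ys) \<subseteq> carrier A" using Cons.prems by (auto intro!: evl_closed)
  have gl: "polar_degree p (length (rights xs) + (length xss + length ys))"
    using polar_degree_comp[of p "length (rights xs) - 1" "length xss + length ys"] Cons.prems(3) polar_degree_pos[OF t(2)] t(2)
    by simp
  have itr: "it (rights xs) \<in> carrier A" using t cl by (intro it_closed)
  have "it (map evl (xs # xss) @ ys) = mprod K (lefts xs) \<odot>\<^bsub>A\<^esub> it (it (rights xs) # map evl xss @ ys)"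
    unfolding evl_def[of xs] list.map append_Cons
    by (rule it_head_linear) (use Cons.prems(3) cm cl itr in auto)
  also have "it (it (rights xs) # map evl xss @ ys) = it (rights xs @ map evl xss @ ys)"
    using t cl by (intro it_Cons_append)
  also have "\<dots> = it (map evl xss @ (rights xs @ ys))"
    by (rule it_perm) (use cl cm gl in auto)
  also have "\<dots> = mprod K (lefts (concat xss)) \<odot>\<^bsub>A\<^esub> it (rights (concat xss) @ (rights xs @ ys))"
    using Cons.prems cl gl by (intro Cons.IH) (auto simp: ac_simps)
  also have gg: "polar_degree p (length (rights (concat xss)) + length (rights xs @ ys))"
  proof -
    have "length (rights (concat xss)) = sum_list (map (\<lambda>xs. length (rights xs)) xss)"
      by (induction xss) auto
    moreover have "polar_degree p (sum_list (map (\<lambda>xs. length (rights xs)) xss) + length (rights xs @ ys))"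
      by (rule polar_degree_sum_list') (use Cons.prems gl in \<open>auto simp: ac_simps\<close>)
    ultimately show ?thesis by simp
  qed
  then have "it (rights (concat xss) @ (rights xs @ ys)) = it (rights (concat (xs # xss)) @ ys)"
    using letters_rights[OF tt] cl Cons.prems(2) by (intro it_perm) auto
  also have "mprod K (lefts xs) \<odot>\<^bsub>A\<^esub> (mprod K (lefts (concat xss)) \<odot>\<^bsub>A\<^esub> it (rights (concat (xs # xss)) @ ys)) =
      (mprod K (lefts xs) \<otimes>\<^bsub>K\<^esub> mprod K (lefts (concat xss))) \<odot>\<^bsub>A\<^esub> it (rights (concat (xs # xss)) @ ys)"
    using cl letters_lefts[OF tt] letters_rights[OF tt] gg Cons.prems(2)
    by (intro smult_assoc1[symmetric] R.mprod_closed it_closed) (auto simp: ac_simps)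
  also have "mprod K (lefts xs) \<otimes>\<^bsub>K\<^esub> mprod K (lefts (concat xss)) = mprod K (lefts (concat (xs # xss)))"
    using cl letters_lefts[OF tt] by (simp add: R.mprod_append)
  finally show ?case .
qed

lemma evl_concat:
  assumes "\<And>xs. xs \<in> set xss \<Longrightarrow> set xs \<subseteq> letters \<and> polar_degree p (length (rights xs))" "polar_degree p (length xss)"
  shows "it (map evl xss) = evl (concat xss)"
  using it_map_evl[of xss "[]"] assms by (simp add: evl_def)

end

context polar_alg
begin

text \<open>The intended use is for polynomials all of whose monomials satisfy
  \<open>polar_at\<close>; the Witt polynomials do so by their weights.\<close>

definition peval :: "('v \<Rightarrow> 'k + 'a) \<Rightarrow> 'v int_mpoly \<Rightarrow> 'a" where
  "peval \<nu> = lin A (\<lambda>m. evl (map \<nu> (mlist m)))"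

definition polar_at :: "('v \<Rightarrow> 'b + 'c) \<Rightarrow> ('v \<Rightarrow>\<^sub>0 nat) \<Rightarrow> bool" where
  "polar_at \<nu> m \<longleftrightarrow> polar_degree p (length (rights (map \<nu> (mlist m))))"

subsection \<open>The universal case\<close>

text \<open>The variables are the elements of \<open>K\<close> and of \<open>A\<close>. The set \<open>\<Lambda>0\<close> is a ring with an evaluation \<open>\<rho>0\<close>
  into \<open>K\<close>, and \<open>\<Lambda>1\<close> is a polar algebra over it with an evaluation \<open>\<rho>1\<close> into \<open>A\<close>. Variables outside the
  carriers are read as zero, which makes both evaluations total.\<close>

definition san :: "'k + 'a \<Rightarrow> 'k + 'a" where
  "san v = (case v of Inl c \<Rightarrow> Inl (if c \<in> carrier K then c else \<zero>\<^bsub>K\<^esub>)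
     | Inr x \<Rightarrow> Inr (if x \<in> carrier A then x else \<zero>\<^bsub>A\<^esub>))"

definition san0 :: "'k + 'a \<Rightarrow> 'k" where
  "san0 v = (case v of Inl c \<Rightarrow> if c \<in> carrier K then c else \<zero>\<^bsub>K\<^esub> | Inr x \<Rightarrow> \<zero>\<^bsub>K\<^esub>)"

definition dg :: "('k + 'a \<Rightarrow>\<^sub>0 nat) \<Rightarrow> nat" where
  "dg m = length (rights (mlist m))"

definition \<Lambda>0 :: "('k + 'a) int_mpoly set" where "\<Lambda>0 = polys_in {m. dg m = 0}"
definition \<Lambda>1 :: "('k + 'a) int_mpoly set" where "\<Lambda>1 = polys_in {m. polar_degree p (dg m)}"

text \<open>Monomials of inadmissible degree are sent to zero. This makes \<open>\<rho>1\<close>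
  additive on the whole polynomial ring, while compatibility with products is claimed only for
  factors from \<open>\<Lambda>0\<close> and \<open>\<Lambda>1\<close>.\<close>

definition hA :: "('k + 'a \<Rightarrow>\<^sub>0 nat) \<Rightarrow> 'a" where
  "hA m = (if polar_degree p (dg m) then evl (map san (mlist m)) else \<zero>\<^bsub>A\<^esub>)"

definition \<rho>0 :: "('k + 'a) int_mpoly \<Rightarrow> 'k" where "\<rho>0 = mpoly_eval K san0"
definition \<rho>1 :: "('k + 'a) int_mpoly \<Rightarrow> 'a" where "\<rho>1 = lin A hA"

lemma san_letters: "set (map san xs) \<subseteq> letters"
  by (auto simp: san_def split: sum.splits)

lemma san0_closed: "san0 v \<in> carrier K"
  by (auto simp: san0_def split: sum.splits)

lemma san_in_letters: "san v \<in> letters"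
  by (auto simp: san_def split: sum.splits)

lemma length_rights_san: "length (rights (map san xs)) = length (rights xs)"
  by (induction xs) (auto simp: san_def split: sum.splits)

lemma dg_eq: "mset xs = mon m \<Longrightarrow> dg m = length (rights xs)"
  unfolding dg_def by (metis mset_mlist mset_rights size_mset)

lemma dg_add [simp]: "dg (m + m') = dg m + dg m'"
  using dg_eq[of "mlist m @ mlist m'" "m + m'"] by (simp add: dg_def)

lemma hA_closed [simp]: "hA m \<in> carrier A"
  using evl_closed[OF san_letters, of "mlist m"] by (auto simp: hA_def length_rights_san dg_def)

lemma \<rho>0_closed [simp]: "\<rho>0 f \<in> carrier K"
  unfolding \<rho>0_def by (rule R.mpoly_eval_closed) (rule san0_closed)
lemma \<rho>1_closed [simp]: "\<rho>1 f \<in> carrier A"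
  unfolding \<rho>1_def by (rule lin_closed) (rule hA_closed)
lemma \<rho>1_0 [simp]: "\<rho>1 0 = \<zero>\<^bsub>A\<^esub>" by (simp add: \<rho>1_def)
lemma \<rho>1_diff: "\<rho>1 (f - g) = \<rho>1 f \<ominus>\<^bsub>A\<^esub> \<rho>1 g"
  by (simp add: \<rho>1_def lin_diff)
lemma \<rho>1_add: "\<rho>1 (f + g) = \<rho>1 f \<oplus>\<^bsub>A\<^esub> \<rho>1 g"
  by (simp add: \<rho>1_def lin_add)
lemma \<rho>1_of_nat_times: "\<rho>1 (of_nat n * f) = [n] \<cdot>\<^bsub>A\<^esub> \<rho>1 f"
  unfolding \<rho>1_def by (rule lin_of_nat_times) (rule hA_closed)
lemma \<rho>1_frag_of: "\<rho>1 (frag_of m) = hA m"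
  by (simp add: \<rho>1_def)
lemma \<rho>0_mult: "\<rho>0 (f * g) = \<rho>0 f \<otimes>\<^bsub>K\<^esub> \<rho>0 g"
  unfolding \<rho>0_def by (rule R.mpoly_eval_mult) (rule san0_closed)
lemma \<rho>0_diff: "\<rho>0 (f - g) = \<rho>0 f \<ominus>\<^bsub>K\<^esub> \<rho>0 g"
  unfolding \<rho>0_def by (rule R.mpoly_eval_diff) (rule san0_closed)
lemma \<rho>0_1: "\<rho>0 1 = \<one>\<^bsub>K\<^esub>"
  unfolding \<rho>0_def by (rule R.mpoly_eval_1) (rule san0_closed)
lemma \<rho>0_0: "\<rho>0 0 = \<zero>\<^bsub>K\<^esub>"
  unfolding \<rho>0_def by (rule R.mpoly_eval_0) (rule san0_closed)

lemma \<Lambda>0_mult: "f \<in> \<Lambda>0 \<Longrightarrow> g \<in> \<Lambda>0 \<Longrightarrow> f * g \<in> \<Lambda>0"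
  unfolding \<Lambda>0_def by (rule polys_in_mult) auto
lemma \<Lambda>0_1: "1 \<in> \<Lambda>0"
  using dg_eq[of "[]" 0] by (simp add: \<Lambda>0_def one_eq_frag_of del: single_one)
lemma \<Lambda>01_mult: "f \<in> \<Lambda>0 \<Longrightarrow> g \<in> \<Lambda>1 \<Longrightarrow> f * g \<in> \<Lambda>1"
  unfolding \<Lambda>0_def \<Lambda>1_def by (rule polys_in_mult) auto

lemma lefts_of_dg_0:
  assumes "dg m = 0" shows "lefts (map san (mlist m)) = map san0 (mlist m)" "rights (map san (mlist m)) = []"
proof -
  have "rights xs = [] \<Longrightarrow> lefts (map san xs) = map san0 xs \<and> rights (map san xs) = []" for xs
    by (induction xs) (auto simp: san_def san0_def split: sum.splits)
  then show "lefts (map san (mlist m)) = map san0 (mlist m)" "rights (map san (mlist m)) = []"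
    using assms by (auto simp: dg_def)
qed

lemma \<rho>1_scalar:
  assumes "c \<in> \<Lambda>0" "f \<in> \<Lambda>1"
  shows "\<rho>1 (c * f) = \<rho>0 c \<odot>\<^bsub>A\<^esub> \<rho>1 f"
  using assms(1) unfolding \<Lambda>0_def
proof (induction c rule: polys_in_induct)
  case (one m)
  then have m: "dg m = 0" by simp
  have mc: "mprod K (map san0 xs) \<in> carrier K" for xs
    by (intro R.mprod_closed) (auto simp: san0_closed)
  have r: "\<rho>0 (frag_of m) = mprod K (map san0 (mlist m))"
    unfolding \<rho>0_def by (rule R.mpoly_eval_frag_of) (rule san0_closed)
  show ?case using assms(2) unfolding \<Lambda>1_def
  proof (induction f rule: polys_in_induct)
    case (one m')
    then have g: "polar_degree p (dg m')" by simp
    have "hA (m + m') = evl (map san (mlist m @ mlist m'))"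
      using m g unfolding hA_def
      by (auto intro!: evl_perm san_in_letters simp: length_rights_san simp flip: dg_def)
    also have "\<dots> = mprod K (map san0 (mlist m)) \<odot>\<^bsub>A\<^esub> hA m'"
      unfolding evl_def map_append lefts_simps rights_simps lefts_of_dg_0[OF m] hA_def
      using g letters_lefts[OF san_letters, of "mlist m'"] letters_rights[OF san_letters, of "mlist m'"]
      by (subst R.mprod_append)
        (auto simp: san0_closed length_rights_san dg_def intro!: smult_assoc1 mc R.mprod_closed it_closed)
    finally show ?case by (simp add: mult_frag_of \<rho>1_frag_of r)
  next
    case (diff a b)
    then show ?case
      by (simp add: right_diff_distrib \<rho>1_diff r mc a_minus_def smult_r_distr smult_r_minus)
  qed (simp add: r mc)
qed (simp_all add: \<rho>0_0 left_diff_distrib \<rho>1_diff \<rho>0_diff a_minus_def smult_l_distr smult_l_minus)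

lemma prod_list_\<Lambda>1:
  assumes "\<And>f. f \<in> set fs \<Longrightarrow> f \<in> \<Lambda>1" "polar_degree p (length fs)"
  shows "prod_list fs \<in> \<Lambda>1"
proof -
  \<comment> \<open>The degree is compared with the length of the list, whatever that length is. In
    this form the statement passes to sublists whose length is not admissible.\<close>
  have "prod_list fs \<in> polys_in {m. \<exists>k. dg m = length fs + k * (p - 1)}" using assms(1)
  proof (induction fs)
    case Nil
    have "dg 0 = 0" using dg_eq[of "[]" 0] by simp
    then show ?case by (auto simp: one_eq_frag_of simp del: single_one intro!: exI[of _ 0])
  next
    case (Cons f fs)
    have f: "f \<in> polys_in {m. polar_degree p (dg m)}" using Cons.prems by (simp add: \<Lambda>1_def)
    have "f * prod_list fs \<in> polys_in {m. \<exists>k. dg m = length (f # fs) + k * (p - 1)}"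
    proof (rule polys_in_mult[OF f])
      show "prod_list fs \<in> polys_in {m. \<exists>k. dg m = length fs + k * (p - 1)}" using Cons by simp
      fix m n assume "m \<in> {m. polar_degree p (dg m)}" "n \<in> {m. \<exists>k. dg m = length fs + k * (p - 1)}"
      then obtain k j where "dg m = Suc (k * (p - 1))" "dg n = length fs + j * (p - 1)"
        unfolding polar_degree_def by blast
      then show "m + n \<in> {m. \<exists>k. dg m = length (f # fs) + k * (p - 1)}"
        by (auto intro!: exI[of _ "k + j"] simp: add_mult_distrib)
    qed
    then show ?case by simp
  qed
  moreover have "{m. \<exists>k. dg m = length fs + k * (p - 1)} \<subseteq> {m. polar_degree p (dg m)}"
  proof safe
    fix m k assume m: "dg m = length fs + k * (p - 1)"
    obtain j where "length fs = Suc (j * (p - 1))" using assms(2) unfolding polar_degree_def by blast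
    with m show "polar_degree p (dg m)" unfolding polar_degree_def by (intro exI[of _ "k + j"]) (simp add: add_mult_distrib)
  qed
  ultimately show ?thesis by (auto simp: polys_in_def \<Lambda>1_def)
qed

text \<open>Multilinear expansion: the factors in \<open>fs\<close> are replaced by monomials one
  after another, and these accumulate in \<open>ms\<close>. Once all factors are monomials,
  \<open>evl_concat\<close> gives the value.\<close>

lemma \<rho>1_prod_list_aux:
  assumes "\<And>m. m \<in> set ms \<Longrightarrow> polar_degree p (dg m)" "\<And>f. f \<in> set fs \<Longrightarrow> f \<in> \<Lambda>1" "polar_degree p (length ms + length fs)"
  shows "\<rho>1 (frag_of (sum_list ms) * prod_list fs) = it (map hA ms @ map \<rho>1 fs)"
  using assms
proof (induction fs arbitrary: ms)
  case Nil
  have e: "map hA ms = map evl (map (\<lambda>m. map san (mlist m)) ms)"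
    using Nil.prems(1) by (auto simp: hA_def)
  have g: "polar_degree p (dg (sum_list ms))"
  proof -
    have "polar_degree p (sum_list (map dg ms) + 0)"
      by (rule polar_degree_sum_list') (use Nil.prems in auto)
    moreover have "dg (sum_list ms) = sum_list (map dg ms)"
      using dg_eq[of "[]" 0] by (induction ms) auto
    ultimately show ?thesis by simp
  qed
  have "it (map hA ms) = evl (concat (map (\<lambda>m. map san (mlist m)) ms))"
    unfolding e by (rule evl_concat)
      (use Nil.prems in \<open>auto simp: length_rights_san dg_def san_in_letters\<close>)
  also have "\<dots> = evl (map san (concat (map mlist ms)))"
    by (simp add: map_concat comp_def)
  also have "\<dots> = hA (sum_list ms)"
  proof -
    have "mset (concat (map mlist ms)) = mon (sum_list ms)"
      by (induction ms) auto
    then have "evl (map san (concat (map mlist ms))) = evl (map san (mlist (sum_list ms)))"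
      using g by (intro evl_perm san_letters) (auto simp: length_rights_san simp flip: dg_eq)
    then show ?thesis using g by (simp add: hA_def)
  qed
  finally show ?case by (simp add: \<rho>1_frag_of)
next
  case (Cons f fs)
  let ?g = "\<lambda>x. it (map hA ms @ x # map \<rho>1 fs)"
  have cr: "set (map hA ms) \<subseteq> carrier A" "set (map \<rho>1 fs) \<subseteq> carrier A" by auto
  have lin: "?g x = it (x # map hA ms @ map \<rho>1 fs)" if "x \<in> carrier A" for x
    by (rule it_perm) (use Cons.prems(3) that cr in auto)
  have gd: "polar_degree p (Suc (length (map hA ms @ map \<rho>1 fs)))" using Cons.prems(3) by simp
  have crr: "set (map hA ms @ map \<rho>1 fs) \<subseteq> carrier A" using cr by simp
  have add: "?g (x \<oplus>\<^bsub>A\<^esub> y) = ?g x \<oplus>\<^bsub>A\<^esub> ?g y" if "x \<in> carrier A" "y \<in> carrier A" for x y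
    using it_head_linear(1)[OF gd crr that] that by (simp add: lin)
  have zero: "?g \<zero>\<^bsub>A\<^esub> = \<zero>\<^bsub>A\<^esub>"
    using it_zero[OF gd crr] by (simp add: lin)
  have cl: "?g x \<in> carrier A" if "x \<in> carrier A" for x
    using that Cons.prems(3) by (intro it_closed) auto
  have uminus: "?g (\<ominus>\<^bsub>A\<^esub> x) = \<ominus>\<^bsub>A\<^esub> ?g x" if "x \<in> carrier A" for x
    using add[of "\<ominus>\<^bsub>A\<^esub> x" x] zero that cl by (simp add: l_neg minus_equality)
  have "f \<in> polys_in {m. polar_degree p (dg m)}" using Cons.prems by (simp add: \<Lambda>1_def)
  then have "\<rho>1 (frag_of (sum_list ms) * (f * prod_list fs)) = ?g (\<rho>1 f)"
  proof (induction f rule: polys_in_induct)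
    case (one m)
    then have m: "polar_degree p (dg m)" by simp
    have "\<rho>1 (frag_of (sum_list (m # ms)) * prod_list fs) = it (map hA (m # ms) @ map \<rho>1 fs)"
      by (rule Cons.IH) (use Cons.prems m in auto)
    moreover have "frag_of (sum_list (m # ms)) * prod_list fs = frag_of (sum_list ms) * (frag_of m * prod_list fs)"
      by (simp add: mult_frag_of[symmetric] ac_simps)
    ultimately show ?case using lin[of "hA m"] by (simp add: \<rho>1_frag_of)
  next
    case (diff a b)
    then show ?case by (simp add: left_diff_distrib right_diff_distrib \<rho>1_diff a_minus_def add uminus)
  qed (simp add: zero)
  then show ?case by simp
qed

lemma \<rho>1_prod_list:
  assumes "\<And>f. f \<in> set fs \<Longrightarrow> f \<in> \<Lambda>1" "polar_degree p (length fs)"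
  shows "\<rho>1 (prod_list fs) = it (map \<rho>1 fs)"
  using \<rho>1_prod_list_aux[of "[]" fs] assms by simp

subsection \<open>Substitution\<close>

text \<open>A substitution tags each polynomial as scalar or vector; a tag is legitimate if the
  polynomial lies in \<open>\<Lambda>0\<close> or \<open>\<Lambda>1\<close> respectively.\<close>

definition typed :: "('k + 'a) int_mpoly + ('k + 'a) int_mpoly \<Rightarrow> bool" where
  "typed t = (case t of Inl f \<Rightarrow> f \<in> \<Lambda>0 | Inr f \<Rightarrow> f \<in> \<Lambda>1)"

definition val :: "'b + 'b \<Rightarrow> 'b" where "val = case_sum id id"

lemma prod_list_typed:
  assumes "\<And>t. t \<in> set ts \<Longrightarrow> typed t" "polar_degree p (length (rights ts))"
  shows "prod_list (map val ts) \<in> \<Lambda>1" "\<rho>1 (prod_list (map val ts)) = evl (map (map_sum \<rho>0 \<rho>1) ts)"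
proof -
  have e: "prod_list (map val ts) = prod_list (lefts ts) * prod_list (rights ts)"
    by (induction ts) (auto simp: val_def ac_simps split: sum.splits)
  have l: "prod_list (lefts ts) \<in> \<Lambda>0 \<and> \<rho>0 (prod_list (lefts ts)) = mprod K (map \<rho>0 (lefts ts))"
    using assms(1)
  proof (induction ts)
    case (Cons t ts)
    then have "typed t" by simp
    with Cons show ?case by (cases t) (auto simp: \<rho>0_mult typed_def \<Lambda>0_mult)
  qed (simp add: \<Lambda>0_1 \<rho>0_1)
  have r: "f \<in> \<Lambda>1" if "f \<in> set (rights ts)" for f
    using assms(1) that by (force simp: set_rights typed_def)
  show "prod_list (map val ts) \<in> \<Lambda>1"
    unfolding e using l prod_list_\<Lambda>1[OF r assms(2)] by (simp add: \<Lambda>01_mult)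
  show "\<rho>1 (prod_list (map val ts)) = evl (map (map_sum \<rho>0 \<rho>1) ts)"
    unfolding e using l prod_list_\<Lambda>1[OF r assms(2)] \<rho>1_prod_list[OF r assms(2)]
    by (simp add: \<rho>1_scalar evl_def lefts_map rights_map)
qed

text \<open>The transfer principle: evaluation commutes with substitution into \<open>Q\<close>. An
  identity between composites of Witt polynomials thus becomes an identity between the corresponding
  operations on \<open>A\<close>. On each monomial this is \<open>prod_list_typed\<close>, and both
  sides are additive in \<open>Q\<close>.\<close>

lemma \<rho>1_psubst:
  assumes "\<And>v. typed (\<tau> v)" "\<And>m. m \<in> kys Q \<Longrightarrow> polar_at \<tau> m"
  shows "psubst (val \<circ> \<tau>) Q \<in> \<Lambda>1" "\<rho>1 (psubst (val \<circ> \<tau>) Q) = peval (map_sum \<rho>0 \<rho>1 \<circ> \<tau>) Q"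
proof -
  have ev: "prod_list (map (val \<circ> \<tau>) (mlist m)) \<in> \<Lambda>1"
    "\<rho>1 (prod_list (map (val \<circ> \<tau>) (mlist m))) = evl (map (map_sum \<rho>0 \<rho>1 \<circ> \<tau>) (mlist m))"
    if "polar_at \<tau> m" for m
    using prod_list_typed[of "map \<tau> (mlist m)"] that assms(1) by (auto simp: polar_at_def)
  have pm: "(\<Prod>v\<in>#mon m. (val \<circ> \<tau>) v) = prod_list (map (val \<circ> \<tau>) (mlist m))" for m
    unfolding mset_mlist[symmetric] mset_map[symmetric] by (rule prod_mset_prod_list)
  have ec: "evl (map (map_sum \<rho>0 \<rho>1 \<circ> \<tau>) (mlist m)) \<in> carrier A" if "polar_at \<tau> m" for m
    using ev(2)[OF that] by (metis \<rho>1_closed)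
  have "Q \<in> polys_in {m. polar_at \<tau> m}" using assms(2) by (auto simp: polys_in_def)
  then have "psubst (val \<circ> \<tau>) Q \<in> \<Lambda>1 \<and> \<rho>1 (psubst (val \<circ> \<tau>) Q) = peval (map_sum \<rho>0 \<rho>1 \<circ> \<tau>) Q"
  proof (induction Q rule: polys_in_induct)
    case (one m)
    then show ?case using ev[of m] ec[of m] unfolding psubst_frag_of pm peval_def
      by (subst lin_frag_of) auto
  next
    case (diff a b)
    then have "\<And>m. m \<in> kys a \<union> kys b \<Longrightarrow> evl (map (map_sum \<rho>0 \<rho>1 \<circ> \<tau>) (mlist m)) \<in> carrier A"
      using ec by (auto simp: polys_in_def)
    then have "peval (map_sum \<rho>0 \<rho>1 \<circ> \<tau>) (a - b) = peval (map_sum \<rho>0 \<rho>1 \<circ> \<tau>) a \<ominus>\<^bsub>A\<^esub> peval (map_sum \<rho>0 \<rho>1 \<circ> \<tau>) b"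
      unfolding peval_def by (rule lin_diff)
    then show ?case using diff by (simp only: psubst_diff \<rho>1_diff \<Lambda>1_def polys_in_diff)
  qed (simp add: peval_def \<Lambda>1_def)
  then show "psubst (val \<circ> \<tau>) Q \<in> \<Lambda>1" "\<rho>1 (psubst (val \<circ> \<tau>) Q) = peval (map_sum \<rho>0 \<rho>1 \<circ> \<tau>) Q" by auto
qed

end

section \<open>Witt vector operations on polynomials\<close>

definition wadd :: "nat \<Rightarrow> (nat \<Rightarrow> 'v int_mpoly) \<Rightarrow> (nat \<Rightarrow> 'v int_mpoly) \<Rightarrow> nat \<Rightarrow> 'v int_mpoly" where
  "wadd p f g i = psubst (case_sum f g) (witt_sum p i)"
definition wmul :: "nat \<Rightarrow> (nat \<Rightarrow> 'v int_mpoly) \<Rightarrow> (nat \<Rightarrow> 'v int_mpoly) \<Rightarrow> nat \<Rightarrow> 'v int_mpoly" where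
  "wmul p f g i = psubst (case_sum f g) (witt_prod p i)"
text \<open>The componentwise power is a Frobenius for Witt vectors only modulo p, so its relations
  below are congruences modulo p.\<close>

definition wF :: "nat \<Rightarrow> (nat \<Rightarrow> 'b::comm_ring_1) \<Rightarrow> nat \<Rightarrow> 'b" where
  "wF p f i = f i ^ p"
definition wV :: "(nat \<Rightarrow> 'b::zero) \<Rightarrow> nat \<Rightarrow> 'b" where
  "wV f i = (if i = 0 then 0 else f (i - 1))"
definition wone :: "nat \<Rightarrow> 'b::zero_neq_one" where
  "wone i = (if i = 0 then 1 else 0)"

primrec wmult :: "nat \<Rightarrow> nat \<Rightarrow> (nat \<Rightarrow> 'v int_mpoly) \<Rightarrow> nat \<Rightarrow> 'v int_mpoly" where
  "wmult p 0 f = (\<lambda>_. 0)"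
| "wmult p (Suc k) f = wadd p (wmult p k f) f"

lemma ghost_wadd: "prime p \<Longrightarrow> ghost p n (wadd p f g) = ghost p n f + ghost p n g"
  unfolding wadd_def psubst_ghost[symmetric] by (simp add: witt_sum_ghost psubst_add psubst_ghost)

lemma ghost_wmul: "prime p \<Longrightarrow> ghost p n (wmul p f g) = ghost p n f * ghost p n g"
  unfolding wmul_def psubst_ghost[symmetric] by (simp add: witt_prod_ghost psubst_mult psubst_ghost)

lemma ghost_zero [simp]: "p \<noteq> 0 \<Longrightarrow> ghost p n (\<lambda>_. 0) = 0"
  by (simp add: ghost_def power_0_left)

lemma ghost_wone [simp]: "p \<noteq> 0 \<Longrightarrow> ghost p n wone = 1"
proof -
  assume p: "p \<noteq> 0"
  have "ghost p n (wone :: nat \<Rightarrow> 'a) = (\<Sum>i\<le>n. if i = 0 then 1 else 0)"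
    unfolding ghost_def using p by (intro sum.cong) (auto simp: wone_def power_0_left)
  then show ?thesis by simp
qed

lemma ghost_wmult: "prime p \<Longrightarrow> ghost p n (wmult p k f) = of_nat k * ghost p n f"
  by (induction k) (simp_all add: ghost_wadd algebra_simps prime_gt_0_nat)

lemma ghost_wV_Suc: "p \<noteq> 0 \<Longrightarrow> ghost p (Suc n) (wV f) = of_nat p * ghost p n f"
  unfolding ghost_def sum_distrib_left
  by (subst sum.atMost_Suc_shift) (simp add: wV_def mult.assoc power_0_left)

lemma wV_0 [simp]: "wV f 0 = 0" by (simp add: wV_def)
lemma wV_Suc [simp]: "wV f (Suc i) = f i" by (simp add: wV_def)

text \<open>Immediate from \<open>ghost_Suc\<close>. An exact Frobenius would shift the ghost
  components by one; the componentwise power does so up to the last summand.\<close>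

lemma ghost_wF_dvd: "of_nat (p ^ Suc n) dvd ghost p n (wF p f) - ghost p (Suc n) f"
  unfolding ghost_Suc wF_def by simp

lemma ghost_wF_dvd': "of_nat (p ^ Suc n) dvd ghost p (Suc n) f - ghost p n (wF p f)"
  using ghost_wF_dvd[of p n f] by (metis dvd_minus_iff minus_diff_eq)

context
  fixes p :: nat assumes p: "prime p"
begin

lemma p0: "p \<noteq> 0" using p by auto

lemma wadd_assoc: "wadd p (wadd p f g) h = wadd p f (wadd p g h)"
  by (rule ghost_inj[OF p0]) (simp add: ghost_wadd p)
lemma wadd_comm: "wadd p f g = wadd p g f"
  by (rule ghost_inj[OF p0]) (simp add: ghost_wadd p)
lemma wadd_0: "wadd p (\<lambda>_. 0) f = f"
  by (rule ghost_inj[OF p0]) (simp add: ghost_wadd p p0)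
lemma wmul_assoc: "wmul p (wmul p f g) h = wmul p f (wmul p g h)"
  by (rule ghost_inj[OF p0]) (simp add: ghost_wmul p ac_simps)
lemma wmul_comm: "wmul p f g = wmul p g f"
  by (rule ghost_inj[OF p0]) (simp add: ghost_wmul p ac_simps)
lemma wmul_1: "wmul p wone f = f"
  by (rule ghost_inj[OF p0]) (simp add: ghost_wmul p p0)
lemma wmul_0: "wmul p (\<lambda>_. 0) f = (\<lambda>_. 0)"
  by (rule ghost_inj[OF p0]) (simp add: ghost_wmul p p0)
lemma wmul_add_left: "wmul p (wadd p f g) h = wadd p (wmul p f h) (wmul p g h)"
  by (rule ghost_inj[OF p0]) (simp add: ghost_wmul ghost_wadd p algebra_simps)
lemma wmul_add_right: "wmul p f (wadd p g h) = wadd p (wmul p f g) (wmul p f h)"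
  by (rule ghost_inj[OF p0]) (simp add: ghost_wmul ghost_wadd p algebra_simps)
lemma wV_add: "wV (wadd p f g) = wadd p (wV f) (wV g)"
proof (rule ghost_inj[OF p0])
  fix n show "ghost p n (wV (wadd p f g)) = ghost p n (wadd p (wV f) (wV g))"
    by (cases n) (simp_all only: ghost_wV_Suc[OF p0] ghost_wadd[OF p], simp_all add: algebra_simps)
qed

lemma dvd_add4:
  assumes "(d :: 'b::comm_ring_1) dvd a - a'" "d dvd b' - b" "a' = b'"
  shows "d dvd a - b"
  using dvd_add[OF assms(1,2)] assms(3) by simp

text \<open>The n-th ghost components of both sides are congruent modulo p^(n+1) to the sum of the
  components with index n + 1 of \<open>f\<close> and \<open>g\<close>, and
  \<open>ghost_dvd_imp\<close> descends to the entries. \<open>wF_mul\<close> replaces this sum by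
  the product.\<close>

lemma wF_add: "of_nat p dvd wF p (wadd p f g) i - wadd p (wF p f) (wF p g) i"
proof (rule ghost_dvd_imp[OF p0], rule dvd_add4[OF ghost_wF_dvd])
  fix n
  show "of_nat (p ^ Suc n) dvd (ghost p (Suc n) f + ghost p (Suc n) g) - ghost p n (wadd p (wF p f) (wF p g))"
    unfolding ghost_wadd[OF p] by (intro dvd_add_diff ghost_wF_dvd')
qed (simp add: ghost_wadd p)

lemma wF_mul: "of_nat p dvd wF p (wmul p f g) i - wmul p (wF p f) (wF p g) i"
proof (rule ghost_dvd_imp[OF p0], rule dvd_add4[OF ghost_wF_dvd])
  fix n
  show "of_nat (p ^ Suc n) dvd (ghost p (Suc n) f * ghost p (Suc n) g) - ghost p n (wmul p (wF p f) (wF p g))"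
    unfolding ghost_wmul[OF p] by (intro dvd_mult_diff ghost_wF_dvd')
qed (simp add: ghost_wmul p)

text \<open>The projection formula. A ghost component of V carries a factor p, which raises the
  congruence between \<open>c\<close> and its Frobenius from modulus p^(k+1) to the required
  p^(k+2). At index 0 both sides vanish.\<close>

lemma wV_mul: "of_nat p dvd wmul p c (wV f) i - wV (wmul p (wF p c) f) i"
proof (rule ghost_dvd_imp[OF p0])
  fix n
  show "of_nat (p ^ Suc n) dvd ghost p n (wmul p c (wV f)) - ghost p n (wV (wmul p (wF p c) f))"
  proof (cases n)
    case (Suc k)
    have "of_nat (p ^ Suc k) dvd ghost p (Suc k) c * ghost p k f - ghost p k (wF p c) * ghost p k f"
      by (rule dvd_mult_diff[OF ghost_wF_dvd']) simp
    then have "of_nat p * of_nat (p ^ Suc k) dvd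
        of_nat p * (ghost p (Suc k) c * ghost p k f - ghost p k (wF p c) * ghost p k f)"
      by (intro mult_dvd_mono) auto
    then show ?thesis unfolding Suc by (simp add: ghost_wmul p ghost_wV_Suc p0 algebra_simps)
  next
    case 0
    have "ghost p 0 (wmul p c (wV f)) = 0" by (simp only: ghost_wmul[OF p]) simp
    then show ?thesis unfolding 0 by simp
  qed
qed

text \<open>Again the factor p from V completes the congruence for \<open>wF\<close>. At index 0 the
  two sides are 0 and p times the first entry.\<close>

lemma wVF: "of_nat p dvd wV (wF p f) i - wmult p p f i"
proof (rule ghost_dvd_imp[OF p0])
  fix n
  show "of_nat (p ^ Suc n) dvd ghost p n (wV (wF p f)) - ghost p n (wmult p p f)"
  proof (cases n)
    case (Suc k)
    have "of_nat p * of_nat (p ^ Suc k) dvd of_nat p * (ghost p k (wF p f) - ghost p (Suc k) f)"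
      by (intro mult_dvd_mono ghost_wF_dvd) auto
    then show ?thesis unfolding Suc by (simp add: ghost_wmult p ghost_wV_Suc p0 algebra_simps)
  next
    case 0
    have "ghost p 0 (wmult p p f) = of_nat p * f 0" by (simp only: ghost_wmult[OF p]) simp
    then show ?thesis unfolding 0 by simp
  qed
qed

lemma in_polys_in_of_ghost:
  assumes S: "0 \<in> S" "\<And>m m'. m \<in> S \<Longrightarrow> m' \<in> S \<Longrightarrow> m + m' \<in> S"
    and g: "\<And>n. ghost p n x \<in> polys_in S"
  shows "x n \<in> polys_in S"
proof (induction n rule: less_induct)
  case (less n)
  have pow: "f ^ k \<in> polys_in S" if "f \<in> polys_in S" for f k
    using that S by (induction k) (auto intro: polys_in_mult simp: one_eq_frag_of simp del: single_one)
  have "(\<Sum>i<n. of_nat (p ^ i) * x i ^ (p ^ (n - i))) \<in> polys_in S"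
    using less by (intro polys_in_sum polys_in_of_nat pow) auto
  moreover have "of_nat (p ^ n) * x n = ghost p n x - (\<Sum>i<n. of_nat (p ^ i) * x i ^ (p ^ (n - i)))"
    by (simp add: ghost_split)
  ultimately have "of_nat (p ^ n) * x n \<in> polys_in S"
    using g[of n] by (simp only: polys_in_diff)
  then show ?case using p0 by (subst (asm) polys_in_of_nat_iff) auto
qed

text \<open>Negation of Witt vectors is not componentwise for p = 2. The inverse is therefore
  produced by \<open>dwork\<close> from the negated ghost components.\<close>

lemma wadd_inverse:
  assumes S: "0 \<in> S" "\<And>m m'. m \<in> S \<Longrightarrow> m' \<in> S \<Longrightarrow> m + m' \<in> S" and h: "\<And>i. mvar (h i) \<in> polys_in S"
  obtains g where "wadd p g (\<lambda>i. mvar (h i)) = (\<lambda>_. 0)" "\<And>i. g i \<in> polys_in S"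
proof -
  let ?f = "\<lambda>i. mvar (h i)"
  have "\<exists>g. \<forall>n. ghost p n g = - ghost p n ?f"
  proof (rule dwork[OF p])
    fix n
    have "- ghost p (Suc n) ?f - frobl p (- ghost p n ?f) = - (ghost p (Suc n) ?f - frobl p (ghost p n ?f))"
      using frobl_simps(3)[of p 0 "ghost p n ?f"] by (simp add: frobl_def)
    then show "of_nat (p ^ Suc n) dvd - ghost p (Suc n) ?f - frobl p (- ghost p n ?f)"
      by (simp only: dvd_minus_iff ghost_mvar_dvd)
  qed
  then obtain g where g: "\<And>n. ghost p n g = - ghost p n ?f" by blast
  have "wadd p g ?f = (\<lambda>_. 0)"
    by (rule ghost_inj[OF p0]) (simp add: ghost_wadd p g p0)
  moreover have "g i \<in> polys_in S" for i
  proof (rule in_polys_in_of_ghost[OF S])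
    fix n
    have pow: "f ^ k \<in> polys_in S" if "f \<in> polys_in S" for f k
      using that S by (induction k) (auto intro: polys_in_mult simp: one_eq_frag_of simp del: single_one)
    show "ghost p n g \<in> polys_in S"
      unfolding g by (intro polys_in_uminus) (unfold ghost_def, intro polys_in_sum polys_in_of_nat pow h)
  qed
  ultimately show ?thesis by (rule that)
qed

end

section \<open>Witt vectors of polar algebras\<close>

lemma polar_degree_weights:
  assumes "2 \<le> p" "polar_degree p (sum_list (map (\<lambda>i. p ^ i) is))" shows "polar_degree p (length is)"
proof -
  obtain k where k: "sum_list (map (\<lambda>i. p ^ i) is) = length is + k * (p - 1)"
    using polar_degree_sum_list[of "map (\<lambda>i. p ^ i) is" p] polar_degree_power[OF assms(1)] by auto
  obtain j where j: "length is + k * (p - 1) = Suc (j * (p - 1))"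
    using assms(2) unfolding k polar_degree_def by blast
  \<comment> \<open>The empty list has weight 0, which is not admissible. With at least one entry
    the difference \<open>j - k\<close> is a genuine subtraction.\<close>
  have l: "is \<noteq> []" using assms(2) polar_degree_pos by fastforce
  then have "length is \<ge> 1" by (cases "is") auto
  then have "k * (p - 1) \<le> j * (p - 1)" using j by linarith
  then have "length is = Suc ((j - k) * (p - 1))" using j unfolding diff_mult_distrib by linarith
  then show ?thesis unfolding polar_degree_def by blast
qed

lemma Witt_carrier [simp]: "c \<in> carrier (Witt p K) \<longleftrightarrow> (\<forall>i. c i \<in> carrier K)"
  by (auto simp: witt_ring_def PiE_iff)

lemma Witt_simps:
  "c \<oplus>\<^bsub>Witt p K\<^esub> d = (\<lambda>i. mpoly_eval K (case_sum c d) (witt_sum p i))"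
  "c \<otimes>\<^bsub>Witt p K\<^esub> d = (\<lambda>i. mpoly_eval K (case_sum c d) (witt_prod p i))"
  "\<zero>\<^bsub>Witt p K\<^esub> = (\<lambda>i. \<zero>\<^bsub>K\<^esub>)"
  "\<one>\<^bsub>Witt p K\<^esub> = (\<lambda>i. if i = 0 then \<one>\<^bsub>K\<^esub> else \<zero>\<^bsub>K\<^esub>)"
  by (auto simp: witt_ring_def)

lemma sum_list_wlr: "sum_list (map (wlr p) xs) = sum_list (map (\<lambda>i. p ^ i) (map (case_sum id id) xs))"
  by (induction xs) (auto simp: wlr_def split: sum.splits)

lemma sum_list_wr: "sum_list (map (wr p) xs) = sum_list (map (\<lambda>i. p ^ i) (rights xs))"
  by (induction xs) (auto simp: wr_def split: sum.splits)

lemma wt_mlist: "wt \<omega> m = sum_list (map \<omega> (mlist m))"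
  unfolding wt_def mset_mlist[symmetric] mset_map[symmetric] by (rule sum_mset_sum_list)

context polar_alg
begin

lemma polar_at_witt_sum:
  assumes "m \<in> kys (witt_sum p i)"
  shows "polar_at (case_sum (\<lambda>i. Inr (f i)) (\<lambda>i. Inr (g i)) :: nat + nat \<Rightarrow> 'x + 'y) m" (is "polar_at ?t m")
proof -
  have "rights (map ?t xs) = map (case_sum f g) xs" for xs
    by (induction xs) (auto split: sum.splits)
  moreover have "polar_degree p (length (map (case_sum id id) (mlist m)))"
    using wt_witt_sum[OF prime_p assms] polar_degree_power[OF p2]
    by (intro polar_degree_weights[OF p2]) (simp only: sum_list_wlr[symmetric] wt_mlist[symmetric])
  ultimately show ?thesis unfolding polar_at_def by (simp only: length_map)
qed

lemma polar_at_witt_prod: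
  assumes "m \<in> kys (witt_prod p i)" shows "polar_at (map_sum f g) m"
proof -
  have "polar_degree p (length (rights (mlist m)))"
    using wt_witt_prod(2)[OF prime_p assms] polar_degree_power[OF p2]
    by (intro polar_degree_weights[OF p2]) (simp only: sum_list_wr[symmetric] wt_mlist[symmetric])
  then show ?thesis by (simp add: polar_at_def rights_map)
qed

definition padd :: "(nat \<Rightarrow> 'a) \<Rightarrow> (nat \<Rightarrow> 'a) \<Rightarrow> nat \<Rightarrow> 'a" where
  "padd x y i = peval (case_sum (\<lambda>i. Inr (x i)) (\<lambda>i. Inr (y i))) (witt_sum p i)"

definition psmult :: "(nat \<Rightarrow> 'k) \<Rightarrow> (nat \<Rightarrow> 'a) \<Rightarrow> nat \<Rightarrow> 'a" where
  "psmult c x i = peval (map_sum c x) (witt_prod p i)"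

definition pF :: "(nat \<Rightarrow> 'a) \<Rightarrow> nat \<Rightarrow> 'a" where
  "pF x i = mu A (replicate p (x i))"

definition pV :: "(nat \<Rightarrow> 'a) \<Rightarrow> nat \<Rightarrow> 'a" where
  "pV x i = (if i = 0 then \<zero>\<^bsub>A\<^esub> else x (i - 1))"

primrec pmult :: "nat \<Rightarrow> (nat \<Rightarrow> 'a) \<Rightarrow> nat \<Rightarrow> 'a" where
  "pmult 0 x = (\<lambda>_. \<zero>\<^bsub>A\<^esub>)"
| "pmult (Suc k) x = padd (pmult k x) x"

definition WA :: "(nat \<Rightarrow> 'a) set" where "WA = {x. \<forall>i. x i \<in> carrier A}"
definition L0 :: "(nat \<Rightarrow> ('k + 'a) int_mpoly) set" where "L0 = {f. \<forall>i. f i \<in> \<Lambda>0}"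
definition L1 :: "(nat \<Rightarrow> ('k + 'a) int_mpoly) set" where "L1 = {f. \<forall>i. f i \<in> \<Lambda>1}"

definition r0 :: "(nat \<Rightarrow> ('k + 'a) int_mpoly) \<Rightarrow> nat \<Rightarrow> 'k" where "r0 f = (\<lambda>i. \<rho>0 (f i))"
definition r1 :: "(nat \<Rightarrow> ('k + 'a) int_mpoly) \<Rightarrow> nat \<Rightarrow> 'a" where "r1 f = (\<lambda>i. \<rho>1 (f i))"

lemma wadd_L1: assumes "f \<in> L1" "g \<in> L1" shows "wadd p f g \<in> L1" and "r1 (wadd p f g) = padd (r1 f) (r1 g)"
proof -
  let ?t = "case_sum (\<lambda>i. Inr (f i)) (\<lambda>i. Inr (g i))"
  have v: "val \<circ> ?t = case_sum f g" by (auto simp: val_def fun_eq_iff split: sum.splits)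
  have m: "map_sum \<rho>0 \<rho>1 \<circ> ?t = case_sum (\<lambda>i. Inr (\<rho>1 (f i))) (\<lambda>i. Inr (\<rho>1 (g i)))"
    by (auto simp: fun_eq_iff split: sum.splits)
  have t: "typed (?t v)" for v using assms by (auto simp: typed_def L1_def split: sum.splits)
  note * = \<rho>1_psubst[of ?t, OF t polar_at_witt_sum, unfolded v m]
  show "wadd p f g \<in> L1" "r1 (wadd p f g) = padd (r1 f) (r1 g)"
    using * by (auto simp: L1_def r1_def padd_def wadd_def fun_eq_iff)
qed

lemma wmul_L1: assumes "f \<in> L0" "g \<in> L1" shows "wmul p f g \<in> L1" and "r1 (wmul p f g) = psmult (r0 f) (r1 g)"
proof -
  let ?t = "map_sum f g"
  have v: "val \<circ> ?t = case_sum f g" by (auto simp: val_def fun_eq_iff map_sum_def split: sum.splits)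
  have m: "map_sum \<rho>0 \<rho>1 \<circ> ?t = map_sum (r0 f) (r1 g)"
    by (auto simp: fun_eq_iff map_sum_def r0_def r1_def split: sum.splits)
  have t: "typed (?t v)" for v using assms by (auto simp: typed_def L0_def L1_def map_sum_def split: sum.splits)
  note * = \<rho>1_psubst[of ?t, OF t polar_at_witt_prod, unfolded v m]
  show "wmul p f g \<in> L1" "r1 (wmul p f g) = psmult (r0 f) (r1 g)"
    using * by (auto simp: L1_def r1_def psmult_def wmul_def fun_eq_iff)
qed

lemma \<rho>0_psubst: "\<rho>0 (psubst \<tau> f) = mpoly_eval K (\<lambda>v. \<rho>0 (\<tau> v)) f"
  unfolding \<rho>0_def by (rule R.mpoly_eval_psubst) (rule san0_closed)

lemma \<rho>0_case_sum: "(\<lambda>v. \<rho>0 (case_sum f g v)) = case_sum (r0 f) (r0 g)"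
  by (auto simp: fun_eq_iff r0_def split: sum.splits)

lemma r0_wadd: "r0 (wadd p f g) = r0 f \<oplus>\<^bsub>Witt p K\<^esub> r0 g"
  by (auto simp: Witt_simps wadd_def r0_def[of "wadd p f g"] \<rho>0_psubst \<rho>0_case_sum)
lemma r0_wmul: "r0 (wmul p f g) = r0 f \<otimes>\<^bsub>Witt p K\<^esub> r0 g"
  by (auto simp: Witt_simps wmul_def r0_def[of "wmul p f g"] \<rho>0_psubst \<rho>0_case_sum)

lemma \<Lambda>0_power: "f \<in> \<Lambda>0 \<Longrightarrow> f ^ n \<in> \<Lambda>0"
  by (induction n) (auto simp: \<Lambda>0_1 \<Lambda>0_mult)

lemma psubst_\<Lambda>0: "(\<And>v. \<tau> v \<in> \<Lambda>0) \<Longrightarrow> psubst \<tau> f \<in> \<Lambda>0"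
proof (induction f rule: int_mpoly_induct)
  case zero
  show ?case by (simp add: \<Lambda>0_def)
next
  case (one m)
  have "(\<Prod>v\<in>#M. \<tau> v) \<in> \<Lambda>0" for M
    by (induction M) (auto simp: \<Lambda>0_1 \<Lambda>0_mult one)
  then show ?case by (simp add: psubst_frag_of)
qed (simp add: psubst_diff \<Lambda>0_def polys_in_diff)

lemma wadd_L0: "f \<in> L0 \<Longrightarrow> g \<in> L0 \<Longrightarrow> wadd p f g \<in> L0"
  unfolding L0_def wadd_def by (auto intro!: psubst_\<Lambda>0 split: sum.splits)
lemma wmul_L0: "f \<in> L0 \<Longrightarrow> g \<in> L0 \<Longrightarrow> wmul p f g \<in> L0"
  unfolding L0_def wmul_def by (auto intro!: psubst_\<Lambda>0 split: sum.splits)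
lemma wF_L0: "f \<in> L0 \<Longrightarrow> wF p f \<in> L0"
  by (simp add: L0_def wF_def \<Lambda>0_power)
lemma zero_L0: "(\<lambda>_. 0) \<in> L0" by (simp add: L0_def \<Lambda>0_def)
lemma zero_L1: "(\<lambda>_. 0) \<in> L1" by (simp add: L1_def \<Lambda>1_def)
lemma one_L0: "wone \<in> L0" using zero_L0 by (auto simp: L0_def wone_def \<Lambda>0_1)
lemma r0_0: "r0 (\<lambda>_. 0) = \<zero>\<^bsub>Witt p K\<^esub>" by (simp add: Witt_simps r0_def \<rho>0_0)
lemma r0_1: "r0 wone = \<one>\<^bsub>Witt p K\<^esub>" by (auto simp: Witt_simps r0_def \<rho>0_0 \<rho>0_1 wone_def)
lemma r1_0: "r1 (\<lambda>_. 0) = (\<lambda>_. \<zero>\<^bsub>A\<^esub>)" by (simp add: r1_def)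

lemma wV_L1: assumes "f \<in> L1" shows "wV f \<in> L1" "r1 (wV f) = pV (r1 f)"
  using assms zero_L1 by (auto simp: L1_def wV_def r1_def pV_def)

lemma power_\<Lambda>1: assumes "f \<in> \<Lambda>1" shows "f ^ p \<in> \<Lambda>1" "\<rho>1 (f ^ p) = mu A (replicate p (\<rho>1 f))"
proof -
  have "polar_degree p p" using polar_degree_power[OF p2, of 1] by simp
  then show "f ^ p \<in> \<Lambda>1" "\<rho>1 (f ^ p) = mu A (replicate p (\<rho>1 f))"
    using prod_list_\<Lambda>1[of "replicate p f"] \<rho>1_prod_list[of "replicate p f"] assms
    by (auto simp: prod_list_replicate it_p)
qed

lemma wF_L1: assumes "f \<in> L1" shows "wF p f \<in> L1" "r1 (wF p f) = pF (r1 f)"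
  using assms by (auto simp: L1_def wF_def r1_def pF_def power_\<Lambda>1)

lemma \<rho>0_power: "\<rho>0 (f ^ n) = \<rho>0 f [^]\<^bsub>K\<^esub> n"
  by (induction n) (simp_all add: \<rho>0_1 \<rho>0_mult R.m_comm)

lemma r0_wF: "r0 (wF p f) = frob p K (r0 f)"
  by (simp add: r0_def wF_def frob_def \<rho>0_power)

lemma wmult_L1: assumes "f \<in> L1" shows "wmult p k f \<in> L1 \<and> r1 (wmult p k f) = pmult k (r1 f)"
  using assms by (induction k) (auto simp: zero_L1 r1_0 wadd_L1)

section \<open>Generic lifts and the identities inherited from polynomials\<close>

definition fK :: "(nat \<Rightarrow> 'k) \<Rightarrow> nat \<Rightarrow> ('k + 'a) int_mpoly" where "fK c i = mvar (Inl (c i))"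
definition fA :: "(nat \<Rightarrow> 'a) \<Rightarrow> nat \<Rightarrow> ('k + 'a) int_mpoly" where "fA x i = mvar (Inr (x i))"

lemma mlist_single: "mlist (Poly_Mapping.single v 1) = [v]"
  by (metis mset_mlist mon_single mset_single_iff)

lemma fK_L0: "fK c \<in> L0"
  unfolding L0_def fK_def \<Lambda>0_def mvar_def by (simp add: dg_def mlist_single del: One_nat_def)
lemma fA_L1: "fA c \<in> L1"
  unfolding L1_def fA_def \<Lambda>1_def mvar_def by (simp add: dg_def mlist_single del: One_nat_def)
lemma r0_fK: assumes "c \<in> carrier (Witt p K)" shows "r0 (fK c) = c"
proof -
  have "\<rho>0 (mvar v) = san0 v" for v unfolding \<rho>0_def by (rule R.mpoly_eval_mvar) (rule san0_closed)
  then show ?thesis using assms by (auto simp: r0_def fK_def san0_def)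
qed
lemma r1_fA: assumes "x \<in> WA" shows "r1 (fA x) = x"
proof -
  have "\<rho>1 (mvar (Inr a)) = a" if "a \<in> carrier A" for a
    unfolding mvar_def \<rho>1_frag_of hA_def using that
    by (simp add: dg_def mlist_single san_def evl_def del: One_nat_def)
  then show ?thesis using assms by (auto simp: r1_def fA_def WA_def)
qed

lemma r1_WA [simp]: "r1 f \<in> WA" by (simp add: WA_def r1_def)
lemma r0_carrier [simp]: "r0 f \<in> carrier (Witt p K)" by (simp add: r0_def)

text \<open>Each entry is the value of the variable that it names, so \<open>r1\<close> and
  \<open>r0\<close> are surjective. The identities below are checked on polynomial preimages, where
  they follow from the corresponding lemmas on \<open>wadd\<close>, \<open>wmul\<close>,
  \<open>wF\<close> and \<open>wV\<close>.\<close>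

lemma WA_cases: assumes "x \<in> WA" obtains f where "f \<in> L1" "x = r1 f"
  using assms r1_fA fA_L1 by metis
lemma WK_cases: assumes "c \<in> carrier (Witt p K)" obtains f where "f \<in> L0" "c = r0 f"
  using assms r0_fK fK_L0 by metis

lemma zero_WA [simp]: "(\<lambda>_. \<zero>\<^bsub>A\<^esub>) \<in> WA" by (simp add: WA_def)

lemma padd_closed [simp]: "x \<in> WA \<Longrightarrow> y \<in> WA \<Longrightarrow> padd x y \<in> WA"
  by (elim WA_cases) (simp only: wadd_L1(2)[symmetric] r1_WA)
lemma psmult_closed [simp]: "c \<in> carrier (Witt p K) \<Longrightarrow> y \<in> WA \<Longrightarrow> psmult c y \<in> WA"
  by (elim WA_cases WK_cases) (simp only: wmul_L1(2)[symmetric] r1_WA)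
lemma pF_closed [simp]: "x \<in> WA \<Longrightarrow> pF x \<in> WA"
  by (elim WA_cases) (simp only: wF_L1(2)[symmetric] r1_WA)
lemma pV_closed [simp]: "x \<in> WA \<Longrightarrow> pV x \<in> WA"
  by (auto simp: WA_def pV_def)
lemma padd_assoc: "x \<in> WA \<Longrightarrow> y \<in> WA \<Longrightarrow> z \<in> WA \<Longrightarrow> padd (padd x y) z = padd x (padd y z)"
  by (elim WA_cases) (simp only: wadd_L1(1) wadd_assoc prime_p wadd_L1(2)[symmetric])
lemma padd_comm: "x \<in> WA \<Longrightarrow> y \<in> WA \<Longrightarrow> padd x y = padd y x"
  by (elim WA_cases) (simp only: wadd_L1(1) wadd_comm[OF prime_p] wadd_L1(2)[symmetric])
lemma padd_zero: "x \<in> WA \<Longrightarrow> padd (\<lambda>_. \<zero>\<^bsub>A\<^esub>) x = x"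
  by (elim WA_cases) (simp only: wadd_L1(1) wadd_0[OF prime_p] zero_L1 wadd_L1(2)[symmetric] r1_0[symmetric])
lemma psmult_zero: "x \<in> WA \<Longrightarrow> psmult \<zero>\<^bsub>Witt p K\<^esub> x = (\<lambda>_. \<zero>\<^bsub>A\<^esub>)"
  by (elim WA_cases) (simp only: wmul_L1(1) wmul_0[OF prime_p] zero_L0 r1_0 wmul_L1(2)[symmetric] r0_0[symmetric])
lemma psmult_one: "x \<in> WA \<Longrightarrow> psmult \<one>\<^bsub>Witt p K\<^esub> x = x"
  by (elim WA_cases) (simp only: wmul_L1(1) wmul_1[OF prime_p] one_L0 wmul_L1(2)[symmetric] r0_1[symmetric])
lemma psmult_assoc: "c \<in> carrier (Witt p K) \<Longrightarrow> d \<in> carrier (Witt p K) \<Longrightarrow> x \<in> WA \<Longrightarrow>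
    psmult (c \<otimes>\<^bsub>Witt p K\<^esub> d) x = psmult c (psmult d x)"
  by (elim WA_cases WK_cases) (simp only: wmul_L1(1) wmul_L0 wmul_assoc[OF prime_p] wmul_L1(2)[symmetric] r0_wmul[symmetric])
lemma psmult_add_left: "c \<in> carrier (Witt p K) \<Longrightarrow> d \<in> carrier (Witt p K) \<Longrightarrow> x \<in> WA \<Longrightarrow>
    psmult (c \<oplus>\<^bsub>Witt p K\<^esub> d) x = padd (psmult c x) (psmult d x)"
  by (elim WA_cases WK_cases)
    (simp only: wmul_L1(1) wadd_L1(1) wadd_L0 wmul_add_left[OF prime_p] wmul_L1(2)[symmetric] r0_wadd[symmetric] wadd_L1(2)[symmetric])
lemma psmult_add_right: "c \<in> carrier (Witt p K) \<Longrightarrow> x \<in> WA \<Longrightarrow> y \<in> WA \<Longrightarrow>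
    psmult c (padd x y) = padd (psmult c x) (psmult c y)"
  by (elim WA_cases WK_cases)
    (simp only: wmul_L1(1) wadd_L1(1) wmul_add_right[OF prime_p] wmul_L1(2)[symmetric] wadd_L1(2)[symmetric])
lemma pV_add: "x \<in> WA \<Longrightarrow> y \<in> WA \<Longrightarrow> pV (padd x y) = padd (pV x) (pV y)"
  by (elim WA_cases) (simp only: wV_L1(1) wadd_L1(1) wV_add[OF prime_p] wadd_L1(2)[symmetric] wV_L1(2)[symmetric])

subsection \<open>The ring of Witt vectors of the base\<close>

text \<open>\<open>r0\<close> maps polynomial vectors onto W(K) and respects both operations, so the
  ring axioms are those of the polynomial identities.\<close>

lemma cring_Witt: "cring (Witt p K)"
proof (rule cringI)
  show "abelian_group (Witt p K)"
  proof (rule abelian_groupI)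
    show "x \<oplus>\<^bsub>Witt p K\<^esub> y \<in> carrier (Witt p K)" if "x \<in> carrier (Witt p K)" "y \<in> carrier (Witt p K)" for x y
      using that by (elim WK_cases) (simp only: r0_wadd[symmetric] r0_carrier)
    show "\<zero>\<^bsub>Witt p K\<^esub> \<in> carrier (Witt p K)" by (simp only: r0_0[symmetric] r0_carrier)
    show "(x \<oplus>\<^bsub>Witt p K\<^esub> y) \<oplus>\<^bsub>Witt p K\<^esub> z = x \<oplus>\<^bsub>Witt p K\<^esub> (y \<oplus>\<^bsub>Witt p K\<^esub> z)"
      if "x \<in> carrier (Witt p K)" "y \<in> carrier (Witt p K)" "z \<in> carrier (Witt p K)" for x y z
      using that by (elim WK_cases) (simp only: r0_wadd[symmetric] wadd_assoc[OF prime_p])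
    show "x \<oplus>\<^bsub>Witt p K\<^esub> y = y \<oplus>\<^bsub>Witt p K\<^esub> x"
      if "x \<in> carrier (Witt p K)" "y \<in> carrier (Witt p K)" for x y
      using that by (elim WK_cases) (simp only: r0_wadd[symmetric] wadd_comm[OF prime_p])
    show "\<zero>\<^bsub>Witt p K\<^esub> \<oplus>\<^bsub>Witt p K\<^esub> x = x" if "x \<in> carrier (Witt p K)" for x
      using that by (elim WK_cases) (simp only: r0_wadd[symmetric] r0_0[symmetric] wadd_0[OF prime_p])
    show "\<exists>y\<in>carrier (Witt p K). y \<oplus>\<^bsub>Witt p K\<^esub> x = \<zero>\<^bsub>Witt p K\<^esub>" if x: "x \<in> carrier (Witt p K)" for x
    proof -
      obtain g where "wadd p g (fK x) = (\<lambda>_. 0)"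
        using wadd_inverse[OF prime_p, of UNIV "\<lambda>i. Inl (x i)"] unfolding fK_def by (auto simp: polys_in_def)
      then have "r0 g \<oplus>\<^bsub>Witt p K\<^esub> r0 (fK x) = \<zero>\<^bsub>Witt p K\<^esub>" by (simp only: r0_wadd[symmetric] r0_0[symmetric])
      then show ?thesis using x r0_carrier[of g] by (auto simp: r0_fK simp del: Witt_carrier)
    qed
  qed
  show "comm_monoid (Witt p K)"
  proof (rule comm_monoidI)
    show "x \<otimes>\<^bsub>Witt p K\<^esub> y \<in> carrier (Witt p K)" if "x \<in> carrier (Witt p K)" "y \<in> carrier (Witt p K)" for x y
      using that by (elim WK_cases) (simp only: r0_wmul[symmetric] r0_carrier)
    show "\<one>\<^bsub>Witt p K\<^esub> \<in> carrier (Witt p K)" by (simp only: r0_1[symmetric] r0_carrier)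
    show "(x \<otimes>\<^bsub>Witt p K\<^esub> y) \<otimes>\<^bsub>Witt p K\<^esub> z = x \<otimes>\<^bsub>Witt p K\<^esub> (y \<otimes>\<^bsub>Witt p K\<^esub> z)"
      if "x \<in> carrier (Witt p K)" "y \<in> carrier (Witt p K)" "z \<in> carrier (Witt p K)" for x y z
      using that by (elim WK_cases) (simp only: r0_wmul[symmetric] wmul_assoc[OF prime_p])
    show "x \<otimes>\<^bsub>Witt p K\<^esub> y = y \<otimes>\<^bsub>Witt p K\<^esub> x"
      if "x \<in> carrier (Witt p K)" "y \<in> carrier (Witt p K)" for x y
      using that by (elim WK_cases) (simp only: r0_wmul[symmetric] wmul_comm[OF prime_p])
    show "\<one>\<^bsub>Witt p K\<^esub> \<otimes>\<^bsub>Witt p K\<^esub> x = x" if "x \<in> carrier (Witt p K)" for x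
      using that by (elim WK_cases) (simp only: r0_wmul[symmetric] r0_1[symmetric] wmul_1[OF prime_p])
  qed
  show "(x \<oplus>\<^bsub>Witt p K\<^esub> y) \<otimes>\<^bsub>Witt p K\<^esub> z = x \<otimes>\<^bsub>Witt p K\<^esub> z \<oplus>\<^bsub>Witt p K\<^esub> y \<otimes>\<^bsub>Witt p K\<^esub> z"
    if "x \<in> carrier (Witt p K)" "y \<in> carrier (Witt p K)" "z \<in> carrier (Witt p K)" for x y z
    using that by (elim WK_cases) (simp only: r0_wmul[symmetric] r0_wadd[symmetric] wmul_add_left[OF prime_p])
qed

end

section \<open>Characteristic p\<close>

locale polar_perf = polar_alg p K A
  for p :: nat and K :: "'k ring" and A :: "('k, 'a) polar" +
  assumes perf: "perfect_field p K"
begin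

lemma p_zero: "[p] \<cdot>\<^bsub>K\<^esub> \<one>\<^bsub>K\<^esub> = \<zero>\<^bsub>K\<^esub>" using perf by (simp add: perfect_field_def)

lemma K_p_zero: "x \<in> carrier K \<Longrightarrow> [p] \<cdot>\<^bsub>K\<^esub> x = \<zero>\<^bsub>K\<^esub>"
  using R.add_pow_ldistr[of "\<one>\<^bsub>K\<^esub>" x p] p_zero by simp

lemma A_p_zero: assumes "x \<in> carrier A" shows "[p] \<cdot>\<^bsub>A\<^esub> x = \<zero>\<^bsub>A\<^esub>"
proof -
  have "[n] \<cdot>\<^bsub>A\<^esub> x = ([n] \<cdot>\<^bsub>K\<^esub> \<one>\<^bsub>K\<^esub>) \<odot>\<^bsub>A\<^esub> x" for n :: nat
    using assms by (induction n) (auto simp: smult_l_distr)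
  then show ?thesis using p_zero assms by simp
qed

text \<open>Characteristic p enters here: \<open>A\<close> is killed by p, so congruences modulo p
  between polynomials become equations in \<open>A\<close>.\<close>

lemma \<rho>1_cong_mod:
  assumes "of_nat p dvd f - g" shows "\<rho>1 f = \<rho>1 g"
proof -
  obtain h where "f - g = of_nat p * h" using assms by (rule dvdE)
  then have "f = of_nat p * h + g" by (simp add: algebra_simps)
  then show ?thesis by (simp add: \<rho>1_add \<rho>1_of_nat_times A_p_zero)
qed

lemma \<rho>0_add: "\<rho>0 (f + g) = \<rho>0 f \<oplus>\<^bsub>K\<^esub> \<rho>0 g"
  using \<rho>0_diff[of f "0 - g"] \<rho>0_diff[of 0 g] by (simp add: \<rho>0_0 a_minus_def)

lemma \<rho>0_cong_mod:
  assumes "of_nat p dvd f - g" shows "\<rho>0 f = \<rho>0 g"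
proof -
  obtain h where "f - g = of_nat p * h" using assms by (rule dvdE)
  then have "f = of_nat p * h + g" by (simp add: algebra_simps)
  moreover have "\<rho>0 (of_nat n * h) = [n] \<cdot>\<^bsub>K\<^esub> \<rho>0 h" for n
    by (induction n) (simp_all add: \<rho>0_add \<rho>0_0 algebra_simps R.a_comm)
  ultimately show ?thesis by (simp add: \<rho>0_add K_p_zero)
qed

lemma r1_cong_mod: "(\<And>i. of_nat p dvd f i - g i) \<Longrightarrow> r1 f = r1 g"
  by (auto simp: r1_def intro: \<rho>1_cong_mod)
lemma r0_cong_mod: "(\<And>i. of_nat p dvd f i - g i) \<Longrightarrow> r0 f = r0 g"
  by (auto simp: r0_def intro: \<rho>0_cong_mod)

lemma pF_add: "x \<in> WA \<Longrightarrow> y \<in> WA \<Longrightarrow> pF (padd x y) = padd (pF x) (pF y)"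
  by (elim WA_cases)
    (simp only: wF_L1(1) wadd_L1(1) r1_cong_mod[OF wF_add[OF prime_p]] wadd_L1(2)[symmetric] wF_L1(2)[symmetric])
lemma pF_smult: "c \<in> carrier (Witt p K) \<Longrightarrow> x \<in> WA \<Longrightarrow> pF (psmult c x) = psmult (frob p K c) (pF x)"
  by (elim WA_cases WK_cases)
    (simp only: wF_L1(1) wmul_L1(1) wF_L0 r1_cong_mod[OF wF_mul[OF prime_p]] wmul_L1(2)[symmetric] wF_L1(2)[symmetric] r0_wF[symmetric])
lemma pV_smult: "c \<in> carrier (Witt p K) \<Longrightarrow> x \<in> WA \<Longrightarrow> psmult c (pV x) = pV (psmult (frob p K c) x)"
  by (elim WA_cases WK_cases)
    (simp only: wV_L1(1) wmul_L1(1) wF_L0 r1_cong_mod[OF wV_mul[OF prime_p]] wmul_L1(2)[symmetric] wV_L1(2)[symmetric] r0_wF[symmetric])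
lemma pVF: "x \<in> WA \<Longrightarrow> pV (pF x) = pmult p x"
  by (elim WA_cases)
    (simp only: wV_L1(1) wF_L1(1) wmult_L1[THEN conjunct1] r1_cong_mod[OF wVF[OF prime_p]] wmult_L1[THEN conjunct2, symmetric] wV_L1(2)[symmetric] wF_L1(2)[symmetric])

lemma frob_closed [simp]: "c \<in> carrier (Witt p K) \<Longrightarrow> frob p K c \<in> carrier (Witt p K)"
  by (simp add: frob_def)
lemma frob_add: "c \<in> carrier (Witt p K) \<Longrightarrow> d \<in> carrier (Witt p K) \<Longrightarrow>
    frob p K (c \<oplus>\<^bsub>Witt p K\<^esub> d) = frob p K c \<oplus>\<^bsub>Witt p K\<^esub> frob p K d"
  by (elim WK_cases) (simp only: r0_cong_mod[OF wF_add[OF prime_p]] r0_wadd[symmetric] r0_wF[symmetric])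
lemma frob_mult: "c \<in> carrier (Witt p K) \<Longrightarrow> d \<in> carrier (Witt p K) \<Longrightarrow>
    frob p K (c \<otimes>\<^bsub>Witt p K\<^esub> d) = frob p K c \<otimes>\<^bsub>Witt p K\<^esub> frob p K d"
  by (elim WK_cases) (simp only: r0_cong_mod[OF wF_mul[OF prime_p]] r0_wmul[symmetric] r0_wF[symmetric])
lemma frob_one: "frob p K \<one>\<^bsub>Witt p K\<^esub> = \<one>\<^bsub>Witt p K\<^esub>"
  using p2 by (auto simp: frob_def Witt_simps R.nat_pow_zero)

end

section \<open>The Frobenius automorphism\<close>

context polar_perf
begin

lemma K_field: "field K" using perf by (simp add: perfect_field_def)

lemma K_power_eq_zero: assumes "x \<in> carrier K" "x [^]\<^bsub>K\<^esub> (n::nat) = \<zero>\<^bsub>K\<^esub>" shows "x = \<zero>\<^bsub>K\<^esub>"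
proof -
  interpret F: field K by (rule K_field)
  show ?thesis using assms(2)
    by (induction n) (use assms(1) F.integral in \<open>auto simp: F.zero_not_one[symmetric]\<close>)
qed

text \<open>Frobenius is additive, so only its kernel matters, and a field has no nilpotent
  elements.\<close>

lemma frob_inj: "inj_on (frob p K) (carrier (Witt p K))"
proof
  interpret W: cring "Witt p K" by (rule cring_Witt)
  fix c d assume c: "c \<in> carrier (Witt p K)" "d \<in> carrier (Witt p K)" "frob p K c = frob p K d"
  have z: "frob p K x = \<zero>\<^bsub>Witt p K\<^esub> \<Longrightarrow> x = \<zero>\<^bsub>Witt p K\<^esub>" if "x \<in> carrier (Witt p K)" for x
    using that K_power_eq_zero by (auto simp: frob_def Witt_simps fun_eq_iff)
  let ?e = "c \<ominus>\<^bsub>Witt p K\<^esub> d"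
  have e: "?e \<in> carrier (Witt p K)" using c by (simp del: Witt_carrier)
  have ed: "?e \<oplus>\<^bsub>Witt p K\<^esub> d = c" using c by (simp add: W.minus_eq W.a_assoc W.l_neg del: Witt_carrier)
  have "frob p K ?e \<oplus>\<^bsub>Witt p K\<^esub> frob p K d = frob p K d"
    using frob_add[OF e c(2)] c(3) ed by simp
  then have "frob p K ?e = \<zero>\<^bsub>Witt p K\<^esub>"
    using frob_closed[OF e] frob_closed[OF c(2)] W.add.r_cancel_one by metis
  then have "?e = \<zero>\<^bsub>Witt p K\<^esub>" using z e by blast
  then show "c = d" using ed W.l_zero[OF c(2)] by simp
qed

lemma frob_surj: "frob p K ` carrier (Witt p K) = carrier (Witt p K)"
proof
  show "frob p K ` carrier (Witt p K) \<subseteq> carrier (Witt p K)" using frob_closed by blast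
  show "carrier (Witt p K) \<subseteq> frob p K ` carrier (Witt p K)"
  proof
    fix c assume c: "c \<in> carrier (Witt p K)"
    then have "\<forall>i. \<exists>d\<in>carrier K. d [^]\<^bsub>K\<^esub> p = c i"
      using perf unfolding perfect_field_def Witt_carrier by (metis imageE)
    then obtain d where "\<And>i. d i \<in> carrier K" "\<And>i. d i [^]\<^bsub>K\<^esub> p = c i" by metis
    then show "c \<in> frob p K ` carrier (Witt p K)"
      by (intro image_eqI[of _ _ d]) (auto simp: frob_def)
  qed
qed

lemma frob_inv_closed [simp]: "c \<in> carrier (Witt p K) \<Longrightarrow> frob_inv p K c \<in> carrier (Witt p K)"
  unfolding frob_inv_def by (metis frob_surj inv_into_into)
lemma frob_frob_inv: "c \<in> carrier (Witt p K) \<Longrightarrow> frob p K (frob_inv p K c) = c"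
  unfolding frob_inv_def by (metis f_inv_into_f frob_surj)
lemma frob_inv_frob: "c \<in> carrier (Witt p K) \<Longrightarrow> frob_inv p K (frob p K c) = c"
  unfolding frob_inv_def by (metis frob_inj inv_into_f_f)

lemma frob_inv_add: assumes "c \<in> carrier (Witt p K)" "d \<in> carrier (Witt p K)"
  shows "frob_inv p K (c \<oplus>\<^bsub>Witt p K\<^esub> d) = frob_inv p K c \<oplus>\<^bsub>Witt p K\<^esub> frob_inv p K d"
proof -
  interpret W: cring "Witt p K" by (rule cring_Witt)
  show ?thesis using frob_inv_frob[of "frob_inv p K c \<oplus>\<^bsub>Witt p K\<^esub> frob_inv p K d"] assms
    by (simp add: frob_add frob_frob_inv del: Witt_carrier)
qed

lemma frob_inv_mult: assumes "c \<in> carrier (Witt p K)" "d \<in> carrier (Witt p K)"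
  shows "frob_inv p K (c \<otimes>\<^bsub>Witt p K\<^esub> d) = frob_inv p K c \<otimes>\<^bsub>Witt p K\<^esub> frob_inv p K d"
proof -
  interpret W: cring "Witt p K" by (rule cring_Witt)
  show ?thesis using frob_inv_frob[of "frob_inv p K c \<otimes>\<^bsub>Witt p K\<^esub> frob_inv p K d"] assms
    by (simp add: frob_mult frob_frob_inv del: Witt_carrier)
qed

lemma frob_inv_one: "frob_inv p K \<one>\<^bsub>Witt p K\<^esub> = \<one>\<^bsub>Witt p K\<^esub>"
proof -
  interpret W: cring "Witt p K" by (rule cring_Witt)
  show ?thesis using frob_inv_frob[of "\<one>\<^bsub>Witt p K\<^esub>"] by (simp add: frob_one del: Witt_carrier)
qed

lemma frob_inv_zero: "frob_inv p K \<zero>\<^bsub>Witt p K\<^esub> = \<zero>\<^bsub>Witt p K\<^esub>"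
proof -
  interpret W: cring "Witt p K" by (rule cring_Witt)
  show ?thesis using frob_inv_add[of "\<zero>\<^bsub>Witt p K\<^esub>" "\<zero>\<^bsub>Witt p K\<^esub>"] frob_inv_closed[of "\<zero>\<^bsub>Witt p K\<^esub>"]
    by (metis W.add.r_cancel_one W.l_zero W.zero_closed)
qed

abbreviation \<sigma> :: "nat \<Rightarrow> (nat \<Rightarrow> 'k) \<Rightarrow> nat \<Rightarrow> 'k" where "\<sigma> n \<equiv> frob_inv p K ^^ n"

lemma \<sigma>_closed [simp]: "c \<in> carrier (Witt p K) \<Longrightarrow> \<sigma> n c \<in> carrier (Witt p K)"
  by (induction n) (auto simp del: Witt_carrier)
lemma \<sigma>_add: "c \<in> carrier (Witt p K) \<Longrightarrow> d \<in> carrier (Witt p K) \<Longrightarrow>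
    \<sigma> n (c \<oplus>\<^bsub>Witt p K\<^esub> d) = \<sigma> n c \<oplus>\<^bsub>Witt p K\<^esub> \<sigma> n d"
  by (induction n) (simp_all add: frob_inv_add del: Witt_carrier)
lemma \<sigma>_mult: "c \<in> carrier (Witt p K) \<Longrightarrow> d \<in> carrier (Witt p K) \<Longrightarrow>
    \<sigma> n (c \<otimes>\<^bsub>Witt p K\<^esub> d) = \<sigma> n c \<otimes>\<^bsub>Witt p K\<^esub> \<sigma> n d"
  by (induction n) (simp_all add: frob_inv_mult del: Witt_carrier)
lemma \<sigma>_one: "\<sigma> n \<one>\<^bsub>Witt p K\<^esub> = \<one>\<^bsub>Witt p K\<^esub>"
  by (induction n) (simp_all add: frob_inv_one)
lemma \<sigma>_zero: "\<sigma> n \<zero>\<^bsub>Witt p K\<^esub> = \<zero>\<^bsub>Witt p K\<^esub>"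
  by (induction n) (simp_all add: frob_inv_zero)
lemma \<sigma>_frob: "c \<in> carrier (Witt p K) \<Longrightarrow> \<sigma> n (frob p K c) = frob p K (\<sigma> n c)"
  by (induction n) (simp_all add: frob_inv_frob frob_frob_inv del: Witt_carrier)
lemma frob_\<sigma>_Suc: "c \<in> carrier (Witt p K) \<Longrightarrow> frob p K (\<sigma> (Suc n) c) = \<sigma> n c"
  by (simp add: frob_frob_inv del: Witt_carrier)

end

section \<open>Nilpotent subsets\<close>

context polar_alg
begin

text \<open>The number of factors is a power of p because a product of that many factors is always
  defined. For a polarized algebra this says that the ideal generated by \<open>X\<close> has
  vanishing power with exponent p^s, as in the definition of CW.\<close>

definition nilpotent_set :: "nat \<Rightarrow> 'a set \<Rightarrow> bool" where
  "nilpotent_set s X \<longleftrightarrow> X \<subseteq> carrier A \<and> (\<forall>xs. set xs \<subseteq> X \<and> length xs = p ^ s \<longrightarrow> it xs = \<zero>\<^bsub>A\<^esub>)"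

text \<open>By symmetry p^s entries from \<open>X\<close> may be collected in front and multiplied
  first. What remains has admissible length, as both the length of \<open>xs\<close> and p^s are 1
  modulo p - 1.\<close>

lemma it_zero_of_many:
  assumes "nilpotent_set s X" "set xs \<subseteq> carrier A" "polar_degree p (length xs)" "p ^ s \<le> length (filter (\<lambda>x. x \<in> X) xs)"
  shows "it xs = \<zero>\<^bsub>A\<^esub>"
proof -
  let ?ys = "filter (\<lambda>x. x \<in> X) xs" and ?zs = "filter (\<lambda>x. x \<notin> X) xs"
  let ?r = "drop (p ^ s) ?ys @ ?zs" and ?t = "take (p ^ s) ?ys"
  have l: "length xs = p ^ s + length ?r"
    using assms(4) sum_length_filter_compl[of "\<lambda>x. x \<in> X" xs] by simp
  have t: "set ?t \<subseteq> X" "length ?t = p ^ s" using assms(4) by (auto dest: in_set_takeD)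
  have X: "X \<subseteq> carrier A" using assms(1) by (simp add: nilpotent_set_def)
  have rc: "set ?r \<subseteq> carrier A" using assms(2) set_drop_subset[of "p ^ s" ?ys] by auto
  have g: "polar_degree p (Suc (length ?r))"
  proof -
    obtain j k where jk: "length xs = Suc (j * (p - 1))" "p ^ s = Suc (k * (p - 1))"
      using assms(3) polar_degree_power[OF p2, of s] unfolding polar_degree_def by blast
    then have "length ?r = (j - k) * (p - 1)" using l unfolding diff_mult_distrib by linarith
    then show ?thesis unfolding polar_degree_def by auto
  qed
  have "mset xs = mset (?ys @ ?zs)" by (simp add: multiset_partition[symmetric])
  also have "?ys @ ?zs = ?t @ ?r" by (metis append_assoc append_take_drop_id)
  finally have "it xs = it (?t @ ?r)" by (rule it_perm) (use assms in auto)
  also have "\<dots> = it (it ?t # ?r)"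
    using t X polar_degree_power[OF p2] by (intro it_Cons_append[symmetric]) auto
  also have "it ?t = \<zero>\<^bsub>A\<^esub>" using assms(1) t by (simp add: nilpotent_set_def)
  also have "it (\<zero>\<^bsub>A\<^esub> # ?r) = \<zero>\<^bsub>A\<^esub>" using g rc by (rule it_zero)
  finally show ?thesis .
qed

lemma nilpotent_set_mono: "nilpotent_set s X \<Longrightarrow> Y \<subseteq> X \<Longrightarrow> nilpotent_set s Y"
  by (auto simp: nilpotent_set_def)

lemma nilpotent_set_Un:
  assumes "nilpotent_set s X" "nilpotent_set t Y" shows "nilpotent_set (s + t + 1) (X \<union> Y)"
  unfolding nilpotent_set_def
proof (intro conjI allI impI)
  show "X \<union> Y \<subseteq> carrier A" using assms by (auto simp: nilpotent_set_def)
  fix xs assume xs: "set xs \<subseteq> X \<union> Y \<and> length xs = p ^ (s + t + 1)"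
  have c: "set xs \<subseteq> carrier A" "polar_degree p (length xs)"
    using xs assms polar_degree_power[OF p2, of "s + t + 1"] by (auto simp: nilpotent_set_def)
  \<comment> \<open>By pigeonhole a list of this length contains p^s entries from \<open>X\<close>
    or p^t entries from \<open>Y\<close>; the exponent s + t + 1 is chosen for this.\<close>
  have "p ^ s + p ^ t \<le> p ^ (s + t + 1)"
  proof -
    have "p ^ s \<le> p ^ (s + t)" "p ^ t \<le> p ^ (s + t)" using p2 by (auto intro: power_increasing)
    moreover have "2 * p ^ (s + t) \<le> p ^ (s + t + 1)" using p2 by simp
    ultimately show ?thesis by linarith
  qed
  moreover have "length ys \<le> length (filter (\<lambda>x. x \<in> X) ys) + length (filter (\<lambda>x. x \<in> Y) ys)"
    if "set ys \<subseteq> X \<union> Y" for ys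
    using that by (induction ys) auto
  ultimately have "p ^ s \<le> length (filter (\<lambda>x. x \<in> X) xs) \<or> p ^ t \<le> length (filter (\<lambda>x. x \<in> Y) xs)"
    using xs by fastforce
  then show "it xs = \<zero>\<^bsub>A\<^esub>" using it_zero_of_many assms c by blast
qed

text \<open>For \<open>X\<close> inside the carrier this is the polar subalgebra generated by
  \<open>X\<close>: linear combinations of admissible products, built by adding one term at a time.
  It takes the place of the ideal in the definition of CW.\<close>

inductive_set pgen :: "'a set \<Rightarrow> 'a set" for X where
  zero: "\<zero>\<^bsub>A\<^esub> \<in> pgen X"
| step: "c \<in> carrier K \<Longrightarrow> set xs \<subseteq> X \<Longrightarrow> polar_degree p (length xs) \<Longrightarrow> u \<in> pgen X \<Longrightarrow>
    c \<odot>\<^bsub>A\<^esub> it xs \<oplus>\<^bsub>A\<^esub> u \<in> pgen X"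

definition pmon :: "'a set \<Rightarrow> 'a set" where
  "pmon X = {c \<odot>\<^bsub>A\<^esub> it xs | c xs. c \<in> carrier K \<and> set xs \<subseteq> X \<and> polar_degree p (length xs)}"

lemma pmon_carrier: "X \<subseteq> carrier A \<Longrightarrow> pmon X \<subseteq> carrier A"
  by (auto simp: pmon_def intro!: smult_closed it_closed)

lemma pgen_carrier: assumes "X \<subseteq> carrier A" shows "pgen X \<subseteq> carrier A"
proof
  fix x assume "x \<in> pgen X"
  then show "x \<in> carrier A"
    by induction (use assms in \<open>auto intro!: M.add.m_closed smult_closed it_closed\<close>)
qed

lemma pgen_add:
  assumes X: "X \<subseteq> carrier A" and "x \<in> pgen X" "y \<in> pgen X" shows "x \<oplus>\<^bsub>A\<^esub> y \<in> pgen X"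
  using assms(2)
proof induction
  case (step c xs u)
  have "c \<odot>\<^bsub>A\<^esub> it xs \<in> carrier A" using step X by (intro smult_closed it_closed) auto
  then have "c \<odot>\<^bsub>A\<^esub> it xs \<oplus>\<^bsub>A\<^esub> u \<oplus>\<^bsub>A\<^esub> y = c \<odot>\<^bsub>A\<^esub> it xs \<oplus>\<^bsub>A\<^esub> (u \<oplus>\<^bsub>A\<^esub> y)"
    using step pgen_carrier[OF X] assms(3) by (intro M.a_assoc) auto
  then show ?case using step pgen.step by metis
qed (use assms pgen_carrier[OF X] in auto)

lemma pgen_smult:
  assumes X: "X \<subseteq> carrier A" and "x \<in> pgen X" "d \<in> carrier K" shows "d \<odot>\<^bsub>A\<^esub> x \<in> pgen X"
  using assms(2)
proof induction
  case zero
  then show ?case using assms(3) by (simp add: pgen.zero)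
next
  case (step c xs u)
  have i: "it xs \<in> carrier A" "u \<in> carrier A" using step X pgen_carrier[OF X] by (auto intro!: it_closed)
  then have "d \<odot>\<^bsub>A\<^esub> (c \<odot>\<^bsub>A\<^esub> it xs \<oplus>\<^bsub>A\<^esub> u) = (d \<otimes>\<^bsub>K\<^esub> c) \<odot>\<^bsub>A\<^esub> it xs \<oplus>\<^bsub>A\<^esub> d \<odot>\<^bsub>A\<^esub> u"
    using step(1) assms(3) by (simp add: smult_r_distr smult_assoc1)
  then show ?case using step assms(3) pgen.step[of "d \<otimes>\<^bsub>K\<^esub> c"] by simp
qed

text \<open>Multilinear expansion of a product of linear combinations. Entries that have been
  expanded into monomials are collected in \<open>ys\<close>; the target set \<open>Q\<close> has to
  absorb the resulting sums.\<close>

lemma it_pgen: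
  assumes X: "X \<subseteq> carrier A" and Q: "\<zero>\<^bsub>A\<^esub> \<in> Q" "\<And>x y. x \<in> Q \<Longrightarrow> y \<in> Q \<Longrightarrow> x \<oplus>\<^bsub>A\<^esub> y \<in> Q"
    and l: "polar_degree p l" and mono: "\<And>ys. set ys \<subseteq> pmon X \<Longrightarrow> length ys = l \<Longrightarrow> it ys \<in> Q"
    and xs: "set xs \<subseteq> pgen X" "length xs = l"
  shows "it xs \<in> Q"
proof -
  have "it (xs @ ys) \<in> Q" if "set xs \<subseteq> pgen X" "set ys \<subseteq> pmon X" "length xs + length ys = l" for xs ys
    using that
  proof (induction xs arbitrary: ys)
    case (Cons x xs)
    have c: "set (xs @ ys) \<subseteq> carrier A" "polar_degree p (Suc (length (xs @ ys)))"
      using Cons.prems pgen_carrier[OF X] pmon_carrier[OF X] l by auto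
    have "x \<in> pgen X" using Cons.prems by simp
    then have "it (x # xs @ ys) \<in> Q"
    proof induction
      case zero
      show ?case using it_zero[OF c(2,1)] Q by simp
    next
      case (step d zs u)
      let ?m = "d \<odot>\<^bsub>A\<^esub> it zs"
      have "?m \<in> pmon X" using step by (auto simp: pmon_def)
      then have m: "?m \<in> pmon X" "?m \<in> carrier A" "u \<in> carrier A"
        using step(4) pgen_carrier[OF X] pmon_carrier[OF X] by auto
      have "it (?m # xs @ ys) = it (xs @ ?m # ys)"
        by (rule it_perm) (use m c in auto)
      also have "\<dots> \<in> Q" using Cons.prems m by (intro Cons.IH) auto
      finally show ?case using step m c Q by (simp add: it_head_linear)
    qed
    then show ?case by simp
  qed (use mono in simp)
  from this[of xs "[]"] xs show ?thesis by simp
qed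

text \<open>Products of monomials concatenate by \<open>evl_concat\<close>. Each monomial contains
  at least one vector, so the number of factors does not drop, which is what preserves the
  nilpotence exponent.\<close>

lemma it_pmon:
  assumes X: "X \<subseteq> carrier A" and "set ys \<subseteq> pmon X" "polar_degree p (length ys)"
  obtains c zs where "c \<in> carrier K" "set zs \<subseteq> X" "polar_degree p (length zs)" "length ys \<le> length zs"
    "it ys = c \<odot>\<^bsub>A\<^esub> it zs"
proof -
  have "\<exists>xss. ys = map evl xss \<and> (\<forall>xs\<in>set xss. set xs \<subseteq> letters \<and> polar_degree p (length (rights xs)) \<and> set (rights xs) \<subseteq> X)"
    using assms(2)
  proof (induction ys)
    case (Cons y ys)
    then obtain xss where xss: "ys = map evl xss"
      "\<forall>xs\<in>set xss. set xs \<subseteq> letters \<and> polar_degree p (length (rights xs)) \<and> set (rights xs) \<subseteq> X" by auto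
    obtain c zs where c: "y = c \<odot>\<^bsub>A\<^esub> it zs" "c \<in> carrier K" "set zs \<subseteq> X" "polar_degree p (length zs)"
      using Cons.prems by (auto simp: pmon_def)
    have e: "lefts (map Inr zs :: ('k + 'a) list) = []" "rights (map Inr zs :: ('k + 'a) list) = zs"
      by (induction zs) auto
    \<comment> \<open>The monomial \<open>y\<close> is written as a mixed word with the single
      scalar \<open>c\<close>.\<close>
    show ?case using xss c X
      by (intro exI[of _ "(Inl c # map Inr zs) # xss"]) (auto simp: evl_def e)
  qed simp
  then obtain xss where xss: "ys = map evl xss"
    "\<forall>xs\<in>set xss. set xs \<subseteq> letters \<and> polar_degree p (length (rights xs)) \<and> set (rights xs) \<subseteq> X" by blast
  have l: "length (rights (concat xss)) = sum_list (map (\<lambda>xs. length (rights xs)) xss)"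
    by (induction xss) auto
  have g: "polar_degree p (length (rights (concat xss)))"
    unfolding l using polar_degree_sum_list'[of "map (\<lambda>xs. length (rights xs)) xss" p 0] xss assms(3) by auto
  have "it ys = evl (concat xss)"
    unfolding xss(1) using xss assms(3) by (intro evl_concat) auto
  then have e: "it ys = mprod K (lefts (concat xss)) \<odot>\<^bsub>A\<^esub> it (rights (concat xss))"
    by (simp only: evl_def)
  have t: "set (concat xss) \<subseteq> letters" using xss(2) by auto
  have r: "set (rights (concat xss)) \<subseteq> X" using xss(2) unfolding set_rights by auto
  have "length ws \<le> sum_list (map (\<lambda>xs. length (rights xs)) ws)"
    if "\<forall>xs\<in>set ws. polar_degree p (length (rights xs))" for ws :: "('k + 'a) list list"
    using that
  proof (induction ws)
    case (Cons w ws)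
    then have "0 < length (rights w)" using polar_degree_pos by fastforce
    then have "1 \<le> length (rights w)" by linarith
    with Cons have "1 + length ws \<le> length (rights w) + sum_list (map (\<lambda>xs. length (rights xs)) ws)"
      by (intro add_mono) auto
    then show ?case by simp
  qed simp
  from this[of xss] have "length ys \<le> length (rights (concat xss))"
    using xss unfolding l by simp
  with e t r g show ?thesis
    by (intro that[of "mprod K (lefts (concat xss))" "rights (concat xss)"] R.mprod_closed letters_lefts)
qed

text \<open>Closure under sums, scalars and products keeps the values of Witt polynomials inside
  \<open>X\<close>, so that sums of admissible families are admissible for the same
  \<open>X\<close>.\<close>

definition nilpotent_sub :: "nat \<Rightarrow> 'a set \<Rightarrow> bool" where
  "nilpotent_sub s X \<longleftrightarrow> nilpotent_set s X \<and> \<zero>\<^bsub>A\<^esub> \<in> X \<and> (\<forall>x\<in>X. \<forall>y\<in>X. x \<oplus>\<^bsub>A\<^esub> y \<in> X) \<and>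
     (\<forall>c\<in>carrier K. \<forall>x\<in>X. c \<odot>\<^bsub>A\<^esub> x \<in> X) \<and> (\<forall>xs. set xs \<subseteq> X \<and> polar_degree p (length xs) \<longrightarrow> it xs \<in> X)"

text \<open>The generated polar subalgebra has the same exponent: a product of p^s monomials in
  \<open>X\<close> has at least p^s factors from \<open>X\<close> and vanishes.\<close>

lemma nilpotent_sub_exists:
  assumes "nilpotent_set s X" obtains Y where "nilpotent_sub s Y" "X \<subseteq> Y"
proof
  have X: "X \<subseteq> carrier A" using assms by (simp add: nilpotent_set_def)
  show "X \<subseteq> pgen X"
  proof
    fix x assume "x \<in> X"
    then have "\<one>\<^bsub>K\<^esub> \<odot>\<^bsub>A\<^esub> it [x] \<oplus>\<^bsub>A\<^esub> \<zero>\<^bsub>A\<^esub> \<in> pgen X" using pgen.zero by (intro pgen.step) auto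
    then show "x \<in> pgen X" using \<open>x \<in> X\<close> X by auto
  qed
  have "it xs \<in> pgen X" if a: "set xs \<subseteq> pgen X" "polar_degree p (length xs)" for xs
  proof (rule it_pgen[OF X _ _ a(2) _ a(1) refl])
    fix ys assume "set ys \<subseteq> pmon X" "length ys = length xs"
    then obtain c zs where "c \<in> carrier K" "set zs \<subseteq> X" "polar_degree p (length zs)" "it ys = c \<odot>\<^bsub>A\<^esub> it zs"
      using it_pmon[OF X, of ys] a(2) by metis
    moreover from this X have "it zs \<in> carrier A" by (intro it_closed) auto
    ultimately show "it ys \<in> pgen X" using pgen.step[OF _ _ _ pgen.zero, of c zs X] by simp
  qed (use pgen.zero pgen_add[OF X] in auto)
  moreover have "it xs = \<zero>\<^bsub>A\<^esub>" if "set xs \<subseteq> pgen X" "length xs = p ^ s" for xs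
  proof -
    have "it xs \<in> {\<zero>\<^bsub>A\<^esub>}"
    proof (rule it_pgen[OF X _ _ polar_degree_power[OF p2] _ that])
      fix ys assume ys: "set ys \<subseteq> pmon X" "length ys = p ^ s"
      then obtain c zs where z: "c \<in> carrier K" "set zs \<subseteq> X" "polar_degree p (length zs)" "length ys \<le> length zs"
        "it ys = c \<odot>\<^bsub>A\<^esub> it zs"
        using it_pmon[OF X, of ys] polar_degree_power[OF p2] by metis
      have "filter (\<lambda>x. x \<in> X) zs = zs" using z(2) by (auto simp: filter_id_conv)
      then have "it zs = \<zero>\<^bsub>A\<^esub>" using assms z X ys by (intro it_zero_of_many) auto
      then show "it ys \<in> {\<zero>\<^bsub>A\<^esub>}" using z by simp
    qed auto
    then show ?thesis by simp
  qed
  ultimately show "nilpotent_sub s (pgen X)"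
    unfolding nilpotent_sub_def nilpotent_set_def using pgen_carrier[OF X] pgen.zero pgen_add[OF X] pgen_smult[OF X] by auto
qed

end

section \<open>Vanishing of monomials\<close>

text \<open>Carrying as in base p: the multiplicity at the lowest index i is divisible by p, and p
  variables of index i can be traded for one of index i + 1 without changing the weight. Each of the
  t - i carries loses at least one variable, and at least one variable is left at the end.\<close>

lemma count_by_weight:
  fixes p :: nat and e :: "nat \<Rightarrow> nat"
  assumes "2 \<le> p" "0 < e i" "i < t" "p ^ t dvd (\<Sum>j = i..<t. p ^ j * e j)"
  shows "t - i < (\<Sum>j = i..<t. e j)"
  using assms(2-)
proof (induction "t - i" arbitrary: i e rule: less_induct)
  case less
  have sp: "(\<Sum>j = i..<t. g j) = g i + (\<Sum>j = Suc i..<t. g j)" for g :: "nat \<Rightarrow> nat"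
    using less.prems by (simp add: sum.atLeast_Suc_lessThan)
  have "p ^ Suc i dvd (\<Sum>j = Suc i..<t. p ^ j * e j)"
    by (intro dvd_sum dvd_mult2 le_imp_power_dvd) auto
  moreover have "p ^ Suc i dvd p ^ i * e i + (\<Sum>j = Suc i..<t. p ^ j * e j)"
    using less.prems le_imp_power_dvd[of "Suc i" t p] unfolding sp by (meson Suc_leI dvd_trans)
  ultimately have "p ^ Suc i dvd p ^ i * e i" using dvd_add_left_iff by blast
  then have "p dvd e i" using assms(1) by (simp add: mult.commute[of p])
  then obtain f where f: "e i = p * f" by (rule dvdE)
  have f1: "1 \<le> f" using f less.prems by (cases f) auto
  have pf: "2 * f \<le> e i" using f assms(1) by simp
  show ?case
  proof (cases "Suc i = t")
    case True
    then show ?thesis unfolding sp using pf f1 by (simp add: True[symmetric])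
  next
    case False
    \<comment> \<open>The carry: the \<open>e i = p * f\<close> variables of index i become
      \<open>f\<close> variables of index i + 1.\<close>
    define e' where "e' = e(Suc i := e (Suc i) + f)"
    have sp': "(\<Sum>j = Suc i..<t. g j) = g (Suc i) + (\<Sum>j = Suc (Suc i)..<t. g j)" for g :: "nat \<Rightarrow> nat"
      using less.prems False by (simp add: sum.atLeast_Suc_lessThan)
    have "(\<Sum>j = Suc i..<t. p ^ j * e' j) = (\<Sum>j = i..<t. p ^ j * e j)"
      unfolding sp[of "\<lambda>j. p ^ j * e j"] sp' by (simp add: e'_def f algebra_simps)
    moreover have s': "(\<Sum>j = Suc i..<t. e' j) = f + (\<Sum>j = Suc i..<t. e j)"
      unfolding sp' by (simp add: e'_def)
    ultimately have "t - Suc i < (\<Sum>j = Suc i..<t. e' j)"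
      using less.prems False f1 by (intro less.hyps) (auto simp: e'_def)
    then show ?thesis unfolding s' sp[of e] using pf f1 by linarith
  qed
qed

lemma count_low_indices:
  fixes p :: nat
  assumes "2 \<le> p" "p ^ t dvd sum_list (map (\<lambda>j. p ^ j) js)" "i \<in> set js" "i < t"
  shows "t - i < length (filter (\<lambda>j. j < t) js)"
proof -
  define l where "l = filter (\<lambda>j. j < t) js"
  define i0 where "i0 = Min (set l)"
  have il: "i \<in> set l" using assms by (simp add: l_def)
  then have i0: "i0 \<in> set l" "i0 \<le> i" unfolding i0_def by (intro Min_in Min_le; force)+
  have sl: "set l \<subseteq> {i0..<t}" by (auto simp: l_def i0_def intro!: Min_le)
  have "p ^ t dvd sum_list (map (\<lambda>j. p ^ j) l)"
    using assms(2) unfolding l_def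
  proof -
    have e: "sum_list (map (\<lambda>j. p ^ j) js) = sum_list (map (\<lambda>j. p ^ j) (filter (\<lambda>j. j < t) js)) +
      sum_list (map (\<lambda>j. p ^ j) (filter (\<lambda>j. \<not> j < t) js))"
      by (induction js) (auto simp: ac_simps)
    have "p ^ t dvd sum_list (map (\<lambda>j. p ^ j) (filter (\<lambda>j. \<not> j < t) js))"
      by (induction js) (auto intro!: dvd_add le_imp_power_dvd)
    then show "p ^ t dvd sum_list (map (\<lambda>j. p ^ j) (filter (\<lambda>j. j < t) js))"
      using assms(2) unfolding e by (simp add: dvd_add_left_iff)
  qed
  moreover have "sum_list (map (\<lambda>j. p ^ j) l) = (\<Sum>j = i0..<t. p ^ j * count_list l j)"
    using sum_list_map_eq_sum_count2[OF sl, of "\<lambda>j. p ^ j"] by (simp add: mult.commute)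
  moreover have "length l = (\<Sum>j = i0..<t. count_list l j)"
    using sum_list_map_eq_sum_count2[OF sl, of "\<lambda>_. 1"] by (simp add: sum_list_triv)
  moreover have "0 < count_list l i0" using i0(1) by (metis count_list_0_iff neq0_conv)
  ultimately have "t - i0 < length l"
    using count_by_weight[OF assms(1), of "count_list l" i0 t] i0 sl by auto
  then show ?thesis using i0(2) unfolding l_def by linarith
qed

context polar_alg
begin

text \<open>A monomial of weight \<open>p ^ M\<close> with a variable of index far below \<open>t\<close> has many variables of
  index below \<open>t\<close>; if these have values in a nilpotent set it vanishes.\<close>

lemma evl_zero_of_low_index:
  assumes X: "nilpotent_set s X" and xs: "set xs \<subseteq> letters" "polar_degree p (length (rights xs))"
    and r: "rights xs = map snd js" and w: "sum_list (map (\<lambda>j. p ^ fst j) js) = p ^ M"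
    and t: "t \<le> M" and low: "\<And>j. j \<in> set js \<Longrightarrow> fst j < t \<Longrightarrow> snd j \<in> X"
    and i: "i \<in> fst ` set js" "i + p ^ s \<le> t"
  shows "evl xs = \<zero>\<^bsub>A\<^esub>"
proof -
  have ps: "0 < p ^ s" using p2 by simp
  have "i < t" using i(2) ps by linarith
  then have "t - i < length (filter (\<lambda>j. j < t) (map fst js))"
    using w t i by (intro count_low_indices[OF p2]) (auto simp: comp_def le_imp_power_dvd)
  also have "\<dots> = length (filter (\<lambda>j. fst j < t) js)" by (simp add: filter_map comp_def)
  also have "\<dots> \<le> length (filter (\<lambda>x. x \<in> X) (rights xs))"
    unfolding r using low by (induction js) auto
  finally have "p ^ s \<le> length (filter (\<lambda>x. x \<in> X) (rights xs))" using i by linarith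
  then have "it (rights xs) = \<zero>\<^bsub>A\<^esub>"
    using X xs by (intro it_zero_of_many letters_rights)
  then show ?thesis using letters_lefts[OF xs(1)] by (simp add: evl_def)
qed

lemma rights_map_Inr: "rights (map (\<lambda>v. Inr (f v)) xs) = map f xs"
  by (induction xs) auto

lemma case_sum_Inr: "case_sum (\<lambda>i. Inr (x i)) (\<lambda>i. Inr (y i)) = (\<lambda>v. Inr (case_sum x y v))"
  by (auto simp: fun_eq_iff split: sum.splits)

abbreviation idx :: "nat + nat \<Rightarrow> nat" where "idx \<equiv> case_sum id id"

text \<open>One variable of index i already has weight p^i. Hence the n-th entry of a sum sees only
  entries up to n.\<close>

lemma index_le:
  assumes "m \<in> kys (witt_sum p M)" "v \<in> set (mlist m)" shows "idx v \<le> M"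
proof -
  have "wlr p v \<le> p ^ M"
    using wt_witt_sum[OF prime_p assms(1)] assms(2) unfolding wt_mlist by (metis member_le_sum_list image_eqI set_map zero_le)
  then show ?thesis using p2 by (auto simp: wlr_def split: sum.splits)
qed

lemma index_le_prod:
  assumes "m \<in> kys (witt_prod p M)" "v \<in> set (mlist m)" shows "idx v \<le> M"
proof -
  have "wl p v \<le> p ^ M" "wr p v \<le> p ^ M"
    using wt_witt_prod[OF prime_p assms(1)] assms(2) unfolding wt_mlist by (metis member_le_sum_list image_eqI set_map zero_le)+
  then show ?thesis using p2 by (auto simp: wl_def wr_def split: sum.splits)
qed

text \<open>A monomial with a variable of index at most t - p^s vanishes for both pairs of
  arguments. All other monomials see only entries on which the two pairs agree.\<close>

lemma padd_continuous:
  assumes X: "nilpotent_set s X" and W: "x \<in> WA" "y \<in> WA" "x' \<in> WA" "y' \<in> WA" and t: "t \<le> M"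
    and low: "\<And>i. i < t \<Longrightarrow> x i \<in> X \<and> y i \<in> X \<and> x' i \<in> X \<and> y' i \<in> X"
    and eq: "\<And>i. t < i + p ^ s \<Longrightarrow> i \<le> M \<Longrightarrow> x i = x' i \<and> y i = y' i"
  shows "padd x y M = padd x' y' M"
  unfolding padd_def peval_def
proof (rule lin_cong)
  fix m assume m: "m \<in> kys (witt_sum p M)"
  let ?n = "\<lambda>x y. case_sum (\<lambda>i. Inr (x i)) (\<lambda>i. Inr (y i)) :: nat + nat \<Rightarrow> 'k + 'a"
  show "evl (map (?n x' y') (mlist m)) \<in> carrier A"
    using W polar_at_witt_sum[OF m, of x' y']
    by (intro evl_closed) (auto simp: polar_at_def WA_def split: sum.splits)
  show "evl (map (?n x y) (mlist m)) = evl (map (?n x' y') (mlist m))"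
  proof (cases "\<exists>v\<in>set (mlist m). idx v + p ^ s \<le> t")
    case True
    then obtain v where v: "v \<in> set (mlist m)" "idx v + p ^ s \<le> t" by blast
    have "evl (map (?n x y) (mlist m)) = \<zero>\<^bsub>A\<^esub>" if "x \<in> WA" "y \<in> WA" "\<And>i. i < t \<Longrightarrow> x i \<in> X \<and> y i \<in> X" for x y
    proof (rule evl_zero_of_low_index[OF X, where js = "map (\<lambda>v. (idx v, case_sum x y v)) (mlist m)" and i = "idx v" and t = t and M = M])
      show "set (map (?n x y) (mlist m)) \<subseteq> letters" using that(1,2) by (auto simp: WA_def split: sum.splits)
      show "polar_degree p (length (rights (map (?n x y) (mlist m))))"
        using polar_at_witt_sum[OF m, of x y] by (simp add: polar_at_def)
      show "rights (map (?n x y) (mlist m)) = map snd (map (\<lambda>v. (idx v, case_sum x y v)) (mlist m))"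
        by (simp add: case_sum_Inr rights_map_Inr comp_def)
      show "sum_list (map (\<lambda>j. p ^ fst j) (map (\<lambda>v. (idx v, case_sum x y v)) (mlist m))) = p ^ M"
        using wt_witt_sum[OF prime_p m] unfolding wt_mlist sum_list_wlr by (simp add: comp_def)
      show "snd j \<in> X" if "j \<in> set (map (\<lambda>v. (idx v, case_sum x y v)) (mlist m))" "fst j < t" for j
        using that \<open>\<And>i. i < t \<Longrightarrow> x i \<in> X \<and> y i \<in> X\<close> by (auto split: sum.splits)
      show "idx v \<in> fst ` set (map (\<lambda>v. (idx v, case_sum x y v)) (mlist m))" using v by force
    qed (use t v in auto)
    from this[of x y] this[of x' y'] show ?thesis using W low by simp
  next
    case False
    have "?n x y v = ?n x' y' v" if "v \<in> set (mlist m)" for v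
      using index_le[OF m that] False that eq by (fastforce split: sum.splits)
    then show ?thesis by (metis (no_types, lifting) map_cong)
  qed
qed

text \<open>As for sums, but only the variables that stand for entries of the vector are counted,
  through the weight \<open>wr\<close>; the scalar is the same on both sides.\<close>

lemma psmult_continuous:
  assumes X: "nilpotent_set s X" and W: "x \<in> WA" "x' \<in> WA" and c: "c \<in> carrier (Witt p K)" and t: "t \<le> M"
    and low: "\<And>i. i < t \<Longrightarrow> x i \<in> X \<and> x' i \<in> X"
    and eq: "\<And>i. t < i + p ^ s \<Longrightarrow> i \<le> M \<Longrightarrow> x i = x' i"
  shows "psmult c x M = psmult c x' M"
  unfolding psmult_def peval_def
proof (rule lin_cong)
  fix m assume m: "m \<in> kys (witt_prod p M)"
  show "evl (map (map_sum c x') (mlist m)) \<in> carrier A"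
    using W c polar_at_witt_prod[OF m, of c x']
    by (intro evl_closed) (auto simp: polar_at_def WA_def map_sum_def split: sum.splits)
  show "evl (map (map_sum c x) (mlist m)) = evl (map (map_sum c x') (mlist m))"
  proof (cases "\<exists>i\<in>set (rights (mlist m)). i + p ^ s \<le> t")
    case True
    then obtain i where v: "i \<in> set (rights (mlist m))" "i + p ^ s \<le> t" by blast
    have "evl (map (map_sum c x) (mlist m)) = \<zero>\<^bsub>A\<^esub>" if x: "x \<in> WA" "\<And>i. i < t \<Longrightarrow> x i \<in> X" for x
    proof (rule evl_zero_of_low_index[OF X, where js = "map (\<lambda>i. (i, x i)) (rights (mlist m))" and i = i and t = t and M = M])
      show "set (map (map_sum c x) (mlist m)) \<subseteq> letters"
        using x(1) c by (auto simp: WA_def map_sum_def split: sum.splits)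
      show "polar_degree p (length (rights (map (map_sum c x) (mlist m))))"
        using polar_at_witt_prod[OF m, of c x] by (simp add: polar_at_def)
      show "sum_list (map (\<lambda>j. p ^ fst j) (map (\<lambda>i. (i, x i)) (rights (mlist m)))) = p ^ M"
        using wt_witt_prod(2)[OF prime_p m] unfolding wt_mlist sum_list_wr by (simp add: comp_def)
    qed (use t v x in \<open>auto simp: rights_map comp_def image_image\<close>)
    from this[of x] this[of x'] show ?thesis using W low by simp
  next
    case False
    have "map_sum c x v = map_sum c x' v" if "v \<in> set (mlist m)" for v
    proof (cases v)
      case (Inr i)
      then have "i \<in> set (rights (mlist m))" "i \<le> M"
        using that index_le_prod[OF m that] by (auto simp: set_rights)
      then show ?thesis using False eq Inr by auto
    qed simp
    then show ?thesis by (metis (no_types, lifting) map_cong)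
  qed
qed

lemma nilpotent_sub_lin:
  assumes X: "nilpotent_sub s X" and "\<And>m. m \<in> kys f \<Longrightarrow> h m \<in> X" shows "lin A h f \<in> X"
proof (rule lin_induct_closed[OF _ _ assms(2)])
  have c: "X \<subseteq> carrier A" using X by (simp add: nilpotent_sub_def nilpotent_set_def)
  then show "X \<subseteq> carrier A" .
  show "\<zero>\<^bsub>A\<^esub> \<in> X" using X by (simp add: nilpotent_sub_def)
  fix x y assume xy: "x \<in> X" "y \<in> X"
  have "\<ominus>\<^bsub>A\<^esub> y = (\<ominus>\<^bsub>K\<^esub> \<one>\<^bsub>K\<^esub>) \<odot>\<^bsub>A\<^esub> y" using xy c by (subst smult_l_minus) auto
  then have "\<ominus>\<^bsub>A\<^esub> y \<in> X" using X xy by (simp add: nilpotent_sub_def)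
  then show "x \<ominus>\<^bsub>A\<^esub> y \<in> X" using X xy by (simp add: nilpotent_sub_def a_minus_def)
qed

lemma nilpotent_sub_evl:
  assumes "nilpotent_sub s X" "set (lefts xs) \<subseteq> carrier K" "set (rights xs) \<subseteq> X" "polar_degree p (length (rights xs))"
  shows "evl xs \<in> X"
  using assms R.mprod_closed[OF assms(2)] by (auto simp: nilpotent_sub_def evl_def)

lemma padd_nilpotent_sub:
  assumes X: "nilpotent_sub s X" and "\<And>i. i \<le> M \<Longrightarrow> x i \<in> X \<and> y i \<in> X"
  shows "padd x y M \<in> X"
  unfolding padd_def peval_def
proof (rule nilpotent_sub_lin[OF X], rule nilpotent_sub_evl[OF X])
  fix m assume m: "m \<in> kys (witt_sum p M)"
  let ?n = "case_sum (\<lambda>i. Inr (x i)) (\<lambda>i. Inr (y i)) :: nat + nat \<Rightarrow> 'k + 'a"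
  show "polar_degree p (length (rights (map ?n (mlist m))))"
    using polar_at_witt_sum[OF m, of x y] by (simp add: polar_at_def)
  have "lefts (map ?n xs) = []" for xs by (induction xs) (auto split: sum.splits)
  then show "set (lefts (map ?n (mlist m))) \<subseteq> carrier K" by simp
  show "set (rights (map ?n (mlist m))) \<subseteq> X"
    unfolding case_sum_Inr rights_map_Inr using index_le[OF m] assms(2) by (fastforce split: sum.splits)
qed

lemma psmult_nilpotent_sub:
  assumes X: "nilpotent_sub s X" and "c \<in> carrier (Witt p K)" "\<And>i. i \<le> M \<Longrightarrow> x i \<in> X"
  shows "psmult c x M \<in> X"
  unfolding psmult_def peval_def
proof (rule nilpotent_sub_lin[OF X], rule nilpotent_sub_evl[OF X])
  fix m assume m: "m \<in> kys (witt_prod p M)"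
  show "polar_degree p (length (rights (map (map_sum c x) (mlist m))))"
    using polar_at_witt_prod[OF m, of c x] by (simp add: polar_at_def)
  show "set (lefts (map (map_sum c x) (mlist m))) \<subseteq> carrier K"
    using assms(2) by (auto simp: lefts_map)
  show "set (rights (map (map_sum c x) (mlist m))) \<subseteq> X"
    unfolding rights_map using index_le_prod[OF m] assms(3) by (fastforce simp: set_rights)
qed

end

section \<open>Co-Witt vectors of polar algebras\<close>

lemma eventual_value_eqI:
  assumes "\<forall>\<^sub>F m in sequentially. f m = c" shows "eventual_value f = c"
  unfolding eventual_value_def
proof (rule the_equality)
  show "\<forall>\<^sub>F m in sequentially. f m = c" by (rule assms)
  fix d assume "\<forall>\<^sub>F m in sequentially. f m = d"
  with assms have "\<forall>\<^sub>F m in sequentially. f m = c \<and> f m = d" by (rule eventually_conj)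
  then obtain m where "f m = c \<and> f m = d" using eventually_happens'[OF sequentially_bot] by blast
  then show "d = c" by metis
qed

lemma eventually_constI:
  assumes "\<forall>\<^sub>F m in sequentially. f (Suc m) = f m" shows "\<exists>c. \<forall>\<^sub>F m in sequentially. f m = c"
proof -
  obtain N where N: "\<And>m. N \<le> m \<Longrightarrow> f (Suc m) = f m" using assms by (auto simp: eventually_sequentially)
  have "f m = f N" if "N \<le> m" for m using that by (induction m rule: dec_induct) (auto simp: N)
  then show ?thesis by (auto simp: eventually_sequentially)
qed

context polar_perf
begin

text \<open>The truncation of a co-Witt vector to N + 1 entries, read as a Witt vector. The entry
  with index 0 of the co-Witt vector becomes the last component, so that V on Witt vectors lengthens
  the truncation at its far end.\<close>

definition rv :: "(nat \<Rightarrow> 'a) \<Rightarrow> nat \<Rightarrow> nat \<Rightarrow> 'a" where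
  "rv a N i = (if i \<le> N then a (N - i) else \<zero>\<^bsub>A\<^esub>)"

definition cwcar :: "(nat \<Rightarrow> 'a) set" where
  "cwcar = {a. (\<forall>n. a n \<in> carrier A) \<and> (\<exists>r s. nilpotent_set s (a ` {r..}))}"

definition cwadd :: "(nat \<Rightarrow> 'a) \<Rightarrow> (nat \<Rightarrow> 'a) \<Rightarrow> nat \<Rightarrow> 'a" where
  "cwadd a b n = eventual_value (\<lambda>m. padd (rv a (n + m)) (rv b (n + m)) m)"

definition cwsmult :: "(nat \<Rightarrow> 'k) \<Rightarrow> (nat \<Rightarrow> 'a) \<Rightarrow> nat \<Rightarrow> 'a" where
  "cwsmult c a n = eventual_value (\<lambda>m. psmult (\<sigma> (n + m) c) (rv a (n + m)) m)"

definition cwF :: "(nat \<Rightarrow> 'a) \<Rightarrow> nat \<Rightarrow> 'a" where "cwF a n = mu A (replicate p (a n))"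
definition cwV :: "(nat \<Rightarrow> 'a) \<Rightarrow> nat \<Rightarrow> 'a" where "cwV a n = a (Suc n)"

lemma rv_WA: "(\<And>n. a n \<in> carrier A) \<Longrightarrow> rv a N \<in> WA"
  by (simp add: rv_def WA_def)

text \<open>Here \<open>u N\<close> is a Witt vector of length \<open>N + 1\<close>, and entries are compared at a fixed distance from
  the last one, as in the colimit along $V$. Addition and scalar multiplication of Witt vectors are
  continuous for \<open>conv\<close> by the vanishing of monomials, so it suffices to check the module axioms on
  the approximating Witt vectors.\<close>

definition adm :: "'a set \<Rightarrow> nat \<Rightarrow> (nat \<Rightarrow> nat \<Rightarrow> 'a) \<Rightarrow> bool" where
  "adm X r u \<longleftrightarrow> (\<forall>N. u N \<in> WA) \<and> (\<forall>N i. i + r \<le> N \<longrightarrow> u N i \<in> X)"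

definition close :: "(nat \<Rightarrow> nat \<Rightarrow> 'a) \<Rightarrow> (nat \<Rightarrow> nat \<Rightarrow> 'a) \<Rightarrow> bool" where
  "close u v \<longleftrightarrow> (\<forall>n. \<forall>\<^sub>F N in sequentially. u N (N - n) = v N (N - n))"

definition conv :: "'a set \<Rightarrow> nat \<Rightarrow> (nat \<Rightarrow> nat \<Rightarrow> 'a) \<Rightarrow> (nat \<Rightarrow> 'a) \<Rightarrow> bool" where
  "conv X r u a \<longleftrightarrow> adm X r u \<and> (\<forall>n. \<forall>\<^sub>F N in sequentially. u N (N - n) = a n)"

lemma close_near:
  assumes "close u v" "k \<ge> (0::nat)"
  shows "\<forall>\<^sub>F N in sequentially. \<forall>j<k. u N (N - j) = v N (N - j)"
proof -
  have "\<forall>\<^sub>F N in sequentially. \<forall>j\<in>{..<k}. u N (N - j) = v N (N - j)"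
    using assms(1) by (intro eventually_ball_finite) (auto simp: close_def)
  then show ?thesis by (rule eventually_mono) auto
qed

lemma close_near':
  assumes "close u v"
  shows "\<forall>\<^sub>F N in sequentially. \<forall>i. N < i + k \<and> i \<le> N \<longrightarrow> u N i = v N i"
proof (rule eventually_mono[OF close_near[OF assms, of k]])
  fix N assume h: "\<forall>j<k. u N (N - j) = v N (N - j)"
  show "\<forall>i. N < i + k \<and> i \<le> N \<longrightarrow> u N i = v N i"
  proof (intro allI impI)
    fix i assume i: "N < i + k \<and> i \<le> N"
    then have "N - i < k" "N - (N - i) = i" by auto
    then show "u N i = v N i" using h by metis
  qed
qed simp

lemma close_padd:
  assumes X: "nilpotent_set s X" and a: "adm X r u" "adm X r u'" "adm X r v" "adm X r v'"
    and c: "close u u'" "close v v'"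
  shows "close (\<lambda>N. padd (u N) (v N)) (\<lambda>N. padd (u' N) (v' N))"
  unfolding close_def
proof
  fix n
  \<comment> \<open>Only the last n + r + p^s entries influence the entry at distance n from the
    end: entries at distance r or more lie in \<open>X\<close>, and \<open>padd_continuous\<close>
    with t = N - n - r looks back p^s further places.\<close>
  have "\<forall>\<^sub>F N in sequentially. (\<forall>i. N < i + (n + r + p ^ s) \<and> i \<le> N \<longrightarrow> u N i = u' N i) \<and>
      (\<forall>i. N < i + (n + r + p ^ s) \<and> i \<le> N \<longrightarrow> v N i = v' N i) \<and> n + r < N"
    using c by (intro eventually_conj close_near' eventually_gt_at_top)
  then show "\<forall>\<^sub>F N in sequentially. padd (u N) (v N) (N - n) = padd (u' N) (v' N) (N - n)"
  proof (rule eventually_mono, elim conjE)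
    fix N
    assume h: "\<forall>i. N < i + (n + r + p ^ s) \<and> i \<le> N \<longrightarrow> u N i = u' N i"
      "\<forall>i. N < i + (n + r + p ^ s) \<and> i \<le> N \<longrightarrow> v N i = v' N i" and n: "n + r < N"
    show "padd (u N) (v N) (N - n) = padd (u' N) (v' N) (N - n)"
    proof (rule padd_continuous[OF X, where t = "N - n - r"])
      fix i assume "i < N - n - r"
      then have "i + r \<le> N" by simp
      then show "u N i \<in> X \<and> v N i \<in> X \<and> u' N i \<in> X \<and> v' N i \<in> X" using a by (auto simp: adm_def)
    next
      fix i assume "N - n - r < i + p ^ s" "i \<le> N - n"
      then have "N < i + (n + r + p ^ s) \<and> i \<le> N" using n by linarith
      then show "u N i = u' N i \<and> v N i = v' N i" using h by blast
    qed (use a in \<open>auto simp: adm_def\<close>)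
  qed
qed

lemma close_psmult:
  assumes X: "nilpotent_set s X" and a: "adm X r u" "adm X r u'" and d: "\<And>N. d N \<in> carrier (Witt p K)"
    and c: "close u u'"
  shows "close (\<lambda>N. psmult (d N) (u N)) (\<lambda>N. psmult (d N) (u' N))"
  unfolding close_def
proof
  fix n
  have "\<forall>\<^sub>F N in sequentially. (\<forall>i. N < i + (n + r + p ^ s) \<and> i \<le> N \<longrightarrow> u N i = u' N i) \<and> n + r < N"
    using c by (intro eventually_conj close_near' eventually_gt_at_top)
  then show "\<forall>\<^sub>F N in sequentially. psmult (d N) (u N) (N - n) = psmult (d N) (u' N) (N - n)"
  proof (rule eventually_mono, elim conjE)
    fix N
    assume h: "\<forall>i. N < i + (n + r + p ^ s) \<and> i \<le> N \<longrightarrow> u N i = u' N i" and n: "n + r < N"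
    show "psmult (d N) (u N) (N - n) = psmult (d N) (u' N) (N - n)"
    proof (rule psmult_continuous[OF X, where t = "N - n - r"])
      fix i assume "i < N - n - r"
      then have "i + r \<le> N" by simp
      then show "u N i \<in> X \<and> u' N i \<in> X" using a by (auto simp: adm_def)
    next
      fix i assume "N - n - r < i + p ^ s" "i \<le> N - n"
      then have "N < i + (n + r + p ^ s) \<and> i \<le> N" using n by linarith
      then show "u N i = u' N i" using h by blast
    qed (use a d in \<open>auto simp: adm_def\<close>)
  qed
qed

lemma close_conv: "conv X r u a \<Longrightarrow> conv X r v a \<Longrightarrow> close u v"
  unfolding close_def conv_def
proof (elim conjE, intro allI)
  fix n assume "\<forall>n. \<forall>\<^sub>F N in sequentially. u N (N - n) = a n" "\<forall>n. \<forall>\<^sub>F N in sequentially. v N (N - n) = a n"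
  from eventually_conj[OF spec[OF this(1), of n] spec[OF this(2), of n]]
  show "\<forall>\<^sub>F N in sequentially. u N (N - n) = v N (N - n)" by (rule eventually_mono) simp
qed

lemma conv_close: "conv X r u a \<Longrightarrow> adm X r v \<Longrightarrow> close v u \<Longrightarrow> conv X r v a"
  unfolding close_def conv_def
proof (elim conjE, intro conjI allI)
  fix n assume "\<forall>n. \<forall>\<^sub>F N in sequentially. v N (N - n) = u N (N - n)" "\<forall>n. \<forall>\<^sub>F N in sequentially. u N (N - n) = a n"
  from eventually_conj[OF spec[OF this(1), of n] spec[OF this(2), of n]]
  show "\<forall>\<^sub>F N in sequentially. v N (N - n) = a n" by (rule eventually_mono) simp
qed

lemma conv_unique: assumes "conv X r u a" "conv X r u b" shows "a = b"
proof
  fix n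
  have "\<forall>\<^sub>F N in sequentially. u N (N - n) = a n \<and> u N (N - n) = b n"
    using assms by (auto simp: conv_def intro: eventually_conj)
  then obtain N where "u N (N - n) = a n \<and> u N (N - n) = b n" using eventually_happens'[OF sequentially_bot] by blast
  then show "a n = b n" by metis
qed

lemma conv_rv:
  assumes "\<And>n. a n \<in> carrier A" "\<And>n. r \<le> n \<Longrightarrow> a n \<in> X" shows "conv X r (rv a) a"
proof -
  have "\<forall>\<^sub>F N in sequentially. rv a N (N - n) = a n" for n
    using eventually_ge_at_top[of n] by (rule eventually_mono) (simp add: rv_def)
  then show ?thesis using assms by (auto simp: conv_def adm_def rv_WA rv_def[of a])
qed

lemma conv_carrier:
  assumes "conv X r u a" shows "a n \<in> carrier A" "r \<le> n \<Longrightarrow> a n \<in> X"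
proof -
  have "\<forall>\<^sub>F N in sequentially. u N (N - n) = a n \<and> n \<le> N"
    using assms by (auto simp: conv_def intro: eventually_conj eventually_ge_at_top)
  then obtain N where N: "u N (N - n) = a n" "n \<le> N" using eventually_happens'[OF sequentially_bot] by blast
  show "a n \<in> carrier A" using N(1) assms unfolding conv_def adm_def WA_def by (metis (lifting) mem_Collect_eq)
  show "a n \<in> X" if "r \<le> n"
  proof -
    have "N - n + r \<le> N" using that N(2) by simp
    then show ?thesis using N(1) assms unfolding conv_def adm_def by metis
  qed
qed

lemma eventually_shift:
  assumes "\<forall>\<^sub>F N in sequentially. P N" shows "\<forall>\<^sub>F m in sequentially. P (n + m)"
  using assms by (auto simp: eventually_sequentially intro: trans_le_add2)

lemma conv_carrier_nilpotent_set: "nilpotent_set s X \<Longrightarrow> conv X r u a \<Longrightarrow> a \<in> cwcar"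
  unfolding cwcar_def using conv_carrier[of X r u a] nilpotent_set_mono[of s X "a ` {r..}"] by blast

section \<open>Operations on co-Witt vectors as limits\<close>

context
  fixes s r :: nat and X :: "'a set"
  assumes nX: "nilpotent_sub s X"
begin

lemma X: "nilpotent_set s X" "\<zero>\<^bsub>A\<^esub> \<in> X" using nX by (auto simp: nilpotent_sub_def)

lemma adm_padd: "adm X r u \<Longrightarrow> adm X r v \<Longrightarrow> adm X r (\<lambda>N. padd (u N) (v N))"
  unfolding adm_def by (auto intro!: padd_nilpotent_sub[OF nX])

lemma adm_psmult: "(\<And>N. d N \<in> carrier (Witt p K)) \<Longrightarrow> adm X r u \<Longrightarrow> adm X r (\<lambda>N. psmult (d N) (u N))"
  unfolding adm_def by (auto intro!: psmult_nilpotent_sub[OF nX] simp del: Witt_carrier)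

lemma adm_pV: "adm X r u \<Longrightarrow> adm X r (\<lambda>N. pV (u N))"
  using X unfolding adm_def pV_def[abs_def] WA_def by auto

lemma adm_shift: "adm X r u \<Longrightarrow> adm X r (\<lambda>N. pV (u (N - 1)))"
  unfolding adm_def
proof (intro conjI allI impI; elim conjE)
  fix N i assume u: "\<forall>N i. i + r \<le> N \<longrightarrow> u N i \<in> X" and i: "i + r \<le> N"
  show "pV (u (N - 1)) i \<in> X"
  proof (cases i)
    case (Suc j)
    then have "j + r \<le> N - 1" using i by simp
    then show ?thesis using u Suc by (simp add: pV_def)
  qed (simp add: pV_def X)
qed simp

text \<open>A longer truncation differs from V applied to the previous one only in the first entry,
  and this moves away from the end. The existence of the limits rests on this.\<close>

lemma rv_shift: "close (rv a) (\<lambda>N. pV (rv a (N - 1)))"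
  unfolding close_def
proof
  fix n
  show "\<forall>\<^sub>F N in sequentially. rv a N (N - n) = pV (rv a (N - 1)) (N - n)"
  proof (rule eventually_mono[OF eventually_gt_at_top[of n]])
    fix N assume n: "n < N"
    then have "N - 1 - (N - n - 1) = n" "N - Suc n \<le> N - Suc 0" by simp_all
    with n show "rv a N (N - n) = pV (rv a (N - 1)) (N - n)"
      by (simp add: pV_def rv_def)
  qed
qed

text \<open>Existence of the limit and independence of the approximation in one. The sum of the
  truncations is close to the sum of the shifted previous truncations, and V is additive, so a fixed
  entry counted from the end is eventually constant. Other approximations \<open>u\<close>,
  \<open>v\<close> are close to the truncations, and \<open>close_padd\<close> carries the limit
  over to them.\<close>

lemma cwadd_conv:
  assumes u: "conv X r u a" and v: "conv X r v b"
  shows "conv X r (\<lambda>N. padd (u N) (v N)) (cwadd a b)"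
proof -
  have ra: "conv X r (rv a) a" using conv_carrier[OF u] by (intro conv_rv) auto
  have rb: "conv X r (rv b) b" using conv_carrier[OF v] by (intro conv_rv) auto
  have adm: "adm X r u" "adm X r v" "adm X r (rv a)" "adm X r (rv b)"
    using u v ra rb by (auto simp: conv_def)
  have W: "rv a N \<in> WA" "rv b N \<in> WA" for N using adm by (auto simp: adm_def)
  have sh: "close (\<lambda>N. padd (rv a N) (rv b N)) (\<lambda>N. padd (pV (rv a (N - 1))) (pV (rv b (N - 1))))"
    by (rule close_padd[OF X(1) adm(3) adm_shift[OF adm(3)] adm(4) adm_shift[OF adm(4)] rv_shift rv_shift])
  have lim: "\<forall>\<^sub>F N in sequentially. padd (rv a N) (rv b N) (N - n) = cwadd a b n" for n
  proof -
    have "\<forall>\<^sub>F N in sequentially. padd (rv a N) (rv b N) (N - n) =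
        padd (pV (rv a (N - 1))) (pV (rv b (N - 1))) (N - n) \<and> n < N"
      using sh by (intro eventually_conj eventually_gt_at_top) (simp add: close_def)
    then have "\<forall>\<^sub>F m in sequentially. padd (rv a (Suc (n + m))) (rv b (Suc (n + m))) (Suc (n + m) - n) =
        padd (pV (rv a (n + m))) (pV (rv b (n + m))) (Suc (n + m) - n)"
      by (rule eventually_mono[OF eventually_shift[where n = "Suc n"]]) simp
    then have "\<forall>\<^sub>F m in sequentially. padd (rv a (n + Suc m)) (rv b (n + Suc m)) (Suc m) =
        padd (rv a (n + m)) (rv b (n + m)) m"
      by (rule eventually_mono) (simp add: W pV_add[symmetric] pV_def Suc_diff_le)
    from eventually_constI[OF this] obtain c
      where c: "\<forall>\<^sub>F m in sequentially. padd (rv a (n + m)) (rv b (n + m)) m = c" by blast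
    then have "cwadd a b n = c" unfolding cwadd_def by (rule eventual_value_eqI)
    with c have "\<forall>\<^sub>F m in sequentially. padd (rv a (m + n)) (rv b (m + n)) (m + n - n) = cwadd a b n"
      by (simp add: add.commute)
    then show ?thesis by (rule eventually_sequentially_seg[THEN iffD1])
  qed
  have "conv X r (\<lambda>N. padd (rv a N) (rv b N)) (cwadd a b)"
    using adm_padd[OF adm(3,4)] lim by (simp add: conv_def)
  then show ?thesis
    by (rule conv_close[OF _ adm_padd[OF adm(1,2)]
          close_padd[OF X(1) adm(1,3,2,4) close_conv[OF u ra] close_conv[OF v rb]]])
qed

text \<open>The same argument, with the projection formula in place of additivity: moving the scalar
  \<open>\<sigma> (Suc N) c\<close> past V turns it into \<open>\<sigma> N c\<close>. The twist by
  inverse Frobenius powers is exactly what makes the truncations compatible.\<close>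

lemma cwsmult_conv:
  assumes c: "c \<in> carrier (Witt p K)" and u: "conv X r u a"
  shows "conv X r (\<lambda>N. psmult (\<sigma> N c) (u N)) (cwsmult c a)"
proof -
  have ra: "conv X r (rv a) a" using conv_carrier[OF u] by (intro conv_rv) auto
  have adm: "adm X r u" "adm X r (rv a)"
    using u ra by (auto simp: conv_def)
  have W: "rv a N \<in> WA" for N using adm by (auto simp: adm_def)
  have cc: "\<sigma> N c \<in> carrier (Witt p K)" for N using c by (rule \<sigma>_closed)
  have sh: "close (\<lambda>N. psmult (\<sigma> N c) (rv a N)) (\<lambda>N. psmult (\<sigma> N c) (pV (rv a (N - 1))))"
    by (rule close_psmult[OF X(1) adm(2) adm_shift[OF adm(2)] cc rv_shift])
  have lim: "\<forall>\<^sub>F N in sequentially. psmult (\<sigma> N c) (rv a N) (N - n) = cwsmult c a n" for n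
  proof -
    have "\<forall>\<^sub>F N in sequentially. psmult (\<sigma> N c) (rv a N) (N - n) =
        psmult (\<sigma> N c) (pV (rv a (N - 1))) (N - n) \<and> n < N"
      using sh by (intro eventually_conj eventually_gt_at_top) (simp add: close_def)
    then have "\<forall>\<^sub>F m in sequentially. psmult (\<sigma> (Suc (n + m)) c) (rv a (Suc (n + m))) (Suc (n + m) - n) =
        psmult (\<sigma> (Suc (n + m)) c) (pV (rv a (n + m))) (Suc (n + m) - n)"
      by (rule eventually_mono[OF eventually_shift[where n = "Suc n"]]) simp
    then have "\<forall>\<^sub>F m in sequentially. psmult (\<sigma> (n + Suc m) c) (rv a (n + Suc m)) (Suc m) =
        psmult (\<sigma> (n + m) c) (rv a (n + m)) m"
    proof (rule eventually_mono)
      fix m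
      have "psmult (\<sigma> (Suc (n + m)) c) (pV (rv a (n + m))) = pV (psmult (\<sigma> (n + m) c) (rv a (n + m)))"
        by (simp only: pV_smult[OF cc W] frob_\<sigma>_Suc[OF c])
      then show "psmult (\<sigma> (Suc (n + m)) c) (rv a (Suc (n + m))) (Suc (n + m) - n) =
        psmult (\<sigma> (Suc (n + m)) c) (pV (rv a (n + m))) (Suc (n + m) - n) \<Longrightarrow>
        psmult (\<sigma> (n + Suc m) c) (rv a (n + Suc m)) (Suc m) = psmult (\<sigma> (n + m) c) (rv a (n + m)) m"
        by (simp add: pV_def Suc_diff_le del: funpow.simps)
    qed
    from eventually_constI[OF this] obtain d
      where d: "\<forall>\<^sub>F m in sequentially. psmult (\<sigma> (n + m) c) (rv a (n + m)) m = d" by blast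
    then have "cwsmult c a n = d" unfolding cwsmult_def by (rule eventual_value_eqI)
    with d have "\<forall>\<^sub>F m in sequentially. psmult (\<sigma> (m + n) c) (rv a (m + n)) (m + n - n) = cwsmult c a n"
      by (simp add: add.commute)
    then show ?thesis by (rule eventually_sequentially_seg[THEN iffD1])
  qed
  have "conv X r (\<lambda>N. psmult (\<sigma> N c) (rv a N)) (cwsmult c a)"
    using adm_psmult[OF cc adm(2)] lim by (simp add: conv_def)
  then show ?thesis
    by (rule conv_close[OF _ adm_psmult[OF cc adm(1)] close_psmult[OF X(1) adm(1,2) cc close_conv[OF u ra]]])
qed

lemma cwF_conv: assumes u: "conv X r u a" shows "conv X r (\<lambda>N. pF (u N)) (cwF a)"
proof -
  have g: "polar_degree p (length (replicate p x))" for x :: 'a using polar_degree_power[OF p2, of 1] by simp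
  have "mu A (replicate p x) \<in> X" if "x \<in> X" for x
  proof -
    have "it (replicate p x) \<in> X" using nX that g unfolding nilpotent_sub_def by (metis in_set_replicate subsetI)
    then show ?thesis by (simp add: it_p)
  qed
  then have "adm X r (\<lambda>N. pF (u N))" using u by (auto simp: conv_def adm_def pF_def[of "u _"])
  moreover have "\<forall>\<^sub>F N in sequentially. pF (u N) (N - n) = cwF a n" for n
  proof -
    have "\<forall>\<^sub>F N in sequentially. u N (N - n) = a n" using u by (simp add: conv_def)
    then show ?thesis by (rule eventually_mono) (simp add: pF_def cwF_def)
  qed
  ultimately show ?thesis by (simp add: conv_def)
qed

lemma cwV_conv: assumes u: "conv X r u a" shows "conv X r (\<lambda>N. pV (u N)) (cwV a)"
proof -
  have "\<forall>\<^sub>F N in sequentially. pV (u N) (N - n) = cwV a n" for n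
  proof -
    have "\<forall>\<^sub>F N in sequentially. u N (N - Suc n) = a (Suc n) \<and> n < N"
      using u by (intro eventually_conj eventually_gt_at_top) (simp add: conv_def)
    then show ?thesis by (rule eventually_mono) (auto simp: pV_def cwV_def)
  qed
  then show ?thesis using u adm_pV by (simp add: conv_def)
qed

lemma zero_conv: "conv X r (\<lambda>N _. \<zero>\<^bsub>A\<^esub>) (\<lambda>_. \<zero>\<^bsub>A\<^esub>)"
  by (simp add: conv_def adm_def X)

end

text \<open>Limits can be combined only for a common \<open>X\<close> and \<open>r\<close>. The
  union of the nilpotent sets is nilpotent, and it is then closed up to a polar subalgebra.\<close>

lemma cwcar_common:
  assumes "set as \<subseteq> cwcar"
  shows "\<exists>s r X. nilpotent_sub s X \<and> (\<forall>a\<in>set as. conv X r (rv a) a)"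
proof -
  have "\<exists>s r Y. nilpotent_set s Y \<and> (\<forall>a\<in>set as. \<forall>n\<ge>r. a n \<in> Y)" using assms
  proof (induction as)
    case Nil
    have "nilpotent_set 0 {}" by (auto simp: nilpotent_set_def)
    then show ?case by auto
  next
    case (Cons a as)
    then obtain s r Y where Y: "nilpotent_set s Y" "\<forall>a\<in>set as. \<forall>n\<ge>r. a n \<in> Y" by auto
    obtain s' r' where a: "nilpotent_set s' (a ` {r'..})" using Cons.prems by (auto simp: cwcar_def)
    show ?case
      by (rule exI[of _ "s' + s + 1"], rule exI[of _ "max r' r"], rule exI[of _ "a ` {r'..} \<union> Y"])
        (use nilpotent_set_Un[OF a Y(1)] Y(2) in auto)
  qed
  then obtain s r Y where Y: "nilpotent_set s Y" "\<forall>a\<in>set as. \<forall>n\<ge>r. a n \<in> Y" by blast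
  obtain X where X: "nilpotent_sub s X" "Y \<subseteq> X" using nilpotent_sub_exists[OF Y(1)] .
  have "conv X r (rv a) a" if "a \<in> set as" for a
    using assms that Y X by (intro conv_rv) (auto simp: cwcar_def)
  then show ?thesis using X by blast
qed

lemma cw1:
  assumes "a \<in> cwcar" obtains s r X u where "nilpotent_sub s X" "conv X r u a"
  using cwcar_common[of "[a]"] assms by auto
lemma cw2:
  assumes "a \<in> cwcar" "b \<in> cwcar" obtains s r X u v where "nilpotent_sub s X" "conv X r u a" "conv X r v b"
proof -
  have "\<exists>s r X. nilpotent_sub s X \<and> (\<forall>x\<in>set [a, b]. conv X r (rv x) x)"
    by (rule cwcar_common) (use assms in auto)
  then show ?thesis using that by auto
qed
lemma cw3:
  assumes "a \<in> cwcar" "b \<in> cwcar" "c \<in> cwcar"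
  obtains s r X u v w where "nilpotent_sub s X" "conv X r u a" "conv X r v b" "conv X r w c"
proof -
  have "\<exists>s r X. nilpotent_sub s X \<and> (\<forall>x\<in>set [a, b, c]. conv X r (rv x) x)"
    by (rule cwcar_common) (use assms in auto)
  then show ?thesis using that by auto
qed

lemma conv_WA: "conv X r u a \<Longrightarrow> u N \<in> WA"
  by (simp add: conv_def adm_def)

text \<open>An identity between co-Witt vectors is reduced to the identity between the approximating
  Witt vectors at each level.\<close>

lemma conv_eqI: "conv X r u a \<Longrightarrow> conv X r v b \<Longrightarrow> (\<And>N. u N = v N) \<Longrightarrow> a = b"
  using conv_unique by (metis ext)

lemma nilpotent_sub_nilpotent_set: "nilpotent_sub s X \<Longrightarrow> nilpotent_set s X" by (simp add: nilpotent_sub_def)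

lemma cwadd_closed: "a \<in> cwcar \<Longrightarrow> b \<in> cwcar \<Longrightarrow> cwadd a b \<in> cwcar"
  by (erule (1) cw2) (blast intro: conv_carrier_nilpotent_set nilpotent_sub_nilpotent_set cwadd_conv)
lemma cwsmult_closed: "c \<in> carrier (Witt p K) \<Longrightarrow> a \<in> cwcar \<Longrightarrow> cwsmult c a \<in> cwcar"
  by (erule cw1) (blast intro: conv_carrier_nilpotent_set nilpotent_sub_nilpotent_set cwsmult_conv)
lemma cwF_closed: "a \<in> cwcar \<Longrightarrow> cwF a \<in> cwcar"
  by (erule cw1) (blast intro: conv_carrier_nilpotent_set nilpotent_sub_nilpotent_set cwF_conv)
lemma cwV_closed: "a \<in> cwcar \<Longrightarrow> cwV a \<in> cwcar"
  by (erule cw1) (blast intro: conv_carrier_nilpotent_set nilpotent_sub_nilpotent_set cwV_conv)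
lemma cwzero_closed: "(\<lambda>_. \<zero>\<^bsub>A\<^esub>) \<in> cwcar"
proof -
  have "nilpotent_set 0 {}" by (auto simp: nilpotent_set_def)
  then show ?thesis by (rule nilpotent_sub_exists) (blast intro: conv_carrier_nilpotent_set nilpotent_sub_nilpotent_set zero_conv)
qed

lemma cwadd_assoc:
  assumes "a \<in> cwcar" "b \<in> cwcar" "c \<in> cwcar" shows "cwadd (cwadd a b) c = cwadd a (cwadd b c)"
proof -
  obtain s r X u v w where *: "nilpotent_sub s X" "conv X r u a" "conv X r v b" "conv X r w c"
    using assms by (rule cw3)
  note cv = cwadd_conv[OF *(1)]
  show ?thesis
    by (rule conv_eqI[OF cv[OF cv[OF *(2,3)] *(4)] cv[OF *(2) cv[OF *(3,4)]]])
      (intro padd_assoc conv_WA[OF *(2)] conv_WA[OF *(3)] conv_WA[OF *(4)])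
qed

lemma cwadd_comm:
  assumes "a \<in> cwcar" "b \<in> cwcar" shows "cwadd a b = cwadd b a"
proof -
  obtain s r X u v where *: "nilpotent_sub s X" "conv X r u a" "conv X r v b"
    using assms by (rule cw2)
  note cv = cwadd_conv[OF *(1)]
  show ?thesis
    by (rule conv_eqI[OF cv[OF *(2,3)] cv[OF *(3,2)]]) (intro padd_comm conv_WA[OF *(2)] conv_WA[OF *(3)])
qed

lemma cwadd_zero:
  assumes "a \<in> cwcar" shows "cwadd (\<lambda>_. \<zero>\<^bsub>A\<^esub>) a = a"
proof -
  obtain s r X u where *: "nilpotent_sub s X" "conv X r u a" using assms by (rule cw1)
  show ?thesis
    by (rule conv_eqI[OF cwadd_conv[OF *(1) zero_conv[OF *(1)] *(2)] *(2)]) (intro padd_zero conv_WA[OF *(2)])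
qed

lemma cwsmult_one:
  assumes "a \<in> cwcar" shows "cwsmult \<one>\<^bsub>Witt p K\<^esub> a = a"
proof -
  interpret W: cring "Witt p K" by (rule cring_Witt)
  obtain s r X u where *: "nilpotent_sub s X" "conv X r u a" using assms by (rule cw1)
  show ?thesis
    by (rule conv_eqI[OF cwsmult_conv[OF *(1) W.one_closed *(2)] *(2)])
      (simp only: \<sigma>_one psmult_one[OF conv_WA[OF *(2)]])
qed

lemma cwsmult_zero:
  assumes "a \<in> cwcar" shows "cwsmult \<zero>\<^bsub>Witt p K\<^esub> a = (\<lambda>_. \<zero>\<^bsub>A\<^esub>)"
proof -
  interpret W: cring "Witt p K" by (rule cring_Witt)
  obtain s r X u where *: "nilpotent_sub s X" "conv X r u a" using assms by (rule cw1)
  show ?thesis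
    by (rule conv_eqI[OF cwsmult_conv[OF *(1) W.zero_closed *(2)] zero_conv[OF *(1)]])
      (simp only: \<sigma>_zero psmult_zero[OF conv_WA[OF *(2)]])
qed

lemma cwsmult_assoc:
  assumes c: "c \<in> carrier (Witt p K)" "d \<in> carrier (Witt p K)" and "a \<in> cwcar"
  shows "cwsmult (c \<otimes>\<^bsub>Witt p K\<^esub> d) a = cwsmult c (cwsmult d a)"
proof -
  interpret W: cring "Witt p K" by (rule cring_Witt)
  obtain s r X u where *: "nilpotent_sub s X" "conv X r u a" using assms(3) by (rule cw1)
  show ?thesis
    by (rule conv_eqI[OF cwsmult_conv[OF *(1) W.m_closed[OF c] *(2)] cwsmult_conv[OF *(1) c(1) cwsmult_conv[OF *(1) c(2) *(2)]]])
      (simp only: \<sigma>_mult[OF c] psmult_assoc[OF \<sigma>_closed[OF c(1)] \<sigma>_closed[OF c(2)] conv_WA[OF *(2)]])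
qed

lemma cwsmult_add_left:
  assumes c: "c \<in> carrier (Witt p K)" "d \<in> carrier (Witt p K)" and "a \<in> cwcar"
  shows "cwsmult (c \<oplus>\<^bsub>Witt p K\<^esub> d) a = cwadd (cwsmult c a) (cwsmult d a)"
proof -
  interpret W: cring "Witt p K" by (rule cring_Witt)
  obtain s r X u where *: "nilpotent_sub s X" "conv X r u a" using assms(3) by (rule cw1)
  show ?thesis
    by (rule conv_eqI[OF cwsmult_conv[OF *(1) W.a_closed[OF c] *(2)]
          cwadd_conv[OF *(1) cwsmult_conv[OF *(1) c(1) *(2)] cwsmult_conv[OF *(1) c(2) *(2)]]])
      (simp only: \<sigma>_add[OF c] psmult_add_left[OF \<sigma>_closed[OF c(1)] \<sigma>_closed[OF c(2)] conv_WA[OF *(2)]])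
qed

lemma cwsmult_add_right:
  assumes c: "c \<in> carrier (Witt p K)" and "a \<in> cwcar" "b \<in> cwcar"
  shows "cwsmult c (cwadd a b) = cwadd (cwsmult c a) (cwsmult c b)"
proof -
  obtain s r X u v where *: "nilpotent_sub s X" "conv X r u a" "conv X r v b" using assms(2,3) by (rule cw2)
  show ?thesis
    by (rule conv_eqI[OF cwsmult_conv[OF *(1) c cwadd_conv[OF *(1,2,3)]]
          cwadd_conv[OF *(1) cwsmult_conv[OF *(1) c *(2)] cwsmult_conv[OF *(1) c *(3)]]])
      (simp only: psmult_add_right[OF \<sigma>_closed[OF c] conv_WA[OF *(2)] conv_WA[OF *(3)]])
qed

lemma cwF_add:
  assumes "a \<in> cwcar" "b \<in> cwcar" shows "cwF (cwadd a b) = cwadd (cwF a) (cwF b)"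
proof -
  obtain s r X u v where *: "nilpotent_sub s X" "conv X r u a" "conv X r v b" using assms by (rule cw2)
  show ?thesis
    by (rule conv_eqI[OF cwF_conv[OF *(1) cwadd_conv[OF *(1,2,3)]]
          cwadd_conv[OF *(1) cwF_conv[OF *(1,2)] cwF_conv[OF *(1,3)]]])
      (simp only: pF_add[OF conv_WA[OF *(2)] conv_WA[OF *(3)]])
qed

lemma cwV_add:
  assumes "a \<in> cwcar" "b \<in> cwcar" shows "cwV (cwadd a b) = cwadd (cwV a) (cwV b)"
proof -
  obtain s r X u v where *: "nilpotent_sub s X" "conv X r u a" "conv X r v b" using assms by (rule cw2)
  show ?thesis
    by (rule conv_eqI[OF cwV_conv[OF *(1) cwadd_conv[OF *(1,2,3)]]
          cwadd_conv[OF *(1) cwV_conv[OF *(1,2)] cwV_conv[OF *(1,3)]]])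
      (simp only: pV_add[OF conv_WA[OF *(2)] conv_WA[OF *(3)]])
qed

lemma cwF_smult:
  assumes c: "c \<in> carrier (Witt p K)" and "a \<in> cwcar"
  shows "cwF (cwsmult c a) = cwsmult (frob p K c) (cwF a)"
proof -
  obtain s r X u where *: "nilpotent_sub s X" "conv X r u a" using assms(2) by (rule cw1)
  show ?thesis
    by (rule conv_eqI[OF cwF_conv[OF *(1) cwsmult_conv[OF *(1) c *(2)]]
          cwsmult_conv[OF *(1) frob_closed[OF c] cwF_conv[OF *(1,2)]]])
      (simp only: pF_smult[OF \<sigma>_closed[OF c] conv_WA[OF *(2)]] \<sigma>_frob[OF c])
qed

lemma cwV_smult:
  assumes c: "c \<in> carrier (Witt p K)" and "a \<in> cwcar"
  shows "cwsmult c (cwV a) = cwV (cwsmult (frob p K c) a)"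
proof -
  obtain s r X u where *: "nilpotent_sub s X" "conv X r u a" using assms(2) by (rule cw1)
  show ?thesis
    by (rule conv_eqI[OF cwsmult_conv[OF *(1) c cwV_conv[OF *(1,2)]]
          cwV_conv[OF *(1) cwsmult_conv[OF *(1) frob_closed[OF c] *(2)]]])
      (simp only: pV_smult[OF \<sigma>_closed[OF c] conv_WA[OF *(2)]] \<sigma>_frob[OF c])
qed

section \<open>The Dieudonne module of co-Witt vectors\<close>

definition CWA :: "(nat \<Rightarrow> 'k, nat \<Rightarrow> 'a) dieudonne" where
  "CWA = \<lparr> carrier = cwcar, mult = undefined, one = undefined, zero = (\<lambda>_. \<zero>\<^bsub>A\<^esub>), add = cwadd,
     smult = cwsmult, dF = cwF, dV = cwV \<rparr>"

lemma CWA_simps [simp]: "carrier CWA = cwcar" "\<zero>\<^bsub>CWA\<^esub> = (\<lambda>_. \<zero>\<^bsub>A\<^esub>)" "add CWA = cwadd" "smult CWA = cwsmult"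
  "dF CWA = cwF" "dV CWA = cwV"
  by (simp_all add: CWA_def)

lemma CWA_module: "module (Witt p K) CWA"
proof -
  interpret W: cring "Witt p K" by (rule cring_Witt)
  have "abelian_group CWA"
  proof (rule abelian_groupI)
    fix a assume a: "a \<in> carrier CWA"
    \<comment> \<open>The additive inverse is the multiple by the scalar -1.\<close>
    have "cwadd (cwsmult (\<ominus>\<^bsub>Witt p K\<^esub> \<one>\<^bsub>Witt p K\<^esub>) a) (cwsmult \<one>\<^bsub>Witt p K\<^esub> a) = (\<lambda>_. \<zero>\<^bsub>A\<^esub>)"
      using a by (simp add: cwsmult_add_left[symmetric] W.l_neg cwsmult_zero del: Witt_carrier)
    then show "\<exists>y\<in>carrier CWA. y \<oplus>\<^bsub>CWA\<^esub> a = \<zero>\<^bsub>CWA\<^esub>"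
      using a by (intro bexI[of _ "cwsmult (\<ominus>\<^bsub>Witt p K\<^esub> \<one>\<^bsub>Witt p K\<^esub>) a"])
        (simp_all add: cwsmult_one cwsmult_closed del: Witt_carrier)
  qed (simp_all only: CWA_simps cwadd_closed cwzero_closed cwadd_assoc cwadd_zero, rule cwadd_comm)
  then show ?thesis
    by (intro moduleI cring_Witt)
      (simp_all add: cwsmult_closed cwsmult_add_left cwsmult_add_right cwsmult_assoc cwsmult_one del: Witt_carrier)
qed

lemma cw_pmult_conv:
  assumes "nilpotent_sub s X" "conv X r u a"
  shows "conv X r (\<lambda>N. pmult k (u N)) ([k] \<cdot>\<^bsub>CWA\<^esub> a)"
proof (induction k)
  case 0
  show ?case using zero_conv[OF assms(1)] by (simp add: add_pow_def nat_pow_def)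
next
  case (Suc k)
  have "[Suc k] \<cdot>\<^bsub>CWA\<^esub> a = cwadd ([k] \<cdot>\<^bsub>CWA\<^esub> a) a"
    by (simp add: add_pow_def nat_pow_def)
  then show ?case using cwadd_conv[OF assms(1) Suc assms(2)] by simp
qed

lemma cwVF:
  assumes "a \<in> cwcar" shows "cwV (cwF a) = [p] \<cdot>\<^bsub>CWA\<^esub> a"
proof -
  obtain s r X u where *: "nilpotent_sub s X" "conv X r u a" using assms by (rule cw1)
  show ?thesis
    by (rule conv_eqI[OF cwV_conv[OF *(1) cwF_conv[OF *(1,2)]] cw_pmult_conv[OF *]])
      (simp only: pVF[OF conv_WA[OF *(2)]])
qed

lemma CWA_dieudonne: "dieudonne_module p K CWA"
proof -
  have "cwF (cwV a) = cwV (cwF a)" for a by (simp add: cwF_def cwV_def fun_eq_iff)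
  then show ?thesis
    unfolding dieudonne_module_def using CWA_module
    by (simp add: cwF_closed cwV_closed cwF_add cwV_add cwVF cwF_smult cwV_smult del: Witt_carrier)
qed

end

section \<open>Transport of Dieudonne modules\<close>

text \<open>\<open>M\<close> is a bare record of operations; an injective map into a Dieudonne
  module that respects them carries all axioms over. The map may be semilinear along
  \<open>\<tau>\<close>: this is a power of Frobenius for truncated vectors inside co-Witt vectors
  and the identity elsewhere.\<close>

locale dieudonne_pullback =
  fixes p :: nat and K :: "'k ring" and N :: "(nat \<Rightarrow> 'k, 'n) dieudonne" and M :: "(nat \<Rightarrow> 'k, 'm) dieudonne"
    and \<tau> :: "(nat \<Rightarrow> 'k) \<Rightarrow> nat \<Rightarrow> 'k" and \<phi> :: "'m \<Rightarrow> 'n"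
  assumes N: "dieudonne_module p K N"
    and \<tau>_closed: "\<And>c. c \<in> carrier (Witt p K) \<Longrightarrow> \<tau> c \<in> carrier (Witt p K)"
    and \<tau>_add: "\<And>c d. c \<in> carrier (Witt p K) \<Longrightarrow> d \<in> carrier (Witt p K) \<Longrightarrow>
      \<tau> (c \<oplus>\<^bsub>Witt p K\<^esub> d) = \<tau> c \<oplus>\<^bsub>Witt p K\<^esub> \<tau> d"
    and \<tau>_mult: "\<And>c d. c \<in> carrier (Witt p K) \<Longrightarrow> d \<in> carrier (Witt p K) \<Longrightarrow>
      \<tau> (c \<otimes>\<^bsub>Witt p K\<^esub> d) = \<tau> c \<otimes>\<^bsub>Witt p K\<^esub> \<tau> d"
    and \<tau>_one: "\<tau> \<one>\<^bsub>Witt p K\<^esub> = \<one>\<^bsub>Witt p K\<^esub>"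
    and \<tau>_frob: "\<And>c. c \<in> carrier (Witt p K) \<Longrightarrow> \<tau> (frob p K c) = frob p K (\<tau> c) \<and> frob p K c \<in> carrier (Witt p K)"
    and inj: "inj_on \<phi> (carrier M)"
    and \<phi>_closed: "\<And>x. x \<in> carrier M \<Longrightarrow> \<phi> x \<in> carrier N"
    and zero: "\<zero>\<^bsub>M\<^esub> \<in> carrier M" "\<phi> \<zero>\<^bsub>M\<^esub> = \<zero>\<^bsub>N\<^esub>"
    and add: "\<And>x y. x \<in> carrier M \<Longrightarrow> y \<in> carrier M \<Longrightarrow> x \<oplus>\<^bsub>M\<^esub> y \<in> carrier M \<and> \<phi> (x \<oplus>\<^bsub>M\<^esub> y) = \<phi> x \<oplus>\<^bsub>N\<^esub> \<phi> y"
    and smult: "\<And>c x. c \<in> carrier (Witt p K) \<Longrightarrow> x \<in> carrier M \<Longrightarrow>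
      c \<odot>\<^bsub>M\<^esub> x \<in> carrier M \<and> \<phi> (c \<odot>\<^bsub>M\<^esub> x) = \<tau> c \<odot>\<^bsub>N\<^esub> \<phi> x"
    and F: "\<And>x. x \<in> carrier M \<Longrightarrow> dF M x \<in> carrier M \<and> \<phi> (dF M x) = dF N (\<phi> x)"
    and V: "\<And>x. x \<in> carrier M \<Longrightarrow> dV M x \<in> carrier M \<and> \<phi> (dV M x) = dV N (\<phi> x)"
begin

interpretation N: module "Witt p K" N using N by (simp add: dieudonne_module_def)

lemma eqI: "x \<in> carrier M \<Longrightarrow> y \<in> carrier M \<Longrightarrow> \<phi> x = \<phi> y \<Longrightarrow> x = y"
  using inj by (auto dest: inj_onD)

lemma \<tau>_zero: "\<tau> \<zero>\<^bsub>Witt p K\<^esub> = \<zero>\<^bsub>Witt p K\<^esub>"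
  using \<tau>_add[of "\<zero>\<^bsub>Witt p K\<^esub>" "\<zero>\<^bsub>Witt p K\<^esub>"] \<tau>_closed[of "\<zero>\<^bsub>Witt p K\<^esub>"]
  by (metis N.R.add.r_cancel_one N.R.l_zero N.R.zero_closed)

lemma module_M: "module (Witt p K) M"
proof (intro moduleI N.R.cring_axioms abelian_groupI)
  fix x assume x: "x \<in> carrier M"
  let ?y = "(\<ominus>\<^bsub>Witt p K\<^esub> \<one>\<^bsub>Witt p K\<^esub>) \<odot>\<^bsub>M\<^esub> x"
  have m: "\<ominus>\<^bsub>Witt p K\<^esub> \<one>\<^bsub>Witt p K\<^esub> \<in> carrier (Witt p K)" by (simp del: Witt_carrier)
  have y: "?y \<in> carrier M" using m x smult by blast
  have "\<phi> (?y \<oplus>\<^bsub>M\<^esub> x) = \<tau> (\<ominus>\<^bsub>Witt p K\<^esub> \<one>\<^bsub>Witt p K\<^esub>) \<odot>\<^bsub>N\<^esub> \<phi> x \<oplus>\<^bsub>N\<^esub> \<tau> \<one>\<^bsub>Witt p K\<^esub> \<odot>\<^bsub>N\<^esub> \<phi> x"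
    using add[OF y x] smult[OF m x] \<phi>_closed[OF x] by (simp add: \<tau>_one)
  also have "\<dots> = \<tau> \<zero>\<^bsub>Witt p K\<^esub> \<odot>\<^bsub>N\<^esub> \<phi> x"
    using N.smult_l_distr[OF \<tau>_closed[OF m] \<tau>_closed[OF N.R.one_closed] \<phi>_closed[OF x]]
      \<tau>_add[OF m N.R.one_closed] by (simp add: N.R.l_neg del: Witt_carrier)
  also have "\<dots> = \<phi> \<zero>\<^bsub>M\<^esub>" using \<phi>_closed[OF x] by (simp add: \<tau>_zero zero)
  finally show "\<exists>y\<in>carrier M. y \<oplus>\<^bsub>M\<^esub> x = \<zero>\<^bsub>M\<^esub>" using y x add zero by (blast intro: eqI)
qed (rule eqI; simp add: zero add smult \<phi>_closed N.a_ac \<tau>_closed \<tau>_add \<tau>_mult \<tau>_one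
    N.smult_l_distr N.smult_r_distr N.smult_assoc1 del: Witt_carrier | simp add: zero add smult del: Witt_carrier)+

lemma dieudonne_M: "dieudonne_module p K M"
proof -
  interpret M: module "Witt p K" M by (rule module_M)
  have np: "\<phi> ([k] \<cdot>\<^bsub>M\<^esub> x) = [k] \<cdot>\<^bsub>N\<^esub> \<phi> x" if "x \<in> carrier M" for x and k :: nat
    using that by (induction k) (auto simp: zero add)
  have ND: "\<And>x y. x \<in> carrier N \<Longrightarrow> y \<in> carrier N \<Longrightarrow> dF N (x \<oplus>\<^bsub>N\<^esub> y) = dF N x \<oplus>\<^bsub>N\<^esub> dF N y \<and> dV N (x \<oplus>\<^bsub>N\<^esub> y) = dV N x \<oplus>\<^bsub>N\<^esub> dV N y"
    "\<And>x. x \<in> carrier N \<Longrightarrow> dF N (dV N x) = [p] \<cdot>\<^bsub>N\<^esub> x \<and> dV N (dF N x) = [p] \<cdot>\<^bsub>N\<^esub> x"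
    "\<And>c x. c \<in> carrier (Witt p K) \<Longrightarrow> x \<in> carrier N \<Longrightarrow> dF N (c \<odot>\<^bsub>N\<^esub> x) = frob p K c \<odot>\<^bsub>N\<^esub> dF N x \<and>
        c \<odot>\<^bsub>N\<^esub> dV N x = dV N (frob p K c \<odot>\<^bsub>N\<^esub> x)"
    using N unfolding dieudonne_module_def by blast+
  show ?thesis
    unfolding dieudonne_module_def
  proof (intro conjI ballI module_M)
    fix x y assume xy: "x \<in> carrier M" "y \<in> carrier M"
    show "dF M (x \<oplus>\<^bsub>M\<^esub> y) = dF M x \<oplus>\<^bsub>M\<^esub> dF M y" "dV M (x \<oplus>\<^bsub>M\<^esub> y) = dV M x \<oplus>\<^bsub>M\<^esub> dV M y"
      using xy by (auto intro!: eqI simp: F V add ND \<phi>_closed)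
  next
    fix x assume x: "x \<in> carrier M"
    show "dF M x \<in> carrier M" "dV M x \<in> carrier M" using x F V by auto
    show "dF M (dV M x) = [p] \<cdot>\<^bsub>M\<^esub> x" "dV M (dF M x) = [p] \<cdot>\<^bsub>M\<^esub> x"
      using x by (auto intro!: eqI simp: F V np ND \<phi>_closed)
  next
    fix c x assume c: "c \<in> carrier (Witt p K)" and x: "x \<in> carrier M"
    have fc: "frob p K c \<in> carrier (Witt p K)" "\<tau> (frob p K c) = frob p K (\<tau> c)" using \<tau>_frob[OF c] by auto
    show "dF M (c \<odot>\<^bsub>M\<^esub> x) = frob p K c \<odot>\<^bsub>M\<^esub> dF M x"
    proof (rule eqI)
      show "\<phi> (dF M (c \<odot>\<^bsub>M\<^esub> x)) = \<phi> (frob p K c \<odot>\<^bsub>M\<^esub> dF M x)"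
        using F[OF x] F[of "c \<odot>\<^bsub>M\<^esub> x"] smult[OF c x] smult[OF fc(1), of "dF M x"]
          ND(3)[OF \<tau>_closed[OF c] \<phi>_closed[OF x]] fc(2) by simp
    qed (use c x fc F smult in blast)+
    show "c \<odot>\<^bsub>M\<^esub> dV M x = dV M (frob p K c \<odot>\<^bsub>M\<^esub> x)"
    proof (rule eqI)
      show "\<phi> (c \<odot>\<^bsub>M\<^esub> dV M x) = \<phi> (dV M (frob p K c \<odot>\<^bsub>M\<^esub> x))"
        using V[OF x] V[of "frob p K c \<odot>\<^bsub>M\<^esub> x"] smult[OF c, of "dV M x"] smult[OF fc(1) x]
          ND(3)[OF \<tau>_closed[OF c] \<phi>_closed[OF x]] fc(2) by simp
    qed (use c x fc V smult in blast)+
  qed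
qed

end

section \<open>Finite length\<close>

lemma finite_length_extend:
  assumes "finite_length S M H" "submodule H' S M"
    "H = H' \<or> (H \<subset> H' \<and> \<not> (\<exists>L. submodule L S M \<and> H \<subset> L \<and> L \<subset> H'))"
  shows "finite_length S M H'"
proof (cases "H = H'")
  case False
  obtain l :: nat and c where c: "c 0 = {\<zero>\<^bsub>M\<^esub>}" "c l = H" "\<forall>i\<le>l. submodule (c i) S M"
    "\<forall>i<l. c i \<subset> c (Suc i) \<and> \<not> (\<exists>L. submodule L S M \<and> c i \<subset> L \<and> L \<subset> c (Suc i))"
    using assms(1) unfolding finite_length_def by blast
  show ?thesis unfolding finite_length_def
    by (rule exI[of _ "Suc l"], rule exI[of _ "c(Suc l := H')"])
      (use c assms False in \<open>auto simp: less_Suc_eq le_Suc_eq\<close>)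
qed (use assms in simp)

context polar_perf
begin

text \<open>A vector with vanishing first component is V of its shift, Frobenius is surjective on
  W(k), and V F = p.\<close>

lemma Witt_p_divides:
  assumes c: "c \<in> carrier (Witt p K)" "c 0 = \<zero>\<^bsub>K\<^esub>"
  obtains d where "d \<in> carrier (Witt p K)" "c = [p] \<cdot>\<^bsub>Witt p K\<^esub> d"
proof -
  have "(\<lambda>i. c (Suc i)) \<in> carrier (Witt p K)" using c by simp
  then obtain d where d: "d \<in> carrier (Witt p K)" "(\<lambda>i. c (Suc i)) = frob p K d"
    using frob_surj by (metis imageE)
  obtain f where f: "f \<in> L0" "d = r0 f" using d(1) by (rule WK_cases)
  have "r0 (wmult p k f) = [k] \<cdot>\<^bsub>Witt p K\<^esub> d" for k
    by (induction k) (simp_all add: r0_0 r0_wadd f add_pow_def nat_pow_def)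
  moreover have "r0 (wV (wF p f)) = r0 (wmult p p f)" by (rule r0_cong_mod[OF wVF[OF prime_p]])
  moreover have "r0 (wV (wF p f)) = c"
  proof
    fix i show "r0 (wV (wF p f)) i = c i"
      using fun_cong[OF d(2), of "i - 1"] c(2) unfolding f(2) r0_wF[symmetric]
      by (cases i) (auto simp: r0_def \<rho>0_0)
  qed
  ultimately show ?thesis using d(1) that by metis
qed

lemma Witt_0:
  assumes "c \<in> carrier (Witt p K)" "d \<in> carrier (Witt p K)"
  shows "(c \<oplus>\<^bsub>Witt p K\<^esub> d) 0 = c 0 \<oplus>\<^bsub>K\<^esub> d 0" "(c \<otimes>\<^bsub>Witt p K\<^esub> d) 0 = c 0 \<otimes>\<^bsub>K\<^esub> d 0"
proof -
  obtain f g where fg: "c = r0 f" "d = r0 g" using assms by (metis WK_cases)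
  have "wadd p f g 0 = f 0 + g 0" "wmul p f g 0 = f 0 * g 0"
    using ghost_wadd[OF prime_p, of 0 f g] ghost_wmul[OF prime_p, of 0 f g] by simp_all
  then show "(c \<oplus>\<^bsub>Witt p K\<^esub> d) 0 = c 0 \<oplus>\<^bsub>K\<^esub> d 0" "(c \<otimes>\<^bsub>Witt p K\<^esub> d) 0 = c 0 \<otimes>\<^bsub>K\<^esub> d 0"
    unfolding fg r0_wadd[symmetric] r0_wmul[symmetric] by (simp_all add: r0_def \<rho>0_add \<rho>0_mult)
qed

text \<open>The vector with the inverse of \<open>c 0\<close> in place 0 and zeros elsewhere inverts
  \<open>c\<close> in the first component, and a vector with vanishing first component is a multiple
  of p. Inverses modulo p are enough, because the quotients considered below are killed by
  p.\<close>

lemma Witt_unit_mod_p: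
  assumes c: "c \<in> carrier (Witt p K)" "c 0 \<noteq> \<zero>\<^bsub>K\<^esub>"
  obtains d e where "d \<in> carrier (Witt p K)" "e \<in> carrier (Witt p K)"
    "\<one>\<^bsub>Witt p K\<^esub> = [p] \<cdot>\<^bsub>Witt p K\<^esub> e \<oplus>\<^bsub>Witt p K\<^esub> d \<otimes>\<^bsub>Witt p K\<^esub> c"
proof -
  interpret W: cring "Witt p K" by (rule cring_Witt)
  interpret F: field K by (rule K_field)
  have u: "c 0 \<in> Units K" using c F.field_Units by simp
  define d where "d = (\<lambda>i::nat. if i = 0 then inv\<^bsub>K\<^esub> (c 0) else \<zero>\<^bsub>K\<^esub>)"
  have d: "d \<in> carrier (Witt p K)" using u by (simp add: d_def)
  let ?x = "\<one>\<^bsub>Witt p K\<^esub> \<ominus>\<^bsub>Witt p K\<^esub> (d \<otimes>\<^bsub>Witt p K\<^esub> c)"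
  have x: "?x \<in> carrier (Witt p K)" "d \<otimes>\<^bsub>Witt p K\<^esub> c \<in> carrier (Witt p K)" using c d by (simp_all del: Witt_carrier)
  have e: "?x \<oplus>\<^bsub>Witt p K\<^esub> d \<otimes>\<^bsub>Witt p K\<^esub> c = \<one>\<^bsub>Witt p K\<^esub>"
    using x by (simp add: W.minus_eq W.a_assoc W.l_neg del: Witt_carrier)
  have "(d \<otimes>\<^bsub>Witt p K\<^esub> c) 0 = \<one>\<^bsub>K\<^esub>" using c d u by (simp add: Witt_0 d_def)
  then have "?x 0 \<oplus>\<^bsub>K\<^esub> \<one>\<^bsub>K\<^esub> = \<one>\<^bsub>K\<^esub>"
    using fun_cong[OF e, of 0] Witt_0(1)[OF x] by (simp add: Witt_simps(4))
  then have "?x 0 = \<zero>\<^bsub>K\<^esub>" using x(1) by (metis R.add.r_cancel_one R.one_closed Witt_carrier)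
  then obtain e' where "e' \<in> carrier (Witt p K)" "?x = [p] \<cdot>\<^bsub>Witt p K\<^esub> e'"
    using Witt_p_divides[OF x(1)] by blast
  then show ?thesis using d e that by metis
qed

section \<open>Finite length of submodules generated by V-nilpotent elements\<close>

context
  fixes M :: "(nat \<Rightarrow> 'k, 'm) dieudonne"
  assumes M: "dieudonne_module p K M"
begin

interpretation M: module "Witt p K" M using M by (simp add: dieudonne_module_def)

lemma p_smult: "c \<in> carrier (Witt p K) \<Longrightarrow> x \<in> carrier M \<Longrightarrow>
   ([(k::nat)] \<cdot>\<^bsub>Witt p K\<^esub> c) \<odot>\<^bsub>M\<^esub> x = c \<odot>\<^bsub>M\<^esub> ([k] \<cdot>\<^bsub>M\<^esub> x)"
  by (induction k) (simp_all add: M.smult_l_distr M.smult_r_distr del: Witt_carrier)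

definition adj :: "'m set \<Rightarrow> 'm \<Rightarrow> 'm set" where
  "adj H g = {h \<oplus>\<^bsub>M\<^esub> c \<odot>\<^bsub>M\<^esub> g | h c. h \<in> H \<and> c \<in> carrier (Witt p K)}"

lemma adj_least:
  assumes "submodule L (Witt p K) M" "H \<subseteq> L" "g \<in> L" shows "adj H g \<subseteq> L"
  using M.submoduleE(4,5)[OF assms(1)] assms(2,3) by (auto simp: adj_def)

lemma adj_submodule:
  assumes H: "submodule H (Witt p K) M" and g: "g \<in> carrier M"
  shows "submodule (adj H g) (Witt p K) M" "H \<subseteq> adj H g" "g \<in> adj H g"
proof -
  note HE = M.submoduleE[OF H]
  have z: "\<zero>\<^bsub>M\<^esub> \<in> H" using HE(2,4) HE(1) M.smult_l_null by (metis M.R.zero_closed ex_in_conv subsetD)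
  show "submodule (adj H g) (Witt p K) M"
  proof (rule M.submoduleI)
    show "adj H g \<subseteq> carrier M" using HE(1) g by (auto simp: adj_def simp del: Witt_carrier)
    have "\<zero>\<^bsub>M\<^esub> = \<zero>\<^bsub>M\<^esub> \<oplus>\<^bsub>M\<^esub> \<zero>\<^bsub>Witt p K\<^esub> \<odot>\<^bsub>M\<^esub> g" using g by simp
    then show "\<zero>\<^bsub>M\<^esub> \<in> adj H g" unfolding adj_def using z M.R.zero_closed by blast
  next
    fix x assume "x \<in> adj H g"
    then obtain h c where x: "x = h \<oplus>\<^bsub>M\<^esub> c \<odot>\<^bsub>M\<^esub> g" "h \<in> H" "c \<in> carrier (Witt p K)" by (auto simp: adj_def)
    then have hc: "h \<in> carrier M" using HE(1) by blast
    have "\<ominus>\<^bsub>M\<^esub> x = \<ominus>\<^bsub>M\<^esub> h \<oplus>\<^bsub>M\<^esub> (\<ominus>\<^bsub>Witt p K\<^esub> c) \<odot>\<^bsub>M\<^esub> g"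
      using x hc g by (simp add: M.minus_add M.smult_l_minus del: Witt_carrier)
    then show "\<ominus>\<^bsub>M\<^esub> x \<in> adj H g" unfolding adj_def using x HE(3) M.R.a_inv_closed by blast
    fix y assume "y \<in> adj H g"
    then obtain h' c' where y: "y = h' \<oplus>\<^bsub>M\<^esub> c' \<odot>\<^bsub>M\<^esub> g" "h' \<in> H" "c' \<in> carrier (Witt p K)" by (auto simp: adj_def)
    then have hc': "h' \<in> carrier M" using HE(1) by blast
    have "x \<oplus>\<^bsub>M\<^esub> y = (h \<oplus>\<^bsub>M\<^esub> h') \<oplus>\<^bsub>M\<^esub> (c \<oplus>\<^bsub>Witt p K\<^esub> c') \<odot>\<^bsub>M\<^esub> g"
      using x y hc hc' g by (simp add: M.smult_l_distr M.a_ac del: Witt_carrier)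
    then show "x \<oplus>\<^bsub>M\<^esub> y \<in> adj H g" unfolding adj_def using x y HE(5) M.R.a_closed by blast
  next
    fix a x assume a: "a \<in> carrier (Witt p K)" and "x \<in> adj H g"
    then obtain h c where x: "x = h \<oplus>\<^bsub>M\<^esub> c \<odot>\<^bsub>M\<^esub> g" "h \<in> H" "c \<in> carrier (Witt p K)" by (auto simp: adj_def)
    then have hc: "h \<in> carrier M" using HE(1) by blast
    have "a \<odot>\<^bsub>M\<^esub> x = a \<odot>\<^bsub>M\<^esub> h \<oplus>\<^bsub>M\<^esub> (a \<otimes>\<^bsub>Witt p K\<^esub> c) \<odot>\<^bsub>M\<^esub> g"
      using x hc g a by (simp add: M.smult_r_distr M.smult_assoc1 del: Witt_carrier)
    then show "a \<odot>\<^bsub>M\<^esub> x \<in> adj H g" unfolding adj_def using x a HE(4) M.R.m_closed by blast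
  qed
  show "H \<subseteq> adj H g"
  proof
    fix h assume h: "h \<in> H"
    then have "h = h \<oplus>\<^bsub>M\<^esub> \<zero>\<^bsub>Witt p K\<^esub> \<odot>\<^bsub>M\<^esub> g" using HE(1) g by (auto simp del: Witt_carrier)
    then show "h \<in> adj H g" unfolding adj_def using h M.R.zero_closed by blast
  qed
  have "g = \<zero>\<^bsub>M\<^esub> \<oplus>\<^bsub>M\<^esub> \<one>\<^bsub>Witt p K\<^esub> \<odot>\<^bsub>M\<^esub> g" using g by simp
  then show "g \<in> adj H g" unfolding adj_def using z M.R.one_closed by blast
qed

text \<open>The quotient of \<open>adj H g\<close> by \<open>H\<close> is generated by one element
  that p annihilates, so over the residue field k it has dimension at most one.\<close>

lemma adj_simple:
  assumes H: "submodule H (Witt p K) M" and g: "g \<in> carrier M" and pg: "[p] \<cdot>\<^bsub>M\<^esub> g \<in> H"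
    and L: "submodule L (Witt p K) M" "H \<subset> L" "L \<subseteq> adj H g"
  shows "L = adj H g"
proof -
  note HE = M.submoduleE[OF H] and LE = M.submoduleE[OF L(1)]
  obtain y where y: "y \<in> L" "y \<notin> H" using L(2) by blast
  then obtain h c where hc: "y = h \<oplus>\<^bsub>M\<^esub> c \<odot>\<^bsub>M\<^esub> g" "h \<in> H" "c \<in> carrier (Witt p K)"
    using L(3) by (auto simp: adj_def)
  have car: "h \<in> carrier M" "c \<odot>\<^bsub>M\<^esub> g \<in> carrier M" using hc HE(1) g by auto
  have "c \<odot>\<^bsub>M\<^esub> g = \<ominus>\<^bsub>M\<^esub> h \<oplus>\<^bsub>M\<^esub> y" using hc(1) car by (simp add: M.a_assoc[symmetric] M.l_neg)
  moreover have "\<ominus>\<^bsub>M\<^esub> h \<in> L" using HE(3) hc L(2) by blast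
  ultimately have cg: "c \<odot>\<^bsub>M\<^esub> g \<in> L" using LE(5) y by simp
  \<comment> \<open>Otherwise \<open>c\<close> is a multiple of p, and its multiple of
    \<open>g\<close> lies in \<open>H\<close> together with p times \<open>g\<close>, which puts
    \<open>y\<close> into \<open>H\<close>.\<close>
  have "c 0 \<noteq> \<zero>\<^bsub>K\<^esub>"
  proof
    assume "c 0 = \<zero>\<^bsub>K\<^esub>"
    then obtain d where d: "d \<in> carrier (Witt p K)" "c = [p] \<cdot>\<^bsub>Witt p K\<^esub> d" using Witt_p_divides hc by metis
    then have "c \<odot>\<^bsub>M\<^esub> g \<in> H" using p_smult[OF d(1) g, of p] HE(4) pg by simp
    then show False using y hc HE(5) by blast
  qed
  then obtain d e where de: "d \<in> carrier (Witt p K)" "e \<in> carrier (Witt p K)"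
    "\<one>\<^bsub>Witt p K\<^esub> = [p] \<cdot>\<^bsub>Witt p K\<^esub> e \<oplus>\<^bsub>Witt p K\<^esub> d \<otimes>\<^bsub>Witt p K\<^esub> c" using Witt_unit_mod_p hc by metis
  have "g = \<one>\<^bsub>Witt p K\<^esub> \<odot>\<^bsub>M\<^esub> g" using g by simp
  also have "\<dots> = e \<odot>\<^bsub>M\<^esub> ([p] \<cdot>\<^bsub>M\<^esub> g) \<oplus>\<^bsub>M\<^esub> d \<odot>\<^bsub>M\<^esub> (c \<odot>\<^bsub>M\<^esub> g)"
    unfolding de(3) using de hc g by (simp add: M.smult_l_distr p_smult M.smult_assoc1 del: Witt_carrier)
  also have "\<dots> \<in> L" using LE(4,5) de cg pg L(2) by blast
  finally have "adj H g \<subseteq> L" using L by (intro adj_least) auto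
  then show ?thesis using L by simp
qed

lemma finite_length_adj:
  assumes H: "submodule H (Witt p K) M" "finite_length (Witt p K) M H" and g: "g \<in> carrier M"
    and pg: "[p] \<cdot>\<^bsub>M\<^esub> g \<in> H"
  shows "finite_length (Witt p K) M (adj H g)"
proof (rule finite_length_extend[OF H(2) adj_submodule(1)[OF H(1) g]])
  show "H = adj H g \<or> H \<subset> adj H g \<and> \<not> (\<exists>L. submodule L (Witt p K) M \<and> H \<subset> L \<and> L \<subset> adj H g)"
    using adj_submodule(2)[OF H(1) g] adj_simple[OF H(1) g pg] by blast
qed

lemma submodule_inter:
  assumes "X \<subseteq> carrier M"
  shows "submodule (submodule_span (Witt p K) M X) (Witt p K) M" "X \<subseteq> submodule_span (Witt p K) M X"
proof -
  have c: "submodule (carrier M) (Witt p K) M" by (rule M.carrier_is_submodule)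
  have z: "\<zero>\<^bsub>M\<^esub> \<in> N" if "submodule N (Witt p K) M" for N
    using M.submoduleE(2,4)[OF that] M.submoduleE(1)[OF that] M.smult_l_null by (metis M.R.zero_closed ex_in_conv subsetD)
  show "submodule (submodule_span (Witt p K) M X) (Witt p K) M"
    unfolding submodule_span_def
  proof (rule M.submoduleI)
    show "\<Inter> {N. submodule N (Witt p K) M \<and> X \<subseteq> N} \<subseteq> carrier M" using c assms by blast
    show "\<zero>\<^bsub>M\<^esub> \<in> \<Inter> {N. submodule N (Witt p K) M \<and> X \<subseteq> N}" using z by blast
  qed (auto dest: M.submoduleE(3,4,5) simp del: Witt_carrier)
  show "X \<subseteq> submodule_span (Witt p K) M X" by (auto simp: submodule_span_def)
qed

text \<open>F and V commute with product p, so an element killed by V^k is killed by p^k. The span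
  of the V^i(x) is then generated by finitely many elements of p-power torsion and is exhausted by
  adjoining one element at a time, each step having length at most one.\<close>

lemma p_adic_of_V_nilpotent:
  assumes nil: "\<And>x. x \<in> carrier M \<Longrightarrow> \<exists>n. (dV M ^^ n) x = \<zero>\<^bsub>M\<^esub>"
  shows "p_adic p K M"
  unfolding p_adic_def
proof
  fix x assume x: "x \<in> carrier M"
  obtain n where n: "(dV M ^^ n) x = \<zero>\<^bsub>M\<^esub>" using nil x by blast
  have D: "\<And>x. x \<in> carrier M \<Longrightarrow> dF M x \<in> carrier M \<and> dV M x \<in> carrier M"
    "\<And>x y. x \<in> carrier M \<Longrightarrow> y \<in> carrier M \<Longrightarrow> dF M (x \<oplus>\<^bsub>M\<^esub> y) = dF M x \<oplus>\<^bsub>M\<^esub> dF M y"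
    "\<And>x y. x \<in> carrier M \<Longrightarrow> y \<in> carrier M \<Longrightarrow> dV M (x \<oplus>\<^bsub>M\<^esub> y) = dV M x \<oplus>\<^bsub>M\<^esub> dV M y"
    "\<And>x. x \<in> carrier M \<Longrightarrow> dF M (dV M x) = [p] \<cdot>\<^bsub>M\<^esub> x" "\<And>x. x \<in> carrier M \<Longrightarrow> dV M (dF M x) = [p] \<cdot>\<^bsub>M\<^esub> x"
    using M unfolding dieudonne_module_def by blast+
  have Vc: "(dV M ^^ i) y \<in> carrier M" if "y \<in> carrier M" for i y using that by (induction i) (auto simp: D)
  have F0: "dF M \<zero>\<^bsub>M\<^esub> = \<zero>\<^bsub>M\<^esub>" "dV M \<zero>\<^bsub>M\<^esub> = \<zero>\<^bsub>M\<^esub>"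
    using D(2)[of "\<zero>\<^bsub>M\<^esub>" "\<zero>\<^bsub>M\<^esub>"] D(3)[of "\<zero>\<^bsub>M\<^esub>" "\<zero>\<^bsub>M\<^esub>"] D(1)[of "\<zero>\<^bsub>M\<^esub>"]
    by (metis M.add.r_cancel_one M.l_zero M.zero_closed)+
  have V0: "(dV M ^^ i) \<zero>\<^bsub>M\<^esub> = \<zero>\<^bsub>M\<^esub>" for i by (induction i) (auto simp: F0)
  have VF: "(dV M ^^ i) (dF M y) = dF M ((dV M ^^ i) y)" if "y \<in> carrier M" for i y
    using that by (induction i) (auto simp: D Vc)
  \<comment> \<open>p^k equals F^k V^k; one factor p = F V is split off in each step, and F commutes
    with powers of V.\<close>
  have kill: "[(p ^ k)] \<cdot>\<^bsub>M\<^esub> y = \<zero>\<^bsub>M\<^esub>" if "y \<in> carrier M" "(dV M ^^ k) y = \<zero>\<^bsub>M\<^esub>" for k y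
    using that
  proof (induction k arbitrary: y)
    case (Suc k)
    have "[(p ^ Suc k)] \<cdot>\<^bsub>M\<^esub> y = [(p ^ k)] \<cdot>\<^bsub>M\<^esub> ([p] \<cdot>\<^bsub>M\<^esub> y)"
      using Suc.prems M.add.nat_pow_pow[of y "p ^ k" p] by (simp add: mult.commute)
    also have "[p] \<cdot>\<^bsub>M\<^esub> y = dF M (dV M y)" using Suc.prems D by simp
    also have "[(p ^ k)] \<cdot>\<^bsub>M\<^esub> (dF M (dV M y)) = \<zero>\<^bsub>M\<^esub>"
    proof (rule Suc.IH)
      have "(dV M ^^ k) (dV M y) = \<zero>\<^bsub>M\<^esub>" using Suc.prems(2) by (simp add: funpow_swap1)
      then show "(dV M ^^ k) (dF M (dV M y)) = \<zero>\<^bsub>M\<^esub>" using VF[of "dV M y" k] D Suc.prems F0 by simp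
    qed (use D Suc.prems in auto)
    finally show ?case .
  qed simp
  have Vadd: "(dV M ^^ (n + i)) x = \<zero>\<^bsub>M\<^esub>" for i
    using n V0 by (simp add: add.commute[of n] funpow_add)
  let ?S = "submodule_span (Witt p K) M (range (\<lambda>i::nat. (dV M ^^ i) x))"
  have rc: "range (\<lambda>i::nat. (dV M ^^ i) x) \<subseteq> carrier M" using Vc x by auto
  note S = submodule_inter[OF rc]
  \<comment> \<open>The submodules reached on the way: of finite length and contained in the
    span.\<close>
  define P where "P H \<longleftrightarrow> submodule H (Witt p K) M \<and> finite_length (Witt p K) M H \<and> H \<subseteq> ?S" for H
  \<comment> \<open>The elements p^(k-1) y, ..., p y, y are adjoined in this order, so that the
    p-multiple of each is already present.\<close>
  have step: "\<exists>H'. P H' \<and> H \<subseteq> H' \<and> y \<in> H'" if "P H" "y \<in> ?S" "[(p ^ k)] \<cdot>\<^bsub>M\<^esub> y \<in> H" for H y k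
    using that
  proof (induction k arbitrary: y)
    case 0
    then have "y \<in> H" using M.submoduleE(1)[OF S(1)] by auto
    then show ?case using 0 by blast
  next
    case (Suc k)
    have yc: "y \<in> carrier M" using Suc.prems M.submoduleE(1)[OF S(1)] by blast
    have "[(p ^ Suc k)] \<cdot>\<^bsub>M\<^esub> y = [(p ^ k)] \<cdot>\<^bsub>M\<^esub> ([p] \<cdot>\<^bsub>M\<^esub> y)"
      using yc M.add.nat_pow_pow[of y "p ^ k" p] by (simp add: mult.commute)
    moreover have "[p] \<cdot>\<^bsub>M\<^esub> y \<in> ?S"
    proof -
      have "[m] \<cdot>\<^bsub>M\<^esub> y = ([m] \<cdot>\<^bsub>Witt p K\<^esub> \<one>\<^bsub>Witt p K\<^esub>) \<odot>\<^bsub>M\<^esub> y" for m :: nat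
        using yc p_smult[OF M.R.one_closed yc, of m] by (simp del: Witt_carrier)
      then show ?thesis using M.submoduleE(4)[OF S(1)] Suc.prems(2) by (simp del: Witt_carrier)
    qed
    ultimately obtain H1 where H1: "P H1" "H \<subseteq> H1" "[p] \<cdot>\<^bsub>M\<^esub> y \<in> H1"
      using Suc.IH[of "[p] \<cdot>\<^bsub>M\<^esub> y"] Suc.prems by auto
    then have "P (adj H1 y)"
      using finite_length_adj[OF _ _ yc] adj_submodule(1)[OF _ yc] adj_least[OF S(1), of H1 y] Suc.prems(2)
      by (auto simp: P_def)
    then show ?case using H1 adj_submodule(2,3)[OF _ yc, of H1] by (auto simp: P_def)
  qed
  have "submodule {\<zero>\<^bsub>M\<^esub>} (Witt p K) M"
    by (rule M.submoduleI) (auto simp del: Witt_carrier)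
  then have P0: "P {\<zero>\<^bsub>M\<^esub>}"
    unfolding P_def finite_length_def using M.submoduleE[OF S(1)] S
    by (auto intro!: exI[of _ "0::nat"] exI[of _ "\<lambda>_. {\<zero>\<^bsub>M\<^esub>}"]) (metis V0 Vadd rangeI subsetD)
  \<comment> \<open>The generators V^i(x) are taken in one after another; from i = n on they are
    zero.\<close>
  have "\<exists>H. P H \<and> (\<forall>i<m. (dV M ^^ i) x \<in> H)" for m
  proof (induction m)
    case (Suc m)
    then obtain H where H: "P H" "\<forall>i<m. (dV M ^^ i) x \<in> H" by blast
    have "(dV M ^^ n) ((dV M ^^ m) x) = \<zero>\<^bsub>M\<^esub>"
      using Vadd[of m] by (simp add: funpow_add)
    then have "[(p ^ n)] \<cdot>\<^bsub>M\<^esub> ((dV M ^^ m) x) = \<zero>\<^bsub>M\<^esub>" using kill Vc[OF x] by blast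
    moreover have "\<zero>\<^bsub>M\<^esub> \<in> H"
      using H(1) submodule.axioms(1) subgroup.one_closed unfolding P_def by fastforce
    ultimately obtain H' where "P H'" "H \<subseteq> H'" "(dV M ^^ m) x \<in> H'"
      using step[OF H(1), of "(dV M ^^ m) x" n] S(2) by auto
    then show ?case using H(2) by (auto simp: less_Suc_eq)
  qed (use P0 in auto)
  then obtain H where H: "P H" "\<forall>i<n. (dV M ^^ i) x \<in> H" by blast
  have "(dV M ^^ i) x \<in> H" for i
  proof (cases "i < n")
    case False
    then obtain j where "i = n + j" using le_Suc_ex not_less by blast
    moreover have "\<zero>\<^bsub>M\<^esub> \<in> H"
      using H(1) submodule.axioms(1) subgroup.one_closed unfolding P_def by fastforce
    ultimately show ?thesis using Vadd by simp
  qed (use H in blast)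
  then have "?S \<subseteq> H" using H(1) unfolding submodule_span_def P_def by blast
  then have "H = ?S" using H(1) unfolding P_def by blast
  then show "finite_length (Witt p K) M ?S" using H(1) unfolding P_def by blast
qed

end

end

section \<open>Truncated and unipotent co-Witt vectors\<close>

context polar_perf
begin

lemma nilpotent_sub_zero: "nilpotent_sub 0 {\<zero>\<^bsub>A\<^esub>}"
proof -
  have "it xs = \<zero>\<^bsub>A\<^esub>" if xs: "set xs \<subseteq> {\<zero>\<^bsub>A\<^esub>}" "polar_degree p (length xs)" for xs
  proof -
    obtain x ys where xs': "xs = x # ys" using xs(2) polar_degree_pos by (cases xs) auto
    then have "x = \<zero>\<^bsub>A\<^esub>" "set ys \<subseteq> carrier A" "polar_degree p (Suc (length ys))" using xs by auto
    then show ?thesis using it_zero xs' by simp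
  qed
  then show ?thesis by (auto simp: nilpotent_sub_def nilpotent_set_def)
qed

definition bounded_by :: "nat \<Rightarrow> (nat \<Rightarrow> 'a) set" where
  "bounded_by N = {a. (\<forall>n. a n \<in> carrier A) \<and> (\<forall>n\<ge>N. a n = \<zero>\<^bsub>A\<^esub>)}"

lemma conv_bounded_by:
  assumes "conv {\<zero>\<^bsub>A\<^esub>} N u a" shows "a \<in> bounded_by N"
proof -
  have "a n \<in> carrier A" for n by (rule conv_carrier(1)[OF assms])
  moreover have "a n = \<zero>\<^bsub>A\<^esub>" if "N \<le> n" for n using conv_carrier(2)[OF assms that] by (rule singletonD)
  ultimately show ?thesis unfolding bounded_by_def by blast
qed

lemma bounded_by_conv: "a \<in> bounded_by N \<longleftrightarrow> conv {\<zero>\<^bsub>A\<^esub>} N (rv a) a"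
proof
  assume "a \<in> bounded_by N"
  then show "conv {\<zero>\<^bsub>A\<^esub>} N (rv a) a" by (intro conv_rv) (simp_all add: bounded_by_def)
qed (rule conv_bounded_by)

lemma bounded_by_cwcar: "a \<in> bounded_by N \<Longrightarrow> a \<in> cwcar"
  unfolding bounded_by_conv using conv_carrier_nilpotent_set nilpotent_sub_nilpotent_set[OF nilpotent_sub_zero] by blast

lemma bounded_by_mono: "N \<le> N' \<Longrightarrow> bounded_by N \<subseteq> bounded_by N'"
  by (auto simp: bounded_by_def)

lemma bounded_by_closed:
  assumes "a \<in> bounded_by N"
  shows "b \<in> bounded_by N \<Longrightarrow> cwadd a b \<in> bounded_by N"
    and "c \<in> carrier (Witt p K) \<Longrightarrow> cwsmult c a \<in> bounded_by N"
    and "cwF a \<in> bounded_by N" and "cwV a \<in> bounded_by N"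
proof -
  note a = assms[unfolded bounded_by_conv]
  show "cwadd a b \<in> bounded_by N" if "b \<in> bounded_by N"
    by (rule conv_bounded_by[OF cwadd_conv[OF nilpotent_sub_zero a that[unfolded bounded_by_conv]]])
  show "cwsmult c a \<in> bounded_by N" if "c \<in> carrier (Witt p K)"
    by (rule conv_bounded_by[OF cwsmult_conv[OF nilpotent_sub_zero that a]])
  show "cwF a \<in> bounded_by N" by (rule conv_bounded_by[OF cwF_conv[OF nilpotent_sub_zero a]])
  show "cwV a \<in> bounded_by N" by (rule conv_bounded_by[OF cwV_conv[OF nilpotent_sub_zero a]])
qed

lemma zero_bounded_by: "(\<lambda>_. \<zero>\<^bsub>A\<^esub>) \<in> bounded_by N"
  by (simp add: bounded_by_def)

lemma cwV_funpow: "(cwV ^^ n) a = (\<lambda>i. a (i + n))"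
  by (induction n) (auto simp: cwV_def)

lemma frob_funpow_closed: "c \<in> carrier (Witt p K) \<Longrightarrow> (frob p K ^^ n) c \<in> carrier (Witt p K)"
  by (induction n) (auto simp del: Witt_carrier)
lemma frob_funpow_add: "c \<in> carrier (Witt p K) \<Longrightarrow> d \<in> carrier (Witt p K) \<Longrightarrow>
    (frob p K ^^ n) (c \<oplus>\<^bsub>Witt p K\<^esub> d) = (frob p K ^^ n) c \<oplus>\<^bsub>Witt p K\<^esub> (frob p K ^^ n) d"
  by (induction n) (simp_all add: frob_add frob_funpow_closed del: Witt_carrier)
lemma frob_funpow_mult: "c \<in> carrier (Witt p K) \<Longrightarrow> d \<in> carrier (Witt p K) \<Longrightarrow>
    (frob p K ^^ n) (c \<otimes>\<^bsub>Witt p K\<^esub> d) = (frob p K ^^ n) c \<otimes>\<^bsub>Witt p K\<^esub> (frob p K ^^ n) d"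
  by (induction n) (simp_all add: frob_mult frob_funpow_closed del: Witt_carrier)
lemma frob_funpow_one: "(frob p K ^^ n) \<one>\<^bsub>Witt p K\<^esub> = \<one>\<^bsub>Witt p K\<^esub>"
  by (induction n) (simp_all add: frob_one)

lemma \<sigma>_frob_funpow: "c \<in> carrier (Witt p K) \<Longrightarrow> \<sigma> (d + n) ((frob p K ^^ n) c) = \<sigma> d c"
proof (induction n)
  case (Suc n)
  then have "\<sigma> (d + Suc n) ((frob p K ^^ Suc n) c) = \<sigma> (d + n) (frob_inv p K (frob p K ((frob p K ^^ n) c)))"
    by (simp add: funpow_swap1)
  then show ?case using Suc by (simp add: frob_inv_frob frob_funpow_closed del: Witt_carrier)
qed simp

lemma frob_\<sigma>_funpow: "c \<in> carrier (Witt p K) \<Longrightarrow> (frob p K ^^ n) (\<sigma> n c) = c"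
proof (induction n arbitrary: c)
  case (Suc n)
  have "(frob p K ^^ Suc n) (\<sigma> (Suc n) c) = (frob p K ^^ n) (frob p K (\<sigma> (Suc n) c))" by (simp add: funpow_swap1)
  also have "\<dots> = (frob p K ^^ n) (\<sigma> n c)" using frob_\<sigma>_Suc[OF Suc.prems, of n] by simp
  finally show ?case using Suc by simp
qed simp

text \<open>The inclusion of $W_n$ into $CW^u$ is semilinear: on the $n$th term of the colimit \<open>c\<close> acts through
  $\mathrm{frob}^{1-n}(c)$.\<close>

definition WnA :: "nat \<Rightarrow> (nat \<Rightarrow> 'k, nat \<Rightarrow> 'a) dieudonne" where
  "WnA n = CWA \<lparr> carrier := bounded_by n, smult := \<lambda>c. cwsmult ((frob p K ^^ (n - 1)) c) \<rparr>"

lemma WnA_simps [simp]: "carrier (WnA n) = bounded_by n" "\<zero>\<^bsub>WnA n\<^esub> = (\<lambda>_. \<zero>\<^bsub>A\<^esub>)" "add (WnA n) = cwadd"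
  "smult (WnA n) c = cwsmult ((frob p K ^^ (n - 1)) c)" "dF (WnA n) = cwF" "dV (WnA n) = cwV"
  using CWA_simps by (simp_all add: WnA_def)

lemma WnA_pullback: "dieudonne_pullback p K CWA (WnA n) (frob p K ^^ (n - 1)) (\<lambda>x. x)"
  by unfold_locales
    (simp_all add: CWA_dieudonne frob_funpow_closed frob_funpow_add frob_funpow_mult frob_funpow_one
      bounded_by_cwcar zero_bounded_by bounded_by_closed funpow_swap1 del: Witt_carrier)

lemma WnA_dieudonne: "dieudonne_module p K (WnA n)"
  by (rule dieudonne_pullback.dieudonne_M[OF WnA_pullback])

lemma WnA_p_adic: "p_adic p K (WnA n)"
proof (rule p_adic_of_V_nilpotent[OF WnA_dieudonne])
  fix x assume "x \<in> carrier (WnA n)"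
  then show "\<exists>m. (dV (WnA n) ^^ m) x = \<zero>\<^bsub>WnA n\<^esub>"
    by (intro exI[of _ n]) (simp add: cwV_funpow bounded_by_def)
qed

text \<open>The type of the elements of \<open>CWuA\<close> is the one of the elements of a colimit, hence the encoding of
  a sequence \<open>a\<close> as \<open>{(0, a)}\<close>.\<close>

definition enc :: "(nat \<Rightarrow> 'a) \<Rightarrow> (nat \<times> (nat \<Rightarrow> 'a)) set" where "enc a = {(0, a)}"
definition dec :: "(nat \<times> (nat \<Rightarrow> 'a)) set \<Rightarrow> nat \<Rightarrow> 'a" where "dec X = snd (the_elem X)"

lemma dec_enc [simp]: "dec (enc a) = a" by (simp add: enc_def dec_def)

lemma enc_image_iff [simp]: "enc a \<in> enc ` S \<longleftrightarrow> a \<in> S" by (auto simp: enc_def)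

definition CWuA :: "(nat \<Rightarrow> 'k, (nat \<times> (nat \<Rightarrow> 'a)) set) dieudonne" where
  "CWuA = \<lparr> carrier = enc ` (\<Union>N. bounded_by N), mult = undefined, one = undefined,
     zero = enc (\<lambda>_. \<zero>\<^bsub>A\<^esub>), add = (\<lambda>X Y. enc (cwadd (dec X) (dec Y))),
     smult = (\<lambda>c X. enc (cwsmult c (dec X))), dF = (\<lambda>X. enc (cwF (dec X))), dV = (\<lambda>X. enc (cwV (dec X))) \<rparr>"

lemma CWuA_simps [simp]: "carrier CWuA = enc ` (\<Union>N. bounded_by N)" "\<zero>\<^bsub>CWuA\<^esub> = enc (\<lambda>_. \<zero>\<^bsub>A\<^esub>)"
  "add CWuA X Y = enc (cwadd (dec X) (dec Y))" "smult CWuA c X = enc (cwsmult c (dec X))"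
  "dF CWuA X = enc (cwF (dec X))" "dV CWuA X = enc (cwV (dec X))"
  by (simp_all add: CWuA_def)

lemma bounded_by_common:
  assumes "a \<in> bounded_by N" "b \<in> bounded_by N'" obtains N'' where "a \<in> bounded_by N''" "b \<in> bounded_by N''"
  using that[of "max N N'"] assms bounded_by_mono[of N "max N N'"] bounded_by_mono[of N' "max N N'"] by auto

lemma fin_closed:
  assumes "a \<in> bounded_by N"
  shows "c \<in> carrier (Witt p K) \<Longrightarrow> \<exists>N. cwsmult c a \<in> bounded_by N"
    and "\<exists>N. cwF a \<in> bounded_by N" and "\<exists>N. cwV a \<in> bounded_by N"
proof -
  show "\<exists>N. cwsmult c a \<in> bounded_by N" if "c \<in> carrier (Witt p K)"
    using bounded_by_closed(2)[OF assms that] by blast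
  show "\<exists>N. cwF a \<in> bounded_by N" using bounded_by_closed(3)[OF assms] by blast
  show "\<exists>N. cwV a \<in> bounded_by N" using bounded_by_closed(4)[OF assms] by blast
qed

lemma CWuA_pullback: "dieudonne_pullback p K CWA CWuA (\<lambda>c. c) dec"
proof unfold_locales
  fix x y assume "x \<in> carrier CWuA" "y \<in> carrier CWuA"
  then obtain a b N N' where x: "x = enc a" "a \<in> bounded_by N" and y: "y = enc b" "b \<in> bounded_by N'" by auto
  obtain N'' where "a \<in> bounded_by N''" "b \<in> bounded_by N''" using bounded_by_common[OF x(2) y(2)] .
  then have "cwadd a b \<in> bounded_by N''" by (rule bounded_by_closed(1))
  then show "x \<oplus>\<^bsub>CWuA\<^esub> y \<in> carrier CWuA \<and> dec (x \<oplus>\<^bsub>CWuA\<^esub> y) = dec x \<oplus>\<^bsub>CWA\<^esub> dec y"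
    using x y by auto
qed (auto simp: CWA_dieudonne inj_on_def bounded_by_cwcar zero_bounded_by
    simp del: Witt_carrier intro: fin_closed)

lemma CWuA_dieudonne: "dieudonne_module p K CWuA"
  by (rule dieudonne_pullback.dieudonne_M[OF CWuA_pullback])

lemma CWuA_p_adic: "p_adic p K CWuA"
proof (rule p_adic_of_V_nilpotent[OF CWuA_dieudonne])
  fix x assume "x \<in> carrier CWuA"
  then obtain a N where x: "x = enc a" "a \<in> bounded_by N" by auto
  have "(dV CWuA ^^ m) (enc a) = enc ((cwV ^^ m) a)" for m
    by (induction m) auto
  then show "\<exists>m. (dV CWuA ^^ m) x = \<zero>\<^bsub>CWuA\<^esub>"
    using x by (intro exI[of _ N]) (simp add: cwV_funpow bounded_by_def)
qed

end

section \<open>Functoriality\<close>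

locale polar_hom = A: polar_perf p K A + B: polar_perf p K B
  for p :: nat and K :: "'k ring" and A :: "('k, 'a) polar" and B :: "('k, 'a) polar" +
  fixes f :: "'a \<Rightarrow> 'a"
  assumes lin: "linear_map K A B f"
    and mu: "\<And>xs. set xs \<subseteq> carrier A \<Longrightarrow> length xs = p \<Longrightarrow> f (mu A xs) = mu B (map f xs)"
begin

lemma f_closed [simp]: "x \<in> carrier A \<Longrightarrow> f x \<in> carrier B" using lin by (simp add: linear_map_def)
lemma f_add: "x \<in> carrier A \<Longrightarrow> y \<in> carrier A \<Longrightarrow> f (x \<oplus>\<^bsub>A\<^esub> y) = f x \<oplus>\<^bsub>B\<^esub> f y"
  using lin by (simp add: linear_map_def)
lemma f_smult: "c \<in> carrier K \<Longrightarrow> x \<in> carrier A \<Longrightarrow> f (c \<odot>\<^bsub>A\<^esub> x) = c \<odot>\<^bsub>B\<^esub> f x"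
  using lin by (simp add: linear_map_def)
lemma f_zero [simp]: "f \<zero>\<^bsub>A\<^esub> = \<zero>\<^bsub>B\<^esub>"
  using f_smult[of "\<zero>\<^bsub>K\<^esub>" "\<zero>\<^bsub>A\<^esub>"] by simp

lemma f_it: "polar_degree p (length xs) \<Longrightarrow> set xs \<subseteq> carrier A \<Longrightarrow> f (A.it xs) = B.it (map f xs)"
proof (induction xs rule: length_induct)
  case (1 xs)
  obtain x ys where xs: "xs = x # ys" using 1(2) polar_degree_pos by (cases xs) auto
  show ?case
  proof (cases "ys = []")
    case False
    then have g: "p - 1 \<le> length ys" "polar_degree p (Suc (length ys - (p - 1)))"
      using polar_degree_step[OF A.p2, of "length ys"] 1(2) xs by auto
    have l: "p \<le> length xs" using g A.p2 xs by simp
    have "Suc (length xs - p) = Suc (length ys - (p - 1))" using xs g A.p2 by simp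
    then have "f (A.it (mu A (take p xs) # drop p xs)) = B.it (map f (mu A (take p xs) # drop p xs))"
      using g A.p2 xs A.step_closed[OF l 1(3)] by (intro 1(1)[rule_format]) (auto simp del: diff_Suc_1)
    moreover have "f (mu A (take p xs)) = mu B (take p (map f xs))"
      using l 1(3) set_take_subset[of p xs] by (subst mu) (auto simp: take_map)
    ultimately show ?thesis using l by (simp add: A.it_step B.it_step drop_map)
  qed (use xs in simp)
qed

lemma f_evl:
  assumes "set xs \<subseteq> A.letters" "polar_degree p (length (rights xs))"
  shows "f (A.evl xs) = B.evl (map (map_sum id f) xs)"
  using assms A.letters_lefts[OF assms(1)] A.letters_rights[OF assms(1)]
  by (simp add: A.evl_def B.evl_def lefts_map rights_map f_smult f_it A.it_closed A.R.mprod_closed)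

lemma f_peval:
  assumes "\<And>v. \<nu> v \<in> A.letters" "\<And>m. m \<in> kys Q \<Longrightarrow> A.polar_at \<nu> m"
  shows "f (A.peval \<nu> Q) = B.peval (\<lambda>v. map_sum id f (\<nu> v)) Q"
proof -
  have t: "set (map \<nu> xs) \<subseteq> A.letters" for xs using assms(1) by auto
  have "f (lin A (\<lambda>m. A.evl (map \<nu> (mlist m))) Q) = lin B (\<lambda>m. f (A.evl (map \<nu> (mlist m)))) Q"
    by (rule A.M.lin_hom) (use f_add assms B.M.abelian_group_axioms in \<open>auto simp: A.polar_at_def intro!: A.evl_closed\<close>)
  also have "\<dots> = lin B (\<lambda>m. B.evl (map (\<lambda>v. map_sum id f (\<nu> v)) (mlist m))) Q"
  proof (rule B.M.lin_cong)
    fix m assume "m \<in> kys Q"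
    then have g: "polar_degree p (length (rights (map \<nu> (mlist m))))" using assms(2) by (simp add: A.polar_at_def)
    show "f (A.evl (map \<nu> (mlist m))) = B.evl (map (\<lambda>v. map_sum id f (\<nu> v)) (mlist m))"
      using f_evl[OF t g] by (simp add: comp_def)
    then show "B.evl (map (\<lambda>v. map_sum id f (\<nu> v)) (mlist m)) \<in> carrier B"
      using A.evl_closed[OF t g] by (metis f_closed)
  qed
  finally show ?thesis by (simp add: A.peval_def B.peval_def)
qed

lemma f_padd:
  assumes "x \<in> A.WA" "y \<in> A.WA" shows "f (A.padd x y i) = B.padd (\<lambda>i. f (x i)) (\<lambda>i. f (y i)) i"
proof -
  have e: "(\<lambda>v. map_sum id f (case_sum (\<lambda>i. Inr (x i)) (\<lambda>i. Inr (y i)) v)) =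
      (case_sum (\<lambda>i. Inr (f (x i))) (\<lambda>i. Inr (f (y i))) :: nat + nat \<Rightarrow> 'k + 'a)"
    by (auto simp: fun_eq_iff split: sum.splits)
  show ?thesis unfolding A.padd_def B.padd_def e[symmetric] using assms
    by (intro f_peval A.polar_at_witt_sum) (auto simp: A.WA_def split: sum.splits)
qed

lemma f_psmult:
  assumes "c \<in> carrier (Witt p K)" "x \<in> A.WA" shows "f (A.psmult c x i) = B.psmult c (\<lambda>i. f (x i)) i"
proof -
  have e: "(\<lambda>v. map_sum id f (map_sum c x v)) = map_sum c (\<lambda>i. f (x i))"
    by (auto simp: fun_eq_iff map_sum_def split: sum.splits)
  show ?thesis unfolding A.psmult_def B.psmult_def e[symmetric] using assms
    by (intro f_peval A.polar_at_witt_prod) (auto simp: A.WA_def map_sum_def split: sum.splits)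
qed

lemma f_rv: "(\<lambda>i. f (A.rv a N i)) = B.rv (\<lambda>n. f (a n)) N"
  by (auto simp: A.rv_def B.rv_def)

lemma f_cwcar: assumes "a \<in> A.cwcar" shows "(\<lambda>n. f (a n)) \<in> B.cwcar"
proof -
  obtain r s where n: "A.nilpotent_set s (a ` {r..})" using assms by (auto simp: A.cwcar_def)
  have "B.nilpotent_set s ((\<lambda>n. f (a n)) ` {r..})"
    unfolding B.nilpotent_set_def
  proof (intro conjI allI impI)
    show "(\<lambda>n. f (a n)) ` {r..} \<subseteq> carrier B" using assms by (auto simp: A.cwcar_def)
    fix xs assume xs: "set xs \<subseteq> (\<lambda>n. f (a n)) ` {r..} \<and> length xs = p ^ s"
    then have "\<exists>ys. xs = map f ys \<and> set ys \<subseteq> a ` {r..}"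
    proof -
      have "set zs \<subseteq> (\<lambda>n. f (a n)) ` {r..} \<Longrightarrow> \<exists>ys. zs = map f ys \<and> set ys \<subseteq> a ` {r..}" for zs
      proof (induction zs)
        case (Cons z zs)
        then obtain ys n where "zs = map f ys" "set ys \<subseteq> a ` {r..}" "z = f (a n)" "r \<le> n" by auto
        then show ?case by (intro exI[of _ "a n # ys"]) auto
      qed simp
      then show ?thesis using xs by blast
    qed
    then obtain ys where ys: "xs = map f ys" "set ys \<subseteq> a ` {r..}" by blast
    have "B.it xs = f (A.it ys)" unfolding ys(1)
      using ys xs n polar_degree_power[OF A.p2, of s] by (intro f_it[symmetric]) (auto simp: A.nilpotent_set_def)
    also have "A.it ys = \<zero>\<^bsub>A\<^esub>" using n ys xs by (auto simp: A.nilpotent_set_def)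
    finally show "B.it xs = \<zero>\<^bsub>B\<^esub>" by simp
  qed
  then show ?thesis using assms by (auto simp: A.cwcar_def B.cwcar_def)
qed

text \<open>Each entry of a limit is attained at some finite level, and there \<open>f\<close> only
  acts on the entries of a Witt vector.\<close>

lemma f_conv_lim:
  assumes "A.conv X r u a" "B.conv Y r' v b" "\<And>N i. f (u N i) = v N i"
  shows "(\<lambda>n. f (a n)) = b"
proof
  fix n
  have "\<forall>\<^sub>F N in sequentially. u N (N - n) = a n \<and> v N (N - n) = b n"
    using assms(1,2) unfolding A.conv_def B.conv_def by (intro eventually_conj) auto
  then obtain N where "u N (N - n) = a n \<and> v N (N - n) = b n"
    using eventually_happens'[OF sequentially_bot] by blast
  then show "f (a n) = b n" using assms(3) by metis
qed

lemma f_cwadd: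
  assumes "a \<in> A.cwcar" "b \<in> A.cwcar"
  shows "(\<lambda>n. f (A.cwadd a b n)) = B.cwadd (\<lambda>n. f (a n)) (\<lambda>n. f (b n))"
proof -
  have "\<exists>s r X. A.nilpotent_sub s X \<and> (\<forall>x\<in>set [a, b]. A.conv X r (A.rv x) x)"
    by (rule A.cwcar_common) (use assms in auto)
  then obtain s r X where *: "A.nilpotent_sub s X" "A.conv X r (A.rv a) a" "A.conv X r (A.rv b) b" by auto
  have "\<exists>s r X. B.nilpotent_sub s X \<and> (\<forall>x\<in>set [\<lambda>n. f (a n), \<lambda>n. f (b n)]. B.conv X r (B.rv x) x)"
    by (rule B.cwcar_common) (use assms f_cwcar in auto)
  then obtain s' r' Y where **: "B.nilpotent_sub s' Y" "B.conv Y r' (B.rv (\<lambda>n. f (a n))) (\<lambda>n. f (a n))"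
    "B.conv Y r' (B.rv (\<lambda>n. f (b n))) (\<lambda>n. f (b n))" by auto
  show ?thesis
    by (rule f_conv_lim[OF A.cwadd_conv[OF *] B.cwadd_conv[OF **]])
      (simp add: f_padd A.conv_WA[OF *(2)] A.conv_WA[OF *(3)] f_rv)
qed

lemma f_cwsmult:
  assumes c: "c \<in> carrier (Witt p K)" and "a \<in> A.cwcar"
  shows "(\<lambda>n. f (A.cwsmult c a n)) = B.cwsmult c (\<lambda>n. f (a n))"
proof -
  have "\<exists>s r X. A.nilpotent_sub s X \<and> (\<forall>x\<in>set [a]. A.conv X r (A.rv x) x)"
    by (rule A.cwcar_common) (use assms in auto)
  then obtain s r X where *: "A.nilpotent_sub s X" "A.conv X r (A.rv a) a" by auto
  have "\<exists>s r X. B.nilpotent_sub s X \<and> (\<forall>x\<in>set [\<lambda>n. f (a n)]. B.conv X r (B.rv x) x)"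
    by (rule B.cwcar_common) (use assms f_cwcar in auto)
  then obtain s' r' Y where **: "B.nilpotent_sub s' Y" "B.conv Y r' (B.rv (\<lambda>n. f (a n))) (\<lambda>n. f (a n))" by auto
  show ?thesis
    by (rule f_conv_lim[OF A.cwsmult_conv[OF *(1) c *(2)] B.cwsmult_conv[OF **(1) c **(2)]])
      (simp only: f_psmult[OF A.\<sigma>_closed[OF c] A.conv_WA[OF *(2)]] f_rv)
qed

lemma f_cwF: assumes "a \<in> A.cwcar" shows "(\<lambda>n. f (A.cwF a n)) = B.cwF (\<lambda>n. f (a n))"
proof
  fix n
  have "a n \<in> carrier A" using assms by (simp add: A.cwcar_def)
  then show "f (A.cwF a n) = B.cwF (\<lambda>n. f (a n)) n"
    unfolding A.cwF_def B.cwF_def by (subst mu) auto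
qed

lemma f_cwV: "(\<lambda>n. f (A.cwV a n)) = B.cwV (\<lambda>n. f (a n))"
  by (simp add: A.cwV_def B.cwV_def fun_eq_iff)

lemma f_bounded_by: "a \<in> A.bounded_by N \<Longrightarrow> (\<lambda>n. f (a n)) \<in> B.bounded_by N"
  by (auto simp: A.bounded_by_def B.bounded_by_def)

lemma hom_CWA: "dieudonne_hom p K A.CWA B.CWA (\<lambda>a n. f (a n))"
  by (simp add: dieudonne_hom_def linear_map_def f_cwcar f_cwadd f_cwsmult f_cwF f_cwV del: Witt_carrier)

lemma hom_WnA: "dieudonne_hom p K (A.WnA N) (B.WnA N) (\<lambda>a n. f (a n))"
  by (simp add: dieudonne_hom_def linear_map_def f_bounded_by A.bounded_by_cwcar f_cwadd f_cwsmult f_cwF f_cwV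
      A.frob_funpow_closed del: Witt_carrier)

lemma hom_CWuA: "dieudonne_hom p K A.CWuA B.CWuA (\<lambda>X. B.enc (\<lambda>n. f (A.dec X n)))"
  by (auto simp: dieudonne_hom_def linear_map_def A.bounded_by_cwcar f_cwadd f_cwsmult f_cwF f_cwV
      simp del: Witt_carrier intro!: f_bounded_by imageI)

end

section \<open>Categories\<close>

lemma dieudonne_closed:
  assumes "dieudonne_module p K M" "x \<in> carrier M"
  shows "y \<in> carrier M \<Longrightarrow> x \<oplus>\<^bsub>M\<^esub> y \<in> carrier M" "c \<in> carrier (Witt p K) \<Longrightarrow> c \<odot>\<^bsub>M\<^esub> x \<in> carrier M"
    "dF M x \<in> carrier M" "dV M x \<in> carrier M"
proof -
  interpret module "Witt p K" M using assms(1) by (simp add: dieudonne_module_def)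
  show "y \<in> carrier M \<Longrightarrow> x \<oplus>\<^bsub>M\<^esub> y \<in> carrier M" "c \<in> carrier (Witt p K) \<Longrightarrow> c \<odot>\<^bsub>M\<^esub> x \<in> carrier M"
    "dF M x \<in> carrier M" "dV M x \<in> carrier M"
    using assms unfolding dieudonne_module_def by (auto simp del: Witt_carrier)
qed

lemma dieudonne_homD:
  assumes "dieudonne_hom p K M N g" "x \<in> carrier M"
  shows "g x \<in> carrier N" "y \<in> carrier M \<Longrightarrow> g (x \<oplus>\<^bsub>M\<^esub> y) = g x \<oplus>\<^bsub>N\<^esub> g y"
    "c \<in> carrier (Witt p K) \<Longrightarrow> g (c \<odot>\<^bsub>M\<^esub> x) = c \<odot>\<^bsub>N\<^esub> g x"
    "g (dF M x) = dF N (g x)" "g (dV M x) = dV N (g x)"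
  using assms unfolding dieudonne_hom_def linear_map_def by blast+

lemma dieudonne_hom_restrict:
  assumes "dieudonne_module p K M" "dieudonne_hom p K M N g"
  shows "restrict g (carrier M) \<in> {h \<in> carrier M \<rightarrow>\<^sub>E carrier N. dieudonne_hom p K M N h}"
  using assms(2) dieudonne_closed[OF assms(1)]
  by (auto simp: dieudonne_hom_def linear_map_def simp del: Witt_carrier)

lemma is_functor_concrete:
  assumes obs: "\<And>M. M \<in> obs \<Longrightarrow> dieudonne_module p K M"
    and ob: "\<And>A. A \<in> Ob C \<Longrightarrow> S A \<in> obs"
    and arr: "\<And>A B f. A \<in> Ob C \<Longrightarrow> B \<in> Ob C \<Longrightarrow> f \<in> Hom C A B \<Longrightarrow> dieudonne_hom p K (S A) (S B) (g A B f)"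
    and id: "\<And>A x. A \<in> Ob C \<Longrightarrow> x \<in> carrier (S A) \<Longrightarrow> g A A (Id C A) x = x"
    and comp: "\<And>A B E f k x. A \<in> Ob C \<Longrightarrow> B \<in> Ob C \<Longrightarrow> E \<in> Ob C \<Longrightarrow> f \<in> Hom C A B \<Longrightarrow> k \<in> Hom C B E \<Longrightarrow>
      x \<in> carrier (S A) \<Longrightarrow> g A E (Comp C A k f) x = g B E k (g A B f x)"
  shows "is_functor C (concrete_category obs carrier (dieudonne_hom p K))
    \<lparr> on_ob = S, on_arr = (\<lambda>A B f. restrict (g A B f) (carrier (S A))) \<rparr>"
proof -
  have cl: "g A B f x \<in> carrier (S B)" if "A \<in> Ob C" "B \<in> Ob C" "f \<in> Hom C A B" "x \<in> carrier (S A)" for A B f x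
    using arr[OF that(1-3)] that(4) by (simp add: dieudonne_hom_def linear_map_def)
  show ?thesis
    unfolding is_functor_def concrete_category_def
    using dieudonne_hom_restrict[OF obs[OF ob] arr]
    by (auto simp: ob id comp compose_def cl fun_eq_iff restrict_def)
qed

lemma is_functor_comp:
  assumes "is_functor C D S" "is_functor D E T" shows "is_functor C E (T \<circ>\<^sub>F S)"
  using assms unfolding is_functor_def functor_comp_def by simp

text \<open>Functoriality of \<open>S\<close> is derived, not assumed: every equation required of
  \<open>S\<close> is mapped by the injective \<open>\<eta>\<close> to an equation that holds for
  \<open>T\<close>. So for the functors on algebras only the comparison bijections have to be
  supplied.\<close>

lemma naturally_isomorphic_concrete:
  assumes obs: "\<And>M. M \<in> obs \<Longrightarrow> dieudonne_module p K M"
    and D: "D = concrete_category obs carrier (dieudonne_hom p K)"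
    and T: "is_functor C D T"
    and C: "\<And>A. A \<in> Ob C \<Longrightarrow> Id C A \<in> Hom C A A"
      "\<And>A B E f k. A \<in> Ob C \<Longrightarrow> B \<in> Ob C \<Longrightarrow> E \<in> Ob C \<Longrightarrow> f \<in> Hom C A B \<Longrightarrow> k \<in> Hom C B E \<Longrightarrow> Comp C A k f \<in> Hom C A E"
    and ob: "\<And>A. A \<in> Ob C \<Longrightarrow> on_ob S A \<in> obs"
    and bij: "\<And>A. A \<in> Ob C \<Longrightarrow> bij_betw (\<eta> A) (carrier (on_ob S A)) (carrier (on_ob T A))"
    and hom: "\<And>A. A \<in> Ob C \<Longrightarrow> dieudonne_hom p K (on_ob S A) (on_ob T A) (\<eta> A)"
    and arr: "\<And>A B f. A \<in> Ob C \<Longrightarrow> B \<in> Ob C \<Longrightarrow> f \<in> Hom C A B \<Longrightarrow>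
      on_arr S A B f \<in> carrier (on_ob S A) \<rightarrow>\<^sub>E carrier (on_ob S B)"
    and nat: "\<And>A B f x. A \<in> Ob C \<Longrightarrow> B \<in> Ob C \<Longrightarrow> f \<in> Hom C A B \<Longrightarrow> x \<in> carrier (on_ob S A) \<Longrightarrow>
      \<eta> B (on_arr S A B f x) = on_arr T A B f (\<eta> A x)"
  shows "naturally_isomorphic C D S T"
proof -
  have D_simps: "Ob D = obs" "Hom D M N = {f \<in> carrier M \<rightarrow>\<^sub>E carrier N. dieudonne_hom p K M N f}"
    "Id D M = restrict (\<lambda>x. x) (carrier M)" "Comp D M h f = compose (carrier M) h f" for M N h f
    by (simp_all add: D concrete_category_def)
  note Tf = T[unfolded is_functor_def D_simps]
  have Tob: "on_ob T A \<in> obs" if "A \<in> Ob C" for A using Tf that by blast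
  have Tarr: "on_arr T A B f \<in> carrier (on_ob T A) \<rightarrow>\<^sub>E carrier (on_ob T B)"
    "dieudonne_hom p K (on_ob T A) (on_ob T B) (on_arr T A B f)" if "A \<in> Ob C" "B \<in> Ob C" "f \<in> Hom C A B" for A B f
    using Tf that by blast+
  have \<eta>c: "\<eta> A x \<in> carrier (on_ob T A)" if "A \<in> Ob C" "x \<in> carrier (on_ob S A)" for A x
    using bij[OF that(1)] that(2) by (auto dest: bij_betwE)
  have inj: "x = y" if "A \<in> Ob C" "x \<in> carrier (on_ob S A)" "y \<in> carrier (on_ob S A)" "\<eta> A x = \<eta> A y" for A x y
    using bij[OF that(1)] that by (auto simp: bij_betw_def dest: inj_onD)
  have cl: "on_arr S A B f x \<in> carrier (on_ob S B)"
    if "A \<in> Ob C" "B \<in> Ob C" "f \<in> Hom C A B" "x \<in> carrier (on_ob S A)" for A B f x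
    using arr[OF that(1-3)] that(4) by auto
  note dcl = dieudonne_closed[OF obs[OF ob]]
  have hom_arr: "dieudonne_hom p K (on_ob S A) (on_ob S B) (on_arr S A B f)"
    if A: "A \<in> Ob C" "B \<in> Ob C" "f \<in> Hom C A B" for A B f
  proof -
    note hA = dieudonne_homD[OF hom[OF A(1)]] and hB = dieudonne_homD[OF hom[OF A(2)]]
      and hT = dieudonne_homD[OF Tarr(2)[OF A]]
    show ?thesis
      unfolding dieudonne_hom_def linear_map_def
    proof (intro conjI ballI)
      fix x assume x: "x \<in> carrier (on_ob S A)"
      note fx = cl[OF A x]
      note n = nat[OF A x, symmetric]
      show "on_arr S A B f x \<in> carrier (on_ob S B)" by (rule fx)
      note dx = dcl[OF A(1) x] and dfx = dcl[OF A(2) fx]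
      show "on_arr S A B f (dF (on_ob S A) x) = dF (on_ob S B) (on_arr S A B f x)"
        by (rule inj[OF A(2) cl[OF A dx(3)] dfx(3)])
          (simp only: nat[OF A dx(3)] hA(4)[OF x] hB(4)[OF fx] hT(4)[OF \<eta>c[OF A(1) x]] n)
      show "on_arr S A B f (dV (on_ob S A) x) = dV (on_ob S B) (on_arr S A B f x)"
        by (rule inj[OF A(2) cl[OF A dx(4)] dfx(4)])
          (simp only: nat[OF A dx(4)] hA(5)[OF x] hB(5)[OF fx] hT(5)[OF \<eta>c[OF A(1) x]] n)
      fix y assume y: "y \<in> carrier (on_ob S A)"
      note fy = cl[OF A y]
      show "on_arr S A B f (x \<oplus>\<^bsub>on_ob S A\<^esub> y) = on_arr S A B f x \<oplus>\<^bsub>on_ob S B\<^esub> on_arr S A B f y"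
        by (rule inj[OF A(2) cl[OF A dx(1)[OF y]] dfx(1)[OF fy]])
          (simp only: nat[OF A dx(1)[OF y]] hA(2)[OF x y] hB(2)[OF fx fy] hT(2)[OF \<eta>c[OF A(1) x] \<eta>c[OF A(1) y]] n
            nat[OF A y, symmetric])
    next
      fix c x assume c: "c \<in> carrier (Witt p K)" and x: "x \<in> carrier (on_ob S A)"
      note dx = dcl(2)[OF A(1) x c]
      show "on_arr S A B f (c \<odot>\<^bsub>on_ob S A\<^esub> x) = c \<odot>\<^bsub>on_ob S B\<^esub> on_arr S A B f x"
        by (rule inj[OF A(2) cl[OF A dx] dcl(2)[OF A(2) cl[OF A x] c]])
          (simp only: nat[OF A dx] hA(3)[OF x c] hB(3)[OF cl[OF A x] c] hT(3)[OF \<eta>c[OF A(1) x] c] nat[OF A x])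
    qed
  qed
  have S: "is_functor C D S"
    unfolding is_functor_def D_simps
  proof (intro conjI ballI)
    fix A assume A: "A \<in> Ob C"
    show "on_ob S A \<in> obs" by (rule ob[OF A])
    have "on_arr T A A (Id C A) = restrict (\<lambda>x. x) (carrier (on_ob T A))" using Tf A by blast
    then have "on_arr S A A (Id C A) x = x" if "x \<in> carrier (on_ob S A)" for x
      using that A C(1)[OF A] by (intro inj[OF A cl]) (auto simp: nat \<eta>c)
    then show "on_arr S A A (Id C A) = restrict (\<lambda>x. x) (carrier (on_ob S A))"
      using arr[OF A A C(1)[OF A]] by (intro extensionalityI[of _ "carrier (on_ob S A)"]) (auto simp: PiE_def)
    fix B assume B: "B \<in> Ob C"
    show "on_arr S A B f \<in> {f \<in> carrier (on_ob S A) \<rightarrow>\<^sub>E carrier (on_ob S B). dieudonne_hom p K (on_ob S A) (on_ob S B) f}"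
      if "f \<in> Hom C A B" for f
      using arr[OF A B that] hom_arr[OF A B that] by simp
    fix E f k assume E: "E \<in> Ob C" and f: "f \<in> Hom C A B" and k: "k \<in> Hom C B E"
    have kf: "Comp C A k f \<in> Hom C A E" by (rule C(2)[OF A B E f k])
    have Tc: "on_arr T A E (Comp C A k f) = compose (carrier (on_ob T A)) (on_arr T B E k) (on_arr T A B f)"
      using Tf A B E f k by blast
    have "on_arr S A E (Comp C A k f) x = on_arr S B E k (on_arr S A B f x)" if x: "x \<in> carrier (on_ob S A)" for x
      by (rule inj[OF E cl[OF A E kf x] cl[OF B E k cl[OF A B f x]]])
        (simp add: nat[OF A E kf x] nat[OF B E k cl[OF A B f x]] nat[OF A B f x] Tc compose_def \<eta>c[OF A x])
    then show "on_arr S A E (Comp C A k f) = compose (carrier (on_ob S A)) (on_arr S B E k) (on_arr S A B f)"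
      using arr[OF A E kf] by (intro extensionalityI[of _ "carrier (on_ob S A)"]) (auto simp: compose_def PiE_def)
  qed
  let ?\<eta> = "\<lambda>A. restrict (\<eta> A) (carrier (on_ob S A))"
  have iso: "is_iso D (on_ob S A) (on_ob T A) (?\<eta> A)" if A: "A \<in> Ob C" for A
  proof -
    let ?\<theta> = "inv_into (carrier (on_ob S A)) (\<eta> A)"
    have \<theta>: "?\<theta> y \<in> carrier (on_ob S A)" "\<eta> A (?\<theta> y) = y" if "y \<in> carrier (on_ob T A)" for y
      using bij[OF A] that by (auto simp: bij_betw_def inv_into_into f_inv_into_f)
    have \<theta>2: "?\<theta> (\<eta> A x) = x" if "x \<in> carrier (on_ob S A)" for x
      using bij[OF A] that by (simp add: bij_betw_def)
    note tcl = dieudonne_closed[OF obs[OF Tob[OF A]]] and h = dieudonne_homD[OF hom[OF A]]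
    have "dieudonne_hom p K (on_ob T A) (on_ob S A) ?\<theta>"
      unfolding dieudonne_hom_def linear_map_def
    proof (intro conjI ballI)
      fix x assume x: "x \<in> carrier (on_ob T A)"
      note tx = \<theta>(1)[OF x]
      show "?\<theta> x \<in> carrier (on_ob S A)" by (rule tx)
      show "?\<theta> (dF (on_ob T A) x) = dF (on_ob S A) (?\<theta> x)"
        by (rule inj[OF A \<theta>(1)[OF tcl(3)[OF x]] dcl(3)[OF A tx]]) (simp only: \<theta>(2)[OF tcl(3)[OF x]] h(4)[OF tx] \<theta>(2)[OF x])
      show "?\<theta> (dV (on_ob T A) x) = dV (on_ob S A) (?\<theta> x)"
        by (rule inj[OF A \<theta>(1)[OF tcl(4)[OF x]] dcl(4)[OF A tx]]) (simp only: \<theta>(2)[OF tcl(4)[OF x]] h(5)[OF tx] \<theta>(2)[OF x])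
      fix y assume y: "y \<in> carrier (on_ob T A)"
      note ty = \<theta>(1)[OF y]
      show "?\<theta> (x \<oplus>\<^bsub>on_ob T A\<^esub> y) = ?\<theta> x \<oplus>\<^bsub>on_ob S A\<^esub> ?\<theta> y"
        by (rule inj[OF A \<theta>(1)[OF tcl(1)[OF x y]] dcl(1)[OF A tx ty]])
          (simp only: \<theta>(2)[OF tcl(1)[OF x y]] h(2)[OF tx ty] \<theta>(2)[OF x] \<theta>(2)[OF y])
    next
      fix c x assume c: "c \<in> carrier (Witt p K)" and x: "x \<in> carrier (on_ob T A)"
      note tx = \<theta>(1)[OF x]
      show "?\<theta> (c \<odot>\<^bsub>on_ob T A\<^esub> x) = c \<odot>\<^bsub>on_ob S A\<^esub> ?\<theta> x"
        by (rule inj[OF A \<theta>(1)[OF tcl(2)[OF x c]] dcl(2)[OF A tx c]])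
          (simp only: \<theta>(2)[OF tcl(2)[OF x c]] h(3)[OF tx c] \<theta>(2)[OF x])
    qed
    then have "restrict ?\<theta> (carrier (on_ob T A)) \<in> Hom D (on_ob T A) (on_ob S A)"
      unfolding D_simps by (rule dieudonne_hom_restrict[OF obs[OF Tob[OF A]]])
    moreover have "?\<eta> A \<in> Hom D (on_ob S A) (on_ob T A)"
      unfolding D_simps by (rule dieudonne_hom_restrict[OF obs[OF ob[OF A]] hom[OF A]])
    ultimately show ?thesis
      unfolding is_iso_def D_simps(3,4)
      by (intro conjI bexI[of _ "restrict ?\<theta> (carrier (on_ob T A))"])
        (auto simp: compose_def fun_eq_iff restrict_def \<theta> \<theta>2 \<eta>c[OF A])
  qed
  have "Comp D (on_ob S A) (?\<eta> B) (on_arr S A B f) = Comp D (on_ob S A) (on_arr T A B f) (?\<eta> A)"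
    if "A \<in> Ob C" "B \<in> Ob C" "f \<in> Hom C A B" for A B f
    unfolding D_simps by (auto simp: compose_def fun_eq_iff restrict_def nat[OF that] cl[OF that])
  then show ?thesis using S T iso unfolding naturally_isomorphic_def by (intro conjI exI[of _ ?\<eta>] ballI) blast+
qed

section \<open>Comparison with the functors on algebras\<close>

lemma pol_simps [simp]:
  "carrier (on_ob pol R) = carrier R" "\<zero>\<^bsub>on_ob pol R\<^esub> = \<zero>\<^bsub>R\<^esub>" "add (on_ob pol R) = add R"
  "smult (on_ob pol R) = smult R" "mu (on_ob pol R) = mprod R" "on_arr pol R S f = f"
  by (simp_all add: pol_def mprod_def fun_eq_iff)

text \<open>The two records differ in multiplication and unit. Finite sums and integer multiples use
  only carrier, addition and zero, which is seen by unfolding.\<close>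

lemma lin_pol:
  fixes h :: "'c \<Rightarrow> 'a"
  shows "lin (on_ob pol R) h f = lin R h f"
proof -
  have p: "[(k::int)] \<cdot>\<^bsub>on_ob pol R\<^esub> x = [k] \<cdot>\<^bsub>R\<^esub> x" for k x
    by (simp add: add_pow_def int_pow_def nat_pow_def m_inv_def Let_def)
  have "finsum (on_ob pol R) g S = finsum R g S" for g :: "'c \<Rightarrow> 'a" and S
    by (simp add: finsum_def finprod_def)
  then show ?thesis by (simp add: lin_def p)
qed

context cring
begin

lemma mprod_update_linear:
  assumes "set xs \<subseteq> carrier R" "i < length xs" "y \<in> carrier R"
  shows "mprod R (xs[i := xs ! i \<oplus> y]) = mprod R xs \<oplus> mprod R (xs[i := y])"
    and "xs ! i \<otimes> mprod R (take i xs @ drop (Suc i) xs) = mprod R xs"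
    and "mprod R (xs[i := y]) = y \<otimes> mprod R (take i xs @ drop (Suc i) xs)"
proof -
  have s: "set (take i xs) \<subseteq> carrier R" "set (drop (Suc i) xs) \<subseteq> carrier R" "xs ! i \<in> carrier R"
    using assms(1,2) set_take_subset[of i xs] set_drop_subset[of "Suc i" xs] nth_mem[of i xs] by auto
  have u: "mprod R (xs[i := z]) = z \<otimes> mprod R (take i xs @ drop (Suc i) xs)" if "z \<in> carrier R" for z
    using that s assms(2) by (simp add: upd_conv_take_nth_drop mprod_append m_lcomm)
  show "mprod R (xs[i := y]) = y \<otimes> mprod R (take i xs @ drop (Suc i) xs)" by (rule u[OF assms(3)])
  show x: "xs ! i \<otimes> mprod R (take i xs @ drop (Suc i) xs) = mprod R xs"
    using u[OF s(3)] by simp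
  show "mprod R (xs[i := xs ! i \<oplus> y]) = mprod R xs \<oplus> mprod R (xs[i := y])"
    using s assms(3) by (simp only: u[OF a_closed[OF s(3) assms(3)]] u[OF assms(3)] x[symmetric])
      (simp add: l_distr)
qed

lemma mprod_replicate: "x \<in> carrier R \<Longrightarrow> mprod R (replicate n x) = x [^] n"
  by (induction n) (simp_all add: m_comm)

end

lemma polar_algebra_pol:
  assumes "algebra K R" "2 \<le> p" shows "polar_algebra p K (on_ob pol R)"
proof -
  interpret algebra K R by fact
  have ag: "abelian_group (on_ob pol R)"
    by (rule abelian_groupI) (auto simp: M.a_ac intro: M.l_neg exI[of _ "\<ominus>\<^bsub>R\<^esub> _"] bexI[of _ "\<ominus>\<^bsub>R\<^esub> _"])
  have m: "module K (on_ob pol R)"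
    by (rule moduleI[OF R.cring_axioms ag])
      (simp_all add: smult_l_distr smult_r_distr smult_assoc1)
  show ?thesis unfolding polar_algebra_def
  proof (intro conjI allI impI m ballI; simp only: pol_simps)
    fix xs assume xs: "set xs \<subseteq> carrier R \<and> length xs = p"
    show "mprod R xs \<in> carrier R" using xs by simp
    show "mprod R ys = mprod R xs" if "mset ys = mset xs" for ys
      using that xs by (intro mprod_perm[symmetric]) auto
    fix i assume i: "i < p"
    show "mprod R (xs[i := xs ! i \<oplus>\<^bsub>R\<^esub> y]) = mprod R xs \<oplus>\<^bsub>R\<^esub> mprod R (xs[i := y])" if "y \<in> carrier R" for y
      using xs i that by (intro mprod_update_linear) auto
    show "mprod R (xs[i := c \<odot>\<^bsub>R\<^esub> xs ! i]) = c \<odot>\<^bsub>R\<^esub> mprod R xs" if c: "c \<in> carrier K" for c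
    proof -
      have x: "xs ! i \<in> carrier R" "set (take i xs @ drop (Suc i) xs) \<subseteq> carrier R"
        using xs i set_take_subset[of i xs] set_drop_subset[of "Suc i" xs] nth_mem[of i xs] by auto
      have l: "set xs \<subseteq> carrier R" "i < length xs" using xs i by auto
      show ?thesis
        using mprod_update_linear(2,3)[OF l, of "c \<odot>\<^bsub>R\<^esub> xs ! i"] smult_assoc2[OF c x(1) mprod_closed[OF x(2)]] c x(1)
        by (metis smult_closed)
    qed
  next
    fix xs ys assume a: "set xs \<subseteq> carrier R \<and> length xs = 2 * p - 1 \<and> mset ys = mset xs"
    have e: "mprod R (mprod R (take p zs) # drop p zs) = mprod R zs" if "set zs \<subseteq> carrier R" for zs
      using that set_take_subset[of p zs] set_drop_subset[of p zs] mprod_append[of "take p zs" "drop p zs"]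
      by (simp add: subset_trans)
    have "set ys \<subseteq> carrier R" using a by (metis mset_eq_setD)
    then show "mprod R (mprod R (take p ys) # drop p ys) = mprod R (mprod R (take p xs) # drop p xs)"
      using a e mprod_perm[of ys xs] by simp
  qed
qed

subsection \<open>Nilpotent ideals\<close>

context cring
begin

lemma ideal_pow: "ideal I R \<Longrightarrow> ideal (I [^]\<^bsub>ideals_set R\<^esub> (n::nat)) R"
  by (induction n) (simp_all add: ideals_set_def nat_pow_def oneideal ideal_prod_is_ideal)

lemma ideal_pow_Suc: "I [^]\<^bsub>ideals_set R\<^esub> Suc n = ideal_prod R (I [^]\<^bsub>ideals_set R\<^esub> n) I"
  by (simp add: ideals_set_def nat_pow_def)

lemma ideal_pow_0: "I [^]\<^bsub>ideals_set R\<^esub> (0::nat) = carrier R"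
  by (simp add: ideals_set_def nat_pow_def)

lemma mprod_in_ideal_pow:
  assumes "ideal I R" "set xs \<subseteq> I" shows "mprod R xs \<in> I [^]\<^bsub>ideals_set R\<^esub> length xs"
  using assms(2)
proof (induction xs)
  case (Cons x xs)
  have c: "x \<in> carrier R" "set xs \<subseteq> carrier R" using Cons.prems ideal.Icarr[OF assms(1)] by auto
  have "mprod R xs \<otimes> x \<in> ideal_prod R (I [^]\<^bsub>ideals_set R\<^esub> length xs) I"
    using Cons by (intro ideal_prod.prod) auto
  then show ?case using c m_comm[of x "mprod R xs"] by (simp only: ideal_pow_Suc list.size mprod_simps add_0_right add_Suc_right mprod_closed)
qed (simp only: list.size mprod_simps ideal_pow_0 one_closed)

text \<open>This extends a vanishing condition from the generators of an ideal to all of its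
  elements.\<close>

lemma annihilator_ideal:
  assumes "y \<in> carrier R" shows "ideal {j \<in> carrier R. j \<otimes> y = \<zero>} R"
proof (rule idealI[OF ring_axioms])
  show "subgroup {j \<in> carrier R. j \<otimes> y = \<zero>} (add_monoid R)"
  proof (rule subgroup.intro)
    fix x assume "x \<in> {j \<in> carrier R. j \<otimes> y = \<zero>}"
    then show "inv\<^bsub>add_monoid R\<^esub> x \<in> {j \<in> carrier R. j \<otimes> y = \<zero>}"
      using assms by (simp add: a_inv_def[symmetric] l_minus)
  qed (use assms in \<open>auto simp: l_distr\<close>)
qed (use assms in \<open>auto simp: m_assoc\<close>, metis m_assoc m_comm r_null)

text \<open>Factors from \<open>X\<close> are replaced by arbitrary elements of the generated ideal,
  one for each increase of \<open>k\<close>. The elements that annihilate a given product form an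
  ideal, and it contains \<open>X\<close>.\<close>

lemma ideal_pow_annihilates:
  assumes X: "X \<subseteq> carrier R" and n: "\<And>xs. set xs \<subseteq> X \<Longrightarrow> length xs = n \<Longrightarrow> mprod R xs = \<zero>"
  shows "x \<in> (Idl X) [^]\<^bsub>ideals_set R\<^esub> k \<Longrightarrow> set xs \<subseteq> X \<Longrightarrow> k + length xs = n \<Longrightarrow> x \<otimes> mprod R xs = \<zero>"
proof (induction k arbitrary: x xs)
  case 0
  then show ?case using n[of xs] unfolding ideal_pow_0 by simp
next
  case (Suc k)
  have I: "ideal (Idl X) R" using X by (rule genideal_ideal)
  have xs: "mprod R xs \<in> carrier R" using Suc.prems X by (intro mprod_closed) auto
  have "x \<in> ideal_prod R ((Idl X) [^]\<^bsub>ideals_set R\<^esub> k) (Idl X)" using Suc.prems(1) by (simp only: ideal_pow_Suc)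
  then have "x \<in> carrier R \<and> x \<otimes> mprod R xs = \<zero>"
  proof induction
    case (prod i j)
    have i: "i \<in> carrier R" using prod(1) ideal.Icarr[OF ideal_pow[OF I]] by blast
    have im: "i \<otimes> mprod R xs \<in> carrier R" using i xs by simp
    have "X \<subseteq> {j \<in> carrier R. j \<otimes> (i \<otimes> mprod R xs) = \<zero>}"
    proof
      fix y assume y: "y \<in> X"
      have "i \<otimes> mprod R (y # xs) = \<zero>"
        using prod(1) Suc.prems y by (intro Suc.IH) auto
      then show "y \<in> {j \<in> carrier R. j \<otimes> (i \<otimes> mprod R xs) = \<zero>}"
        using y X i xs by (auto simp: m_lcomm)
    qed
    then have "j \<in> {j \<in> carrier R. j \<otimes> (i \<otimes> mprod R xs) = \<zero>}"
      using prod(2) genideal_minimal[OF annihilator_ideal[OF im]] by blast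
    then show ?case using i xs by (simp add: m_assoc m_lcomm[of i j])
  next
    case (sum s1 s2)
    then show ?case using xs by (simp add: l_distr)
  qed
  then show ?case by simp
qed

text \<open>The condition that defines CW is thereby expressed by products of entries alone. In this
  form it makes sense in a polar algebra.\<close>

lemma Idl_pow_eq_zero_iff:
  assumes X: "X \<subseteq> carrier R"
  shows "(Idl X) [^]\<^bsub>ideals_set R\<^esub> n = {\<zero>} \<longleftrightarrow> (\<forall>xs. set xs \<subseteq> X \<and> length xs = n \<longrightarrow> mprod R xs = \<zero>)"
proof safe
  have I: "ideal (Idl X) R" using X by (rule genideal_ideal)
  show "mprod R xs = \<zero>" if "(Idl X) [^]\<^bsub>ideals_set R\<^esub> length xs = {\<zero>}" "set xs \<subseteq> X" for xs
    using mprod_in_ideal_pow[OF I, of xs] that genideal_self[OF X] by auto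
  assume n: "\<forall>xs. set xs \<subseteq> X \<and> length xs = n \<longrightarrow> mprod R xs = \<zero>"
  show "x = \<zero>" if x: "x \<in> (Idl X) [^]\<^bsub>ideals_set R\<^esub> n" for x
    using ideal_pow_annihilates[OF X, of n x n "[]"] n x ideal.Icarr[OF ideal_pow[OF I] x] by simp
  show "\<zero> \<in> (Idl X) [^]\<^bsub>ideals_set R\<^esub> n"
    using ideal_pow[OF I, of n] by (simp add: additive_subgroup.zero_closed ideal.axioms(1))
qed

lemma mpoly_eval_cong:
  assumes "\<And>m v. m \<in> kys f \<Longrightarrow> v \<in> set (mlist m) \<Longrightarrow> \<nu> v = \<nu>' v \<and> \<nu>' v \<in> carrier R"
  shows "mpoly_eval R \<nu> f = mpoly_eval R \<nu>' f"
proof -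
  have c: "\<nu> v \<in> carrier R" "\<nu>' v \<in> carrier R" if "m \<in> kys f" "v \<in> kys m" for m v
    using assms[OF that(1), of v] that(2) by (auto simp: set_mlist)
  have m: "map \<nu> (mlist m) = map \<nu>' (mlist m)" if "m \<in> kys f" for m
    using assms[OF that] by simp
  have "lin R (mono_prod R \<nu>) f = lin R (mono_prod R \<nu>') f"
    using assms by (intro lin_cong) (auto simp: m intro!: mprod_closed)
  then show ?thesis using c by (simp add: mpoly_eval_eq_lin)
qed

end

locale alg_perf =
  fixes p :: nat and K :: "'k ring" and R :: "('k, 'a) module"
  assumes prime: "prime p" and perfect: "perfect_field p K" and alg: "algebra K R"
begin

sublocale R: algebra K R by (rule alg)

sublocale P: polar_perf p K "on_ob pol R"
  by unfold_locales (use prime perfect polar_algebra_pol[OF alg prime_ge_2_nat[OF prime]] in auto)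

lemma it_eq_mprod: "polar_degree p (length xs) \<Longrightarrow> set xs \<subseteq> carrier R \<Longrightarrow> P.it xs = mprod R xs"
proof (induction xs rule: length_induct)
  case (1 xs)
  obtain x ys where xs: "xs = x # ys" using 1(2) polar_degree_pos by (cases xs) auto
  show ?case
  proof (cases "ys = []")
    case False
    then have g: "p - 1 \<le> length ys" "polar_degree p (Suc (length ys - (p - 1)))"
      using polar_degree_step[OF P.p2, of "length ys"] 1(2) xs by auto
    have l: "p \<le> length xs" using g P.p2 xs by simp
    have "Suc (length xs - p) = Suc (length ys - (p - 1))" using xs g P.p2 by simp
    then have "P.it (mu (on_ob pol R) (take p xs) # drop p xs) = mprod R (mu (on_ob pol R) (take p xs) # drop p xs)"
      using g P.p2 xs P.step_closed[OF l] 1(3) by (intro 1(1)[rule_format]) (auto simp del: diff_Suc_1)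
    also have "\<dots> = mprod R xs"
      using 1(3) set_take_subset[of p xs] set_drop_subset[of p xs] R.mprod_append[of "take p xs" "drop p xs"]
      by (simp add: subset_trans)
    finally show ?thesis using l P.it_step[of xs] by simp
  qed (use xs 1 P.it_single[of x] in simp)
qed

lemmas it_eq_mprod' = it_eq_mprod[simplified]

lemma nilpotent_set_eq: assumes "X \<subseteq> carrier R"
  shows "P.nilpotent_set s X \<longleftrightarrow> (Idl\<^bsub>R\<^esub> X) [^]\<^bsub>ideals_set R\<^esub> (p ^ s) = {\<zero>\<^bsub>R\<^esub>}"
  unfolding R.Idl_pow_eq_zero_iff[OF assms] P.nilpotent_set_def
  using assms it_eq_mprod polar_degree_power[OF P.p2, of s] by (auto simp: subset_trans)

lemma WA_eq: "x \<in> P.WA \<longleftrightarrow> (\<forall>i. x i \<in> carrier R)" by (simp add: P.WA_def)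

text \<open>All monomials of the Witt polynomials have admissible degree, and on admissible lists
  the iterated p-ary product is the product of the ring.\<close>

lemma padd_eq:
  assumes "\<And>i. x i \<in> carrier R" "\<And>i. y i \<in> carrier R"
  shows "P.padd x y i = mpoly_eval R (case_sum x y) (witt_sum p i)"
proof -
  have c: "case_sum x y v \<in> carrier R" for v using assms by (simp split: sum.splits)
  have "lin R (\<lambda>m. P.evl (map (case_sum (\<lambda>i. Inr (x i)) (\<lambda>i. Inr (y i))) (mlist m))) (witt_sum p i) =
    lin R (mono_prod R (case_sum x y)) (witt_sum p i)"
  proof (rule R.M.lin_cong)
    fix m assume m: "m \<in> kys (witt_sum p i)"
    have "lefts (map (case_sum (\<lambda>i. Inr (x i)) (\<lambda>i. Inr (y i)) :: nat + nat \<Rightarrow> 'k + 'a) xs) = []" for xs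
      by (induction xs) (auto split: sum.splits)
    moreover have "polar_degree p (length (map (case_sum x y) (mlist m)))"
      using P.polar_at_witt_sum[OF m, of x y] by (simp add: P.polar_at_def P.case_sum_Inr P.rights_map_Inr)
    moreover have mc: "set (map (case_sum x y) (mlist m)) \<subseteq> carrier R" using c by auto
    ultimately show "P.evl (map (case_sum (\<lambda>i. Inr (x i)) (\<lambda>i. Inr (y i))) (mlist m)) = mono_prod R (case_sum x y) m"
      unfolding P.evl_def using R.mprod_closed[OF mc]
      by (simp add: P.case_sum_Inr P.rights_map_Inr it_eq_mprod')
    show "mono_prod R (case_sum x y) m \<in> carrier R" by (rule R.mprod_closed[OF mc])
  qed
  then show ?thesis unfolding P.padd_def P.peval_def lin_pol using c by (simp add: R.mpoly_eval_eq_lin)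
qed

text \<open>A scalar acts on the polarization, whereas in the algebra it is inserted as a multiple
  of the unit. Pulling all such factors out of a product identifies the two.\<close>

lemma psmult_eq:
  assumes c: "\<And>i. c i \<in> carrier K" and x: "\<And>i. x i \<in> carrier R"
  shows "P.psmult c x i = mpoly_eval R (case_sum (\<lambda>i. c i \<odot>\<^bsub>R\<^esub> \<one>\<^bsub>R\<^esub>) x) (witt_prod p i)"
proof -
  let ?n = "case_sum (\<lambda>i. c i \<odot>\<^bsub>R\<^esub> \<one>\<^bsub>R\<^esub>) x"
  have n: "?n v \<in> carrier R" for v using assms by (simp split: sum.splits)
  have pr: "mprod R (map ?n vs) = mprod K (map c (lefts vs)) \<odot>\<^bsub>R\<^esub> mprod R (map x (rights vs))" for vs
  proof (induction vs)
    case (Cons v vs)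
    have cl: "mprod K (map c (lefts vs)) \<in> carrier K" "mprod R (map x (rights vs)) \<in> carrier R"
      using c x by (auto intro!: R.R.mprod_closed R.mprod_closed)
    show ?case
    proof (cases v)
      case (Inl i)
      then show ?thesis using Cons cl c by (simp add: R.smult_assoc2 R.smult_assoc1)
    next
      case (Inr i)
      have "x i \<otimes>\<^bsub>R\<^esub> (mprod K (map c (lefts vs)) \<odot>\<^bsub>R\<^esub> mprod R (map x (rights vs))) =
        mprod K (map c (lefts vs)) \<odot>\<^bsub>R\<^esub> (x i \<otimes>\<^bsub>R\<^esub> mprod R (map x (rights vs)))"
        using cl x by (simp add: R.m_comm[of "x i"] R.smult_assoc2)
      then show ?thesis using Cons Inr by simp
    qed
  qed simp
  have "lin R (\<lambda>m. P.evl (map (map_sum c x) (mlist m))) (witt_prod p i) = lin R (mono_prod R ?n) (witt_prod p i)"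
  proof (rule R.M.lin_cong)
    fix m assume m: "m \<in> kys (witt_prod p i)"
    have "polar_degree p (length (map x (rights (mlist m))))"
      using P.polar_at_witt_prod[OF m, of c x] by (simp add: P.polar_at_def rights_map)
    moreover have "set (map x (rights (mlist m))) \<subseteq> carrier R" using x by auto
    ultimately show "P.evl (map (map_sum c x) (mlist m)) = mono_prod R ?n m"
      unfolding P.evl_def pr by (simp add: lefts_map rights_map it_eq_mprod')
    show "mono_prod R ?n m \<in> carrier R" using n by (intro R.mprod_closed) auto
  qed
  then show ?thesis unfolding P.psmult_def P.peval_def lin_pol using n by (simp add: R.mpoly_eval_eq_lin)
qed

lemma mpoly_eval_sum_eq_padd:
  assumes "\<And>j. j \<le> i \<Longrightarrow> x j = x' j \<and> y j = y' j" "\<And>i. x' i \<in> carrier R" "\<And>i. y' i \<in> carrier R"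
  shows "mpoly_eval R (case_sum x y) (witt_sum p i) = P.padd x' y' i"
  unfolding padd_eq[of x' y', OF assms(2,3)]
  by (rule R.mpoly_eval_cong) (use P.index_le assms in \<open>fastforce split: sum.splits\<close>)

lemma mpoly_eval_prod_eq_psmult:
  assumes "\<And>j. j \<le> i \<Longrightarrow> d j = c j \<odot>\<^bsub>R\<^esub> \<one>\<^bsub>R\<^esub> \<and> x j = x' j" "\<And>i. x' i \<in> carrier R" "\<And>i. c i \<in> carrier K"
  shows "mpoly_eval R (case_sum d x) (witt_prod p i) = P.psmult c x' i"
  unfolding psmult_eq[of c x', OF assms(3,2)]
  by (rule R.mpoly_eval_cong) (use P.index_le_prod assms in \<open>fastforce split: sum.splits\<close>)

subsection \<open>Co-Witt vectors\<close>

lemma CW_carrier: "carrier (CW_ob p K R) = P.cwcar"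
proof -
  have "(\<exists>r s :: nat. (Idl\<^bsub>R\<^esub> (a ` {r..})) [^]\<^bsub>ideals_set R\<^esub> (p ^ s) = {\<zero>\<^bsub>R\<^esub>}) \<longleftrightarrow> (\<exists>r s. P.nilpotent_set s (a ` {r..}))"
    if "\<forall>n. a n \<in> carrier R" for a
    using nilpotent_set_eq that by (metis image_subsetI)
  then have "{a. (\<forall>n. a n \<in> carrier R) \<and>
      (\<exists>r s :: nat. (Idl\<^bsub>R\<^esub> (a ` {r..})) [^]\<^bsub>ideals_set R\<^esub> (p ^ s) = {\<zero>\<^bsub>R\<^esub>})} = P.cwcar"
    unfolding P.cwcar_def pol_simps by (intro Collect_cong conj_cong refl)
  then show ?thesis by (simp add: CW_ob_def)
qed

lemma CW_add: assumes "a \<in> P.cwcar" "b \<in> P.cwcar" shows "a \<oplus>\<^bsub>CW_ob p K R\<^esub> b = P.cwadd a b"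
proof
  fix n
  have c: "a i \<in> carrier R" "b i \<in> carrier R" for i using assms by (auto simp: P.cwcar_def)
  have "mpoly_eval R (case_sum (\<lambda>i. a (n + m - i)) (\<lambda>i. b (n + m - i))) (witt_sum p m) =
      P.padd (P.rv a (n + m)) (P.rv b (n + m)) m" for m
    by (rule mpoly_eval_sum_eq_padd) (auto simp: P.rv_def c)
  then show "(a \<oplus>\<^bsub>CW_ob p K R\<^esub> b) n = P.cwadd a b n" by (simp add: CW_ob_def P.cwadd_def)
qed

lemma CW_smult:
  assumes "c \<in> carrier (Witt p K)" "a \<in> P.cwcar" shows "c \<odot>\<^bsub>CW_ob p K R\<^esub> a = P.cwsmult c a"
proof
  fix n
  have ac: "a i \<in> carrier R" for i using assms by (auto simp: P.cwcar_def)
  have "mpoly_eval R (case_sum (\<lambda>i. (frob_inv p K ^^ (n + m)) c i \<odot>\<^bsub>R\<^esub> \<one>\<^bsub>R\<^esub>) (\<lambda>i. a (n + m - i))) (witt_prod p m) =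
      P.psmult (P.\<sigma> (n + m) c) (P.rv a (n + m)) m" for m
    using P.\<sigma>_closed[OF assms(1), of "n + m"]
    by (intro mpoly_eval_prod_eq_psmult) (auto simp: P.rv_def ac)
  then show "(c \<odot>\<^bsub>CW_ob p K R\<^esub> a) n = P.cwsmult c a n" by (simp add: CW_ob_def P.cwsmult_def)
qed

lemma CW_F: assumes "a \<in> P.cwcar" shows "dF (CW_ob p K R) a = P.cwF a"
  using assms by (auto simp: CW_ob_def P.cwF_def P.cwcar_def R.mprod_replicate)

lemma CW_V: "dV (CW_ob p K R) a = P.cwV a"
  by (simp add: CW_ob_def P.cwV_def fun_eq_iff)

lemma CW_zero: "\<zero>\<^bsub>CW_ob p K R\<^esub> = (\<lambda>_. \<zero>\<^bsub>R\<^esub>)"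
  by (simp add: CW_ob_def)

lemma CW_pullback: "dieudonne_pullback p K P.CWA (CW_ob p K R) (\<lambda>c. c) (\<lambda>x. x)"
  using P.cwzero_closed
  by unfold_locales
    (simp_all add: P.CWA_dieudonne CW_carrier CW_add CW_smult CW_F CW_V CW_zero P.cwadd_closed P.cwsmult_closed
      P.cwF_closed P.cwV_closed P.frob_closed[simplified] del: Witt_carrier)

subsection \<open>Finite Witt vectors\<close>

definition rev_emb :: "nat \<Rightarrow> (nat \<Rightarrow> 'a) \<Rightarrow> nat \<Rightarrow> 'a" where
  "rev_emb n x = (\<lambda>j. if j < n then x (n - 1 - j) else \<zero>\<^bsub>R\<^esub>)"

definition ext :: "nat \<Rightarrow> (nat \<Rightarrow> 'a) \<Rightarrow> nat \<Rightarrow> 'a" where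
  "ext n x = (\<lambda>i. if i < n then x i else \<zero>\<^bsub>R\<^esub>)"

lemma ext_carrier: "x \<in> {..<n} \<rightarrow>\<^sub>E carrier R \<Longrightarrow> ext n x i \<in> carrier R"
  by (auto simp: ext_def PiE_def)

lemma ext_WA: "x \<in> {..<n} \<rightarrow>\<^sub>E carrier R \<Longrightarrow> ext n x \<in> P.WA"
  by (simp add: WA_eq ext_carrier)

lemma pV_funpow: "(P.pV ^^ d) x i = (if i < d then \<zero>\<^bsub>R\<^esub> else x (i - d))"
  by (induction d arbitrary: i) (auto simp: P.pV_def)

lemma pV_funpow_WA: "x \<in> P.WA \<Longrightarrow> (P.pV ^^ d) x \<in> P.WA"
  by (induction d) auto

lemma pV_funpow_add: "x \<in> P.WA \<Longrightarrow> y \<in> P.WA \<Longrightarrow> P.padd ((P.pV ^^ d) x) ((P.pV ^^ d) y) = (P.pV ^^ d) (P.padd x y)"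
  by (induction d) (simp_all add: P.pV_add[symmetric] pV_funpow_WA)

lemma pV_funpow_smult: "c \<in> carrier (Witt p K) \<Longrightarrow> x \<in> P.WA \<Longrightarrow>
    P.psmult (P.\<sigma> d c) ((P.pV ^^ d) x) = (P.pV ^^ d) (P.psmult c x)"
proof (induction d)
  case (Suc d)
  have "P.psmult (P.\<sigma> (Suc d) c) ((P.pV ^^ Suc d) x) = P.pV (P.psmult (frob p K (P.\<sigma> (Suc d) c)) ((P.pV ^^ d) x))"
    using P.pV_smult[OF P.\<sigma>_closed[OF Suc.prems(1)] pV_funpow_WA[OF Suc.prems(2)], of "Suc d" d] by simp
  then show ?case using Suc P.frob_\<sigma>_Suc[OF Suc.prems(1)] by simp
qed simp

text \<open>Truncating the reversed vector at a level beyond its length only adds leading zeros, and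
  these are what V inserts. A vector of length n fills level n - 1 exactly.\<close>

lemma rv_rev_emb: "P.rv (rev_emb n x) (n - 1 + d) = (P.pV ^^ d) (ext n x)" if "1 \<le> n"
proof
  fix i
  have "n - Suc (n - Suc 0 + d - i) = i - d" if "d \<le> i" "i \<le> n - 1 + d" using that \<open>1 \<le> n\<close> by linarith
  then show "P.rv (rev_emb n x) (n - 1 + d) i = (P.pV ^^ d) (ext n x) i"
    using that by (auto simp: P.rv_def rev_emb_def ext_def pV_funpow)
qed

lemma rev_emb_bounded: "x \<in> {..<n} \<rightarrow>\<^sub>E carrier R \<Longrightarrow> rev_emb n x \<in> P.bounded_by n"
  by (auto simp: P.bounded_by_def rev_emb_def PiE_def)

lemma rev_emb_inj: assumes "x \<in> {..<n} \<rightarrow>\<^sub>E carrier R" "y \<in> {..<n} \<rightarrow>\<^sub>E carrier R" "rev_emb n x = rev_emb n y"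
  shows "x = y"
proof (rule PiE_ext[OF assms(1,2)])
  fix i assume "i \<in> {..<n}"
  then have i: "n - 1 - i < n" "n - 1 - (n - 1 - i) = i" by auto
  then show "x i = y i" using fun_cong[OF assms(3), of "n - 1 - i"] unfolding rev_emb_def by simp
qed

lemma rev_emb_surj: assumes "a \<in> P.bounded_by n"
  shows "\<exists>x \<in> {..<n} \<rightarrow>\<^sub>E carrier R. rev_emb n x = a"
proof (intro bexI)
  show "rev_emb n (\<lambda>i\<in>{..<n}. a (n - 1 - i)) = a"
    using assms by (auto simp: rev_emb_def P.bounded_by_def fun_eq_iff)
  show "(\<lambda>i\<in>{..<n}. a (n - 1 - i)) \<in> {..<n} \<rightarrow>\<^sub>E carrier R"
    using assms by (auto simp: P.bounded_by_def)
qed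

text \<open>If the approximations are the iterated shifts of one vector \<open>w\<close> from level
  n - 1 on, every entry counted from the end is constant, and the limit is \<open>w\<close> read
  backwards. This computes the co-Witt operations on truncated vectors without evaluating a
  limit.\<close>

lemma rev_emb_of_limit:
  assumes n: "1 \<le> n" and a: "P.conv X r u a" and u: "\<And>d. u (n - 1 + d) = (P.pV ^^ d) w"
    and x: "\<And>i. i < n \<Longrightarrow> x i = w i"
  shows "rev_emb n x = a"
proof
  fix j
  have "\<forall>\<^sub>F N in sequentially. u N (N - j) = a j \<and> n + j \<le> N"
    using a by (intro eventually_conj eventually_ge_at_top) (simp add: P.conv_def)
  then obtain N where N: "u N (N - j) = a j" "n + j \<le> N"
    using eventually_happens'[OF sequentially_bot] by blast
  define d where "d = N - (n - 1)"
  have d: "N = n - 1 + d" using N(2) by (simp add: d_def)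
  have "a j = (P.pV ^^ d) w (N - j)" using N(1) u[of d] d by simp
  also have "\<dots> = rev_emb n x j"
    using N(2) d n x by (auto simp: pV_funpow rev_emb_def)
  finally show "rev_emb n x j = a j" by simp
qed

lemma W_carrier: "carrier (W_ob p n R) = {..<n} \<rightarrow>\<^sub>E carrier R"
  by (simp add: W_ob_def witt_ring_def Let_def)

lemma W_zero: "\<zero>\<^bsub>W_ob p n R\<^esub> \<in> {..<n} \<rightarrow>\<^sub>E carrier R" "rev_emb n \<zero>\<^bsub>W_ob p n R\<^esub> = (\<lambda>_. \<zero>\<^bsub>R\<^esub>)"
  by (auto simp: W_ob_def witt_ring_def Let_def rev_emb_def fun_eq_iff)

lemma W_add:
  assumes n: "1 \<le> n" and x: "x \<in> {..<n} \<rightarrow>\<^sub>E carrier R" and y: "y \<in> {..<n} \<rightarrow>\<^sub>E carrier R"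
  shows "x \<oplus>\<^bsub>W_ob p n R\<^esub> y \<in> {..<n} \<rightarrow>\<^sub>E carrier R"
    "rev_emb n (x \<oplus>\<^bsub>W_ob p n R\<^esub> y) = P.cwadd (rev_emb n x) (rev_emb n y)"
proof -
  have e: "(x \<oplus>\<^bsub>W_ob p n R\<^esub> y) = (\<lambda>i\<in>{..<n}. P.padd (ext n x) (ext n y) i)"
    unfolding W_ob_def witt_ring_def Let_def
    by (auto simp: fun_eq_iff restrict_def ext_carrier[OF x] ext_carrier[OF y] ext_def[of n x] ext_def[of n y]
        intro!: mpoly_eval_sum_eq_padd[where x' = "ext n x" and y' = "ext n y", unfolded ext_def])
      (use x y in \<open>auto simp: PiE_def\<close>)
  show "x \<oplus>\<^bsub>W_ob p n R\<^esub> y \<in> {..<n} \<rightarrow>\<^sub>E carrier R"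
    unfolding e using P.padd_closed[OF ext_WA[OF x] ext_WA[OF y]] by (auto simp: WA_eq)
  note cx = rev_emb_bounded[OF x, unfolded P.bounded_by_conv] and cy = rev_emb_bounded[OF y, unfolded P.bounded_by_conv]
  show "rev_emb n (x \<oplus>\<^bsub>W_ob p n R\<^esub> y) = P.cwadd (rev_emb n x) (rev_emb n y)"
    by (rule rev_emb_of_limit[OF n P.cwadd_conv[OF P.nilpotent_sub_zero cx cy], where w = "P.padd (ext n x) (ext n y)"])
      (simp_all only: rv_rev_emb[OF n] pV_funpow_add[OF ext_WA[OF x] ext_WA[OF y]], simp add: e)
qed

lemma W_smult:
  assumes n: "1 \<le> n" and c: "c \<in> carrier (Witt p K)" and x: "x \<in> {..<n} \<rightarrow>\<^sub>E carrier R"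
  shows "c \<odot>\<^bsub>W_ob p n R\<^esub> x \<in> {..<n} \<rightarrow>\<^sub>E carrier R"
    "rev_emb n (c \<odot>\<^bsub>W_ob p n R\<^esub> x) = P.cwsmult ((frob p K ^^ (n - 1)) c) (rev_emb n x)"
proof -
  have cc: "c i \<in> carrier K" for i using c by simp
  have e: "c \<odot>\<^bsub>W_ob p n R\<^esub> x = (\<lambda>i\<in>{..<n}. P.psmult c (ext n x) i)"
    unfolding W_ob_def witt_ring_def Let_def
    by (auto simp: fun_eq_iff restrict_def cc
        intro!: mpoly_eval_prod_eq_psmult[where x' = "ext n x" and c = c, unfolded ext_def] simp: ext_def)
      (use x in \<open>auto simp: PiE_def\<close>)
  show "c \<odot>\<^bsub>W_ob p n R\<^esub> x \<in> {..<n} \<rightarrow>\<^sub>E carrier R"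
    unfolding e using P.psmult_closed[OF c ext_WA[OF x]] by (auto simp: WA_eq)
  note cx = rev_emb_bounded[OF x, unfolded P.bounded_by_conv]
  \<comment> \<open>At level n - 1 + d the scalar is twisted by n - 1 + d inverse Frobenius powers.
    The factor frob^(n-1) removes n - 1 of them, and moving the rest past V^d removes the other
    d.\<close>
  have s: "P.\<sigma> (n - 1 + d) ((frob p K ^^ (n - 1)) c) = P.\<sigma> d c" for d
    using P.\<sigma>_frob_funpow[OF c, of d "n - 1"] by (simp only: add.commute)
  show "rev_emb n (c \<odot>\<^bsub>W_ob p n R\<^esub> x) = P.cwsmult ((frob p K ^^ (n - 1)) c) (rev_emb n x)"
    by (rule rev_emb_of_limit[OF n P.cwsmult_conv[OF P.nilpotent_sub_zero P.frob_funpow_closed[OF c] cx], where w = "P.psmult c (ext n x)"])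
      (simp_all only: s rv_rev_emb[OF n] pV_funpow_smult[OF c ext_WA[OF x]], simp add: e)
qed

lemma W_F:
  assumes x: "x \<in> {..<n} \<rightarrow>\<^sub>E carrier R"
  shows "dF (W_ob p n R) x \<in> {..<n} \<rightarrow>\<^sub>E carrier R" "rev_emb n (dF (W_ob p n R) x) = P.cwF (rev_emb n x)"
proof -
  have xi: "x i \<in> carrier R" if "i < n" for i using x that by auto
  have "\<zero>\<^bsub>R\<^esub> [^]\<^bsub>R\<^esub> p = \<zero>\<^bsub>R\<^esub>" using P.p2 by (intro R.nat_pow_zero) simp
  then show "dF (W_ob p n R) x \<in> {..<n} \<rightarrow>\<^sub>E carrier R" "rev_emb n (dF (W_ob p n R) x) = P.cwF (rev_emb n x)"
    using xi by (auto simp: W_ob_def Let_def rev_emb_def P.cwF_def fun_eq_iff R.mprod_replicate)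
qed

lemma W_V:
  assumes x: "x \<in> {..<n} \<rightarrow>\<^sub>E carrier R"
  shows "dV (W_ob p n R) x \<in> {..<n} \<rightarrow>\<^sub>E carrier R" "rev_emb n (dV (W_ob p n R) x) = P.cwV (rev_emb n x)"
proof -
  have xi: "x i \<in> carrier R" if "i < n" for i using x that by auto
  show "dV (W_ob p n R) x \<in> {..<n} \<rightarrow>\<^sub>E carrier R" using xi by (auto simp: W_ob_def Let_def)
  show "rev_emb n (dV (W_ob p n R) x) = P.cwV (rev_emb n x)"
  proof
    fix j
    have "Suc j < n \<longleftrightarrow> j < n \<and> n - 1 - j \<noteq> 0" "n - 1 - j - 1 = n - 1 - Suc j" by auto
    then show "rev_emb n (dV (W_ob p n R) x) j = P.cwV (rev_emb n x) j"
      by (auto simp: W_ob_def Let_def rev_emb_def P.cwV_def)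
  qed
qed

lemma W_pullback:
  assumes n: "1 \<le> n"
  shows "dieudonne_pullback p K (P.WnA n) (W_ob p n R) (\<lambda>c. c) (rev_emb n)"
  by unfold_locales
    (use W_zero W_add[OF n] W_smult[OF n] W_F W_V rev_emb_bounded P.frob_closed in
      \<open>auto simp: P.WnA_dieudonne W_carrier inj_on_def rev_emb_inj simp del: Witt_carrier PiE_iff\<close>)

end

subsection \<open>Unipotent co-Witt vectors\<close>

context alg_perf
begin

definition pts :: "(nat \<times> (nat \<Rightarrow> 'a)) set" where
  "pts = (SIGMA i : UNIV. {..<Suc i} \<rightarrow>\<^sub>E carrier R)"

definition emb :: "nat \<times> (nat \<Rightarrow> 'a) \<Rightarrow> nat \<Rightarrow> 'a" where
  "emb u = rev_emb (Suc (fst u)) (snd u)"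

text \<open>The equivalence classes of the colimit are the fibres of \<open>emb\<close>; this names
  a class by its sequence.\<close>

definition fib :: "(nat \<Rightarrow> 'a) \<Rightarrow> (nat \<times> (nat \<Rightarrow> 'a)) set" where
  "fib a = {u \<in> pts. emb u = a}"

lemma term_simps: "carrier (CWu_term p K R j) = {..<Suc j} \<rightarrow>\<^sub>E carrier R"
  "add (CWu_term p K R j) = add (W_ob p (Suc j) R)" "zero (CWu_term p K R j) = zero (W_ob p (Suc j) R)"
  "smult (CWu_term p K R j) a x = smult (W_ob p (Suc j) R) (P.\<sigma> j a) x"
  "dF (CWu_term p K R j) = dF (W_ob p (Suc j) R)" "dV (CWu_term p K R j) = dV (W_ob p (Suc j) R)"
  using W_carrier[of "Suc j"] by (simp_all add: CWu_term_def)

lemma pts_eq: "(SIGMA i : UNIV. carrier (CWu_term p K R i)) = pts"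
  by (simp add: pts_def term_simps)

text \<open>V inserts a leading zero, which after reversal continues the zeros behind the last
  entry.\<close>

lemma transition_emb:
  assumes "x \<in> {..<Suc i} \<rightarrow>\<^sub>E carrier R"
  shows "transition (CWu_trans R) i d x \<in> {..<Suc (i + d)} \<rightarrow>\<^sub>E carrier R \<and>
    rev_emb (Suc (i + d)) (transition (CWu_trans R) i d x) = rev_emb (Suc i) x"
proof (induction d)
  case (Suc d)
  let ?y = "transition (CWu_trans R) i d x"
  have y: "?y \<in> {..<Suc (i + d)} \<rightarrow>\<^sub>E carrier R" using Suc by simp
  then have yc: "?y j \<in> carrier R" if "j < Suc (i + d)" for j using that by auto
  have "rev_emb (Suc (i + Suc d)) (CWu_trans R (i + d) ?y) = rev_emb (Suc (i + d)) ?y"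
  proof
    fix j
    show "rev_emb (Suc (i + Suc d)) (CWu_trans R (i + d) ?y) j = rev_emb (Suc (i + d)) ?y j"
      by (cases "j < Suc (i + d)") (auto simp: rev_emb_def CWu_trans_def less_Suc_eq)
  qed
  moreover have "CWu_trans R (i + d) ?y \<in> {..<Suc (i + Suc d)} \<rightarrow>\<^sub>E carrier R"
    using yc by (auto simp: CWu_trans_def)
  ultimately show ?case using Suc by simp
qed (use assms in simp)

text \<open>Transition maps do not change the reversed sequence, and at a common level this sequence
  determines the vector. Hence the sequences of two representatives agree exactly when these become
  equal in the diagram.\<close>

lemma colim_rel_eq: "colim_rel (CWu_term p K R) (CWu_trans R) = {(u, v). u \<in> pts \<and> v \<in> pts \<and> emb u = emb v}"
proof -
  have "(\<exists>l \<ge> max i j. transition (CWu_trans R) i (l - i) x = transition (CWu_trans R) j (l - j) y) \<longleftrightarrow>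
      rev_emb (Suc i) x = rev_emb (Suc j) y"
    if x: "x \<in> {..<Suc i} \<rightarrow>\<^sub>E carrier R" and y: "y \<in> {..<Suc j} \<rightarrow>\<^sub>E carrier R" for i j x y
  proof
    assume "\<exists>l \<ge> max i j. transition (CWu_trans R) i (l - i) x = transition (CWu_trans R) j (l - j) y"
    then obtain l where l: "i \<le> l" "j \<le> l"
      and t: "transition (CWu_trans R) i (l - i) x = transition (CWu_trans R) j (l - j) y"
      by auto
    have "i + (l - i) = l" "j + (l - j) = l" using l by auto
    then show "rev_emb (Suc i) x = rev_emb (Suc j) y"
      using transition_emb[OF x, of "l - i"] transition_emb[OF y, of "l - j"] t by metis
  next
    assume e: "rev_emb (Suc i) x = rev_emb (Suc j) y"
    define l where "l = max i j"
    have l: "i + (l - i) = l" "j + (l - j) = l" by (auto simp: l_def)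
    note tx = transition_emb[OF x, of "l - i", unfolded l] and ty = transition_emb[OF y, of "l - j", unfolded l]
    have "transition (CWu_trans R) i (l - i) x = transition (CWu_trans R) j (l - j) y"
      by (rule rev_emb_inj[OF conjunct1[OF tx] conjunct1[OF ty]]) (simp only: tx ty e)
    then show "\<exists>l \<ge> max i j. transition (CWu_trans R) i (l - i) x = transition (CWu_trans R) j (l - j) y"
      unfolding l_def by blast
  qed
  note eq = this
  show ?thesis
  proof (rule Set.set_eqI)
    fix w :: "(nat \<times> (nat \<Rightarrow> 'a)) \<times> (nat \<times> (nat \<Rightarrow> 'a))"
    obtain i x j y where w: "w = ((i, x), (j, y))" by (metis surj_pair)
    let ?x = "x \<in> {..<Suc i} \<rightarrow>\<^sub>E carrier R" and ?y = "y \<in> {..<Suc j} \<rightarrow>\<^sub>E carrier R"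
    have "w \<in> colim_rel (CWu_term p K R) (CWu_trans R) \<longleftrightarrow> ?x \<and> ?y \<and>
        (\<exists>l \<ge> max i j. transition (CWu_trans R) i (l - i) x = transition (CWu_trans R) j (l - j) y)"
      unfolding w colim_rel_def term_simps by blast
    also have "\<dots> \<longleftrightarrow> ?x \<and> ?y \<and> rev_emb (Suc i) x = rev_emb (Suc j) y"
      by (rule conj_cong[OF refl conj_cong[OF refl eq]])
    also have "\<dots> \<longleftrightarrow> w \<in> {(u, v). u \<in> pts \<and> v \<in> pts \<and> emb u = emb v}"
      unfolding w pts_def emb_def mem_Sigma_iff mem_Collect_eq prod.case fst_conv snd_conv by blast
    finally show "w \<in> colim_rel (CWu_term p K R) (CWu_trans R) \<longleftrightarrow> w \<in> {(u, v). u \<in> pts \<and> v \<in> pts \<and> emb u = emb v}" .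
  qed
qed

lemma class_eq: "u \<in> pts \<Longrightarrow> colim_rel (CWu_term p K R) (CWu_trans R) `` {u} = fib (emb u)"
  by (auto simp: colim_rel_eq fib_def)

lemma emb_fin: "u \<in> pts \<Longrightarrow> emb u \<in> P.bounded_by (Suc (fst u))"
  unfolding pts_def emb_def by (cases u) (simp add: rev_emb_bounded del: PiE_iff)

lemma fib_member:
  assumes "a \<in> P.bounded_by N" "N \<le> Suc i"
  obtains x where "x \<in> {..<Suc i} \<rightarrow>\<^sub>E carrier R" "rev_emb (Suc i) x = a" "(i, x) \<in> fib a"
proof -
  have "a \<in> P.bounded_by (Suc i)" using assms P.bounded_by_mono by blast
  then obtain x where "x \<in> {..<Suc i} \<rightarrow>\<^sub>E carrier R" "rev_emb (Suc i) x = a" using rev_emb_surj by blast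
  then show ?thesis using that by (auto simp: fib_def pts_def emb_def)
qed

lemma fibD: "(i, x) \<in> fib a \<Longrightarrow> x \<in> {..<Suc i} \<rightarrow>\<^sub>E carrier R \<and> rev_emb (Suc i) x = a"
  by (auto simp: fib_def pts_def emb_def)

abbreviation "fin \<equiv> \<Union>N. P.bounded_by N"

lemma CWu_carrier: "carrier (CWu_ob p K R) = fib ` fin"
proof -
  have "{(u, v). u \<in> pts \<and> v \<in> pts \<and> emb u = emb v} `` {u} = fib (emb u)" if "u \<in> pts" for u
    using that by (auto simp: fib_def)
  then have "pts // {(u, v). u \<in> pts \<and> v \<in> pts \<and> emb u = emb v} = fib ` emb ` pts"
    unfolding quotient_def image_image UNION_singleton_eq_range by (rule image_cong[OF refl])
  moreover have "emb ` pts = fin"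
  proof
    show "emb ` pts \<subseteq> fin" using emb_fin by blast
    show "fin \<subseteq> emb ` pts"
    proof
      fix a assume "a \<in> fin"
      then obtain N where "a \<in> P.bounded_by N" by blast
      then obtain x where "(N, x) \<in> fib a" using fib_member[of a N N] by auto
      then show "a \<in> emb ` pts" by (auto simp: fib_def)
    qed
  qed
  ultimately show ?thesis by (simp add: CWu_ob_def dieudonne_colim_def Let_def pts_eq colim_rel_eq)
qed

definition pr :: "(nat \<times> (nat \<Rightarrow> 'a)) set \<Rightarrow> nat \<Rightarrow> 'a" where
  "pr X = emb (SOME u. u \<in> X)"

lemma pr_fib: assumes "a \<in> fin" shows "pr (fib a) = a"
proof -
  obtain N where "a \<in> P.bounded_by N" using assms by blast
  then obtain x where "(N, x) \<in> fib a" using fib_member[of a N N] by auto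
  then have "(SOME u. u \<in> fib a) \<in> fib a" by (rule someI)
  then show ?thesis by (simp add: pr_def fib_def)
qed

text \<open>The operations of the colimit are unions over all representatives. If the results all
  have the same sequence, each contributes the same class; nonemptiness excludes the empty
  union.\<close>

lemma Union_class:
  assumes "\<And>u. u \<in> U \<Longrightarrow> u \<in> pts \<and> emb u = a" "U \<noteq> {}"
  shows "\<Union>{colim_rel (CWu_term p K R) (CWu_trans R) `` {u} | u. u \<in> U} = fib a"
proof -
  have "{colim_rel (CWu_term p K R) (CWu_trans R) `` {u} | u. u \<in> U} = {fib a}"
    using assms class_eq by fastforce
  then show ?thesis by simp
qed

lemma in_pts: "x \<in> {..<Suc i} \<rightarrow>\<^sub>E carrier R \<Longrightarrow> (i, x) \<in> pts"
  by (simp add: pts_def)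

lemma CWu_add:
  assumes "a \<in> fin" "b \<in> fin" shows "fib a \<oplus>\<^bsub>CWu_ob p K R\<^esub> fib b = fib (P.cwadd a b)"
proof -
  let ?U = "{(i, x \<oplus>\<^bsub>W_ob p (Suc i) R\<^esub> y) | i x y. (i, x) \<in> fib a \<and> (i, y) \<in> fib b}"
  obtain N M where NM: "a \<in> P.bounded_by N" "b \<in> P.bounded_by M" using assms by blast
  \<comment> \<open>Both classes have representatives at the common level \<open>max N M\<close>, so
    there is at least one pair to be added.\<close>
  obtain x where x: "(max N M, x) \<in> fib a" using fib_member[OF NM(1), of "max N M"] by (metis le_SucI max.cobounded1)
  obtain y where y: "(max N M, y) \<in> fib b" using fib_member[OF NM(2), of "max N M"] by (metis le_SucI max.cobounded2)
  have ne: "?U \<noteq> {}" using x y by blast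
  have m: "u \<in> pts \<and> emb u = P.cwadd a b" if u: "u \<in> ?U" for u
  proof -
    obtain i x y where u: "u = (i, x \<oplus>\<^bsub>W_ob p (Suc i) R\<^esub> y)" "(i, x) \<in> fib a" "(i, y) \<in> fib b" using u by blast
    note xy = fibD[OF u(2)] fibD[OF u(3)]
    show ?thesis using W_add[of "Suc i" x y] xy u(1) in_pts by (simp add: emb_def)
  qed
  have "fib a \<oplus>\<^bsub>CWu_ob p K R\<^esub> fib b = \<Union>{colim_rel (CWu_term p K R) (CWu_trans R) `` {u} | u. u \<in> ?U}"
    unfolding CWu_ob_def dieudonne_colim_def Let_def by (simp add: term_simps) blast
  then show ?thesis using Union_class[OF m ne] by simp
qed

lemma CWu_unary:
  assumes "a \<in> fin" and g: "\<And>i x. x \<in> {..<Suc i} \<rightarrow>\<^sub>E carrier R \<Longrightarrow> rev_emb (Suc i) x = a \<Longrightarrow>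
    g i x \<in> {..<Suc i} \<rightarrow>\<^sub>E carrier R \<and> rev_emb (Suc i) (g i x) = b"
  shows "\<Union>{colim_rel (CWu_term p K R) (CWu_trans R) `` {(i, g i x)} | i x. (i, x) \<in> fib a} = fib b"
proof -
  let ?U = "{(i, g i x) | i x. (i, x) \<in> fib a}"
  obtain N where N: "a \<in> P.bounded_by N" using assms by blast
  obtain x where x: "(N, x) \<in> fib a" using fib_member[OF N, of N] by auto
  have ne: "?U \<noteq> {}" using x by blast
  have m: "u \<in> pts \<and> emb u = b" if u: "u \<in> ?U" for u
  proof -
    obtain i x where u: "u = (i, g i x)" "(i, x) \<in> fib a" using u by blast
    show ?thesis using g[of x i] fibD[OF u(2)] u(1) in_pts by (simp add: emb_def)
  qed
  have "{colim_rel (CWu_term p K R) (CWu_trans R) `` {(i, g i x)} | i x. (i, x) \<in> fib a} =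
    {colim_rel (CWu_term p K R) (CWu_trans R) `` {u} | u. u \<in> ?U}" by blast
  then show ?thesis using Union_class[OF m ne] by simp
qed

lemma CWu_smult:
  assumes "c \<in> carrier (Witt p K)" "a \<in> fin" shows "c \<odot>\<^bsub>CWu_ob p K R\<^esub> fib a = fib (P.cwsmult c a)"
proof -
  have "\<Union>{colim_rel (CWu_term p K R) (CWu_trans R) `` {(i, P.\<sigma> i c \<odot>\<^bsub>W_ob p (Suc i) R\<^esub> x)} | i x. (i, x) \<in> fib a}
      = fib (P.cwsmult c a)"
  proof (rule CWu_unary[OF assms(2)])
    fix i x assume x: "x \<in> {..<Suc i} \<rightarrow>\<^sub>E carrier R" "rev_emb (Suc i) x = a"
    \<comment> \<open>The twist \<open>\<sigma> i\<close> of the diagram and the twist frob^i of the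
      embedding of this term cancel, so the colimit maps linearly to co-Witt vectors.\<close>
    show "P.\<sigma> i c \<odot>\<^bsub>W_ob p (Suc i) R\<^esub> x \<in> {..<Suc i} \<rightarrow>\<^sub>E carrier R \<and>
        rev_emb (Suc i) (P.\<sigma> i c \<odot>\<^bsub>W_ob p (Suc i) R\<^esub> x) = P.cwsmult c a"
      using W_smult[OF _ P.\<sigma>_closed[OF assms(1)] x(1), of i] x(2) P.frob_\<sigma>_funpow[OF assms(1), of i] by simp
  qed
  then show ?thesis unfolding CWu_ob_def dieudonne_colim_def Let_def by (simp add: term_simps)
qed

lemma CWu_F: assumes "a \<in> fin" shows "dF (CWu_ob p K R) (fib a) = fib (P.cwF a)"
proof -
  have "\<Union>{colim_rel (CWu_term p K R) (CWu_trans R) `` {(i, dF (W_ob p (Suc i) R) x)} | i x. (i, x) \<in> fib a}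
      = fib (P.cwF a)"
    by (rule CWu_unary[OF assms]) (use W_F in auto)
  then show ?thesis unfolding CWu_ob_def dieudonne_colim_def Let_def by (simp add: term_simps)
qed

lemma CWu_V: assumes "a \<in> fin" shows "dV (CWu_ob p K R) (fib a) = fib (P.cwV a)"
proof -
  have "\<Union>{colim_rel (CWu_term p K R) (CWu_trans R) `` {(i, dV (W_ob p (Suc i) R) x)} | i x. (i, x) \<in> fib a}
      = fib (P.cwV a)"
    by (rule CWu_unary[OF assms]) (use W_V in auto)
  then show ?thesis unfolding CWu_ob_def dieudonne_colim_def Let_def by (simp add: term_simps)
qed

lemma CWu_zero: "\<zero>\<^bsub>CWu_ob p K R\<^esub> = fib (\<lambda>_. \<zero>\<^bsub>R\<^esub>)"
  using W_zero[of "Suc 0"] class_eq[OF in_pts[of _ 0]]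
  by (simp add: CWu_ob_def dieudonne_colim_def Let_def term_simps emb_def)

lemma fin_closed:
  "a \<in> fin \<Longrightarrow> b \<in> fin \<Longrightarrow> P.cwadd a b \<in> fin" "c \<in> carrier (Witt p K) \<Longrightarrow> a \<in> fin \<Longrightarrow> P.cwsmult c a \<in> fin"
  "a \<in> fin \<Longrightarrow> P.cwF a \<in> fin" "a \<in> fin \<Longrightarrow> P.cwV a \<in> fin" "(\<lambda>_. \<zero>\<^bsub>R\<^esub>) \<in> fin"
proof -
  show "P.cwadd a b \<in> fin" if ab: "a \<in> fin" "b \<in> fin"
  proof -
    obtain N where "a \<in> P.bounded_by N" "b \<in> P.bounded_by N" using ab P.bounded_by_common by blast
    then show ?thesis using P.bounded_by_closed(1) by blast
  qed
  show "P.cwsmult c a \<in> fin" if "c \<in> carrier (Witt p K)" "a \<in> fin" using that P.bounded_by_closed(2) by blast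
  show "P.cwF a \<in> fin" if "a \<in> fin" using that P.bounded_by_closed(3) by blast
  show "P.cwV a \<in> fin" if "a \<in> fin" using that P.bounded_by_closed(4) by blast
  show "(\<lambda>_. \<zero>\<^bsub>R\<^esub>) \<in> fin" using P.zero_bounded_by by auto
qed

definition CWu_iso :: "(nat \<times> (nat \<Rightarrow> 'a)) set \<Rightarrow> (nat \<times> (nat \<Rightarrow> 'a)) set" where
  "CWu_iso X = P.enc (pr X)"

lemma CWu_iso_fib: "a \<in> fin \<Longrightarrow> CWu_iso (fib a) = P.enc a"
  by (simp add: CWu_iso_def pr_fib)

lemma CWu_pullback: "dieudonne_pullback p K P.CWuA (CWu_ob p K R) (\<lambda>c. c) CWu_iso"
proof (unfold_locales, unfold CWu_carrier)
  show "inj_on CWu_iso (fib ` fin)"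
    by (rule inj_on_inverseI[of _ "\<lambda>X. fib (P.dec X)"]) (metis CWu_iso_fib P.dec_enc imageE)
  show "CWu_iso x \<in> carrier P.CWuA" if "x \<in> fib ` fin" for x
    using that unfolding P.CWuA_simps(1) by (elim imageE) (simp only: CWu_iso_fib imageI)
  show "\<zero>\<^bsub>CWu_ob p K R\<^esub> \<in> fib ` fin" "CWu_iso \<zero>\<^bsub>CWu_ob p K R\<^esub> = \<zero>\<^bsub>P.CWuA\<^esub>"
    using fin_closed(5) CWu_iso_fib[OF fin_closed(5)] unfolding CWu_zero by simp_all
  show "x \<oplus>\<^bsub>CWu_ob p K R\<^esub> y \<in> fib ` fin \<and> CWu_iso (x \<oplus>\<^bsub>CWu_ob p K R\<^esub> y) = CWu_iso x \<oplus>\<^bsub>P.CWuA\<^esub> CWu_iso y"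
    if xy: "x \<in> fib ` fin" "y \<in> fib ` fin" for x y
  proof -
    obtain a b where ab: "x = fib a" "a \<in> fin" "y = fib b" "b \<in> fin" using xy by blast
    show ?thesis using fin_closed(1)[OF ab(2,4)]
      by (simp only: ab CWu_add CWu_iso_fib P.CWuA_simps P.dec_enc imageI)
  qed
  show "c \<odot>\<^bsub>CWu_ob p K R\<^esub> x \<in> fib ` fin \<and> CWu_iso (c \<odot>\<^bsub>CWu_ob p K R\<^esub> x) = c \<odot>\<^bsub>P.CWuA\<^esub> CWu_iso x"
    if c: "c \<in> carrier (Witt p K)" and x: "x \<in> fib ` fin" for c x
  proof -
    obtain a where ab: "x = fib a" "a \<in> fin" using x by blast
    show ?thesis using fin_closed(2)[OF c ab(2)]
      by (simp only: ab CWu_smult[OF c] CWu_iso_fib P.CWuA_simps P.dec_enc imageI)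
  qed
  show "dF (CWu_ob p K R) x \<in> fib ` fin \<and> CWu_iso (dF (CWu_ob p K R) x) = dF P.CWuA (CWu_iso x)"
    "dV (CWu_ob p K R) x \<in> fib ` fin \<and> CWu_iso (dV (CWu_ob p K R) x) = dV P.CWuA (CWu_iso x)"
    if x: "x \<in> fib ` fin" for x
  proof -
    obtain a where ab: "x = fib a" "a \<in> fin" using x by blast
    show "dF (CWu_ob p K R) x \<in> fib ` fin \<and> CWu_iso (dF (CWu_ob p K R) x) = dF P.CWuA (CWu_iso x)"
      "dV (CWu_ob p K R) x \<in> fib ` fin \<and> CWu_iso (dV (CWu_ob p K R) x) = dV P.CWuA (CWu_iso x)"
      using fin_closed(3,4)[OF ab(2)]
      by (simp_all only: ab CWu_F CWu_V CWu_iso_fib P.CWuA_simps P.dec_enc imageI)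
  qed
qed (use P.CWuA_dieudonne P.frob_closed in \<open>simp_all del: Witt_carrier\<close>)

lemma CWu_iso_bij: "bij_betw CWu_iso (carrier (CWu_ob p K R)) (carrier P.CWuA)"
  unfolding bij_betw_def
proof
  show "inj_on CWu_iso (carrier (CWu_ob p K R))" by (rule dieudonne_pullback.inj[OF CWu_pullback])
  show "CWu_iso ` carrier (CWu_ob p K R) = carrier P.CWuA"
    by (simp add: CWu_carrier image_image CWu_iso_fib cong: image_cong_simp)
qed

end

section \<open>The main theorem\<close>

lemma dieudonne_hom_pullback:
  fixes N M :: "(nat \<Rightarrow> 'k, 'm) dieudonne"
  assumes "dieudonne_pullback p K N M (\<lambda>c. c) \<phi>" shows "dieudonne_hom p K M N \<phi>"
proof -
  interpret dieudonne_pullback p K N M "\<lambda>c. c" \<phi> by fact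
  show ?thesis using add smult F V \<phi>_closed by (auto simp: dieudonne_hom_def linear_map_def simp del: Witt_carrier)
qed

locale alg_hom = A: alg_perf p K R + B: alg_perf p K S
  for p :: nat and K :: "'k ring" and R S :: "('k, 'a) module" +
  fixes f :: "'a \<Rightarrow> 'a"
  assumes ring_hom: "f \<in> ring_hom R S" and lin: "linear_map K R S f"
begin

sublocale P: polar_hom p K "on_ob pol R" "on_ob pol S" f
proof unfold_locales
  show "linear_map K (on_ob pol R) (on_ob pol S) f" using lin by (simp add: linear_map_def)
  fix xs assume "set xs \<subseteq> carrier (on_ob pol R)"
  then have "set xs \<subseteq> carrier R" by simp
  then have "f (mprod R xs) = mprod S (map f xs)"
    by (induction xs) (auto simp: ring_hom_one[OF ring_hom] ring_hom_mult[OF ring_hom] A.R.mprod_closed)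
  then show "f (mu (on_ob pol R) xs) = mu (on_ob pol S) (map f xs)" by simp
qed

lemma f_rev_emb: "(\<lambda>j. f (A.rev_emb n x j)) = B.rev_emb n (\<lambda>i\<in>{..<n}. f (x i))"
  using P.f_zero by (auto simp: A.rev_emb_def B.rev_emb_def fun_eq_iff)

lemma f_ext: "x \<in> {..<n} \<rightarrow>\<^sub>E carrier R \<Longrightarrow> (\<lambda>i\<in>{..<n}. f (x i)) \<in> {..<n} \<rightarrow>\<^sub>E carrier S"
  using lin by (auto simp: linear_map_def)

lemma CWu_arr:
  assumes "a \<in> A.fin"
  shows "on_arr (CWu_functor p K) R S f (A.fib a) = B.fib (\<lambda>n. f (a n))" "(\<lambda>n. f (a n)) \<in> B.fin"
proof -
  obtain N where N: "a \<in> A.P.bounded_by N" using assms by blast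
  show fa: "(\<lambda>n. f (a n)) \<in> B.fin" using P.f_bounded_by[OF N] by blast
  let ?U = "{(j, W_arr p (Suc j) R f x) | j x. (j, x) \<in> A.fib a}"
  obtain x where x: "(N, x) \<in> A.fib a" using A.fib_member[OF N, of N] by auto
  have ne: "?U \<noteq> {}" using x by blast
  have m: "u \<in> B.pts \<and> B.emb u = (\<lambda>n. f (a n))" if u: "u \<in> ?U" for u
  proof -
    obtain j x where u: "u = (j, W_arr p (Suc j) R f x)" "(j, x) \<in> A.fib a" using u by blast
    note x = A.fibD[OF u(2)]
    have "W_arr p (Suc j) R f x = (\<lambda>i\<in>{..<Suc j}. f (x i))"
      using x A.W_carrier[of "Suc j"] by (simp add: W_arr_def)
    then show ?thesis
      using u(1) x f_ext[of x "Suc j"] f_rev_emb[of "Suc j" x] B.in_pts by (simp add: B.emb_def)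
  qed
  have "on_arr (CWu_functor p K) R S f (A.fib a) =
      \<Union>{colim_rel (CWu_term p K S) (CWu_trans S) `` {u} | u. u \<in> ?U}"
    using assms by (simp add: CWu_functor_def A.CWu_carrier) blast
  then show "on_arr (CWu_functor p K) R S f (A.fib a) = B.fib (\<lambda>n. f (a n))"
    using B.Union_class[OF m ne] by simp
qed

end

context
  fixes p :: nat and K :: "'k ring"
  assumes p: "prime p" and K: "perfect_field p K"
begin

lemma polar_perfI: "polar_algebra p K A \<Longrightarrow> polar_perf p K A"
  using p K by unfold_locales
lemma alg_perfI: "algebra K R \<Longrightarrow> alg_perf p K R"
  using p K by (intro alg_perf.intro)

lemma Pol_simps: "Ob (Pol p K) = {A. polar_algebra p K A}"
  "Id (Pol p K) A = restrict (\<lambda>x. x) (carrier A)" "Comp (Pol p K) A g f = compose (carrier A) g f"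
  by (simp_all add: Pol_def concrete_category_def)

lemma Pol_HomD:
  assumes "A \<in> Ob (Pol p K)" "B \<in> Ob (Pol p K)" "f \<in> Hom (Pol p K) A B"
  shows "polar_hom p K A B f"
  using assms polar_perfI[of A] polar_perfI[of B]
  by (auto simp: Pol_def concrete_category_def polar_hom_def polar_hom_axioms_def)

lemma Alg_simps: "Ob (Alg K) = {A. algebra K A}"
  "Id (Alg K) A = restrict (\<lambda>x. x) (carrier A)" "Comp (Alg K) A g f = compose (carrier A) g f"
  by (simp_all add: Alg_def concrete_category_def)

lemma Alg_HomD:
  assumes "A \<in> Ob (Alg K)" "B \<in> Ob (Alg K)" "f \<in> Hom (Alg K) A B"
  shows "alg_hom p K A B f" "f \<in> carrier A \<rightarrow>\<^sub>E carrier B"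
  using assms alg_perfI[of A] alg_perfI[of B]
  by (auto simp: Alg_def concrete_category_def alg_hom_def alg_hom_axioms_def)

lemma Alg_Hom_iff: "f \<in> Hom (Alg K) A B \<longleftrightarrow> f \<in> carrier A \<rightarrow>\<^sub>E carrier B \<and> f \<in> ring_hom A B \<and> linear_map K A B f"
  by (simp add: Alg_def concrete_category_def)

lemma Alg_Id: "A \<in> Ob (Alg K) \<Longrightarrow> Id (Alg K) A \<in> Hom (Alg K) A A"
proof -
  assume "A \<in> Ob (Alg K)"
  then interpret algebra K A by (simp add: Alg_simps)
  show ?thesis by (auto simp: Alg_Hom_iff Alg_simps ring_hom_def linear_map_def)
qed

lemma Alg_Comp:
  assumes "A \<in> Ob (Alg K)" "f \<in> Hom (Alg K) A B" "g \<in> Hom (Alg K) B E"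
  shows "Comp (Alg K) A g f \<in> Hom (Alg K) A E"
proof -
  interpret algebra K A using assms(1) by (simp add: Alg_simps)
  show ?thesis using assms(2,3) unfolding Alg_Hom_iff Alg_simps
    by (auto simp: compose_def ring_hom_def linear_map_def PiE_iff Pi_iff)
qed

lemma pol_functor: "is_functor (Alg K) (Pol p K) pol"
  unfolding is_functor_def
proof (intro conjI ballI)
  fix A assume A: "A \<in> Ob (Alg K)"
  then show "on_ob pol A \<in> Ob (Pol p K)"
    using polar_algebra_pol[of K A p] prime_ge_2_nat[OF p] by (simp add: Alg_simps Pol_simps)
  show "on_arr pol A A (Id (Alg K) A) = Id (Pol p K) (on_ob pol A)" by (simp add: Alg_simps Pol_simps)
  fix B f assume B: "B \<in> Ob (Alg K)" and f: "f \<in> Hom (Alg K) A B"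
  interpret alg_hom p K A B f by (rule Alg_HomD(1)[OF A B f])
  show "on_arr pol A B f \<in> Hom (Pol p K) (on_ob pol A) (on_ob pol B)"
    using Alg_HomD(2)[OF A B f] P.lin P.mu by (simp add: Pol_def concrete_category_def)
next
  fix A B E f g
  show "on_arr pol A E (Comp (Alg K) A g f) = Comp (Pol p K) (on_ob pol A) (on_arr pol B E g) (on_arr pol A B f)"
    by (simp add: Alg_simps Pol_simps)
qed

definition TW :: "nat \<Rightarrow> (('k, 'a) polar, 'a \<Rightarrow> 'a, (nat \<Rightarrow> 'k, nat \<Rightarrow> 'a) dieudonne, (nat \<Rightarrow> 'a) \<Rightarrow> nat \<Rightarrow> 'a) cat_functor"
  where "TW n = \<lparr> on_ob = (\<lambda>A. polar_perf.WnA p K A n),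
    on_arr = (\<lambda>A B f. restrict (\<lambda>a n. f (a n)) (carrier (polar_perf.WnA p K A n))) \<rparr>"

definition TCW :: "(('k, 'a) polar, 'a \<Rightarrow> 'a, (nat \<Rightarrow> 'k, nat \<Rightarrow> 'a) dieudonne, (nat \<Rightarrow> 'a) \<Rightarrow> nat \<Rightarrow> 'a) cat_functor"
  where "TCW = \<lparr> on_ob = (\<lambda>A. polar_perf.CWA p K A),
    on_arr = (\<lambda>A B f. restrict (\<lambda>a n. f (a n)) (carrier (polar_perf.CWA p K A))) \<rparr>"

definition TCWu :: "(('k, 'a) polar, 'a \<Rightarrow> 'a, (nat \<Rightarrow> 'k, (nat \<times> (nat \<Rightarrow> 'a)) set) dieudonne,
    (nat \<times> (nat \<Rightarrow> 'a)) set \<Rightarrow> (nat \<times> (nat \<Rightarrow> 'a)) set) cat_functor"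
  where "TCWu = \<lparr> on_ob = (\<lambda>A. polar_perf.CWuA p K A),
    on_arr = (\<lambda>A B f. restrict (\<lambda>X. polar_perf.enc (\<lambda>n. f (polar_perf.dec X n))) (carrier (polar_perf.CWuA p K A))) \<rparr>"

lemma TW_functor: "is_functor (Pol p K) (Dmod_p p K) (TW n)"
  unfolding TW_def Dmod_p_def
proof (rule is_functor_concrete)
  fix A :: "('k, 'a) polar" assume A: "A \<in> Ob (Pol p K)"
  then interpret A: polar_perf p K A by (intro polar_perfI) (simp add: Pol_simps)
  show "A.WnA n \<in> {M. dieudonne_module p K M \<and> p_adic p K M}"
    by (simp add: A.WnA_dieudonne A.WnA_p_adic)
  show "(\<lambda>n. Id (Pol p K) A (x n)) = x" if "x \<in> carrier (A.WnA n)" for x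
    using that by (auto simp: Pol_simps A.bounded_by_def)
  fix B f assume B: "B \<in> Ob (Pol p K)" and f: "f \<in> Hom (Pol p K) A B"
  show "dieudonne_hom p K (A.WnA n) (polar_perf.WnA p K B n) (\<lambda>a n. f (a n))"
    by (rule polar_hom.hom_WnA[OF Pol_HomD[OF A B f]])
  show "(\<lambda>n. Comp (Pol p K) A k f (x n)) = (\<lambda>n. k (f (x n)))" if "x \<in> carrier (A.WnA n)" for k x
    using that by (auto simp: Pol_simps A.bounded_by_def compose_def)
qed simp

lemma TCW_functor: "is_functor (Pol p K) (Dmod p K) TCW"
  unfolding TCW_def Dmod_def
proof (rule is_functor_concrete)
  fix A :: "('k, 'a) polar" assume A: "A \<in> Ob (Pol p K)"
  then interpret A: polar_perf p K A by (intro polar_perfI) (simp add: Pol_simps)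
  show "A.CWA \<in> {M. dieudonne_module p K M}"
    by (simp add: A.CWA_dieudonne)
  show "(\<lambda>n. Id (Pol p K) A (x n)) = x" if "x \<in> carrier A.CWA" for x
    using that by (auto simp: Pol_simps A.cwcar_def)
  fix B f assume B: "B \<in> Ob (Pol p K)" and f: "f \<in> Hom (Pol p K) A B"
  show "dieudonne_hom p K A.CWA (polar_perf.CWA p K B) (\<lambda>a n. f (a n))"
    by (rule polar_hom.hom_CWA[OF Pol_HomD[OF A B f]])
  show "(\<lambda>n. Comp (Pol p K) A k f (x n)) = (\<lambda>n. k (f (x n)))" if "x \<in> carrier A.CWA" for k x
    using that by (auto simp: Pol_simps A.cwcar_def compose_def)
qed simp

lemma TCWu_functor: "is_functor (Pol p K) (Dmod_p p K) TCWu"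
  unfolding TCWu_def Dmod_p_def
proof (rule is_functor_concrete)
  fix A :: "('k, 'a) polar" assume A: "A \<in> Ob (Pol p K)"
  then interpret A: polar_perf p K A by (intro polar_perfI) (simp add: Pol_simps)
  show "A.CWuA \<in> {M. dieudonne_module p K M \<and> p_adic p K M}"
    by (simp add: A.CWuA_dieudonne A.CWuA_p_adic)
  show "A.enc (\<lambda>n. Id (Pol p K) A (A.dec x n)) = x" if "x \<in> carrier A.CWuA" for x
    using that by (auto simp: Pol_simps A.bounded_by_def)
  fix B f assume B: "B \<in> Ob (Pol p K)" and f: "f \<in> Hom (Pol p K) A B"
  show "dieudonne_hom p K A.CWuA (polar_perf.CWuA p K B) (\<lambda>X. A.enc (\<lambda>n. f (A.dec X n)))"
    by (rule polar_hom.hom_CWuA[OF Pol_HomD[OF A B f]])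
  show "A.enc (\<lambda>n. Comp (Pol p K) A k f (A.dec x n)) = A.enc (\<lambda>n. k (A.dec (A.enc (\<lambda>n. f (A.dec x n))) n))"
    if "x \<in> carrier A.CWuA" for k x
    using that by (auto simp: Pol_simps A.bounded_by_def compose_def)
qed simp

lemma W_iso:
  assumes n: "1 \<le> n"
  shows "naturally_isomorphic (Alg K) (Dmod_p p K) (W_functor p K n) (TW n \<circ>\<^sub>F pol)"
proof (rule naturally_isomorphic_concrete[OF _ Dmod_p_def is_functor_comp[OF pol_functor TW_functor] Alg_Id Alg_Comp,
      where \<eta> = "\<lambda>R. alg_perf.rev_emb R n"])
  fix A :: "('k, 'a) module" assume A: "A \<in> Ob (Alg K)"
  then interpret A: alg_perf p K A by (intro alg_perfI) (simp add: Alg_simps)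
  note pb = A.W_pullback[OF n]
  \<comment> \<open>The notion of natural isomorphism requires the values of both functors to be
    p-adic. Nilpotence of V is read off through the injective embedding, where V^n shifts all
    nonzero entries away.\<close>
  have nil: "\<exists>m. (dV (W_ob p n A) ^^ m) x = \<zero>\<^bsub>W_ob p n A\<^esub>" if x: "x \<in> carrier (W_ob p n A)" for x
  proof -
    have "(dV (W_ob p n A) ^^ m) x \<in> carrier (W_ob p n A) \<and>
        A.rev_emb n ((dV (W_ob p n A) ^^ m) x) = (A.P.cwV ^^ m) (A.rev_emb n x)" for m
      using x dieudonne_pullback.V[OF pb] by (induction m) auto
    from this[of n] show ?thesis
      using A.W_zero[of n] dieudonne_pullback.eqI[OF pb] A.W_carrier[of n]
      by (intro exI[of _ n]) (auto simp: A.P.cwV_funpow A.rev_emb_def)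
  qed
  show "on_ob (W_functor p K n) A \<in> {M. dieudonne_module p K M \<and> p_adic p K M}"
    using dieudonne_pullback.dieudonne_M[OF pb] A.P.p_adic_of_V_nilpotent[OF _ nil] by (simp add: W_functor_def)
  show "bij_betw (A.rev_emb n) (carrier (on_ob (W_functor p K n) A)) (carrier (on_ob (TW n \<circ>\<^sub>F pol) A))"
    using A.rev_emb_inj A.rev_emb_surj[of _ n] A.rev_emb_bounded[of _ n]
    by (auto simp: bij_betw_def inj_on_def W_functor_def TW_def functor_comp_def A.W_carrier image_iff) metis
  show "dieudonne_hom p K (on_ob (W_functor p K n) A) (on_ob (TW n \<circ>\<^sub>F pol) A) (A.rev_emb n)"
    using dieudonne_hom_pullback[OF pb] by (simp add: W_functor_def TW_def functor_comp_def)
  fix B f assume B: "B \<in> Ob (Alg K)" and f: "f \<in> Hom (Alg K) A B"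
  interpret alg_hom p K A B f by (rule Alg_HomD(1)[OF A B f])
  show "on_arr (W_functor p K n) A B f \<in> carrier (on_ob (W_functor p K n) A) \<rightarrow>\<^sub>E carrier (on_ob (W_functor p K n) B)"
    using f_ext[of _ n] by (auto simp: W_functor_def W_arr_def A.W_carrier B.W_carrier)
  fix x assume "x \<in> carrier (on_ob (W_functor p K n) A)"
  then have x: "x \<in> {..<n} \<rightarrow>\<^sub>E carrier A" by (simp add: W_functor_def A.W_carrier)
  then show "B.rev_emb n (on_arr (W_functor p K n) A B f x) = on_arr (TW n \<circ>\<^sub>F pol) A B f (A.rev_emb n x)"
    using A.rev_emb_bounded[OF x] f_rev_emb[of n x]
    by (simp add: W_functor_def W_arr_def TW_def functor_comp_def A.W_carrier)
qed simp_all

text \<open>The comparison map is the identity, because the ideal condition and the polar nilpotence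
  condition select the same sequences and the limits defining the operations agree term by
  term.\<close>

lemma CW_iso: "naturally_isomorphic (Alg K) (Dmod p K) (CW_functor p K) (TCW \<circ>\<^sub>F pol)"
proof (rule naturally_isomorphic_concrete[OF _ Dmod_def is_functor_comp[OF pol_functor TCW_functor] Alg_Id Alg_Comp,
      where \<eta> = "\<lambda>R x. x"])
  fix A :: "('k, 'a) module" assume A: "A \<in> Ob (Alg K)"
  then interpret A: alg_perf p K A by (intro alg_perfI) (simp add: Alg_simps)
  note pb = A.CW_pullback
  show "on_ob (CW_functor p K) A \<in> {M. dieudonne_module p K M}"
    using dieudonne_pullback.dieudonne_M[OF pb] by (simp add: CW_functor_def)
  show "bij_betw (\<lambda>x. x) (carrier (on_ob (CW_functor p K) A)) (carrier (on_ob (TCW \<circ>\<^sub>F pol) A))"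
    by (simp add: bij_betw_def CW_functor_def TCW_def functor_comp_def A.CW_carrier)
  show "dieudonne_hom p K (on_ob (CW_functor p K) A) (on_ob (TCW \<circ>\<^sub>F pol) A) (\<lambda>x. x)"
    using dieudonne_hom_pullback[OF pb] by (simp add: CW_functor_def TCW_def functor_comp_def)
  fix B f assume B: "B \<in> Ob (Alg K)" and f: "f \<in> Hom (Alg K) A B"
  interpret alg_hom p K A B f by (rule Alg_HomD(1)[OF A B f])
  show "on_arr (CW_functor p K) A B f \<in> carrier (on_ob (CW_functor p K) A) \<rightarrow>\<^sub>E carrier (on_ob (CW_functor p K) B)"
    using P.f_cwcar by (auto simp: CW_functor_def A.CW_carrier B.CW_carrier)
  fix x assume "x \<in> carrier (on_ob (CW_functor p K) A)"
  then show "on_arr (CW_functor p K) A B f x = on_arr (TCW \<circ>\<^sub>F pol) A B f x"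
    by (simp add: CW_functor_def TCW_def functor_comp_def A.CW_carrier)
qed simp_all

lemma CWu_iso: "naturally_isomorphic (Alg K) (Dmod_p p K) (CWu_functor p K) (TCWu \<circ>\<^sub>F pol)"
proof (rule naturally_isomorphic_concrete[OF _ Dmod_p_def is_functor_comp[OF pol_functor TCWu_functor] Alg_Id Alg_Comp,
      where \<eta> = alg_perf.CWu_iso])
  fix A :: "('k, 'a) module" assume A: "A \<in> Ob (Alg K)"
  then interpret A: alg_perf p K A by (intro alg_perfI) (simp add: Alg_simps)
  note pb = A.CWu_pullback
  \<comment> \<open>Unlike for W_n the exponent depends on the element: it bounds the number of
    nonzero entries of the sequence.\<close>
  have nil: "\<exists>m. (dV (CWu_ob p K A) ^^ m) x = \<zero>\<^bsub>CWu_ob p K A\<^esub>" if x: "x \<in> carrier (CWu_ob p K A)" for x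
  proof -
    obtain a N where a: "x = A.fib a" "a \<in> A.P.bounded_by N" using x unfolding A.CWu_carrier by blast
    then have "(A.P.cwV ^^ m) a \<in> A.fin \<and> (dV (CWu_ob p K A) ^^ m) x = A.fib ((A.P.cwV ^^ m) a)" for m
      using A.fin_closed(4) A.CWu_V by (induction m) auto
    from this[of N] show ?thesis
      using a by (intro exI[of _ N]) (simp add: A.CWu_zero A.P.cwV_funpow A.P.bounded_by_def)
  qed
  show "on_ob (CWu_functor p K) A \<in> {M. dieudonne_module p K M \<and> p_adic p K M}"
    using dieudonne_pullback.dieudonne_M[OF pb] A.P.p_adic_of_V_nilpotent[OF _ nil] by (simp add: CWu_functor_def)
  show "bij_betw A.CWu_iso (carrier (on_ob (CWu_functor p K) A)) (carrier (on_ob (TCWu \<circ>\<^sub>F pol) A))"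
    using A.CWu_iso_bij by (simp add: CWu_functor_def TCWu_def functor_comp_def)
  show "dieudonne_hom p K (on_ob (CWu_functor p K) A) (on_ob (TCWu \<circ>\<^sub>F pol) A) A.CWu_iso"
    using dieudonne_hom_pullback[OF pb] by (simp add: CWu_functor_def TCWu_def functor_comp_def)
  fix B f assume B: "B \<in> Ob (Alg K)" and f: "f \<in> Hom (Alg K) A B"
  interpret alg_hom p K A B f by (rule Alg_HomD(1)[OF A B f])
  have ext: "on_arr (CWu_functor p K) A B f \<in> extensional (carrier (CWu_ob p K A))"
    by (simp add: CWu_functor_def)
  show "on_arr (CWu_functor p K) A B f \<in> carrier (on_ob (CWu_functor p K) A) \<rightarrow>\<^sub>E carrier (on_ob (CWu_functor p K) B)"
  proof
    fix x assume "x \<in> carrier (on_ob (CWu_functor p K) A)"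
    then obtain a where "x = A.fib a" "a \<in> A.fin" by (auto simp: CWu_functor_def A.CWu_carrier)
    then show "on_arr (CWu_functor p K) A B f x \<in> carrier (on_ob (CWu_functor p K) B)"
      using CWu_arr by (simp add: CWu_functor_def[of p K] B.CWu_carrier)
  next
    fix x assume "x \<notin> carrier (on_ob (CWu_functor p K) A)"
    then show "on_arr (CWu_functor p K) A B f x = undefined"
      using ext by (simp add: extensional_def CWu_functor_def[of p K])
  qed
  fix x assume "x \<in> carrier (on_ob (CWu_functor p K) A)"
  then obtain a where a: "x = A.fib a" "a \<in> A.fin" by (auto simp: CWu_functor_def A.CWu_carrier)
  have "A.P.enc a \<in> carrier A.P.CWuA" using a(2) by simp
  then have "on_arr (TCWu \<circ>\<^sub>F pol) A B f (A.P.enc a) = A.P.enc (\<lambda>n. f (a n))"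
    by (simp add: TCWu_def functor_comp_def)
  then show "B.CWu_iso (on_arr (CWu_functor p K) A B f x) = on_arr (TCWu \<circ>\<^sub>F pol) A B f (A.CWu_iso x)"
    using CWu_arr[OF a(2)] a by (simp add: A.CWu_iso_fib B.CWu_iso_fib)
qed simp_all

end

theorem theorem1p4:
  fixes p :: nat and K :: "'k ring"
  assumes "prime p" and "perfect_field p K"
  shows "(\<forall>n\<ge>1. \<exists>T.
            is_functor (Pol p K) (Dmod_p p K) T \<and>
            naturally_isomorphic (Alg K) (Dmod_p p K)
              (W_functor p K n :: (('k, 'a) module, 'a \<Rightarrow> 'a, _, _) cat_functor) (T \<circ>\<^sub>F pol)) \<and>
         (\<exists>T.
            is_functor (Pol p K) (Dmod_p p K) T \<and>
            naturally_isomorphic (Alg K) (Dmod_p p K)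
              (CWu_functor p K :: (('k, 'a) module, 'a \<Rightarrow> 'a, _, _) cat_functor) (T \<circ>\<^sub>F pol)) \<and>
         (\<exists>T.
            is_functor (Pol p K) (Dmod p K) T \<and>
            naturally_isomorphic (Alg K) (Dmod p K)
              (CW_functor p K :: (('k, 'a) module, 'a \<Rightarrow> 'a, _, _) cat_functor) (T \<circ>\<^sub>F pol))"
  using TW_functor[OF assms] W_iso[OF assms] TCWu_functor[OF assms] CWu_iso[OF assms]
    TCW_functor[OF assms] CW_iso[OF assms]
  by blast

end
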